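(* Let $X$ be a smooth compact complex variety of dimension $m$. Let $\mathcal{F}$ be a locally free sheaf of rank $n$ on $X$ and $\mathcal{L}$ an invertible sheaf on $X$. Consider an extension $0\to\mathcal{L}\to\mathcal{E}\to\mathcal{F}\to 0$ corresponding to $\xi\in \mathrm{Ext}^1(\mathcal{F},\mathcal{L})\cong H^1(X,\mathcal{F}^\vee\otimes\mathcal{L})$, with connecting homomorphism $\partial_\xi\colon H^0(X,\mathcal{F})\to H^1(X,\mathcal{L})$. Let $W=\langle\eta_1,\ldots,\eta_{n+1}\rangle\subset\ker(\partial_\xi)\subset H^0(X,\mathcal{F})$ be an $(n+1)$-dimensional vector subspace with $\lambda^nW\neq 0$, and let $D_W$ be the fixed divisor of the linear system $|\lambda^nW|$. Let $\Omega\in H^0(X,\det\mathcal{E})$ be a generalized adjoint form associated to $W$ and $\xi$. Assume that $H^0(X,\mathcal{L})\cong H^0(X,\mathcal{L}(D_W))$. If $$\xi\in\ker\big(H^1(X,\mathcal{F}^\vee\otimes\mathcal{L})\to H^1(X,\mathcal{F}^\vee\otimes\mathcal{L}(D_W))\big),$$ then $$\Omega\in\mathrm{Im}\big(H^0(X,\mathcal{L})\otimes\lambda^nW\to H^0(X,\det\mathcal{E})\big).$$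
   Context: Write $\det\mathcal{F}=\bigwedge^n\mathcal{F}$ and $\det\mathcal{E}=\bigwedge^{n+1}\mathcal{E}$; the extension gives a canonical isomorphism $\det\mathcal{F}\otimes\mathcal{L}\cong\det\mathcal{E}$. Let $\eta_1,\ldots,\eta_{n+1}$ be a basis of $W$. Let $\lambda^n\colon\bigwedge^nH^0(X,\mathcal{F})\to H^0(X,\det\mathcal{F})$ be the natural map and put $\omega_i:=\lambda^n(\eta_1\wedge\ldots\wedge\widehat{\eta_i}\wedge\ldots\wedge\eta_{n+1})$ for $i=1,\ldots,n+1$. Then $\lambda^nW\subset H^0(X,\det\mathcal{F})$ is the span of $\omega_1,\ldots,\omega_{n+1}$. When $\lambda^nW\ne0$ it defines a linear system $|\lambda^nW|\subset\mathbb{P}(H^0(X,\det\mathcal{F}))$, and $D_W$ denotes its fixed divisor (the largest effective divisor contained in the divisor of every nonzero element of $\lambda^nW$). Since $W\subset\ker(\partial_\xi)$, one can choose liftings $s_1,\ldots,s_{n+1}\in H^0(X,\mathcal{E})$ of $\eta_1,\ldots,\eta_{n+1}$. A generalized adjoint form associated to $W$ and $\xi$ is the image $\Omega\in H^0(X,\det\mathcal{E})$ of $s_1\wedge\ldots\wedge s_{n+1}$ under the natural map $\bigwedge^{n+1}H^0(X,\mathcal{E})\to H^0(X,\det\mathcal{E})$, for some choice of basis and liftings. The map $H^0(X,\mathcal{L})\otimes\lambda^nW\to H^0(X,\det\mathcal{E})$ is the multiplication map induced by $\mathcal{L}\otimes\det\mathcal{F}\cong\det\mathcal{E}$. The map $H^1(X,\mathcal{F}^\vee\otimes\mathcal{L})\to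 H^1(X,\mathcal{F}^\vee\otimes\mathcal{L}(D_W))$ is induced by the natural inclusion $\mathcal{L}\to\mathcal{L}(D_W)$. The hypothesis $H^0(X,\mathcal{L})\cong H^0(X,\mathcal{L}(D_W))$ means that the natural injection $H^0(X,\mathcal{L})\to H^0(X,\mathcal{L}(D_W))$, given by multiplication by a section of $\mathcal{O}_X(D_W)$ with divisor $D_W$, is an isomorphism (equivalently, the two finite-dimensional spaces have the same dimension). *)

theory Defs
  imports "HOL-Analysis.Analysis" "HOL-Algebra.Module" "HOL-Algebra.Ideal"
begin

section \<open>Compact complex manifolds and their structure sheaf\<close>

definition multi_holomorphic_on :: "(complex^'m \<Rightarrow> complex) \<Rightarrow> (complex^'m) set \<Rightarrow> bool" where
  "multi_holomorphic_on f S \<longleftrightarrow>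
     (\<forall>z\<in>S. \<exists>f'. (f has_derivative f') (at z) \<and> (\<forall>c v. f' (c *s v) = c * f' v))"

definition complex_atlas :: "('a::topological_space set \<times> ('a \<Rightarrow> complex^'m)) set \<Rightarrow> bool" where
  "complex_atlas A \<longleftrightarrow>
     (\<Union>(U, x)\<in>A. U) = UNIV \<and>
     (\<forall>(U, x)\<in>A. open U \<and> open (x ` U) \<and> homeomorphism U (x ` U) x (inv_into U x)) \<and>
     (\<forall>(U, x)\<in>A. \<forall>(V, y)\<in>A. \<forall>k.
        multi_holomorphic_on (\<lambda>z. y (inv_into U x z) $ k) (x ` (U \<inter> V)))"

text \<open>The underlying space is the whole type; it is Hausdorff by its class.\<close>

definition compact_complex_manifold ::
    "('a::t2_space set \<times> ('a \<Rightarrow> complex^'m)) set \<Rightarrow> bool" where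
  "compact_complex_manifold A \<longleftrightarrow>
     complex_atlas A \<and> compact (UNIV :: 'a set) \<and> connected (UNIV :: 'a set)"

text \<open>A function on an open set \<open>U\<close> is represented by its extension by zero, so
  restriction to a smaller open set is \<open>rst\<close>.\<close>

definition rst :: "'a set \<Rightarrow> ('a \<Rightarrow> complex) \<Rightarrow> 'a \<Rightarrow> complex" where
  "rst V f = (\<lambda>x. if x \<in> V then f x else 0)"

definition hol :: "('a::topological_space set \<times> ('a \<Rightarrow> complex^'m)) set \<Rightarrow> 'a set
    \<Rightarrow> ('a \<Rightarrow> complex) ring" where
  "hol A U = \<lparr>carrier = {f. (\<forall>x. x \<notin> U \<longrightarrow> f x = 0) \<and>
                 (\<forall>(V, x)\<in>A. multi_holomorphic_on (f \<circ> inv_into V x) (x ` (U \<inter> V)))},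
     monoid.mult = (\<lambda>f g x. f x * g x), one = (\<lambda>x. if x \<in> U then 1 else 0),
     zero = (\<lambda>_. 0), add = (\<lambda>f g x. f x + g x)\<rparr>"


section \<open>Free modules, quotients, tensor and exterior powers over a ring\<close>

definition mod_homs :: "('r, 'x) ring_scheme \<Rightarrow> ('r, 's, 'y) module_scheme
    \<Rightarrow> ('r, 't, 'z) module_scheme \<Rightarrow> ('s \<Rightarrow> 't) set" where
  "mod_homs R M N = {f \<in> carrier M \<rightarrow> carrier N.
     (\<forall>s\<in>carrier M. \<forall>t\<in>carrier M. f (s \<oplus>\<^bsub>M\<^esub> t) = f s \<oplus>\<^bsub>N\<^esub> f t) \<and>
     (\<forall>r\<in>carrier R. \<forall>s\<in>carrier M. f (r \<odot>\<^bsub>M\<^esub> s) = r \<odot>\<^bsub>N\<^esub> f s)}"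

text \<open>The fields \<open>mult\<close> and \<open>one\<close>, which the library record for modules inherits from
  rings, play no role and are left undefined.\<close>

definition free_mod :: "('r, 'x) ring_scheme \<Rightarrow> 'g set \<Rightarrow> ('r, 'g \<Rightarrow> 'r) module" where
  "free_mod R S = \<lparr>carrier = {f. range f \<subseteq> carrier R \<and> finite {g. f g \<noteq> \<zero>\<^bsub>R\<^esub>} \<and>
                       {g. f g \<noteq> \<zero>\<^bsub>R\<^esub>} \<subseteq> S},
     monoid.mult = undefined, one = undefined,
     zero = (\<lambda>_. \<zero>\<^bsub>R\<^esub>), add = (\<lambda>f f' g. f g \<oplus>\<^bsub>R\<^esub> f' g),
     smult = (\<lambda>r f g. r \<otimes>\<^bsub>R\<^esub> f g)\<rparr>"

definition free_gen :: "('r, 'x) ring_scheme \<Rightarrow> 'g \<Rightarrow> 'g \<Rightarrow> 'r" where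
  "free_gen R g = (\<lambda>h. if h = g then \<one>\<^bsub>R\<^esub> else \<zero>\<^bsub>R\<^esub>)"

definition gen_submod :: "('r, 'x) ring_scheme \<Rightarrow> ('r, 's) module \<Rightarrow> 's set \<Rightarrow> 's set" where
  "gen_submod R M X = \<Inter>{H. submodule H R M \<and> X \<subseteq> H}"

definition quot_mod :: "('r, 's) module \<Rightarrow> 's set \<Rightarrow> ('r, 's set) module" where
  "quot_mod M N = \<lparr>carrier = a_rcosets\<^bsub>M\<^esub> N,
     monoid.mult = undefined, one = undefined,
     zero = N, add = (\<lambda>A B. A <+>\<^bsub>M\<^esub> B),
     smult = (\<lambda>r A. \<Union>a\<in>A. N +>\<^bsub>M\<^esub> (r \<odot>\<^bsub>M\<^esub> a))\<rparr>"

text \<open>\<open>quot_lift R h N b\<close> is the map, semilinear along the ring map \<open>h\<close>, from a quotient of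
  a free \<open>R\<close>-module to \<open>N\<close> that sends the class of a generator \<open>g\<close> to \<open>b g\<close>. It is only used
  where \<open>b\<close> respects the relations, so that the choice of representative is immaterial.\<close>

definition lin_ext :: "('r, 'x) ring_scheme \<Rightarrow> ('r \<Rightarrow> 'q) \<Rightarrow> ('q, 't, 'y) module_scheme
    \<Rightarrow> ('g \<Rightarrow> 't) \<Rightarrow> ('g \<Rightarrow> 'r) \<Rightarrow> 't" where
  "lin_ext R h N b f = (\<Oplus>\<^bsub>N\<^esub>g\<in>{g. f g \<noteq> \<zero>\<^bsub>R\<^esub>}. h (f g) \<odot>\<^bsub>N\<^esub> b g)"

definition quot_lift :: "('r, 'x) ring_scheme \<Rightarrow> ('r \<Rightarrow> 'q) \<Rightarrow> ('q, 't, 'y) module_scheme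
    \<Rightarrow> ('g \<Rightarrow> 't) \<Rightarrow> ('g \<Rightarrow> 'r) set \<Rightarrow> 't" where
  "quot_lift R h N b C = lin_ext R h N b (SOME f. f \<in> C)"

definition tensor_relators :: "('r, 'x) ring_scheme \<Rightarrow> ('r, 's) module \<Rightarrow> ('r, 't) module
    \<Rightarrow> ('s \<times> 't \<Rightarrow> 'r) set" where
  "tensor_relators R M N =
    (let P = free_mod R (carrier M \<times> carrier N); e = free_gen R in
     {e (s \<oplus>\<^bsub>M\<^esub> s', t) \<ominus>\<^bsub>P\<^esub> e (s, t) \<ominus>\<^bsub>P\<^esub> e (s', t) | s s' t.
        s \<in> carrier M \<and> s' \<in> carrier M \<and> t \<in> carrier N} \<union>
     {e (s, t \<oplus>\<^bsub>N\<^esub> t') \<ominus>\<^bsub>P\<^esub> e (s, t) \<ominus>\<^bsub>P\<^esub> e (s, t') | s t t'.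
        s \<in> carrier M \<and> t \<in> carrier N \<and> t' \<in> carrier N} \<union>
     {e (r \<odot>\<^bsub>M\<^esub> s, t) \<ominus>\<^bsub>P\<^esub> r \<odot>\<^bsub>P\<^esub> e (s, t) | r s t.
        r \<in> carrier R \<and> s \<in> carrier M \<and> t \<in> carrier N} \<union>
     {e (s, r \<odot>\<^bsub>N\<^esub> t) \<ominus>\<^bsub>P\<^esub> r \<odot>\<^bsub>P\<^esub> e (s, t) | r s t.
        r \<in> carrier R \<and> s \<in> carrier M \<and> t \<in> carrier N})"

definition tensor_ker :: "('r, 'x) ring_scheme \<Rightarrow> ('r, 's) module \<Rightarrow> ('r, 't) module
    \<Rightarrow> ('s \<times> 't \<Rightarrow> 'r) set" where
  "tensor_ker R M N =
     gen_submod R (free_mod R (carrier M \<times> carrier N)) (tensor_relators R M N)"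

definition tensor_mod :: "('r, 'x) ring_scheme \<Rightarrow> ('r, 's) module \<Rightarrow> ('r, 't) module
    \<Rightarrow> ('r, ('s \<times> 't \<Rightarrow> 'r) set) module" where
  "tensor_mod R M N = quot_mod (free_mod R (carrier M \<times> carrier N)) (tensor_ker R M N)"

definition pure_tensor :: "('r, 'x) ring_scheme \<Rightarrow> ('r, 's) module \<Rightarrow> ('r, 't) module
    \<Rightarrow> 's \<Rightarrow> 't \<Rightarrow> ('s \<times> 't \<Rightarrow> 'r) set" where
  "pure_tensor R M N s t =
     tensor_ker R M N +>\<^bsub>free_mod R (carrier M \<times> carrier N)\<^esub> free_gen R (s, t)"

definition ext_gens :: "nat \<Rightarrow> ('r, 's) module \<Rightarrow> 's list set" where
  "ext_gens k M = {xs. length xs = k \<and> set xs \<subseteq> carrier M}"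

definition ext_relators :: "('r, 'x) ring_scheme \<Rightarrow> nat \<Rightarrow> ('r, 's) module
    \<Rightarrow> ('s list \<Rightarrow> 'r) set" where
  "ext_relators R k M =
    (let P = free_mod R (ext_gens k M); e = free_gen R in
     {e (xs @ (s \<oplus>\<^bsub>M\<^esub> t) # ys) \<ominus>\<^bsub>P\<^esub> e (xs @ s # ys) \<ominus>\<^bsub>P\<^esub> e (xs @ t # ys) | xs s t ys.
        xs @ s # ys \<in> ext_gens k M \<and> t \<in> carrier M} \<union>
     {e (xs @ (r \<odot>\<^bsub>M\<^esub> s) # ys) \<ominus>\<^bsub>P\<^esub> r \<odot>\<^bsub>P\<^esub> e (xs @ s # ys) | xs r s ys.
        xs @ s # ys \<in> ext_gens k M \<and> r \<in> carrier R} \<union>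
     {e xs | xs. xs \<in> ext_gens k M \<and> \<not> distinct xs})"

definition ext_ker :: "('r, 'x) ring_scheme \<Rightarrow> nat \<Rightarrow> ('r, 's) module \<Rightarrow> ('s list \<Rightarrow> 'r) set" where
  "ext_ker R k M = gen_submod R (free_mod R (ext_gens k M)) (ext_relators R k M)"

definition ext_pow :: "('r, 'x) ring_scheme \<Rightarrow> nat \<Rightarrow> ('r, 's) module
    \<Rightarrow> ('r, ('s list \<Rightarrow> 'r) set) module" where
  "ext_pow R k M = quot_mod (free_mod R (ext_gens k M)) (ext_ker R k M)"

definition pure_wedge :: "('r, 'x) ring_scheme \<Rightarrow> ('r, 's) module \<Rightarrow> 's list
    \<Rightarrow> ('s list \<Rightarrow> 'r) set" where
  "pure_wedge R M xs =
     ext_ker R (length xs) M +>\<^bsub>free_mod R (ext_gens (length xs) M)\<^esub> free_gen R xs"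


section \<open>Sheaves of modules over a sheaf of rings of functions\<close>

type_synonym 'a ring_sheaf = "'a set \<Rightarrow> ('a \<Rightarrow> complex) ring"

text \<open>\<open>sec P U\<close> is the module of sections over \<open>U\<close>, and \<open>res P U V\<close> is the restriction from
  \<open>U\<close> to \<open>V\<close>. Only the values on open sets matter.\<close>

record ('a, 's) mod_presheaf =
  sec :: "'a set \<Rightarrow> ('a \<Rightarrow> complex, 's) module"
  res :: "'a set \<Rightarrow> 'a set \<Rightarrow> 's \<Rightarrow> 's"

definition is_presheaf :: "('a::topological_space) ring_sheaf \<Rightarrow> ('a, 's) mod_presheaf \<Rightarrow> bool" where
  "is_presheaf \<O> P \<longleftrightarrow>
     (\<forall>U. open U \<longrightarrow> Module.module (\<O> U) (sec P U)) \<and>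
     (\<forall>U V. open U \<and> open V \<and> V \<subseteq> U \<longrightarrow>
        res P U V \<in> carrier (sec P U) \<rightarrow> carrier (sec P V) \<and>
        (\<forall>s\<in>carrier (sec P U). \<forall>t\<in>carrier (sec P U).
           res P U V (s \<oplus>\<^bsub>sec P U\<^esub> t) = res P U V s \<oplus>\<^bsub>sec P V\<^esub> res P U V t) \<and>
        (\<forall>r\<in>carrier (\<O> U). \<forall>s\<in>carrier (sec P U).
           res P U V (r \<odot>\<^bsub>sec P U\<^esub> s) = rst V r \<odot>\<^bsub>sec P V\<^esub> res P U V s)) \<and>
     (\<forall>U. open U \<longrightarrow> (\<forall>s\<in>carrier (sec P U). res P U U s = s)) \<and>
     (\<forall>U V W. open U \<and> open V \<and> open W \<and> W \<subseteq> V \<and> V \<subseteq> U \<longrightarrow>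
        (\<forall>s\<in>carrier (sec P U). res P V W (res P U V s) = res P U W s))"

definition is_sheaf :: "('a::topological_space) ring_sheaf \<Rightarrow> ('a, 's) mod_presheaf \<Rightarrow> bool" where
  "is_sheaf \<O> F \<longleftrightarrow> is_presheaf \<O> F \<and>
     (\<forall>\<U> t. (\<forall>U\<in>\<U>. open U \<and> t U \<in> carrier (sec F U)) \<and>
        (\<forall>U\<in>\<U>. \<forall>V\<in>\<U>. res F U (U \<inter> V) (t U) = res F V (U \<inter> V) (t V)) \<longrightarrow>
        (\<exists>!s. s \<in> carrier (sec F (\<Union>\<U>)) \<and> (\<forall>U\<in>\<U>. res F (\<Union>\<U>) U s = t U)))"

abbreviation H0 :: "('a, 's) mod_presheaf \<Rightarrow> ('a \<Rightarrow> complex, 's) module" where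
  "H0 F \<equiv> sec F UNIV"

text \<open>Morphisms \<open>F|U \<rightarrow> G|U\<close>.\<close>

definition is_mor :: "('a::topological_space) ring_sheaf \<Rightarrow> 'a set \<Rightarrow> ('a, 's) mod_presheaf
    \<Rightarrow> ('a, 't) mod_presheaf \<Rightarrow> ('a set \<Rightarrow> 's \<Rightarrow> 't) \<Rightarrow> bool" where
  "is_mor \<O> U F G \<phi> \<longleftrightarrow>
     (\<forall>V. open V \<and> V \<subseteq> U \<longrightarrow> \<phi> V \<in> mod_homs (\<O> V) (sec F V) (sec G V)) \<and>
     (\<forall>V W. open V \<and> open W \<and> W \<subseteq> V \<and> V \<subseteq> U \<longrightarrow>
        (\<forall>s\<in>carrier (sec F V). \<phi> W (res F V W s) = res G V W (\<phi> V s)))"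

definition is_iso :: "('a::topological_space) ring_sheaf \<Rightarrow> 'a set \<Rightarrow> ('a, 's) mod_presheaf
    \<Rightarrow> ('a, 't) mod_presheaf \<Rightarrow> ('a set \<Rightarrow> 's \<Rightarrow> 't) \<Rightarrow> bool" where
  "is_iso \<O> U F G \<phi> \<longleftrightarrow> is_mor \<O> U F G \<phi> \<and>
     (\<forall>V. open V \<and> V \<subseteq> U \<longrightarrow> bij_betw (\<phi> V) (carrier (sec F V)) (carrier (sec G V)))"

definition structure_sheaf :: "'a ring_sheaf \<Rightarrow> ('a, 'a \<Rightarrow> complex) mod_presheaf" where
  "structure_sheaf \<O> =
     \<lparr>sec = (\<lambda>U. \<lparr>carrier = carrier (\<O> U), monoid.mult = monoid.mult (\<O> U), one = \<one>\<^bsub>\<O> U\<^esub>,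
                  zero = \<zero>\<^bsub>\<O> U\<^esub>, add = add (\<O> U), smult = monoid.mult (\<O> U)\<rparr>),
      res = (\<lambda>U V. rst V)\<rparr>"

definition free_sheaf :: "'a ring_sheaf \<Rightarrow> nat \<Rightarrow> ('a, nat \<Rightarrow> 'a \<Rightarrow> complex) mod_presheaf" where
  "free_sheaf \<O> n =
     \<lparr>sec = (\<lambda>U. \<lparr>carrier = {..<n} \<rightarrow>\<^sub>E carrier (\<O> U),
                  monoid.mult = undefined, one = undefined,
                  zero = (\<lambda>j\<in>{..<n}. \<zero>\<^bsub>\<O> U\<^esub>), add = (\<lambda>s t. \<lambda>j\<in>{..<n}. s j \<oplus>\<^bsub>\<O> U\<^esub> t j),
                  smult = (\<lambda>r s. \<lambda>j\<in>{..<n}. r \<otimes>\<^bsub>\<O> U\<^esub> s j)\<rparr>),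
      res = (\<lambda>U V s. \<lambda>j\<in>{..<n}. rst V (s j))\<rparr>"

definition locally_free :: "('a::topological_space) ring_sheaf \<Rightarrow> nat \<Rightarrow> ('a, 's) mod_presheaf \<Rightarrow> bool" where
  "locally_free \<O> n F \<longleftrightarrow> is_sheaf \<O> F \<and>
     (\<forall>x. \<exists>U \<phi>. open U \<and> x \<in> U \<and> is_iso \<O> U (free_sheaf \<O> n) F \<phi>)"

abbreviation invertible_sheaf :: "('a::topological_space) ring_sheaf \<Rightarrow> ('a, 's) mod_presheaf \<Rightarrow> bool" where
  "invertible_sheaf \<O> \<equiv> locally_free \<O> 1"

text \<open>Exactness of \<open>0 \<rightarrow> L \<rightarrow> E \<rightarrow> F \<rightarrow> 0\<close> as sheaves, that is, up to passing to smaller open sets.\<close>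

definition short_exact :: "('a::topological_space) ring_sheaf \<Rightarrow> ('a, 'l) mod_presheaf
    \<Rightarrow> ('a, 'e) mod_presheaf \<Rightarrow> ('a, 'f) mod_presheaf
    \<Rightarrow> ('a set \<Rightarrow> 'l \<Rightarrow> 'e) \<Rightarrow> ('a set \<Rightarrow> 'e \<Rightarrow> 'f) \<Rightarrow> bool" where
  "short_exact \<O> L E F i p \<longleftrightarrow>
     is_mor \<O> UNIV L E i \<and> is_mor \<O> UNIV E F p \<and>
     (\<forall>U. open U \<longrightarrow> inj_on (i U) (carrier (sec L U))) \<and>
     (\<forall>U. open U \<longrightarrow> (\<forall>l\<in>carrier (sec L U). p U (i U l) = \<zero>\<^bsub>sec F U\<^esub>)) \<and>
     (\<forall>U. open U \<longrightarrow> (\<forall>e\<in>carrier (sec E U). p U e = \<zero>\<^bsub>sec F U\<^esub> \<longrightarrow>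
        (\<forall>x\<in>U. \<exists>V. open V \<and> x \<in> V \<and> V \<subseteq> U \<and> res E U V e \<in> i V ` carrier (sec L V)))) \<and>
     (\<forall>U. open U \<longrightarrow> (\<forall>f\<in>carrier (sec F U). \<forall>x\<in>U.
        \<exists>V. open V \<and> x \<in> V \<and> V \<subseteq> U \<and> res F U V f \<in> p V ` carrier (sec E V)))"

text \<open>The sheaf \<open>Hom(F, G)\<close>: its sections over \<open>U\<close> are the morphisms \<open>F|U \<rightarrow> G|U\<close>,
  normalised by \<open>cut\<close> to be undefined outside their domain.\<close>

definition cut :: "('a::topological_space, 's) mod_presheaf \<Rightarrow> 'a set \<Rightarrow> ('a set \<Rightarrow> 's \<Rightarrow> 't)
    \<Rightarrow> 'a set \<Rightarrow> 's \<Rightarrow> 't" where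
  "cut F U \<phi> = (\<lambda>V s. if open V \<and> V \<subseteq> U \<and> s \<in> carrier (sec F V) then \<phi> V s else undefined)"

definition hom_sheaf :: "('a::topological_space) ring_sheaf \<Rightarrow> ('a, 's) mod_presheaf
    \<Rightarrow> ('a, 't) mod_presheaf \<Rightarrow> ('a, 'a set \<Rightarrow> 's \<Rightarrow> 't) mod_presheaf" where
  "hom_sheaf \<O> F G =
     \<lparr>sec = (\<lambda>U. \<lparr>carrier = {\<phi>. is_mor \<O> U F G \<phi> \<and> cut F U \<phi> = \<phi>},
                  monoid.mult = undefined, one = undefined,
                  zero = cut F U (\<lambda>V s. \<zero>\<^bsub>sec G V\<^esub>),
                  add = (\<lambda>\<phi> \<psi>. cut F U (\<lambda>V s. \<phi> V s \<oplus>\<^bsub>sec G V\<^esub> \<psi> V s)),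
                  smult = (\<lambda>r \<phi>. cut F U (\<lambda>V s. rst V r \<odot>\<^bsub>sec G V\<^esub> \<phi> V s))\<rparr>),
      res = (\<lambda>U V. cut F V)\<rparr>"

definition dual_sheaf :: "('a::topological_space) ring_sheaf \<Rightarrow> ('a, 's) mod_presheaf
    \<Rightarrow> ('a, 'a set \<Rightarrow> 's \<Rightarrow> 'a \<Rightarrow> complex) mod_presheaf" where
  "dual_sheaf \<O> F = hom_sheaf \<O> F (structure_sheaf \<O>)"


section \<open>Sheafification, tensor products and determinants\<close>

text \<open>A germ at \<open>x\<close> is an equivalence class of pairs \<open>(V, t)\<close> with \<open>t\<close> a section over \<open>V \<ni> x\<close>.
  Sections of the sheafification over \<open>U\<close> are functions from \<open>U\<close> to germs that locally come
  from sections of the presheaf.\<close>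

type_synonym ('a, 's) germ = "('a set \<times> 's) set"

definition germ :: "('a::topological_space, 's) mod_presheaf \<Rightarrow> 'a \<Rightarrow> 'a set \<Rightarrow> 's \<Rightarrow> ('a, 's) germ" where
  "germ P x U s = {(V, t). open V \<and> x \<in> V \<and> t \<in> carrier (sec P V) \<and>
     (\<exists>W. open W \<and> x \<in> W \<and> W \<subseteq> U \<inter> V \<and> res P U W s = res P V W t)}"

definition sheafify :: "('a::topological_space, 's) mod_presheaf
    \<Rightarrow> ('a, 'a \<Rightarrow> ('a, 's) germ) mod_presheaf" where
  "sheafify P =
     \<lparr>sec = (\<lambda>U. \<lparr>carrier = {f \<in> extensional U. \<forall>x\<in>U. \<exists>V t. open V \<and> x \<in> V \<and> V \<subseteq> U \<and>
                              t \<in> carrier (sec P V) \<and> (\<forall>y\<in>V. f y = germ P y V t)},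
                  monoid.mult = undefined, one = undefined,
                  zero = (\<lambda>x\<in>U. germ P x U \<zero>\<^bsub>sec P U\<^esub>),
                  add = (\<lambda>f g. \<lambda>x\<in>U. \<Union>(V, s)\<in>f x. \<Union>(W, t)\<in>g x.
                           germ P x (V \<inter> W) (res P V (V \<inter> W) s \<oplus>\<^bsub>sec P (V \<inter> W)\<^esub> res P W (V \<inter> W) t)),
                  smult = (\<lambda>r f. \<lambda>x\<in>U. \<Union>(V, s)\<in>f x.
                           germ P x (U \<inter> V) (rst (U \<inter> V) r \<odot>\<^bsub>sec P (U \<inter> V)\<^esub> res P V (U \<inter> V) s))\<rparr>),
      res = (\<lambda>U V f. restrict f V)\<rparr>"

definition sh_unit :: "('a::topological_space, 's) mod_presheaf \<Rightarrow> 'a set \<Rightarrow> 's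
    \<Rightarrow> 'a \<Rightarrow> ('a, 's) germ" where
  "sh_unit P U s = (\<lambda>x\<in>U. germ P x U s)"

text \<open>The maps \<open>sheafify P \<rightarrow> sheafify Q\<close> and (for \<open>G\<close> a sheaf) \<open>sheafify P \<rightarrow> G\<close> induced by a
  morphism of presheaves \<open>\<psi>\<close> from \<open>P\<close>.\<close>

definition sh_map :: "('a::topological_space, 't) mod_presheaf \<Rightarrow> ('a set \<Rightarrow> 's \<Rightarrow> 't) \<Rightarrow> 'a set
    \<Rightarrow> ('a \<Rightarrow> ('a, 's) germ) \<Rightarrow> 'a \<Rightarrow> ('a, 't) germ" where
  "sh_map Q \<psi> U f = (\<lambda>x\<in>U. \<Union>(V, s)\<in>f x. germ Q x V (\<psi> V s))"

definition sh_ext :: "('a, 't) mod_presheaf \<Rightarrow> ('a set \<Rightarrow> 's \<Rightarrow> 't) \<Rightarrow> 'a set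
    \<Rightarrow> ('a \<Rightarrow> ('a, 's) germ) \<Rightarrow> 't" where
  "sh_ext G \<psi> U f = (THE g. g \<in> carrier (sec G U) \<and>
     (\<forall>x\<in>U. \<exists>(V, s)\<in>f x. V \<subseteq> U \<and> res G U V g = \<psi> V s))"

definition tensor_presheaf :: "'a ring_sheaf \<Rightarrow> ('a, 's) mod_presheaf \<Rightarrow> ('a, 't) mod_presheaf
    \<Rightarrow> ('a, ('s \<times> 't \<Rightarrow> 'a \<Rightarrow> complex) set) mod_presheaf" where
  "tensor_presheaf \<O> F G =
     \<lparr>sec = (\<lambda>U. tensor_mod (\<O> U) (sec F U) (sec G U)),
      res = (\<lambda>U V. quot_lift (\<O> U) (rst V) (tensor_mod (\<O> V) (sec F V) (sec G V))
               (\<lambda>(s, t). pure_tensor (\<O> V) (sec F V) (sec G V) (res F U V s) (res G U V t)))\<rparr>"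

definition tensor_sheaf :: "('a::topological_space) ring_sheaf \<Rightarrow> ('a, 's) mod_presheaf
    \<Rightarrow> ('a, 't) mod_presheaf
    \<Rightarrow> ('a, 'a \<Rightarrow> ('a, ('s \<times> 't \<Rightarrow> 'a \<Rightarrow> complex) set) germ) mod_presheaf" where
  "tensor_sheaf \<O> F G = sheafify (tensor_presheaf \<O> F G)"

text \<open>The morphism \<open>id \<otimes> \<phi> : F \<otimes> G \<rightarrow> F \<otimes> G'\<close>.\<close>

definition tensor_map :: "('a::topological_space) ring_sheaf \<Rightarrow> ('a, 's) mod_presheaf
    \<Rightarrow> ('a, 't) mod_presheaf \<Rightarrow> ('a, 'u) mod_presheaf \<Rightarrow> ('a set \<Rightarrow> 't \<Rightarrow> 'u) \<Rightarrow> 'a set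
    \<Rightarrow> ('a \<Rightarrow> ('a, ('s \<times> 't \<Rightarrow> 'a \<Rightarrow> complex) set) germ)
    \<Rightarrow> 'a \<Rightarrow> ('a, ('s \<times> 'u \<Rightarrow> 'a \<Rightarrow> complex) set) germ" where
  "tensor_map \<O> F G G' \<phi> = sh_map (tensor_presheaf \<O> F G')
     (\<lambda>V. quot_lift (\<O> V) id (tensor_mod (\<O> V) (sec F V) (sec G' V))
            (\<lambda>(s, t). pure_tensor (\<O> V) (sec F V) (sec G' V) s (\<phi> V t)))"

text \<open>The canonical map \<open>F\<^sup>\<or> \<otimes> L \<rightarrow> Hom(F, L)\<close>, \<open>\<alpha> \<otimes> l \<mapsto> (s \<mapsto> \<alpha>(s) l)\<close>: \<open>contract \<O> F L U \<tau> s\<close>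
  is the value at \<open>s \<in> F(U)\<close> of the homomorphism given by \<open>\<tau> \<in> (F\<^sup>\<or> \<otimes> L)(U)\<close>.\<close>

definition contract :: "('a::topological_space) ring_sheaf \<Rightarrow> ('a, 's) mod_presheaf
    \<Rightarrow> ('a, 'l) mod_presheaf \<Rightarrow> 'a set
    \<Rightarrow> ('a \<Rightarrow> ('a, (('a set \<Rightarrow> 's \<Rightarrow> 'a \<Rightarrow> complex) \<times> 'l \<Rightarrow> 'a \<Rightarrow> complex) set) germ)
    \<Rightarrow> 's \<Rightarrow> 'l" where
  "contract \<O> F L U \<tau> s = sh_ext L
     (\<lambda>V. quot_lift (\<O> V) id (sec L V) (\<lambda>(\<alpha>, l). \<alpha> V (res F U V s) \<odot>\<^bsub>sec L V\<^esub> l)) U \<tau>"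

definition ext_presheaf :: "'a ring_sheaf \<Rightarrow> nat \<Rightarrow> ('a, 's) mod_presheaf
    \<Rightarrow> ('a, ('s list \<Rightarrow> 'a \<Rightarrow> complex) set) mod_presheaf" where
  "ext_presheaf \<O> k F =
     \<lparr>sec = (\<lambda>U. ext_pow (\<O> U) k (sec F U)),
      res = (\<lambda>U V. quot_lift (\<O> U) (rst V) (ext_pow (\<O> V) k (sec F V))
               (\<lambda>xs. pure_wedge (\<O> V) (sec F V) (map (res F U V) xs)))\<rparr>"

definition ext_sheaf :: "('a::topological_space) ring_sheaf \<Rightarrow> nat \<Rightarrow> ('a, 's) mod_presheaf
    \<Rightarrow> ('a, 'a \<Rightarrow> ('a, ('s list \<Rightarrow> 'a \<Rightarrow> complex) set) germ) mod_presheaf" where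
  "ext_sheaf \<O> k F = sheafify (ext_presheaf \<O> k F)"

text \<open>The section \<open>s\<^sub>1 \<and> \<dots> \<and> s\<^sub>k\<close> of the \<open>k\<close>-th exterior power over \<open>U\<close>.\<close>

definition wedge :: "('a::topological_space) ring_sheaf \<Rightarrow> ('a, 's) mod_presheaf \<Rightarrow> 'a set
    \<Rightarrow> 's list \<Rightarrow> 'a \<Rightarrow> ('a, ('s list \<Rightarrow> 'a \<Rightarrow> complex) set) germ" where
  "wedge \<O> F U xs =
     sh_unit (ext_presheaf \<O> (length xs) F) U (pure_wedge (\<O> U) (sec F U) xs)"


section \<open>First Cech cohomology\<close>

definition open_cover :: "'a::topological_space set set \<Rightarrow> bool" where
  "open_cover \<U> \<longleftrightarrow> (\<forall>U\<in>\<U>. open U) \<and> \<Union>\<U> = UNIV"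

type_synonym ('a, 's) cocycle = "'a set set \<times> ('a set \<Rightarrow> 'a set \<Rightarrow> 's)"

definition cech_Z1 :: "('a::topological_space, 's) mod_presheaf \<Rightarrow> ('a, 's) cocycle set" where
  "cech_Z1 F = {(\<U>, c). open_cover \<U> \<and>
     (\<forall>U\<in>\<U>. \<forall>V\<in>\<U>. c U V \<in> carrier (sec F (U \<inter> V))) \<and>
     (\<forall>U\<in>\<U>. \<forall>V\<in>\<U>. \<forall>W\<in>\<U>.
        res F (U \<inter> V) (U \<inter> V \<inter> W) (c U V) \<oplus>\<^bsub>sec F (U \<inter> V \<inter> W)\<^esub> res F (V \<inter> W) (U \<inter> V \<inter> W) (c V W)
          = res F (U \<inter> W) (U \<inter> V \<inter> W) (c U W))}"

text \<open>Equality in the direct limit over covers: the cocycles differ by a coboundary on some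
  common refinement.\<close>

definition cech_rel :: "('a::topological_space, 's) mod_presheaf
    \<Rightarrow> (('a, 's) cocycle \<times> ('a, 's) cocycle) set" where
  "cech_rel F = {((\<U>, c), (\<V>, d)). (\<U>, c) \<in> cech_Z1 F \<and> (\<V>, d) \<in> cech_Z1 F \<and>
     (\<exists>\<W> u v b. open_cover \<W> \<and>
        (\<forall>W\<in>\<W>. u W \<in> \<U> \<and> W \<subseteq> u W \<and> v W \<in> \<V> \<and> W \<subseteq> v W \<and> b W \<in> carrier (sec F W)) \<and>
        (\<forall>W\<in>\<W>. \<forall>W'\<in>\<W>.
           res F (u W \<inter> u W') (W \<inter> W') (c (u W) (u W'))
             \<ominus>\<^bsub>sec F (W \<inter> W')\<^esub> res F (v W \<inter> v W') (W \<inter> W') (d (v W) (v W'))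
           = res F W' (W \<inter> W') (b W') \<ominus>\<^bsub>sec F (W \<inter> W')\<^esub> res F W (W \<inter> W') (b W)))}"

definition H1 :: "('a::topological_space, 's) mod_presheaf \<Rightarrow> ('a, 's) cocycle set set" where
  "H1 F = cech_Z1 F // cech_rel F"

definition H1_class :: "('a::topological_space, 's) mod_presheaf \<Rightarrow> ('a, 's) cocycle
    \<Rightarrow> ('a, 's) cocycle set" where
  "H1_class F z = cech_rel F `` {z}"

definition H1_zero :: "('a::topological_space, 's) mod_presheaf \<Rightarrow> ('a, 's) cocycle set" where
  "H1_zero F = H1_class F ({UNIV}, \<lambda>_ _. \<zero>\<^bsub>sec F UNIV\<^esub>)"

definition H1_map :: "('a::topological_space, 't) mod_presheaf \<Rightarrow> ('a set \<Rightarrow> 's \<Rightarrow> 't)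
    \<Rightarrow> ('a, 's) cocycle set \<Rightarrow> ('a, 't) cocycle set" where
  "H1_map G \<phi> \<xi> = (\<Union>(\<U>, c)\<in>\<xi>. H1_class G (\<U>, \<lambda>U V. \<phi> (U \<inter> V) (c U V)))"

text \<open>The class in \<open>H\<^sup>1(F\<^sup>\<or> \<otimes> L)\<close> of an extension \<open>0 \<rightarrow> L \<rightarrow> E \<rightarrow> F \<rightarrow> 0\<close>: differences of local
  splittings, regarded as sections of \<open>F\<^sup>\<or> \<otimes> L \<cong> Hom(F, L)\<close>.\<close>

definition extension_class :: "('a::topological_space) ring_sheaf \<Rightarrow> ('a, 'l) mod_presheaf
    \<Rightarrow> ('a, 'e) mod_presheaf \<Rightarrow> ('a, 'f) mod_presheaf
    \<Rightarrow> ('a set \<Rightarrow> 'l \<Rightarrow> 'e) \<Rightarrow> ('a set \<Rightarrow> 'e \<Rightarrow> 'f)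
    \<Rightarrow> ('a, 'a \<Rightarrow> ('a, (('a set \<Rightarrow> 'f \<Rightarrow> 'a \<Rightarrow> complex) \<times> 'l \<Rightarrow> 'a \<Rightarrow> complex) set) germ) cocycle set"
  where
  "extension_class \<O> L E F i p =
     (let T = tensor_sheaf \<O> (dual_sheaf \<O> F) L in
      \<Union>{H1_class T (\<U>, c) | \<U> c. (\<U>, c) \<in> cech_Z1 T \<and>
        (\<exists>\<sigma>. (\<forall>U\<in>\<U>. is_mor \<O> U F E (\<sigma> U) \<and>
                (\<forall>V. open V \<and> V \<subseteq> U \<longrightarrow> (\<forall>s\<in>carrier (sec F V). p V (\<sigma> U V s) = s))) \<and>
             (\<forall>U\<in>\<U>. \<forall>U'\<in>\<U>. \<forall>V. open V \<and> V \<subseteq> U \<inter> U' \<longrightarrow> (\<forall>s\<in>carrier (sec F V).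
                i V (contract \<O> F L V (res T (U \<inter> U') V (c U U')) s)
                  = \<sigma> U' V s \<ominus>\<^bsub>sec E V\<^esub> \<sigma> U V s)))})"

text \<open>The connecting homomorphism \<open>H\<^sup>0(F) \<rightarrow> H\<^sup>1(L)\<close>.\<close>

definition connecting :: "('a::topological_space, 'l) mod_presheaf \<Rightarrow> ('a, 'e) mod_presheaf
    \<Rightarrow> ('a, 'f) mod_presheaf \<Rightarrow> ('a set \<Rightarrow> 'l \<Rightarrow> 'e) \<Rightarrow> ('a set \<Rightarrow> 'e \<Rightarrow> 'f)
    \<Rightarrow> 'f \<Rightarrow> ('a, 'l) cocycle set" where
  "connecting L E F i p \<eta> =
     \<Union>{H1_class L (\<U>, c) | \<U> c. (\<U>, c) \<in> cech_Z1 L \<and>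
       (\<exists>t. (\<forall>U\<in>\<U>. t U \<in> carrier (sec E U) \<and> p U (t U) = res F UNIV U \<eta>) \<and>
            (\<forall>U\<in>\<U>. \<forall>V\<in>\<U>. i (U \<inter> V) (c U V)
               = res E V (U \<inter> V) (t V) \<ominus>\<^bsub>sec E (U \<inter> V)\<^esub> res E U (U \<inter> V) (t U)))}"


section \<open>Effective divisors\<close>

text \<open>An effective (Cartier) divisor is represented by its ideal sheaf, which is locally
  generated by one nonzerodivisor. So \<open>D \<le> D'\<close> means that the ideal of \<open>D'\<close> is contained in
  that of \<open>D\<close>.\<close>

type_synonym 'a ideal_sheaf = "'a set \<Rightarrow> ('a \<Rightarrow> complex) set"

definition effective_divisor :: "('a::topological_space) ring_sheaf \<Rightarrow> 'a ideal_sheaf \<Rightarrow> bool" where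
  "effective_divisor \<O> D \<longleftrightarrow>
     (\<forall>U. open U \<longrightarrow> ideal (D U) (\<O> U)) \<and>
     (\<forall>U V. open U \<and> open V \<and> V \<subseteq> U \<longrightarrow> rst V ` D U \<subseteq> D V) \<and>
     (\<forall>U. open U \<longrightarrow> (\<forall>f\<in>carrier (\<O> U).
        (\<forall>x\<in>U. \<exists>V. open V \<and> x \<in> V \<and> V \<subseteq> U \<and> rst V f \<in> D V) \<longrightarrow> f \<in> D U)) \<and>
     (\<forall>x. \<exists>U f. open U \<and> x \<in> U \<and> f \<in> carrier (\<O> U) \<and>
        (\<forall>V. open V \<and> V \<subseteq> U \<longrightarrow>
           (\<forall>g\<in>carrier (\<O> V). g \<otimes>\<^bsub>\<O> V\<^esub> rst V f = \<zero>\<^bsub>\<O> V\<^esub> \<longrightarrow> g = \<zero>\<^bsub>\<O> V\<^esub>) \<and>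
           D V = (\<lambda>g. g \<otimes>\<^bsub>\<O> V\<^esub> rst V f) ` carrier (\<O> V)))"

definition divisor_le :: "('a::topological_space) ideal_sheaf \<Rightarrow> 'a ideal_sheaf \<Rightarrow> bool" where
  "divisor_le D D' \<longleftrightarrow> (\<forall>U. open U \<longrightarrow> D' U \<subseteq> D U)"

text \<open>The divisor of a global section \<open>s\<close> of an invertible sheaf \<open>M\<close>: its ideal sheaf is the image
  of evaluation at \<open>s\<close>, \<open>M\<^sup>\<or> \<rightarrow> \<O>\<close>.\<close>

definition divisor_of :: "('a::topological_space) ring_sheaf \<Rightarrow> ('a, 's) mod_presheaf \<Rightarrow> 's
    \<Rightarrow> 'a ideal_sheaf" where
  "divisor_of \<O> M s = (\<lambda>U. {f \<in> carrier (\<O> U). \<forall>x\<in>U. \<exists>V. open V \<and> x \<in> V \<and> V \<subseteq> U \<and>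
     (\<exists>\<alpha>\<in>carrier (sec (dual_sheaf \<O> M) V). rst V f = \<alpha> V (res M UNIV V s))})"

definition is_fixed_divisor :: "('a::topological_space) ring_sheaf \<Rightarrow> ('a, 's) mod_presheaf
    \<Rightarrow> 's set \<Rightarrow> 'a ideal_sheaf \<Rightarrow> bool" where
  "is_fixed_divisor \<O> M \<Lambda> D \<longleftrightarrow>
     (let below = (\<lambda>D'. effective_divisor \<O> D' \<and>
            (\<forall>\<omega>\<in>\<Lambda>. \<omega> \<noteq> \<zero>\<^bsub>H0 M\<^esub> \<longrightarrow> divisor_le D' (divisor_of \<O> M \<omega>)))
      in below D \<and> (\<forall>D'. below D' \<longrightarrow> divisor_le D' D))"

text \<open>\<open>\<O>(D) = Hom(I\<^sub>D, \<O>)\<close>, whose canonical section, with divisor \<open>D\<close>, is the inclusion of the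
  ideal sheaf \<open>I\<^sub>D\<close> into \<open>\<O>\<close>.\<close>

definition ideal_module :: "'a ring_sheaf \<Rightarrow> 'a ideal_sheaf \<Rightarrow> ('a, 'a \<Rightarrow> complex) mod_presheaf" where
  "ideal_module \<O> D =
     (structure_sheaf \<O>)\<lparr>sec := (\<lambda>U. (sec (structure_sheaf \<O>) U)\<lparr>carrier := D U\<rparr>)\<rparr>"

definition divisor_sheaf :: "('a::topological_space) ring_sheaf \<Rightarrow> 'a ideal_sheaf
    \<Rightarrow> ('a, 'a set \<Rightarrow> ('a \<Rightarrow> complex) \<Rightarrow> 'a \<Rightarrow> complex) mod_presheaf" where
  "divisor_sheaf \<O> D = dual_sheaf \<O> (ideal_module \<O> D)"

definition canonical_section :: "('a::topological_space) ring_sheaf \<Rightarrow> 'a ideal_sheaf \<Rightarrow> 'a set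
    \<Rightarrow> 'a set \<Rightarrow> ('a \<Rightarrow> complex) \<Rightarrow> 'a \<Rightarrow> complex" where
  "canonical_section \<O> D U = cut (ideal_module \<O> D) U (\<lambda>V f. f)"

definition twist :: "('a::topological_space) ring_sheaf \<Rightarrow> ('a, 'l) mod_presheaf \<Rightarrow> 'a ideal_sheaf
    \<Rightarrow> ('a, 'a \<Rightarrow> ('a, ('l \<times> ('a set \<Rightarrow> ('a \<Rightarrow> complex) \<Rightarrow> 'a \<Rightarrow> complex)
          \<Rightarrow> 'a \<Rightarrow> complex) set) germ) mod_presheaf" where
  "twist \<O> L D = tensor_sheaf \<O> L (divisor_sheaf \<O> D)"

text \<open>The natural inclusion \<open>L \<rightarrow> L(D)\<close>.\<close>

definition twist_incl :: "('a::topological_space) ring_sheaf \<Rightarrow> ('a, 'l) mod_presheaf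
    \<Rightarrow> 'a ideal_sheaf \<Rightarrow> 'a set \<Rightarrow> 'l
    \<Rightarrow> 'a \<Rightarrow> ('a, ('l \<times> ('a set \<Rightarrow> ('a \<Rightarrow> complex) \<Rightarrow> 'a \<Rightarrow> complex) \<Rightarrow> 'a \<Rightarrow> complex) set) germ"
  where
  "twist_incl \<O> L D U l = sh_unit (tensor_presheaf \<O> L (divisor_sheaf \<O> D)) U
     (pure_tensor (\<O> U) (sec L U) (sec (divisor_sheaf \<O> D) U) l (canonical_section \<O> D U))"


section \<open>Adjoint forms\<close>

text \<open>Complex scalars act on \<open>H\<^sup>0\<close> as constant functions.\<close>

definition lin_comb :: "('a \<Rightarrow> complex, 's) module \<Rightarrow> nat \<Rightarrow> (nat \<Rightarrow> complex) \<Rightarrow> (nat \<Rightarrow> 's) \<Rightarrow> 's" where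
  "lin_comb M k c v = (\<Oplus>\<^bsub>M\<^esub>j\<in>{..<k}. (\<lambda>_. c j) \<odot>\<^bsub>M\<^esub> v j)"

definition cspan :: "('a \<Rightarrow> complex, 's) module \<Rightarrow> 's set \<Rightarrow> 's set" where
  "cspan M S = {lin_comb M k c v | k c v. \<forall>j<k. v j \<in> S}"

definition is_cbasis :: "('a \<Rightarrow> complex, 's) module \<Rightarrow> 's set \<Rightarrow> nat \<Rightarrow> (nat \<Rightarrow> 's) \<Rightarrow> bool" where
  "is_cbasis M W k \<eta> \<longleftrightarrow> (\<forall>j<k. \<eta> j \<in> carrier M) \<and>
     W = {lin_comb M k c \<eta> | c. True} \<and>
     (\<forall>c. lin_comb M k c \<eta> = \<zero>\<^bsub>M\<^esub> \<longrightarrow> (\<forall>j<k. c j = 0))"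

text \<open>\<open>\<lambda>\<^sup>nW \<subseteq> H\<^sup>0(\<And>\<^sup>n F)\<close>.\<close>

definition lambda_image :: "('a::topological_space) ring_sheaf \<Rightarrow> nat \<Rightarrow> ('a, 's) mod_presheaf
    \<Rightarrow> 's set \<Rightarrow> ('a \<Rightarrow> ('a, ('s list \<Rightarrow> 'a \<Rightarrow> complex) set) germ) set" where
  "lambda_image \<O> n F W =
     cspan (H0 (ext_sheaf \<O> n F)) {wedge \<O> F UNIV ws | ws. length ws = n \<and> set ws \<subseteq> W}"

definition is_adjoint_form :: "('a::topological_space) ring_sheaf \<Rightarrow> nat \<Rightarrow> ('a, 'e) mod_presheaf
    \<Rightarrow> ('a, 'f) mod_presheaf \<Rightarrow> ('a set \<Rightarrow> 'e \<Rightarrow> 'f) \<Rightarrow> 'f set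
    \<Rightarrow> ('a \<Rightarrow> ('a, ('e list \<Rightarrow> 'a \<Rightarrow> complex) set) germ) \<Rightarrow> bool" where
  "is_adjoint_form \<O> n E F p W \<Omega> \<longleftrightarrow>
     (\<exists>\<eta> s. is_cbasis (H0 F) W (n + 1) \<eta> \<and>
        (\<forall>j<n + 1. s j \<in> carrier (H0 E) \<and> p UNIV (s j) = \<eta> j) \<and>
        \<Omega> = wedge \<O> E UNIV (map s [0..<n + 1]))"

text \<open>The bilinear map \<open>L(U) \<times> (det F)(U) \<rightarrow> (det E)(U)\<close> given by the canonical isomorphism
  \<open>L \<otimes> det F \<cong> det E\<close>, \<open>l \<otimes> (p e\<^sub>1 \<and> \<dots> \<and> p e\<^sub>n) \<mapsto> i l \<and> e\<^sub>1 \<and> \<dots> \<and> e\<^sub>n\<close>. Every section of \<open>det F\<close>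
  is locally a multiple of one of the form \<open>p e\<^sub>1 \<and> \<dots> \<and> p e\<^sub>n\<close>.\<close>

definition det_mult :: "('a::topological_space) ring_sheaf \<Rightarrow> nat \<Rightarrow> ('a, 'l) mod_presheaf
    \<Rightarrow> ('a, 'e) mod_presheaf \<Rightarrow> ('a, 'f) mod_presheaf
    \<Rightarrow> ('a set \<Rightarrow> 'l \<Rightarrow> 'e) \<Rightarrow> ('a set \<Rightarrow> 'e \<Rightarrow> 'f) \<Rightarrow> 'a set \<Rightarrow> 'l
    \<Rightarrow> ('a \<Rightarrow> ('a, ('f list \<Rightarrow> 'a \<Rightarrow> complex) set) germ)
    \<Rightarrow> 'a \<Rightarrow> ('a, ('e list \<Rightarrow> 'a \<Rightarrow> complex) set) germ" where
  "det_mult \<O> n L E F i p U l \<omega> =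
     (let dF = ext_sheaf \<O> n F; dE = ext_sheaf \<O> (n + 1) E in
      THE \<theta>. \<theta> \<in> carrier (sec dE U) \<and>
        (\<forall>V a es. open V \<and> V \<subseteq> U \<and> a \<in> carrier (\<O> V) \<and> length es = n \<and>
           set es \<subseteq> carrier (sec E V) \<and>
           res dF U V \<omega> = a \<odot>\<^bsub>sec dF V\<^esub> wedge \<O> F V (map (p V) es) \<longrightarrow>
           res dE U V \<theta> = a \<odot>\<^bsub>sec dE V\<^esub> wedge \<O> E V (i V (res L U V l) # es)))"

text \<open>The image of \<open>H\<^sup>0(L) \<otimes> \<Lambda> \<rightarrow> H\<^sup>0(det E)\<close>: finite sums of products.\<close>

definition mult_image :: "('a::topological_space) ring_sheaf \<Rightarrow> nat \<Rightarrow> ('a, 'l) mod_presheaf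
    \<Rightarrow> ('a, 'e) mod_presheaf \<Rightarrow> ('a, 'f) mod_presheaf
    \<Rightarrow> ('a set \<Rightarrow> 'l \<Rightarrow> 'e) \<Rightarrow> ('a set \<Rightarrow> 'e \<Rightarrow> 'f)
    \<Rightarrow> ('a \<Rightarrow> ('a, ('f list \<Rightarrow> 'a \<Rightarrow> complex) set) germ) set
    \<Rightarrow> ('a \<Rightarrow> ('a, ('e list \<Rightarrow> 'a \<Rightarrow> complex) set) germ) set" where
  "mult_image \<O> n L E F i p \<Lambda> =
     cspan (H0 (ext_sheaf \<O> (n + 1) E))
       {det_mult \<O> n L E F i p UNIV l \<omega> | l \<omega>. l \<in> carrier (H0 L) \<and> \<omega> \<in> \<Lambda>}"

end

theory Submission
  imports Defs "Jordan_Normal_Form.Determinant"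
begin

text \<open>Let \<open>0 \<rightarrow> L \<rightarrow> E \<rightarrow> F \<rightarrow> 0\<close> be the extension, with maps \<open>i\<close> and \<open>p\<close>. Its class is represented by differences of
  local splittings \<open>\<sigma>\<close> of \<open>p\<close>. That it dies in \<open>H\<^sup>1(F\<^sup>\<or> \<otimes> L(D))\<close> means that, after enlarging \<open>L\<close> to \<open>L(D)\<close>, these
  differences are a coboundary of local sections \<open>b\<close> of \<open>F\<^sup>\<or> \<otimes> L(D)\<close>. Hence \<open>e \<mapsto> (e - \<sigma> (p e)) - b (p e)\<close> does not
  depend on the local choices, and it is a retraction \<open>r : E \<rightarrow> L(D)\<close> extending the inclusion \<open>L \<rightarrow> L(D)\<close>
  (\<open>retract_agree\<close>, \<open>retract_glue\<close>).

  Let \<open>s\<^sub>0, \<dots>, s\<^sub>n\<close> be the lifts that define \<open>\<Omega>\<close>. Every global section of \<open>L(D)\<close> comes from \<open>L\<close>, so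
  \<open>r (s\<^sub>j)\<close> is the image of some \<open>l\<^sub>j\<close> in \<open>H\<^sup>0(L)\<close>, and \<open>s\<^sub>j - i l\<^sub>j\<close> lies in the kernel of \<open>r\<close>. The kernel has generic rank
  \<open>n\<close>, so the wedge product of these \<open>n + 1\<close> sections is zero (\<open>kernel_wedge_zero\<close>). Concretely, evaluating \<open>L(D)\<close> at a
  local equation \<open>g\<close> of \<open>D\<close> (\<open>twist_eval\<close>) turns \<open>r = 0\<close> into a linear relation with first coefficient \<open>g\<close> between the
  coordinates of the sections in a frame of \<open>E\<close>; therefore \<open>g\<close> times the determinant of coordinates is zero, and \<open>g\<close> is
  a nonzerodivisor (\<open>det_kernel\<close>, \<open>alternating_kernel_zero\<close>).

  As \<open>L\<close> has rank one, a wedge product with two factors from \<open>L\<close> vanishes (\<open>wedge_line_zero\<close>). Expanding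
  \<open>\<Omega> = \<And> ((s\<^sub>j - i l\<^sub>j) + i l\<^sub>j)\<close> thus leaves only the terms linear in the \<open>l\<^sub>j\<close> (\<open>m_expand\<close>), and
  \<open>\<Omega> = \<Sum> (-1)\<^sup>j i l\<^sub>j \<and> s\<^sub>0 \<and> \<dots> \<and> s\<^sub>n\<close>, with \<open>s\<^sub>j\<close> omitted in the \<open>j\<close>th term. That term is the product of \<open>l\<^sub>j\<close> with
  the wedge product of the sections \<open>p s\<^sub>k\<close> of \<open>W\<close>, \<open>k \<noteq> j\<close> (\<open>det_mult_wedge\<close>). So \<open>\<Omega>\<close> is in the image of
  \<open>H\<^sup>0(L) \<otimes> \<lambda>\<^sup>nW\<close>.

  Most of the development makes the objects in this argument usable. Tensor and exterior powers are treated as modules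
  given by generators and relations (\<open>presentation\<close>), sheafification through its universal property (\<open>sh_ext_local\<close>,
  \<open>sh_ext_mor\<close>), and wedge products through the calculus of alternating maps (\<open>alternating\<close>). Holomorphic functions
  enter through their ring operations, constants and restriction (\<open>function_rings\<close>).\<close>

section \<open>Free modules\<close>

lemma free_mod_carrier:
  "f \<in> carrier (free_mod R S) \<longleftrightarrow>
     range f \<subseteq> carrier R \<and> finite {g. f g \<noteq> \<zero>\<^bsub>R\<^esub>} \<and> {g. f g \<noteq> \<zero>\<^bsub>R\<^esub>} \<subseteq> S"
  by (simp add: free_mod_def)

lemma free_mod_simps:
  "\<zero>\<^bsub>free_mod R S\<^esub> = (\<lambda>_. \<zero>\<^bsub>R\<^esub>)"
  "f \<oplus>\<^bsub>free_mod R S\<^esub> f' = (\<lambda>g. f g \<oplus>\<^bsub>R\<^esub> f' g)"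
  "r \<odot>\<^bsub>free_mod R S\<^esub> f = (\<lambda>g. r \<otimes>\<^bsub>R\<^esub> f g)"
  by (simp_all add: free_mod_def)

lemma free_mod_module:
  assumes "cring R"
  shows "Module.module R (free_mod R S)"
proof -
  interpret cring R by fact
  have add: "f \<oplus>\<^bsub>free_mod R S\<^esub> f' \<in> carrier (free_mod R S)"
    if "f \<in> carrier (free_mod R S)" "f' \<in> carrier (free_mod R S)" for f f'
  proof -
    have "{g. f g \<oplus>\<^bsub>R\<^esub> f' g \<noteq> \<zero>\<^bsub>R\<^esub>} \<subseteq> {g. f g \<noteq> \<zero>\<^bsub>R\<^esub>} \<union> {g. f' g \<noteq> \<zero>\<^bsub>R\<^esub>}" by auto
    then show ?thesis using that unfolding free_mod_carrier free_mod_simps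
      by (auto intro: finite_subset simp: range_subsetD)
  qed
  have smult: "r \<odot>\<^bsub>free_mod R S\<^esub> f \<in> carrier (free_mod R S)"
    if "f \<in> carrier (free_mod R S)" "r \<in> carrier R" for f r
  proof -
    have "{g. r \<otimes>\<^bsub>R\<^esub> f g \<noteq> \<zero>\<^bsub>R\<^esub>} \<subseteq> {g. f g \<noteq> \<zero>\<^bsub>R\<^esub>}" using that by auto
    then show ?thesis using that unfolding free_mod_carrier free_mod_simps
      by (auto intro: finite_subset simp: range_subsetD)
  qed
  have inv: "\<exists>y\<in>carrier (free_mod R S). y \<oplus>\<^bsub>free_mod R S\<^esub> f = \<zero>\<^bsub>free_mod R S\<^esub>"
    if "f \<in> carrier (free_mod R S)" for f
  proof
    have "{g. \<ominus>\<^bsub>R\<^esub> f g \<noteq> \<zero>\<^bsub>R\<^esub>} \<subseteq> {g. f g \<noteq> \<zero>\<^bsub>R\<^esub>}" by auto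
    then show "(\<lambda>g. \<ominus>\<^bsub>R\<^esub> f g) \<in> carrier (free_mod R S)" using that unfolding free_mod_carrier
      by (auto intro: finite_subset)
    show "(\<lambda>g. \<ominus>\<^bsub>R\<^esub> f g) \<oplus>\<^bsub>free_mod R S\<^esub> f = \<zero>\<^bsub>free_mod R S\<^esub>"
      using that unfolding free_mod_carrier free_mod_simps by (auto simp: l_neg range_subsetD)
  qed
  have zero: "\<zero>\<^bsub>free_mod R S\<^esub> \<in> carrier (free_mod R S)"
    by (auto simp: free_mod_carrier free_mod_simps)
  have rg: "f \<in> carrier (free_mod R S) \<Longrightarrow> f g \<in> carrier R" for f g
    by (auto simp: free_mod_carrier)
  show ?thesis
    by (rule moduleI, rule assms, rule abelian_groupI)
      (auto simp: add smult inv zero, auto simp: free_mod_simps rg a_ac m_assoc l_distr r_distr)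
qed

lemma free_gen_carrier:
  assumes "cring R" "g \<in> S"
  shows "free_gen R g \<in> carrier (free_mod R S)"
proof -
  interpret cring R by fact
  have "{h. (if h = g then \<one>\<^bsub>R\<^esub> else \<zero>\<^bsub>R\<^esub>) \<noteq> \<zero>\<^bsub>R\<^esub>} \<subseteq> {g}" by auto
  then show ?thesis using assms(2) unfolding free_mod_carrier free_gen_def
    by (auto intro: finite_subset)
qed

lemma submodule_abelian_subgroup:
  assumes "Module.module R M" "submodule N R M"
  shows "abelian_subgroup N M"
proof -
  interpret Module.module R M by fact
  show ?thesis
    by (rule abelian_subgroupI3)
      (auto intro: additive_subgroupI submodule.axioms(1)[OF assms(2)] M.abelian_group_axioms)
qed

section \<open>Quotient modules\<close>

locale quotient_module = M: Module.module R M
  for R :: "('r, 'x) ring_scheme" and M :: "('r, 's) module" +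
  fixes N
  assumes N: "submodule N R M"
begin

sublocale ab: abelian_subgroup N M
  by (rule submodule_abelian_subgroup[OF M.module_axioms N])

lemma carrier_quot: "carrier (quot_mod M N) = {N +>\<^bsub>M\<^esub> a | a. a \<in> carrier M}"
  by (auto simp: quot_mod_def A_RCOSETS_def')

lemma cls_add: "a \<in> carrier M \<Longrightarrow> b \<in> carrier M \<Longrightarrow>
    (N +>\<^bsub>M\<^esub> a) \<oplus>\<^bsub>quot_mod M N\<^esub> (N +>\<^bsub>M\<^esub> b) = N +>\<^bsub>M\<^esub> (a \<oplus>\<^bsub>M\<^esub> b)"
  by (simp add: quot_mod_def ab.a_rcos_sum)

lemma cls_eq_iff: "a \<in> carrier M \<Longrightarrow> b \<in> carrier M \<Longrightarrow>
    N +>\<^bsub>M\<^esub> a = N +>\<^bsub>M\<^esub> b \<longleftrightarrow> a \<ominus>\<^bsub>M\<^esub> b \<in> N"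
proof -
  assume ab: "a \<in> carrier M" "b \<in> carrier M"
  have "N +>\<^bsub>M\<^esub> a = N +>\<^bsub>M\<^esub> b \<longleftrightarrow> a \<in> N +>\<^bsub>M\<^esub> b"
    using ab.a_repr_independence'[of a b] ab.a_repr_independenceD[of a b] ab by metis
  also have "\<dots> \<longleftrightarrow> a \<ominus>\<^bsub>M\<^esub> b \<in> N"
    using ab.a_rcos_module[of b a] ab by (simp add: a_minus_def)
  finally show ?thesis .
qed

lemma cls_smult:
  assumes r: "r \<in> carrier R" and a: "a \<in> carrier M"
  shows "r \<odot>\<^bsub>quot_mod M N\<^esub> (N +>\<^bsub>M\<^esub> a) = N +>\<^bsub>M\<^esub> (r \<odot>\<^bsub>M\<^esub> a)"
proof -
  have "N +>\<^bsub>M\<^esub> (r \<odot>\<^bsub>M\<^esub> a') = N +>\<^bsub>M\<^esub> (r \<odot>\<^bsub>M\<^esub> a)" if a': "a' \<in> N +>\<^bsub>M\<^esub> a" for a'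
  proof -
    obtain h where h: "h \<in> N" "a' = h \<oplus>\<^bsub>M\<^esub> a" using a' by (auto simp: a_r_coset_def')
    have hM: "h \<in> carrier M" using h(1) by simp
    have "r \<odot>\<^bsub>M\<^esub> a' = r \<odot>\<^bsub>M\<^esub> h \<oplus>\<^bsub>M\<^esub> r \<odot>\<^bsub>M\<^esub> a"
      using hM r a h(2) by (simp add: M.smult_r_distr)
    moreover have "r \<odot>\<^bsub>M\<^esub> h \<in> N" by (rule submodule.smult_closed[OF N r h(1)])
    ultimately have "r \<odot>\<^bsub>M\<^esub> a' \<in> N +>\<^bsub>M\<^esub> (r \<odot>\<^bsub>M\<^esub> a)" by (auto simp: a_r_coset_def')
    then show ?thesis using ab.a_repr_independence'[OF _ M.smult_closed[OF r a]] by simp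
  qed
  moreover have "a \<in> N +>\<^bsub>M\<^esub> a" using a by (rule ab.a_rcos_self)
  ultimately have "(\<Union>a'\<in>N +>\<^bsub>M\<^esub> a. N +>\<^bsub>M\<^esub> (r \<odot>\<^bsub>M\<^esub> a')) = N +>\<^bsub>M\<^esub> (r \<odot>\<^bsub>M\<^esub> a)" by blast
  then show ?thesis by (simp add: quot_mod_def)
qed

lemma zero_quot: "\<zero>\<^bsub>quot_mod M N\<^esub> = N +>\<^bsub>M\<^esub> \<zero>\<^bsub>M\<^esub>"
  by (simp add: quot_mod_def ab.a_subset)

lemma module_quot: "Module.module R (quot_mod M N)"
proof (rule moduleI)
  show "cring R" by (rule M.R.is_cring)
  show "abelian_group (quot_mod M N)"
  proof (rule abelian_groupI)
    fix x assume "x \<in> carrier (quot_mod M N)"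
    then obtain a where a: "a \<in> carrier M" "x = N +>\<^bsub>M\<^esub> a" by (auto simp: carrier_quot)
    have "(N +>\<^bsub>M\<^esub> (\<ominus>\<^bsub>M\<^esub> a)) \<oplus>\<^bsub>quot_mod M N\<^esub> x = \<zero>\<^bsub>quot_mod M N\<^esub>"
      using a by (simp add: cls_add zero_quot M.M.l_neg del: M.M.a_coset_add_zero)
    moreover have "N +>\<^bsub>M\<^esub> (\<ominus>\<^bsub>M\<^esub> a) \<in> carrier (quot_mod M N)"
      using a by (auto simp: carrier_quot)
    ultimately show "\<exists>y\<in>carrier (quot_mod M N). y \<oplus>\<^bsub>quot_mod M N\<^esub> x = \<zero>\<^bsub>quot_mod M N\<^esub>" by blast
  qed (auto simp: carrier_quot cls_add zero_quot M.M.a_ac simp del: M.M.a_coset_add_zero)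
qed (auto simp: carrier_quot cls_add cls_smult M.smult_l_distr M.smult_r_distr M.smult_assoc1)

end

section \<open>Linear extension\<close>

text \<open>The target is a module over a second ring \<open>Q\<close> and the extension is
  semilinear along \<open>h\<close>: one construction then covers restriction maps (\<open>h\<close>
  restricts functions) and linear maps (\<open>h\<close> is the identity).\<close>

locale lin_target = R: cring R + N: Module.module Q N
  for R :: "('r, 'x) ring_scheme" and Q :: "('q, 'y) ring_scheme" and N :: "('q, 't) module" +
  fixes h and S :: "'g set" and b
  assumes h: "h \<in> Ring.ring_hom R Q" and b: "b \<in> S \<rightarrow> carrier N"
begin

lemma h_zero: "h \<zero>\<^bsub>R\<^esub> = \<zero>\<^bsub>Q\<^esub>"
  by (rule ring_hom_zero[OF h R.ring_axioms N.R.ring_axioms])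

lemma h_closed: "r \<in> carrier R \<Longrightarrow> h r \<in> carrier Q"
  by (rule ring_hom_closed[OF h])

lemma bc: "g \<in> S \<Longrightarrow> b g \<in> carrier N" using b by auto

text \<open>Enlarging the support to a common finite set lets sums for different elements be
  compared.\<close>

lemma lin_ext_superset:
  assumes f: "f \<in> carrier (free_mod R S)" and A: "finite A" "{g. f g \<noteq> \<zero>\<^bsub>R\<^esub>} \<subseteq> A" "A \<subseteq> S"
  shows "lin_ext R h N b f = (\<Oplus>\<^bsub>N\<^esub>g\<in>A. h (f g) \<odot>\<^bsub>N\<^esub> b g)"
  unfolding lin_ext_def
proof (rule N.M.add.finprod_mono_neutral_cong_left)
  show "(\<lambda>g. h (f g) \<odot>\<^bsub>N\<^esub> b g) \<in> A \<rightarrow> carrier N"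
    using f A bc h_closed unfolding free_mod_carrier by (auto simp: range_subsetD)
  fix g assume "g \<in> A - {g. f g \<noteq> \<zero>\<^bsub>R\<^esub>}"
  then show "h (f g) \<odot>\<^bsub>N\<^esub> b g = \<zero>\<^bsub>N\<^esub>" using h_zero A bc by auto
qed (use A in auto)

lemma coeff: "f \<in> carrier (free_mod R S) \<Longrightarrow> f g \<in> carrier R"
  by (auto simp: free_mod_carrier)

lemma lin_ext_closed: "f \<in> carrier (free_mod R S) \<Longrightarrow> lin_ext R h N b f \<in> carrier N"
  unfolding lin_ext_def by (rule N.M.finsum_closed) (auto simp: free_mod_carrier bc h_closed range_subsetD subset_iff)

lemma lin_ext_add:
  assumes f: "f \<in> carrier (free_mod R S)" and f': "f' \<in> carrier (free_mod R S)"
  shows "lin_ext R h N b (f \<oplus>\<^bsub>free_mod R S\<^esub> f') = lin_ext R h N b f \<oplus>\<^bsub>N\<^esub> lin_ext R h N b f'"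
proof -
  interpret P: Module.module R "free_mod R S" by (rule free_mod_module) (rule R.is_cring)
  let ?A = "{g. f g \<noteq> \<zero>\<^bsub>R\<^esub>} \<union> {g. f' g \<noteq> \<zero>\<^bsub>R\<^esub>}"
  have A: "finite ?A" "?A \<subseteq> S" using f f' by (auto simp: free_mod_carrier)
  have "lin_ext R h N b (f \<oplus>\<^bsub>free_mod R S\<^esub> f') =
      (\<Oplus>\<^bsub>N\<^esub>g\<in>?A. h (f g \<oplus>\<^bsub>R\<^esub> f' g) \<odot>\<^bsub>N\<^esub> b g)"
  proof -
    have "{g. f g \<oplus>\<^bsub>R\<^esub> f' g \<noteq> \<zero>\<^bsub>R\<^esub>} \<subseteq> ?A" by auto
    then show ?thesis
      using lin_ext_superset[OF P.M.a_closed[OF f f'] A(1) _ A(2)] by (simp add: free_mod_simps)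
  qed
  also have "\<dots> = (\<Oplus>\<^bsub>N\<^esub>g\<in>?A. h (f g) \<odot>\<^bsub>N\<^esub> b g \<oplus>\<^bsub>N\<^esub> h (f' g) \<odot>\<^bsub>N\<^esub> b g)"
    by (rule N.M.finsum_cong')
      (use A coeff[OF f] coeff[OF f'] ring_hom_add[OF h] in \<open>auto simp: N.smult_l_distr bc h_closed subset_iff\<close>)
  also have "\<dots> = (\<Oplus>\<^bsub>N\<^esub>g\<in>?A. h (f g) \<odot>\<^bsub>N\<^esub> b g) \<oplus>\<^bsub>N\<^esub> (\<Oplus>\<^bsub>N\<^esub>g\<in>?A. h (f' g) \<odot>\<^bsub>N\<^esub> b g)"
    by (rule N.M.finsum_addf) (use A coeff[OF f] coeff[OF f'] in \<open>auto simp: bc h_closed subset_iff\<close>)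
  finally show ?thesis using lin_ext_superset[OF f, of ?A] lin_ext_superset[OF f', of ?A] A by auto
qed

lemma lin_ext_smult:
  assumes f: "f \<in> carrier (free_mod R S)" and r: "r \<in> carrier R"
  shows "lin_ext R h N b (r \<odot>\<^bsub>free_mod R S\<^esub> f) = h r \<odot>\<^bsub>N\<^esub> lin_ext R h N b f"
proof -
  interpret P: Module.module R "free_mod R S" by (rule free_mod_module) (rule R.is_cring)
  let ?A = "{g. f g \<noteq> \<zero>\<^bsub>R\<^esub>}"
  have A: "finite ?A" "?A \<subseteq> S" using f by (auto simp: free_mod_carrier)
  have "lin_ext R h N b (r \<odot>\<^bsub>free_mod R S\<^esub> f) = (\<Oplus>\<^bsub>N\<^esub>g\<in>?A. h (r \<otimes>\<^bsub>R\<^esub> f g) \<odot>\<^bsub>N\<^esub> b g)"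
  proof -
    have "{g. r \<otimes>\<^bsub>R\<^esub> f g \<noteq> \<zero>\<^bsub>R\<^esub>} \<subseteq> ?A" using r by auto
    then show ?thesis
      using lin_ext_superset[OF P.smult_closed[OF r f] A(1) _ A(2)] by (simp add: free_mod_simps)
  qed
  also have "\<dots> = (\<Oplus>\<^bsub>N\<^esub>g\<in>?A. h r \<odot>\<^bsub>N\<^esub> (h (f g) \<odot>\<^bsub>N\<^esub> b g))"
    by (rule N.M.finsum_cong')
      (use A coeff[OF f] ring_hom_mult[OF h] r in \<open>auto simp: N.smult_assoc1 bc h_closed subset_iff\<close>)
  also have "\<dots> = h r \<odot>\<^bsub>N\<^esub> (\<Oplus>\<^bsub>N\<^esub>g\<in>?A. h (f g) \<odot>\<^bsub>N\<^esub> b g)"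
    by (rule N.finsum_smult_ldistr[symmetric])
      (use A coeff[OF f] r in \<open>auto simp: bc h_closed subset_iff\<close>)
  finally show ?thesis by (simp add: lin_ext_def)
qed

lemma lin_ext_gen:
  assumes g: "g \<in> S"
  shows "lin_ext R h N b (free_gen R g) = b g"
proof -
  have "lin_ext R h N b (free_gen R g) = (\<Oplus>\<^bsub>N\<^esub>g'\<in>{g}. h (free_gen R g g') \<odot>\<^bsub>N\<^esub> b g')"
    by (rule lin_ext_superset[OF free_gen_carrier[OF R.is_cring g]]) (use g in \<open>auto simp: free_gen_def\<close>)
  also have "\<dots> = b g" using bc[OF g] ring_hom_one[OF h]
    by (simp add: free_gen_def)
  finally show ?thesis .
qed

lemma lin_ext_hom: "abelian_group_hom (free_mod R S) N (lin_ext R h N b)"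
proof -
  interpret P: Module.module R "free_mod R S" by (rule free_mod_module) (rule R.is_cring)
  show ?thesis
    by (rule abelian_group_homI[OF P.M.abelian_group_axioms N.M.abelian_group_axioms])
      (auto intro!: group_hom.intro group_hom_axioms.intro P.M.a_group N.M.a_group homI
        simp: lin_ext_closed lin_ext_add)
qed

end

section \<open>Modules given by generators and relations\<close>

text \<open>Tensor products and exterior powers are both quotients of a free module by the submodule
  generated by relators. Induction on elements and the universal property are proved once, for an
  arbitrary set of relators.\<close>

definition pres_mod :: "('r, 'x) ring_scheme \<Rightarrow> 'g set \<Rightarrow> ('g \<Rightarrow> 'r) set \<Rightarrow> ('r, ('g \<Rightarrow> 'r) set) module" where
  "pres_mod R S X = quot_mod (free_mod R S) (gen_submod R (free_mod R S) X)"

definition pres_gen :: "('r, 'x) ring_scheme \<Rightarrow> 'g set \<Rightarrow> ('g \<Rightarrow> 'r) set \<Rightarrow> 'g \<Rightarrow> ('g \<Rightarrow> 'r) set" where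
  "pres_gen R S X g = gen_submod R (free_mod R S) X +>\<^bsub>free_mod R S\<^esub> free_gen R g"

locale presentation = R: cring R for R :: "('r, 'x) ring_scheme" +
  fixes S :: "'g set" and X :: "('g \<Rightarrow> 'r) set"
  assumes X: "X \<subseteq> carrier (free_mod R S)"
begin

definition "rel = gen_submod R (free_mod R S) X"
definition "cls f = rel +>\<^bsub>free_mod R S\<^esub> f"
abbreviation "Q \<equiv> pres_mod R S X"
abbreviation "gen \<equiv> pres_gen R S X"

lemma Q_def: "Q = quot_mod (free_mod R S) rel"
  by (simp add: pres_mod_def rel_def)

lemma gen_def: "gen g = cls (free_gen R g)"
  by (simp add: pres_gen_def rel_def cls_def)

sublocale P: Module.module R "free_mod R S" by (rule free_mod_module) (rule R.is_cring)

lemma rel_submodule: "submodule rel R (free_mod R S)"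
proof (rule P.submoduleI)
  show "rel \<subseteq> carrier (free_mod R S)"
    using P.carrier_is_submodule X by (auto simp: rel_def gen_submod_def)
qed (auto simp: rel_def gen_submod_def P.submoduleE submodule.smult_closed
      intro: subgroup.one_closed[OF submodule.axioms(1), simplified])

lemma X_rel: "X \<subseteq> rel"
  by (auto simp: rel_def gen_submod_def)

lemma rel_least: "submodule H R (free_mod R S) \<Longrightarrow> X \<subseteq> H \<Longrightarrow> rel \<subseteq> H"
  by (auto simp: rel_def gen_submod_def)

sublocale quot: quotient_module R "free_mod R S" rel
  by (rule quotient_module.intro[OF P.module_axioms quotient_module_axioms.intro[OF rel_submodule]])

sublocale Q: Module.module R Q
  unfolding Q_def by (rule quot.module_quot)

lemma carrier_Q: "carrier Q = {cls f | f. f \<in> carrier (free_mod R S)}"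
  by (auto simp: Q_def cls_def quot.carrier_quot)

lemma cls_closed: "f \<in> carrier (free_mod R S) \<Longrightarrow> cls f \<in> carrier Q"
  by (auto simp: carrier_Q)

lemma cls_add: "f \<in> carrier (free_mod R S) \<Longrightarrow> f' \<in> carrier (free_mod R S) \<Longrightarrow>
    cls (f \<oplus>\<^bsub>free_mod R S\<^esub> f') = cls f \<oplus>\<^bsub>Q\<^esub> cls f'"
  by (simp add: Q_def cls_def quot.cls_add)

lemma cls_smult: "f \<in> carrier (free_mod R S) \<Longrightarrow> r \<in> carrier R \<Longrightarrow>
    cls (r \<odot>\<^bsub>free_mod R S\<^esub> f) = r \<odot>\<^bsub>Q\<^esub> cls f"
  by (simp add: Q_def cls_def quot.cls_smult)

lemma cls_zero: "\<zero>\<^bsub>Q\<^esub> = cls \<zero>\<^bsub>free_mod R S\<^esub>"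
  by (simp only: Q_def cls_def quot.zero_quot)

lemma cls_eq_iff: "f \<in> carrier (free_mod R S) \<Longrightarrow> f' \<in> carrier (free_mod R S) \<Longrightarrow>
    cls f = cls f' \<longleftrightarrow> f \<ominus>\<^bsub>free_mod R S\<^esub> f' \<in> rel"
  by (simp add: cls_def quot.cls_eq_iff)

lemma cls_hom: "abelian_group_hom (free_mod R S) Q cls"
  by (rule abelian_group_homI[OF P.M.abelian_group_axioms Q.M.abelian_group_axioms])
    (auto intro!: group_hom.intro group_hom_axioms.intro P.M.a_group Q.M.a_group homI
      simp: cls_closed cls_add)

lemma cls_minus: "f \<in> carrier (free_mod R S) \<Longrightarrow> f' \<in> carrier (free_mod R S) \<Longrightarrow>
    cls (f \<ominus>\<^bsub>free_mod R S\<^esub> f') = cls f \<ominus>\<^bsub>Q\<^esub> cls f'"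
proof -
  interpret c: abelian_group_hom "free_mod R S" Q cls by (rule cls_hom)
  show "f \<in> carrier (free_mod R S) \<Longrightarrow> f' \<in> carrier (free_mod R S) \<Longrightarrow> ?thesis"
    by (simp add: a_minus_def)
qed

lemma cls_X: "x \<in> X \<Longrightarrow> cls x = \<zero>\<^bsub>Q\<^esub>"
proof -
  assume x: "x \<in> X"
  have "x \<ominus>\<^bsub>free_mod R S\<^esub> \<zero>\<^bsub>free_mod R S\<^esub> = x"
    using X x by (auto simp: a_minus_def)
  then show ?thesis using x X_rel X by (subst cls_zero, subst cls_eq_iff) auto
qed

lemma gen_closed: "g \<in> S \<Longrightarrow> gen g \<in> carrier Q"
  by (simp add: gen_def cls_closed free_gen_carrier R.is_cring)

lemma free_decomp:
  assumes f: "f \<in> carrier (free_mod R S)"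
    and zero: "T \<zero>\<^bsub>free_mod R S\<^esub>"
    and gen: "\<And>g. g \<in> S \<Longrightarrow> T (free_gen R g)"
    and add: "\<And>s t. s \<in> carrier (free_mod R S) \<Longrightarrow> t \<in> carrier (free_mod R S) \<Longrightarrow> T s \<Longrightarrow> T t \<Longrightarrow>
      T (s \<oplus>\<^bsub>free_mod R S\<^esub> t)"
    and smult: "\<And>r s. r \<in> carrier R \<Longrightarrow> s \<in> carrier (free_mod R S) \<Longrightarrow> T s \<Longrightarrow>
      T (r \<odot>\<^bsub>free_mod R S\<^esub> s)"
  shows "T f"
proof -
  have "finite A \<Longrightarrow> f \<in> carrier (free_mod R S) \<Longrightarrow> {g. f g \<noteq> \<zero>\<^bsub>R\<^esub>} \<subseteq> A \<Longrightarrow> T f" for A f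
  proof (induction A arbitrary: f rule: finite_induct)
    case empty
    then have "f = \<zero>\<^bsub>free_mod R S\<^esub>" by (auto simp: free_mod_simps)
    then show ?case using zero by simp
  next
    case (insert a A)
    show ?case
    proof (cases "f a = \<zero>\<^bsub>R\<^esub>")
      case True
      then show ?thesis using insert by blast
    next
      case False
      have aS: "a \<in> S" using False insert.prems(1) by (auto simp: free_mod_carrier)
      have fc: "f g \<in> carrier R" for g using insert.prems(1) by (auto simp: free_mod_carrier)
      let ?f = "f(a := \<zero>\<^bsub>R\<^esub>)"
      have "finite {g. ?f g \<noteq> \<zero>\<^bsub>R\<^esub>}"
        by (rule finite_subset[of _ "{g. f g \<noteq> \<zero>\<^bsub>R\<^esub>}"]) (use insert.prems(1) in \<open>auto simp: free_mod_carrier\<close>)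
      then have f': "?f \<in> carrier (free_mod R S)" using insert.prems(1)
        by (auto simp: free_mod_carrier split: if_splits)
      have "{g. ?f g \<noteq> \<zero>\<^bsub>R\<^esub>} \<subseteq> A" using insert.prems(2) by auto
      then have 1: "T ?f" using insert.IH f' by blast
      have 2: "T (f a \<odot>\<^bsub>free_mod R S\<^esub> free_gen R a)"
        by (rule smult[OF fc free_gen_carrier[OF R.is_cring aS] gen[OF aS]])
      have "f = ?f \<oplus>\<^bsub>free_mod R S\<^esub> (f a \<odot>\<^bsub>free_mod R S\<^esub> free_gen R a)"
        using fc by (auto simp: free_mod_simps free_gen_def)
      then show ?thesis
        using add[OF f' P.smult_closed[OF fc free_gen_carrier[OF R.is_cring aS]] 1 2] by metis
    qed
  qed
  from this[of "{g. f g \<noteq> \<zero>\<^bsub>R\<^esub>}" f] show ?thesis using f by (auto simp: free_mod_carrier)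
qed

lemma Q_induct [consumes 1, case_names zero gen add smult]:
  assumes t: "t \<in> carrier Q"
    and zero: "T \<zero>\<^bsub>Q\<^esub>"
    and gen: "\<And>g. g \<in> S \<Longrightarrow> T (gen g)"
    and add: "\<And>s t. s \<in> carrier Q \<Longrightarrow> t \<in> carrier Q \<Longrightarrow> T s \<Longrightarrow> T t \<Longrightarrow> T (s \<oplus>\<^bsub>Q\<^esub> t)"
    and smult: "\<And>r s. r \<in> carrier R \<Longrightarrow> s \<in> carrier Q \<Longrightarrow> T s \<Longrightarrow> T (r \<odot>\<^bsub>Q\<^esub> s)"
  shows "T t"
proof -
  obtain f where f: "f \<in> carrier (free_mod R S)" "t = cls f" using t by (auto simp: carrier_Q)
  have "T (cls f)"
    by (rule free_decomp[OF f(1), of "\<lambda>f. T (cls f)"])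
      (use zero gen add smult in \<open>auto simp: cls_zero[symmetric] gen_def cls_add cls_smult cls_closed\<close>)
  then show ?thesis using f by simp
qed

end

locale presentation_map = presentation R S X + lin_target R Q' N h S b
  for R :: "('r, 'x) ring_scheme" and S :: "'g set" and X
    and Q' :: "('q, 'y) ring_scheme" and N :: "('q, 't) module" and h b +
  assumes resp: "\<And>x. x \<in> X \<Longrightarrow> lin_ext R h N b x = \<zero>\<^bsub>N\<^esub>"
begin

sublocale le: abelian_group_hom "free_mod R S" N "lin_ext R h N b" by (rule lin_ext_hom)

lemma lin_ext_rel: "x \<in> rel \<Longrightarrow> lin_ext R h N b x = \<zero>\<^bsub>N\<^esub>"
proof -
  let ?H = "{f \<in> carrier (free_mod R S). lin_ext R h N b f = \<zero>\<^bsub>N\<^esub>}"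
  have "submodule ?H R (free_mod R S)"
    by (rule P.submoduleI) (auto simp: lin_ext_add lin_ext_smult h_closed)
  then have "rel \<subseteq> ?H" by (rule rel_least) (use X resp in auto)
  then show "x \<in> rel \<Longrightarrow> ?thesis" by auto
qed

abbreviation "lft \<equiv> quot_lift R h N b"

text \<open>The value of \<open>quot_lift\<close> is computed from a chosen representative of a
  coset; any two differ by an element of \<open>rel\<close>, on which the linear extension
  vanishes.\<close>

lemma lft_cls:
  assumes f: "f \<in> carrier (free_mod R S)"
  shows "lft (cls f) = lin_ext R h N b f"
proof -
  have "f \<in> cls f" unfolding cls_def using f by (rule quot.ab.a_rcos_self)
  then have "(SOME f'. f' \<in> cls f) \<in> cls f" by (rule someI[of "\<lambda>f'. f' \<in> cls f"])
  then obtain x where x: "x \<in> rel" "(SOME f'. f' \<in> cls f) = x \<oplus>\<^bsub>free_mod R S\<^esub> f"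
    by (auto simp: cls_def a_r_coset_def')
  have "x \<in> carrier (free_mod R S)" using x(1) by simp
  then show ?thesis using x f lin_ext_rel[OF x(1)]
    by (simp add: quot_lift_def lin_ext_closed)
qed

lemma lft_gen: "g \<in> S \<Longrightarrow> lft (gen g) = b g"
  by (simp add: gen_def lft_cls free_gen_carrier R.is_cring lin_ext_gen)

lemma lft_closed: "t \<in> carrier Q \<Longrightarrow> lft t \<in> carrier N"
  by (auto simp: carrier_Q lft_cls lin_ext_closed)

lemma lft_add: "s \<in> carrier Q \<Longrightarrow> t \<in> carrier Q \<Longrightarrow> lft (s \<oplus>\<^bsub>Q\<^esub> t) = lft s \<oplus>\<^bsub>N\<^esub> lft t"
  by (auto simp: carrier_Q lft_cls cls_add[symmetric] lin_ext_add simp del: le.hom_add)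

lemma lft_smult: "r \<in> carrier R \<Longrightarrow> t \<in> carrier Q \<Longrightarrow> lft (r \<odot>\<^bsub>Q\<^esub> t) = h r \<odot>\<^bsub>N\<^esub> lft t"
  by (auto simp: carrier_Q lft_cls cls_smult[symmetric] lin_ext_smult)

lemma lft_zero: "lft \<zero>\<^bsub>Q\<^esub> = \<zero>\<^bsub>N\<^esub>"
  by (simp add: cls_zero lft_cls)

end

section \<open>Tensor products and exterior powers as presented modules\<close>

lemma (in abelian_group) minus_eq_zero_iff:
  assumes "x \<in> carrier G" "a \<in> carrier G"
  shows "x \<ominus> a = \<zero> \<longleftrightarrow> x = a"
proof
  assume "x \<ominus> a = \<zero>"
  then have "\<ominus> (\<ominus> a) = x" using assms by (intro minus_equality) (simp_all add: a_minus_def)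
  then show "x = a" using assms by simp
qed (use assms in \<open>simp add: a_minus_def r_neg\<close>)

lemma (in abelian_group) minus_minus_eq_zero_iff:
  assumes "x \<in> carrier G" "a \<in> carrier G" "b \<in> carrier G"
  shows "x \<ominus> a \<ominus> b = \<zero> \<longleftrightarrow> x = a \<oplus> b"
proof -
  have "x \<ominus> a \<ominus> b = x \<ominus> (a \<oplus> b)" using assms by (simp add: a_minus_def minus_add a_assoc)
  then show ?thesis using assms minus_eq_zero_iff by simp
qed

text \<open>The relators only involve sums and scalar multiples of elements of the factors, so for
  the factors closure under the two operations is enough. This spares verifying the module axioms
  for modules of homomorphisms and for ideals.\<close>

definition op_closed :: "('r, 'x) ring_scheme \<Rightarrow> ('r, 's, 'y) module_scheme \<Rightarrow> bool" where
  "op_closed R M \<longleftrightarrow> (\<forall>s\<in>carrier M. \<forall>t\<in>carrier M. s \<oplus>\<^bsub>M\<^esub> t \<in> carrier M) \<and>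
     (\<forall>r\<in>carrier R. \<forall>s\<in>carrier M. r \<odot>\<^bsub>M\<^esub> s \<in> carrier M)"

lemma module_op_closed: "Module.module R M \<Longrightarrow> op_closed R M"
  by (simp add: op_closed_def Module.module_def module_axioms_def abelian_group_def
      abelian_monoid.a_closed)

lemma tensor_mod_pres:
  "tensor_mod R M N = pres_mod R (carrier M \<times> carrier N) (tensor_relators R M N)"
  by (simp add: tensor_mod_def pres_mod_def tensor_ker_def)

lemma pure_tensor_pres:
  "pure_tensor R M N s t = pres_gen R (carrier M \<times> carrier N) (tensor_relators R M N) (s, t)"
  by (simp add: pure_tensor_def pres_gen_def tensor_ker_def)

lemma ext_pow_pres:
  "ext_pow R k M = pres_mod R (ext_gens k M) (ext_relators R k M)"
  by (simp add: ext_pow_def pres_mod_def ext_ker_def)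

lemma pure_wedge_pres:
  "pure_wedge R M xs = pres_gen R (ext_gens (length xs) M) (ext_relators R (length xs) M) xs"
  by (simp add: pure_wedge_def pres_gen_def ext_ker_def)

lemma tensor_presentation:
  assumes "cring R" "op_closed R M" "op_closed R N"
  shows "presentation R (carrier M \<times> carrier N) (tensor_relators R M N)"
proof -
  interpret P: Module.module R "free_mod R (carrier M \<times> carrier N)"
    by (rule free_mod_module) fact
  have "tensor_relators R M N \<subseteq> carrier (free_mod R (carrier M \<times> carrier N))"
    using assms unfolding tensor_relators_def Let_def op_closed_def
    by (auto intro!: P.M.minus_closed P.smult_closed free_gen_carrier)
  then show ?thesis using assms(1) by (simp add: presentation_def presentation_axioms_def)
qed

lemma ext_gens_replace:
  "xs @ s # ys \<in> ext_gens k M \<Longrightarrow> t \<in> carrier M \<Longrightarrow> xs @ t # ys \<in> ext_gens k M"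
  by (simp add: ext_gens_def)

lemma ext_gens_elem: "xs @ s # ys \<in> ext_gens k M \<Longrightarrow> s \<in> carrier M"
  by (simp add: ext_gens_def)

lemma ext_gens_closed:
  assumes "op_closed R M" "xs @ s # ys \<in> ext_gens k M"
  shows "t \<in> carrier M \<Longrightarrow> xs @ (s \<oplus>\<^bsub>M\<^esub> t) # ys \<in> ext_gens k M"
    and "r \<in> carrier R \<Longrightarrow> xs @ (r \<odot>\<^bsub>M\<^esub> s) # ys \<in> ext_gens k M"
  using assms by (auto simp: ext_gens_def op_closed_def)

lemma ext_presentation:
  assumes "cring R" "op_closed R M"
  shows "presentation R (ext_gens k M) (ext_relators R k M)"
proof -
  interpret P: Module.module R "free_mod R (ext_gens k M)"
    by (rule free_mod_module) fact
  have "ext_relators R k M \<subseteq> carrier (free_mod R (ext_gens k M))"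
    using ext_gens_closed[OF assms(2)] assms(1) unfolding ext_relators_def Let_def
    by (auto intro!: P.M.minus_closed P.smult_closed free_gen_carrier
        intro: ext_gens_replace)
  then show ?thesis using assms(1) by (simp add: presentation_def presentation_axioms_def)
qed

lemma (in lin_target) lin_ext_rel3:
  assumes "g \<in> S" "g1 \<in> S" "g2 \<in> S" "b g = b g1 \<oplus>\<^bsub>N\<^esub> b g2"
  shows "lin_ext R h N b (free_gen R g \<ominus>\<^bsub>free_mod R S\<^esub> free_gen R g1 \<ominus>\<^bsub>free_mod R S\<^esub> free_gen R g2) = \<zero>\<^bsub>N\<^esub>"
proof -
  interpret le: abelian_group_hom "free_mod R S" N "lin_ext R h N b" by (rule lin_ext_hom)
  show ?thesis using assms
    by (simp add: a_minus_def free_gen_carrier R.is_cring lin_ext_gen bc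
        N.M.minus_minus_eq_zero_iff[unfolded a_minus_def])
qed

lemma (in lin_target) lin_ext_rel2:
  assumes "g \<in> S" "g1 \<in> S" "r \<in> carrier R" "b g = h r \<odot>\<^bsub>N\<^esub> b g1"
  shows "lin_ext R h N b (free_gen R g \<ominus>\<^bsub>free_mod R S\<^esub> r \<odot>\<^bsub>free_mod R S\<^esub> free_gen R g1) = \<zero>\<^bsub>N\<^esub>"
proof -
  interpret le: abelian_group_hom "free_mod R S" N "lin_ext R h N b" by (rule lin_ext_hom)
  interpret P: Module.module R "free_mod R S" by (rule free_mod_module) (rule R.is_cring)
  show ?thesis using assms
    by (simp add: a_minus_def free_gen_carrier R.is_cring lin_ext_gen lin_ext_smult bc N.M.r_neg h_closed)
qed

text \<open>Bilinearity of \<open>b\<close> is exactly what makes the four families of relators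
  vanish.\<close>

lemma tensor_resp:
  assumes lt: "lin_target R Q N h (carrier M \<times> carrier M') b" and cl: "op_closed R M" "op_closed R M'"
    and add1: "\<And>s s' t. s \<in> carrier M \<Longrightarrow> s' \<in> carrier M \<Longrightarrow> t \<in> carrier M' \<Longrightarrow>
      b (s \<oplus>\<^bsub>M\<^esub> s', t) = b (s, t) \<oplus>\<^bsub>N\<^esub> b (s', t)"
    and add2: "\<And>s t t'. s \<in> carrier M \<Longrightarrow> t \<in> carrier M' \<Longrightarrow> t' \<in> carrier M' \<Longrightarrow>
      b (s, t \<oplus>\<^bsub>M'\<^esub> t') = b (s, t) \<oplus>\<^bsub>N\<^esub> b (s, t')"
    and smult1: "\<And>r s t. r \<in> carrier R \<Longrightarrow> s \<in> carrier M \<Longrightarrow> t \<in> carrier M' \<Longrightarrow>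
      b (r \<odot>\<^bsub>M\<^esub> s, t) = h r \<odot>\<^bsub>N\<^esub> b (s, t)"
    and smult2: "\<And>r s t. r \<in> carrier R \<Longrightarrow> s \<in> carrier M \<Longrightarrow> t \<in> carrier M' \<Longrightarrow>
      b (s, r \<odot>\<^bsub>M'\<^esub> t) = h r \<odot>\<^bsub>N\<^esub> b (s, t)"
    and x: "x \<in> tensor_relators R M M'"
  shows "lin_ext R h N b x = \<zero>\<^bsub>N\<^esub>"
proof -
  interpret lin_target R Q N h "carrier M \<times> carrier M'" b by (rule lt)
  show ?thesis using x cl unfolding tensor_relators_def Let_def op_closed_def
    by (elim UnE) (auto intro!: lin_ext_rel3 lin_ext_rel2 simp: add1 add2 smult1 smult2)
qed

text \<open>Multilinearity and vanishing on lists with a repetition make the three families of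
  relators vanish.\<close>

lemma ext_resp:
  assumes lt: "lin_target R Q N h (ext_gens k M) b" and cl: "op_closed R M"
    and add: "\<And>xs s t ys. xs @ s # ys \<in> ext_gens k M \<Longrightarrow> t \<in> carrier M \<Longrightarrow>
      b (xs @ (s \<oplus>\<^bsub>M\<^esub> t) # ys) = b (xs @ s # ys) \<oplus>\<^bsub>N\<^esub> b (xs @ t # ys)"
    and smult: "\<And>xs r s ys. xs @ s # ys \<in> ext_gens k M \<Longrightarrow> r \<in> carrier R \<Longrightarrow>
      b (xs @ (r \<odot>\<^bsub>M\<^esub> s) # ys) = h r \<odot>\<^bsub>N\<^esub> b (xs @ s # ys)"
    and alt: "\<And>xs. xs \<in> ext_gens k M \<Longrightarrow> \<not> distinct xs \<Longrightarrow> b xs = \<zero>\<^bsub>N\<^esub>"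
    and x: "x \<in> ext_relators R k M"
  shows "lin_ext R h N b x = \<zero>\<^bsub>N\<^esub>"
proof -
  define S where "S = ext_gens k M"
  interpret lin_target R Q N h S b unfolding S_def by (rule lt)
  show ?thesis unfolding S_def[symmetric] using x unfolding ext_relators_def Let_def S_def[symmetric]
  proof (elim UnE)
  assume "x \<in> {free_gen R (xs @ (s \<oplus>\<^bsub>M\<^esub> t) # ys) \<ominus>\<^bsub>free_mod R S\<^esub> free_gen R (xs @ s # ys) \<ominus>\<^bsub>free_mod R S\<^esub>
       free_gen R (xs @ t # ys) | xs s t ys. xs @ s # ys \<in> S \<and> t \<in> carrier M}"
  then obtain xs s t ys where st: "xs @ s # ys \<in> S" "t \<in> carrier M"
    and x': "x = free_gen R (xs @ (s \<oplus>\<^bsub>M\<^esub> t) # ys) \<ominus>\<^bsub>free_mod R S\<^esub> free_gen R (xs @ s # ys) \<ominus>\<^bsub>free_mod R S\<^esub>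
       free_gen R (xs @ t # ys)" by blast
  show ?thesis unfolding x' using st cl add
    by (intro lin_ext_rel3) (auto simp: S_def ext_gens_def op_closed_def)
next
  assume "x \<in> {free_gen R (xs @ (r \<odot>\<^bsub>M\<^esub> s) # ys) \<ominus>\<^bsub>free_mod R S\<^esub> r \<odot>\<^bsub>free_mod R S\<^esub> free_gen R (xs @ s # ys) | xs r s ys.
       xs @ s # ys \<in> S \<and> r \<in> carrier R}"
  then obtain xs r s ys where st: "xs @ s # ys \<in> S" "r \<in> carrier R"
    and x': "x = free_gen R (xs @ (r \<odot>\<^bsub>M\<^esub> s) # ys) \<ominus>\<^bsub>free_mod R S\<^esub> r \<odot>\<^bsub>free_mod R S\<^esub> free_gen R (xs @ s # ys)"
    by blast
  show ?thesis unfolding x' using st cl smult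
    by (intro lin_ext_rel2) (auto simp: S_def ext_gens_def op_closed_def)
next
  assume "x \<in> {free_gen R xs | xs. xs \<in> S \<and> \<not> distinct xs}"
  then show ?thesis using alt lin_ext_gen by (auto simp: S_def)
  qed
qed

lemma (in presentation) gen_rel3:
  assumes "g \<in> S" "g1 \<in> S" "g2 \<in> S"
    and "free_gen R g \<ominus>\<^bsub>free_mod R S\<^esub> free_gen R g1 \<ominus>\<^bsub>free_mod R S\<^esub> free_gen R g2 \<in> X"
  shows "gen g = gen g1 \<oplus>\<^bsub>Q\<^esub> gen g2"
proof -
  have "gen g \<ominus>\<^bsub>Q\<^esub> gen g1 \<ominus>\<^bsub>Q\<^esub> gen g2 = \<zero>\<^bsub>Q\<^esub>"
    using cls_X[OF assms(4)] assms
    by (simp add: cls_minus gen_def free_gen_carrier R.is_cring)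
  then show ?thesis using assms gen_closed by (simp add: Q.M.minus_minus_eq_zero_iff)
qed

lemma (in presentation) gen_rel2:
  assumes "g \<in> S" "g1 \<in> S" "r \<in> carrier R"
    and "free_gen R g \<ominus>\<^bsub>free_mod R S\<^esub> r \<odot>\<^bsub>free_mod R S\<^esub> free_gen R g1 \<in> X"
  shows "gen g = r \<odot>\<^bsub>Q\<^esub> gen g1"
proof -
  have "gen g \<ominus>\<^bsub>Q\<^esub> r \<odot>\<^bsub>Q\<^esub> gen g1 = \<zero>\<^bsub>Q\<^esub>"
    using cls_X[OF assms(4)] assms
    by (simp add: cls_minus gen_def free_gen_carrier R.is_cring cls_smult)
  then show ?thesis using assms gen_closed by (simp add: Q.M.minus_eq_zero_iff)
qed

context
  fixes R :: "('r, 'x) ring_scheme" and M :: "('r, 's) module" and N :: "('r, 't) module"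
  assumes R: "cring R" and M: "op_closed R M" and N: "op_closed R N"
begin

interpretation presentation R "carrier M \<times> carrier N" "tensor_relators R M N"
  by (rule tensor_presentation[OF R M N])

lemma pure_tensor_closed: "s \<in> carrier M \<Longrightarrow> t \<in> carrier N \<Longrightarrow>
    pure_tensor R M N s t \<in> carrier (tensor_mod R M N)"
  unfolding tensor_mod_pres pure_tensor_pres by (simp add: gen_closed)

lemma pure_tensor_add1: "s \<in> carrier M \<Longrightarrow> s' \<in> carrier M \<Longrightarrow> t \<in> carrier N \<Longrightarrow>
    pure_tensor R M N (s \<oplus>\<^bsub>M\<^esub> s') t = pure_tensor R M N s t \<oplus>\<^bsub>tensor_mod R M N\<^esub> pure_tensor R M N s' t"
  unfolding tensor_mod_pres pure_tensor_pres using M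
  by (intro gen_rel3) (auto simp: op_closed_def, unfold tensor_relators_def Let_def, blast)

lemma pure_tensor_add2: "s \<in> carrier M \<Longrightarrow> t \<in> carrier N \<Longrightarrow> t' \<in> carrier N \<Longrightarrow>
    pure_tensor R M N s (t \<oplus>\<^bsub>N\<^esub> t') = pure_tensor R M N s t \<oplus>\<^bsub>tensor_mod R M N\<^esub> pure_tensor R M N s t'"
  unfolding tensor_mod_pres pure_tensor_pres using N
  by (intro gen_rel3) (auto simp: op_closed_def, unfold tensor_relators_def Let_def, blast)

lemma pure_tensor_smult1: "r \<in> carrier R \<Longrightarrow> s \<in> carrier M \<Longrightarrow> t \<in> carrier N \<Longrightarrow>
    pure_tensor R M N (r \<odot>\<^bsub>M\<^esub> s) t = r \<odot>\<^bsub>tensor_mod R M N\<^esub> pure_tensor R M N s t"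
  unfolding tensor_mod_pres pure_tensor_pres using M
  by (intro gen_rel2) (auto simp: op_closed_def, unfold tensor_relators_def Let_def, blast)

lemma pure_tensor_smult2: "r \<in> carrier R \<Longrightarrow> s \<in> carrier M \<Longrightarrow> t \<in> carrier N \<Longrightarrow>
    pure_tensor R M N s (r \<odot>\<^bsub>N\<^esub> t) = r \<odot>\<^bsub>tensor_mod R M N\<^esub> pure_tensor R M N s t"
  unfolding tensor_mod_pres pure_tensor_pres using N
  by (intro gen_rel2) (auto simp: op_closed_def, unfold tensor_relators_def Let_def, blast)

end

context
  fixes R :: "('r, 'x) ring_scheme" and M :: "('r, 's) module" and k :: nat
  assumes R: "cring R" and M: "op_closed R M"
begin

interpretation presentation R "ext_gens k M" "ext_relators R k M"
  by (rule ext_presentation[OF R M])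

lemma ext_module: "Module.module R (ext_pow R k M)"
  unfolding ext_pow_pres by (rule Q.module_axioms)

lemma pure_wedge_closed: "xs \<in> ext_gens k M \<Longrightarrow> pure_wedge R M xs \<in> carrier (ext_pow R k M)"
  unfolding ext_pow_pres pure_wedge_pres using gen_closed by (auto simp: ext_gens_def)

lemma pure_wedge_add: "xs @ s # ys \<in> ext_gens k M \<Longrightarrow> t \<in> carrier M \<Longrightarrow>
    pure_wedge R M (xs @ (s \<oplus>\<^bsub>M\<^esub> t) # ys) =
      pure_wedge R M (xs @ s # ys) \<oplus>\<^bsub>ext_pow R k M\<^esub> pure_wedge R M (xs @ t # ys)"
proof -
  assume a: "xs @ s # ys \<in> ext_gens k M" "t \<in> carrier M"
  have "length (xs @ (s \<oplus>\<^bsub>M\<^esub> t) # ys) = k" "length (xs @ s # ys) = k" "length (xs @ t # ys) = k"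
    using a by (auto simp: ext_gens_def)
  note len = this
  have g: "xs @ (s \<oplus>\<^bsub>M\<^esub> t) # ys \<in> ext_gens k M" "xs @ t # ys \<in> ext_gens k M"
    using M a by (auto simp: op_closed_def ext_gens_def)
  show ?thesis unfolding ext_pow_pres pure_wedge_pres len
    by (rule gen_rel3[OF g(1) a(1) g(2)]) (use a in \<open>unfold ext_relators_def Let_def, blast\<close>)
qed

lemma pure_wedge_smult: "xs @ s # ys \<in> ext_gens k M \<Longrightarrow> r \<in> carrier R \<Longrightarrow>
    pure_wedge R M (xs @ (r \<odot>\<^bsub>M\<^esub> s) # ys) = r \<odot>\<^bsub>ext_pow R k M\<^esub> pure_wedge R M (xs @ s # ys)"
proof -
  assume a: "xs @ s # ys \<in> ext_gens k M" "r \<in> carrier R"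
  have "length (xs @ (r \<odot>\<^bsub>M\<^esub> s) # ys) = k" "length (xs @ s # ys) = k"
    using a by (auto simp: ext_gens_def)
  note len = this
  have g: "xs @ (r \<odot>\<^bsub>M\<^esub> s) # ys \<in> ext_gens k M"
    using M a by (auto simp: op_closed_def ext_gens_def)
  show ?thesis unfolding ext_pow_pres pure_wedge_pres len
    by (rule gen_rel2[OF g(1) a]) (use a in \<open>unfold ext_relators_def Let_def, blast\<close>)
qed

lemma pure_wedge_alt: "xs \<in> ext_gens k M \<Longrightarrow> \<not> distinct xs \<Longrightarrow>
    pure_wedge R M xs = \<zero>\<^bsub>ext_pow R k M\<^esub>"
proof -
  assume a: "xs \<in> ext_gens k M" "\<not> distinct xs"
  have len: "length xs = k" using a by (auto simp: ext_gens_def)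
  show ?thesis unfolding ext_pow_pres pure_wedge_pres len gen_def
    by (rule cls_X) (use a in \<open>auto simp: ext_relators_def Let_def\<close>)
qed

end

section \<open>Presheaves\<close>

text \<open>Closure under the operations and the behaviour of restriction are the properties through
  which duals and ideal sheaves enter tensor products.\<close>

definition op_presheaf :: "('a::topological_space) ring_sheaf \<Rightarrow> ('a, 's) mod_presheaf \<Rightarrow> bool" where
  "op_presheaf \<O> P \<longleftrightarrow>
     (\<forall>U. open U \<longrightarrow> op_closed (\<O> U) (sec P U)) \<and>
     (\<forall>U V. open U \<and> open V \<and> V \<subseteq> U \<longrightarrow>
        res P U V \<in> carrier (sec P U) \<rightarrow> carrier (sec P V) \<and>
        (\<forall>s\<in>carrier (sec P U). \<forall>t\<in>carrier (sec P U).
           res P U V (s \<oplus>\<^bsub>sec P U\<^esub> t) = res P U V s \<oplus>\<^bsub>sec P V\<^esub> res P U V t) \<and>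
        (\<forall>r\<in>carrier (\<O> U). \<forall>s\<in>carrier (sec P U).
           res P U V (r \<odot>\<^bsub>sec P U\<^esub> s) = rst V r \<odot>\<^bsub>sec P V\<^esub> res P U V s)) \<and>
     (\<forall>U. open U \<longrightarrow> (\<forall>s\<in>carrier (sec P U). res P U U s = s)) \<and>
     (\<forall>U V W. open U \<and> open V \<and> open W \<and> W \<subseteq> V \<and> V \<subseteq> U \<longrightarrow>
        (\<forall>s\<in>carrier (sec P U). res P V W (res P U V s) = res P U W s))"

lemma is_presheaf_iff:
  "is_presheaf \<O> P \<longleftrightarrow> op_presheaf \<O> P \<and> (\<forall>U. open U \<longrightarrow> Module.module (\<O> U) (sec P U))"
  unfolding is_presheaf_def op_presheaf_def
  by (rule iffI; (elim conjE)?; (intro conjI)?; (assumption | simp add: module_op_closed)?)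

lemma is_presheaf_op: "is_presheaf \<O> P \<Longrightarrow> op_presheaf \<O> P"
  by (simp add: is_presheaf_iff)

lemma presheaf_module: "is_presheaf \<O> P \<Longrightarrow> open U \<Longrightarrow> Module.module (\<O> U) (sec P U)"
  by (simp add: is_presheaf_iff)

context
  fixes \<O> :: "('a::topological_space) ring_sheaf" and P :: "('a, 's) mod_presheaf"
  assumes P: "op_presheaf \<O> P"
begin

lemma op_closed_sec: "open U \<Longrightarrow> op_closed (\<O> U) (sec P U)"
  using P by (simp add: op_presheaf_def)

lemma op_add: "open U \<Longrightarrow> s \<in> carrier (sec P U) \<Longrightarrow> t \<in> carrier (sec P U) \<Longrightarrow>
    s \<oplus>\<^bsub>sec P U\<^esub> t \<in> carrier (sec P U)"
  using op_closed_sec by (simp add: op_closed_def)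

lemma op_smult: "open U \<Longrightarrow> r \<in> carrier (\<O> U) \<Longrightarrow> s \<in> carrier (sec P U) \<Longrightarrow>
    r \<odot>\<^bsub>sec P U\<^esub> s \<in> carrier (sec P U)"
  using op_closed_sec by (simp add: op_closed_def)

lemma res_closed: "open U \<Longrightarrow> open V \<Longrightarrow> V \<subseteq> U \<Longrightarrow> s \<in> carrier (sec P U) \<Longrightarrow>
    res P U V s \<in> carrier (sec P V)"
  using P by (simp add: op_presheaf_def Pi_iff)

lemma res_add: "open U \<Longrightarrow> open V \<Longrightarrow> V \<subseteq> U \<Longrightarrow> s \<in> carrier (sec P U) \<Longrightarrow> t \<in> carrier (sec P U) \<Longrightarrow>
    res P U V (s \<oplus>\<^bsub>sec P U\<^esub> t) = res P U V s \<oplus>\<^bsub>sec P V\<^esub> res P U V t"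
  using P by (auto simp: op_presheaf_def)

lemma res_smult: "open U \<Longrightarrow> open V \<Longrightarrow> V \<subseteq> U \<Longrightarrow> r \<in> carrier (\<O> U) \<Longrightarrow> s \<in> carrier (sec P U) \<Longrightarrow>
    res P U V (r \<odot>\<^bsub>sec P U\<^esub> s) = rst V r \<odot>\<^bsub>sec P V\<^esub> res P U V s"
  using P by (auto simp: op_presheaf_def)

lemma res_id: "open U \<Longrightarrow> s \<in> carrier (sec P U) \<Longrightarrow> res P U U s = s"
  using P by (auto simp: op_presheaf_def)

lemma res_comp: "open U \<Longrightarrow> open V \<Longrightarrow> open W \<Longrightarrow> W \<subseteq> V \<Longrightarrow> V \<subseteq> U \<Longrightarrow> s \<in> carrier (sec P U) \<Longrightarrow>
    res P V W (res P U V s) = res P U W s"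
  using P by (simp add: op_presheaf_def)

end

context
  fixes \<O> :: "('a::topological_space) ring_sheaf" and P :: "('a, 's) mod_presheaf"
  assumes P: "is_presheaf \<O> P"
begin

lemma res_hom: "open U \<Longrightarrow> open V \<Longrightarrow> V \<subseteq> U \<Longrightarrow> abelian_group_hom (sec P U) (sec P V) (res P U V)"
proof -
  assume UV: "open U" "open V" "V \<subseteq> U"
  interpret U: Module.module "\<O> U" "sec P U" using presheaf_module[OF P UV(1)] .
  interpret V: Module.module "\<O> V" "sec P V" using presheaf_module[OF P UV(2)] .
  note op = is_presheaf_op[OF P]
  show ?thesis
    by (rule abelian_group_homI[OF U.M.abelian_group_axioms V.M.abelian_group_axioms])
      (auto intro!: group_hom.intro group_hom_axioms.intro U.M.a_group V.M.a_group homI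
        simp: res_closed[OF op UV] res_add[OF op UV])
qed

lemma res_zero: "open U \<Longrightarrow> open V \<Longrightarrow> V \<subseteq> U \<Longrightarrow> res P U V \<zero>\<^bsub>sec P U\<^esub> = \<zero>\<^bsub>sec P V\<^esub>"
  using abelian_group_hom.hom_zero[OF res_hom] .

lemma res_minus: "open U \<Longrightarrow> open V \<Longrightarrow> V \<subseteq> U \<Longrightarrow> s \<in> carrier (sec P U) \<Longrightarrow> t \<in> carrier (sec P U) \<Longrightarrow>
    res P U V (s \<ominus>\<^bsub>sec P U\<^esub> t) = res P U V s \<ominus>\<^bsub>sec P V\<^esub> res P U V t"
proof -
  assume UV: "open U" "open V" "V \<subseteq> U" and st: "s \<in> carrier (sec P U)" "t \<in> carrier (sec P U)"
  interpret r: abelian_group_hom "sec P U" "sec P V" "res P U V" by (rule res_hom[OF UV])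
  show ?thesis using st by (simp add: a_minus_def)
qed

end

lemma sheaf_presheaf: "is_sheaf \<O> F \<Longrightarrow> is_presheaf \<O> F"
  by (simp add: is_sheaf_def)

lemma sheaf_ex1:
  assumes "is_sheaf \<O> F" "\<forall>U\<in>\<U>. open U \<and> t U \<in> carrier (sec F U)"
    "\<forall>U\<in>\<U>. \<forall>V\<in>\<U>. res F U (U \<inter> V) (t U) = res F V (U \<inter> V) (t V)"
  shows "\<exists>!s. s \<in> carrier (sec F (\<Union>\<U>)) \<and> (\<forall>U\<in>\<U>. res F (\<Union>\<U>) U s = t U)"
  by (rule assms(1)[unfolded is_sheaf_def, THEN conjunct2, THEN spec, THEN spec, THEN mp,
      OF conjI[OF assms(2,3)]])

lemma sheaf_separated:
  assumes F: "is_sheaf \<O> F" and U: "open U" and s: "s \<in> carrier (sec F U)" "t \<in> carrier (sec F U)"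
    and loc: "\<And>x. x \<in> U \<Longrightarrow> \<exists>V. open V \<and> x \<in> V \<and> V \<subseteq> U \<and> res F U V s = res F U V t"
  shows "s = t"
proof -
  note op = is_presheaf_op[OF sheaf_presheaf[OF F]]
  define \<U> where "\<U> = {V. open V \<and> V \<subseteq> U \<and> res F U V s = res F U V t}"
  have cov: "\<Union>\<U> = U" using loc unfolding \<U>_def by blast
  have 1: "\<forall>V\<in>\<U>. open V \<and> res F U V s \<in> carrier (sec F V)"
    using U s unfolding \<U>_def by (auto intro: res_closed[OF op])
  have 2: "\<forall>V\<in>\<U>. \<forall>V'\<in>\<U>. res F V (V \<inter> V') (res F U V s) = res F V' (V \<inter> V') (res F U V' s)"
    using U s unfolding \<U>_def by (simp add: res_comp[OF op] open_Int)
  have "\<exists>!z. z \<in> carrier (sec F U) \<and> (\<forall>V\<in>\<U>. res F U V z = res F U V s)"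
    using sheaf_ex1[OF F 1 2] unfolding cov .
  moreover have "\<forall>V\<in>\<U>. res F U V t = res F U V s" by (simp add: \<U>_def)
  ultimately show "s = t" using s by blast
qed

text \<open>Indexed form of the gluing axiom. Sections indexed by the same open set agree there by
  hypothesis, so the family may be re-indexed by open sets.\<close>

lemma sheaf_glue:
  assumes F: "is_sheaf \<O> F" and U: "\<And>i. i \<in> I \<Longrightarrow> open (U i)" and t: "\<And>i. i \<in> I \<Longrightarrow> t i \<in> carrier (sec F (U i))"
    and agree: "\<And>i j. i \<in> I \<Longrightarrow> j \<in> I \<Longrightarrow> res F (U i) (U i \<inter> U j) (t i) = res F (U j) (U i \<inter> U j) (t j)"
  obtains s where "s \<in> carrier (sec F (\<Union>i\<in>I. U i))" "\<And>i. i \<in> I \<Longrightarrow> res F (\<Union>i\<in>I. U i) (U i) s = t i"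
proof -
  note op = is_presheaf_op[OF sheaf_presheaf[OF F]]
  define c where "c V = (SOME i. i \<in> I \<and> U i = V)" for V
  have c: "c (U i) \<in> I" "U (c (U i)) = U i" if "i \<in> I" for i
    using someI[of "\<lambda>j. j \<in> I \<and> U j = U i" i] that unfolding c_def by auto
  have tc: "t (c (U i)) = t i" if i: "i \<in> I" for i
  proof -
    have "res F (U i) (U i) (t (c (U i))) = res F (U i) (U i) (t i)"
      using agree[OF c(1)[OF i] i] c(2)[OF i] by simp
    then show ?thesis using res_id[OF op U[OF i]] t[OF i] t[OF c(1)[OF i]] c(2)[OF i] by simp
  qed
  have "\<exists>!s. s \<in> carrier (sec F (\<Union>(U ` I))) \<and> (\<forall>V\<in>U ` I. res F (\<Union>(U ` I)) V s = t (c V))"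
    by (rule sheaf_ex1[OF F]) (auto simp: U t tc intro: agree)
  then obtain s where s: "s \<in> carrier (sec F (\<Union>(U ` I)))" "\<forall>V\<in>U ` I. res F (\<Union>(U ` I)) V s = t (c V)"
    by auto
  show ?thesis by (rule that[of s]) (use s tc in auto)
qed

section \<open>Sheaves of rings of functions\<close>

text \<open>The facts about holomorphic functions on which the argument rests: rings of functions
  extended by zero, with pointwise operations, containing the constants and stable under
  restriction.\<close>

locale function_rings =
  fixes \<O> :: "('a::topological_space) ring_sheaf"
  assumes O_mult: "monoid.mult (\<O> U) = (\<lambda>f g x. f x * g x)"
    and O_one: "\<one>\<^bsub>\<O> U\<^esub> = (\<lambda>x. if x \<in> U then 1 else 0)"
    and O_zero: "\<zero>\<^bsub>\<O> U\<^esub> = (\<lambda>_. 0)"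
    and O_add: "add (\<O> U) = (\<lambda>f g x. f x + g x)"
    and O_supp: "f \<in> carrier (\<O> U) \<Longrightarrow> x \<notin> U \<Longrightarrow> f x = 0"
    and O_const: "open U \<Longrightarrow> (\<lambda>x. if x \<in> U then c else 0) \<in> carrier (\<O> U)"
    and O_add_closed: "open U \<Longrightarrow> f \<in> carrier (\<O> U) \<Longrightarrow> g \<in> carrier (\<O> U) \<Longrightarrow>
      (\<lambda>x. f x + g x) \<in> carrier (\<O> U)"
    and O_mult_closed: "open U \<Longrightarrow> f \<in> carrier (\<O> U) \<Longrightarrow> g \<in> carrier (\<O> U) \<Longrightarrow>
      (\<lambda>x. f x * g x) \<in> carrier (\<O> U)"
    and O_rst: "open U \<Longrightarrow> open V \<Longrightarrow> V \<subseteq> U \<Longrightarrow> f \<in> carrier (\<O> U) \<Longrightarrow> rst V f \<in> carrier (\<O> V)"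
begin

lemma O_restrict_one: "f \<in> carrier (\<O> U) \<Longrightarrow> (if x \<in> U then 1 else 0) * f x = f x"
  using O_supp by auto

lemma O_uminus: "open U \<Longrightarrow> f \<in> carrier (\<O> U) \<Longrightarrow> (\<lambda>x. - f x) \<in> carrier (\<O> U)"
proof -
  assume f: "open U" "f \<in> carrier (\<O> U)"
  have "(\<lambda>x. (if x \<in> U then - 1 else 0) * f x) = (\<lambda>x. - f x)" using O_supp[OF f(2)] by auto
  then show ?thesis using O_mult_closed[OF f(1) O_const[OF f(1), of "-1"] f(2)] by simp
qed

lemma cring_O: "open U \<Longrightarrow> cring (\<O> U)"
proof (rule cringI)
  assume U: "open U"
  show "abelian_group (\<O> U)"
  proof (rule abelian_groupI)
    fix f assume "f \<in> carrier (\<O> U)"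
    then show "\<exists>y\<in>carrier (\<O> U). y \<oplus>\<^bsub>\<O> U\<^esub> f = \<zero>\<^bsub>\<O> U\<^esub>"
      by (intro bexI[OF _ O_uminus[OF U]]) (auto simp: O_zero O_add)
  qed (use O_const[OF U, of 0] in \<open>auto simp: O_add O_zero O_add_closed[OF U]\<close>)
  show "comm_monoid (\<O> U)"
    by (rule comm_monoidI)
      (use O_const[OF U, of 1] in \<open>auto simp: O_mult O_one O_mult_closed[OF U] O_restrict_one\<close>)
qed (auto simp: O_add O_mult distrib_right)

lemma rst_hom: "open U \<Longrightarrow> open V \<Longrightarrow> V \<subseteq> U \<Longrightarrow> rst V \<in> Ring.ring_hom (\<O> U) (\<O> V)"
proof (rule ring_hom_memI)
  assume "V \<subseteq> U"
  then show "rst V \<one>\<^bsub>\<O> U\<^esub> = \<one>\<^bsub>\<O> V\<^esub>" by (auto simp: O_one rst_def fun_eq_iff)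
qed (auto simp: O_rst, auto simp: O_add O_mult rst_def)

lemma id_hom: "id \<in> Ring.ring_hom (\<O> U) (\<O> U)"
  by (rule ring_hom_memI) auto

lemma rst_id: "f \<in> carrier (\<O> U) \<Longrightarrow> rst U f = f"
  using O_supp by (fastforce simp: rst_def)

lemma rst_rst: "V \<subseteq> U \<Longrightarrow> rst V (rst U f) = rst V f"
  by (auto simp: rst_def fun_eq_iff)

end

section \<open>Presheaves of presented modules\<close>

text \<open>A presheaf given over each open set by generators and relators, whose restriction maps
  are induced by maps \<open>\<rho>\<close> of generators. Functoriality and morphisms out of it are
  checked on generators.\<close>

locale presented_presheaf = function_rings \<O>
  for \<O> :: "('a::topological_space) ring_sheaf" +
  fixes P :: "('a, ('g \<Rightarrow> 'a \<Rightarrow> complex) set) mod_presheaf"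
    and S :: "'a set \<Rightarrow> 'g set" and X :: "'a set \<Rightarrow> ('g \<Rightarrow> 'a \<Rightarrow> complex) set"
    and \<rho> :: "'a set \<Rightarrow> 'a set \<Rightarrow> 'g \<Rightarrow> 'g"
    and b :: "'a set \<Rightarrow> 'a set \<Rightarrow> 'g \<Rightarrow> ('g \<Rightarrow> 'a \<Rightarrow> complex) set"
  assumes sec_P: "sec P U = pres_mod (\<O> U) (S U) (X U)"
    and res_P: "res P U V = quot_lift (\<O> U) (rst V) (sec P V) (b U V)"
    and pres: "open U \<Longrightarrow> presentation (\<O> U) (S U) (X U)"
    and b_gen: "open U \<Longrightarrow> open V \<Longrightarrow> V \<subseteq> U \<Longrightarrow> g \<in> S U \<Longrightarrow>
      b U V g = pres_gen (\<O> V) (S V) (X V) (\<rho> U V g)"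
    and rho: "open U \<Longrightarrow> open V \<Longrightarrow> V \<subseteq> U \<Longrightarrow> g \<in> S U \<Longrightarrow> \<rho> U V g \<in> S V"
    and rho_id: "open U \<Longrightarrow> g \<in> S U \<Longrightarrow> \<rho> U U g = g"
    and rho_comp: "open U \<Longrightarrow> open V \<Longrightarrow> open W \<Longrightarrow> W \<subseteq> V \<Longrightarrow> V \<subseteq> U \<Longrightarrow> g \<in> S U \<Longrightarrow>
      \<rho> V W (\<rho> U V g) = \<rho> U W g"
    and resp: "open U \<Longrightarrow> open V \<Longrightarrow> V \<subseteq> U \<Longrightarrow> lin_target (\<O> U) (\<O> V) (sec P V) (rst V) (S U) (b U V) \<Longrightarrow>
      x \<in> X U \<Longrightarrow> lin_ext (\<O> U) (rst V) (sec P V) (b U V) x = \<zero>\<^bsub>sec P V\<^esub>"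
begin

abbreviation "pgen U \<equiv> pres_gen (\<O> U) (S U) (X U)"

lemma module_P: "open U \<Longrightarrow> Module.module (\<O> U) (sec P U)"
proof -
  assume "open U"
  then interpret presentation "\<O> U" "S U" "X U" by (rule pres)
  show ?thesis unfolding sec_P by (rule Q.module_axioms)
qed

lemma gen_closed: "open U \<Longrightarrow> g \<in> S U \<Longrightarrow> pgen U g \<in> carrier (sec P U)"
  unfolding sec_P using presentation.gen_closed[OF pres] .

lemma res_map:
  assumes "open U" "open V" "V \<subseteq> U"
  shows "presentation_map (\<O> U) (S U) (X U) (\<O> V) (sec P V) (rst V) (b U V)"
proof -
  have "lin_target (\<O> U) (\<O> V) (sec P V) (rst V) (S U) (b U V)"
    using assms by (auto intro!: lin_target.intro lin_target_axioms.intro cring_O module_P rst_hom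
        simp: b_gen gen_closed rho)
  then show ?thesis using assms
    by (intro presentation_map.intro presentation_map_axioms.intro pres resp)
qed

lemma induct [consumes 2, case_names zero gen add smult]:
  assumes "open U" "t \<in> carrier (sec P U)"
    and "T \<zero>\<^bsub>sec P U\<^esub>"
    and "\<And>g. g \<in> S U \<Longrightarrow> T (pgen U g)"
    and "\<And>s t. s \<in> carrier (sec P U) \<Longrightarrow> t \<in> carrier (sec P U) \<Longrightarrow> T s \<Longrightarrow> T t \<Longrightarrow> T (s \<oplus>\<^bsub>sec P U\<^esub> t)"
    and "\<And>r s. r \<in> carrier (\<O> U) \<Longrightarrow> s \<in> carrier (sec P U) \<Longrightarrow> T s \<Longrightarrow> T (r \<odot>\<^bsub>sec P U\<^esub> s)"
  shows "T t"
  using presentation.Q_induct[OF pres[OF assms(1)], of t T] assms unfolding sec_P by blast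

lemma res_gen:
  assumes "open U" "open V" "V \<subseteq> U" "g \<in> S U"
  shows "res P U V (pgen U g) = pgen V (\<rho> U V g)"
  using presentation_map.lft_gen[OF res_map[OF assms(1-3)] assms(4)] b_gen[OF assms]
  by (simp add: res_P)

lemma presheaf: "is_presheaf \<O> P"
proof -
  have clos: "res P U V s \<in> carrier (sec P V)" if "open U" "open V" "V \<subseteq> U" "s \<in> carrier (sec P U)" for U V s
    using presentation_map.lft_closed[OF res_map[OF that(1-3)], of s] that(4) by (simp add: res_P sec_P[of U])
  have add: "res P U V (s \<oplus>\<^bsub>sec P U\<^esub> t) = res P U V s \<oplus>\<^bsub>sec P V\<^esub> res P U V t"
    if "open U" "open V" "V \<subseteq> U" "s \<in> carrier (sec P U)" "t \<in> carrier (sec P U)" for U V s t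
    using presentation_map.lft_add[OF res_map[OF that(1-3)], of s t] that(4,5) by (simp add: res_P sec_P[of U])
  have smult: "res P U V (r \<odot>\<^bsub>sec P U\<^esub> s) = rst V r \<odot>\<^bsub>sec P V\<^esub> res P U V s"
    if "open U" "open V" "V \<subseteq> U" "s \<in> carrier (sec P U)" "r \<in> carrier (\<O> U)" for U V s r
    using presentation_map.lft_smult[OF res_map[OF that(1-3)], of r s] that(4,5) by (simp add: res_P sec_P[of U])
  have zero: "res P U V \<zero>\<^bsub>sec P U\<^esub> = \<zero>\<^bsub>sec P V\<^esub>"
    if "open U" "open V" "V \<subseteq> U" for U V
    using presentation_map.lft_zero[OF res_map[OF that(1-3)]] by (simp add: res_P sec_P[of U])
  note radd = add and rsm = smult and rzero = zero
  have id: "res P U U s = s" if U: "open U" and s: "s \<in> carrier (sec P U)" for U s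
    using U s
    by (induction rule: induct)
      (simp_all add: U zero[OF U U] res_gen[OF U U] rho_id add[OF U U] smult[OF U U] rst_id)
  have comp: "res P V W (res P U V s) = res P U W s"
    if U: "open U" "open V" "open W" "W \<subseteq> V" "V \<subseteq> U" and s: "s \<in> carrier (sec P U)" for U V W s
  proof -
    have WU: "W \<subseteq> U" using U by blast
    note UV = U(1,2,5) and VW = U(2,3,4) and UW = U(1,3) WU
    show ?thesis using U(1) s
    proof (induction rule: induct)
      case zero show ?case by (simp only: rzero[OF UV] rzero[OF VW] rzero[OF UW])
    next
      case (gen g)
      then show ?case using rho_comp[OF U gen] rho[OF UV gen]
        by (simp add: res_gen[OF UV] res_gen[OF VW] res_gen[OF UW])
    next
      case (add s t) then show ?case
        by (simp add: clos[OF UV] radd[OF UV] radd[OF VW] radd[OF UW])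
    next
      case (smult r s) then show ?case
        by (simp add: clos[OF UV] rsm[OF UV] rsm[OF VW] rsm[OF UW] O_rst[OF UV] rst_rst[OF U(4)])
    qed
  qed
  show ?thesis unfolding is_presheaf_def
    using module_P clos add smult id comp by (intro conjI allI impI ballI Pi_I) simp_all
qed

text \<open>Linearity comes with each module of sections; compatibility with restriction is proved
  by induction on elements, from its validity on generators.\<close>

lemma lift_mor:
  assumes N: "is_presheaf \<O> N" and U: "open U"
    and \<beta>: "\<And>V g. open V \<Longrightarrow> V \<subseteq> U \<Longrightarrow> g \<in> S V \<Longrightarrow> \<beta> V g \<in> carrier (sec N V)"
    and resp: "\<And>V x. open V \<Longrightarrow> V \<subseteq> U \<Longrightarrow> lin_target (\<O> V) (\<O> V) (sec N V) id (S V) (\<beta> V) \<Longrightarrow>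
      x \<in> X V \<Longrightarrow> lin_ext (\<O> V) id (sec N V) (\<beta> V) x = \<zero>\<^bsub>sec N V\<^esub>"
    and nat: "\<And>V W g. open V \<Longrightarrow> open W \<Longrightarrow> W \<subseteq> V \<Longrightarrow> V \<subseteq> U \<Longrightarrow> g \<in> S V \<Longrightarrow>
      res N V W (\<beta> V g) = \<beta> W (\<rho> V W g)"
  shows "is_mor \<O> U P N (\<lambda>V. quot_lift (\<O> V) id (sec N V) (\<beta> V))"
    and "\<And>V g. open V \<Longrightarrow> V \<subseteq> U \<Longrightarrow> g \<in> S V \<Longrightarrow> quot_lift (\<O> V) id (sec N V) (\<beta> V) (pgen V g) = \<beta> V g"
proof -
  have map: "presentation_map (\<O> V) (S V) (X V) (\<O> V) (sec N V) id (\<beta> V)" if V: "open V" "V \<subseteq> U" for V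
  proof -
    have lt: "lin_target (\<O> V) (\<O> V) (sec N V) id (S V) (\<beta> V)"
      using V by (auto intro!: lin_target.intro lin_target_axioms.intro cring_O presheaf_module[OF N] id_hom \<beta>)
    then show ?thesis
      using V by (intro presentation_map.intro presentation_map_axioms.intro pres resp) auto
  qed
  show val: "quot_lift (\<O> V) id (sec N V) (\<beta> V) (pgen V g) = \<beta> V g" if "open V" "V \<subseteq> U" "g \<in> S V" for V g
    using presentation_map.lft_gen[OF map[OF that(1,2)] that(3)] .
  define \<psi> where "\<psi> = (\<lambda>V. quot_lift (\<O> V) id (sec N V) (\<beta> V))"
  have val': "\<psi> V (pgen V g) = \<beta> V g" if "open V" "V \<subseteq> U" "g \<in> S V" for V g
    using val[OF that] by (simp only: \<psi>_def)
  have zero': "\<psi> V \<zero>\<^bsub>sec P V\<^esub> = \<zero>\<^bsub>sec N V\<^esub>" if "open V" "V \<subseteq> U" for V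
    using presentation_map.lft_zero[OF map[OF that]] by (simp only: \<psi>_def sec_P)
  have hom: "\<psi> V \<in> mod_homs (\<O> V) (sec P V) (sec N V)" if V: "open V" "V \<subseteq> U" for V
  proof -
    interpret presentation_map "\<O> V" "S V" "X V" "\<O> V" "sec N V" id "\<beta> V" by (rule map[OF V])
    show ?thesis unfolding mod_homs_def sec_P \<psi>_def using lft_closed lft_add lft_smult by auto
  qed
  have clos: "\<psi> V s \<in> carrier (sec N V)" if "open V" "V \<subseteq> U" "s \<in> carrier (sec P V)" for V s
    using hom[OF that(1,2)] that(3) by (auto simp: mod_homs_def)
  note opN = is_presheaf_op[OF N] and opP = is_presheaf_op[OF presheaf]
  have natural: "\<psi> W (res P V W s) = res N V W (\<psi> V s)"
    if V: "open V" "open W" "W \<subseteq> V" "V \<subseteq> U" and s: "s \<in> carrier (sec P V)" for V W s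
  proof -
    have WU: "W \<subseteq> U" using V by blast
    note homV = hom[OF V(1,4)] and homW = hom[OF V(2) WU]
    show ?thesis using V(1) s
    proof (induction rule: induct)
      case zero
      show ?case
        by (simp only: res_zero[OF presheaf V(1-3)] res_zero[OF N V(1-3)] zero'[OF V(1,4)] zero'[OF V(2) WU])
    next
      case (gen g)
      then show ?case using nat[OF V gen] rho[OF V(1-3) gen] V WU
        by (simp only: res_gen[OF V(1-3) gen] val'[OF V(1,4) gen] val'[OF V(2) WU])
    next
      case (add s t)
      then show ?case using homV homW clos[OF V(1,4)] res_closed[OF opP V(1-3)]
        by (simp add: res_add[OF opP V(1-3)] res_add[OF opN V(1-3)] mod_homs_def)
    next
      case (smult r s)
      then show ?case using homV homW clos[OF V(1,4)] res_closed[OF opP V(1-3)] O_rst[OF V(1-3)]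
        by (simp add: res_smult[OF opP V(1-3)] res_smult[OF opN V(1-3)] mod_homs_def)
    qed
  qed
  have "is_mor \<O> U P N \<psi>"
    unfolding is_mor_def using hom natural by blast
  then show "is_mor \<O> U P N (\<lambda>V. quot_lift (\<O> V) id (sec N V) (\<beta> V))" by (simp only: \<psi>_def)
qed

end

section \<open>Morphisms of presheaves\<close>

context
  fixes \<O> :: "('a::topological_space) ring_sheaf" and U F G \<phi>
  assumes mor: "is_mor \<O> U F G \<phi>"
begin

lemma mor_closed: "open V \<Longrightarrow> V \<subseteq> U \<Longrightarrow> s \<in> carrier (sec F V) \<Longrightarrow> \<phi> V s \<in> carrier (sec G V)"
  using mor by (auto simp: is_mor_def mod_homs_def)

lemma mor_add: "open V \<Longrightarrow> V \<subseteq> U \<Longrightarrow> s \<in> carrier (sec F V) \<Longrightarrow> t \<in> carrier (sec F V) \<Longrightarrow>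
    \<phi> V (s \<oplus>\<^bsub>sec F V\<^esub> t) = \<phi> V s \<oplus>\<^bsub>sec G V\<^esub> \<phi> V t"
  using mor by (auto simp: is_mor_def mod_homs_def)

lemma mor_smult: "open V \<Longrightarrow> V \<subseteq> U \<Longrightarrow> r \<in> carrier (\<O> V) \<Longrightarrow> s \<in> carrier (sec F V) \<Longrightarrow>
    \<phi> V (r \<odot>\<^bsub>sec F V\<^esub> s) = r \<odot>\<^bsub>sec G V\<^esub> \<phi> V s"
  using mor by (auto simp: is_mor_def mod_homs_def)

lemma mor_res: "open V \<Longrightarrow> open W \<Longrightarrow> W \<subseteq> V \<Longrightarrow> V \<subseteq> U \<Longrightarrow> s \<in> carrier (sec F V) \<Longrightarrow>
    \<phi> W (res F V W s) = res G V W (\<phi> V s)"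
  using mor by (simp add: is_mor_def)

lemma mor_hom:
  assumes "is_presheaf \<O> F" "is_presheaf \<O> G" "open V" "V \<subseteq> U"
  shows "abelian_group_hom (sec F V) (sec G V) (\<phi> V)"
proof -
  interpret F: Module.module "\<O> V" "sec F V" using presheaf_module assms by blast
  interpret G: Module.module "\<O> V" "sec G V" using presheaf_module assms by blast
  show ?thesis
    by (rule abelian_group_homI[OF F.M.abelian_group_axioms G.M.abelian_group_axioms])
      (auto intro!: group_hom.intro group_hom_axioms.intro F.M.a_group G.M.a_group homI
        simp: mor_closed[OF assms(3,4)] mor_add[OF assms(3,4)])
qed

lemma mor_zero: "is_presheaf \<O> F \<Longrightarrow> is_presheaf \<O> G \<Longrightarrow> open V \<Longrightarrow> V \<subseteq> U \<Longrightarrow>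
    \<phi> V \<zero>\<^bsub>sec F V\<^esub> = \<zero>\<^bsub>sec G V\<^esub>"
  using abelian_group_hom.hom_zero[OF mor_hom] .

lemma mor_minus:
  assumes "is_presheaf \<O> F" "is_presheaf \<O> G" "open V" "V \<subseteq> U" "s \<in> carrier (sec F V)" "t \<in> carrier (sec F V)"
  shows "\<phi> V (s \<ominus>\<^bsub>sec F V\<^esub> t) = \<phi> V s \<ominus>\<^bsub>sec G V\<^esub> \<phi> V t"
proof -
  interpret abelian_group_hom "sec F V" "sec G V" "\<phi> V" by (rule mor_hom[OF assms(1-4)])
  show ?thesis using assms by (simp add: a_minus_def)
qed

end

lemma is_mor_subset: "is_mor \<O> U F G \<phi> \<Longrightarrow> U' \<subseteq> U \<Longrightarrow> is_mor \<O> U' F G \<phi>"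
  unfolding is_mor_def by (meson order_trans)

section \<open>Tensor products and exterior powers of presheaves\<close>

context function_rings
begin

lemma tensor_presented:
  assumes F: "op_presheaf \<O> F" and G: "op_presheaf \<O> G"
  shows "presented_presheaf \<O> (tensor_presheaf \<O> F G) (\<lambda>U. carrier (sec F U) \<times> carrier (sec G U))
    (\<lambda>U. tensor_relators (\<O> U) (sec F U) (sec G U)) (\<lambda>U V (s, t). (res F U V s, res G U V t))
    (\<lambda>U V (s, t). pure_tensor (\<O> V) (sec F V) (sec G V) (res F U V s) (res G U V t))"
proof (intro presented_presheaf.intro function_rings_axioms presented_presheaf_axioms.intro)
  fix U V x assume UV: "open U" "open V" "V \<subseteq> U"
    and lt: "lin_target (\<O> U) (\<O> V) (sec (tensor_presheaf \<O> F G) V) (rst V) (carrier (sec F U) \<times> carrier (sec G U))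
      (\<lambda>(s, t). pure_tensor (\<O> V) (sec F V) (sec G V) (res F U V s) (res G U V t))"
    and x: "x \<in> tensor_relators (\<O> U) (sec F U) (sec G U)"
  note c = cring_O[OF UV(2)] op_closed_sec[OF F UV(2)] op_closed_sec[OF G UV(2)]
  show "lin_ext (\<O> U) (rst V) (sec (tensor_presheaf \<O> F G) V)
      (\<lambda>(s, t). pure_tensor (\<O> V) (sec F V) (sec G V) (res F U V s) (res G U V t)) x = \<zero>\<^bsub>sec (tensor_presheaf \<O> F G) V\<^esub>"
    by (rule tensor_resp[OF lt op_closed_sec[OF F UV(1)] op_closed_sec[OF G UV(1)] _ _ _ _ x])
      (simp_all add: tensor_presheaf_def res_add[OF F UV] res_add[OF G UV] res_smult[OF F UV]
        res_smult[OF G UV] res_closed[OF F UV] res_closed[OF G UV] pure_tensor_add1[OF c]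
        pure_tensor_add2[OF c] pure_tensor_smult1[OF c] pure_tensor_smult2[OF c] O_rst[OF UV])
qed (auto simp: tensor_presheaf_def tensor_mod_pres pure_tensor_pres tensor_presentation cring_O
    op_closed_sec[OF F] op_closed_sec[OF G] res_closed[OF F] res_closed[OF G] res_id[OF F] res_id[OF G]
    res_comp[OF F] res_comp[OF G])

lemma sec_tensor: "sec (tensor_presheaf \<O> F G) U = tensor_mod (\<O> U) (sec F U) (sec G U)"
  by (simp add: tensor_presheaf_def)

lemma tensor_presheaf: "op_presheaf \<O> F \<Longrightarrow> op_presheaf \<O> G \<Longrightarrow> is_presheaf \<O> (tensor_presheaf \<O> F G)"
  using presented_presheaf.presheaf[OF tensor_presented] .

abbreviation "pten F G U \<equiv> pure_tensor (\<O> U) (sec F U) (sec G U)"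

lemma pten_closed:
  assumes F: "op_presheaf \<O> F" and G: "op_presheaf \<O> G" and U: "open U"
    and "s \<in> carrier (sec F U)" "t \<in> carrier (sec G U)"
  shows "pten F G U s t \<in> carrier (sec (tensor_presheaf \<O> F G) U)"
  unfolding sec_tensor
  by (rule pure_tensor_closed[OF cring_O[OF U] op_closed_sec[OF F U] op_closed_sec[OF G U] assms(4,5)])

lemma res_tensor:
  assumes F: "op_presheaf \<O> F" and G: "op_presheaf \<O> G" and UV: "open U" "open V" "V \<subseteq> U"
    and st: "s \<in> carrier (sec F U)" "t \<in> carrier (sec G U)"
  shows "res (tensor_presheaf \<O> F G) U V (pten F G U s t) = pten F G V (res F U V s) (res G U V t)"
  using presented_presheaf.res_gen[OF tensor_presented[OF F G] UV, of "(s, t)"] st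
  by (simp add: pure_tensor_pres)

lemma tensor_induct [consumes 4, case_names zero pure add smult]:
  assumes F: "op_presheaf \<O> F" and G: "op_presheaf \<O> G" and U: "open U"
    and t: "t \<in> carrier (sec (tensor_presheaf \<O> F G) U)"
    and zero: "T \<zero>\<^bsub>sec (tensor_presheaf \<O> F G) U\<^esub>"
    and pure: "\<And>s t. s \<in> carrier (sec F U) \<Longrightarrow> t \<in> carrier (sec G U) \<Longrightarrow> T (pten F G U s t)"
    and add: "\<And>s t. s \<in> carrier (sec (tensor_presheaf \<O> F G) U) \<Longrightarrow> t \<in> carrier (sec (tensor_presheaf \<O> F G) U) \<Longrightarrow>
      T s \<Longrightarrow> T t \<Longrightarrow> T (s \<oplus>\<^bsub>sec (tensor_presheaf \<O> F G) U\<^esub> t)"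
    and smult: "\<And>r s. r \<in> carrier (\<O> U) \<Longrightarrow> s \<in> carrier (sec (tensor_presheaf \<O> F G) U) \<Longrightarrow> T s \<Longrightarrow>
      T (r \<odot>\<^bsub>sec (tensor_presheaf \<O> F G) U\<^esub> s)"
  shows "T t"
  by (rule presented_presheaf.induct[OF tensor_presented[OF F G] U t, of T])
    (use assms in \<open>auto simp: pure_tensor_pres\<close>)

lemma tensor_lift:
  assumes F: "op_presheaf \<O> F" and G: "op_presheaf \<O> G" and N: "is_presheaf \<O> N" and U: "open U"
    and clos: "\<And>V s t. open V \<Longrightarrow> V \<subseteq> U \<Longrightarrow> s \<in> carrier (sec F V) \<Longrightarrow> t \<in> carrier (sec G V) \<Longrightarrow>
      \<beta> V s t \<in> carrier (sec N V)"
    and add1: "\<And>V s s' t. open V \<Longrightarrow> V \<subseteq> U \<Longrightarrow> s \<in> carrier (sec F V) \<Longrightarrow> s' \<in> carrier (sec F V) \<Longrightarrow>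
      t \<in> carrier (sec G V) \<Longrightarrow> \<beta> V (s \<oplus>\<^bsub>sec F V\<^esub> s') t = \<beta> V s t \<oplus>\<^bsub>sec N V\<^esub> \<beta> V s' t"
    and add2: "\<And>V s t t'. open V \<Longrightarrow> V \<subseteq> U \<Longrightarrow> s \<in> carrier (sec F V) \<Longrightarrow> t \<in> carrier (sec G V) \<Longrightarrow>
      t' \<in> carrier (sec G V) \<Longrightarrow> \<beta> V s (t \<oplus>\<^bsub>sec G V\<^esub> t') = \<beta> V s t \<oplus>\<^bsub>sec N V\<^esub> \<beta> V s t'"
    and smult1: "\<And>V r s t. open V \<Longrightarrow> V \<subseteq> U \<Longrightarrow> r \<in> carrier (\<O> V) \<Longrightarrow> s \<in> carrier (sec F V) \<Longrightarrow>
      t \<in> carrier (sec G V) \<Longrightarrow> \<beta> V (r \<odot>\<^bsub>sec F V\<^esub> s) t = r \<odot>\<^bsub>sec N V\<^esub> \<beta> V s t"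
    and smult2: "\<And>V r s t. open V \<Longrightarrow> V \<subseteq> U \<Longrightarrow> r \<in> carrier (\<O> V) \<Longrightarrow> s \<in> carrier (sec F V) \<Longrightarrow>
      t \<in> carrier (sec G V) \<Longrightarrow> \<beta> V s (r \<odot>\<^bsub>sec G V\<^esub> t) = r \<odot>\<^bsub>sec N V\<^esub> \<beta> V s t"
    and nat: "\<And>V W s t. open V \<Longrightarrow> open W \<Longrightarrow> W \<subseteq> V \<Longrightarrow> V \<subseteq> U \<Longrightarrow> s \<in> carrier (sec F V) \<Longrightarrow>
      t \<in> carrier (sec G V) \<Longrightarrow> res N V W (\<beta> V s t) = \<beta> W (res F V W s) (res G V W t)"
  shows "is_mor \<O> U (tensor_presheaf \<O> F G) N (\<lambda>V. quot_lift (\<O> V) id (sec N V) (\<lambda>(s, t). \<beta> V s t))"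
    and "\<And>V s t. open V \<Longrightarrow> V \<subseteq> U \<Longrightarrow> s \<in> carrier (sec F V) \<Longrightarrow> t \<in> carrier (sec G V) \<Longrightarrow>
      quot_lift (\<O> V) id (sec N V) (\<lambda>(s, t). \<beta> V s t) (pten F G V s t) = \<beta> V s t"
proof -
  note L = presented_presheaf.lift_mor[OF tensor_presented[OF F G] N U, of "\<lambda>V (s, t). \<beta> V s t"]
  have 1: "(case g of (s, t) \<Rightarrow> \<beta> V s t) \<in> carrier (sec N V)"
    if "open V" "V \<subseteq> U" "g \<in> carrier (sec F V) \<times> carrier (sec G V)" for V g
    using that clos by auto
  have 2: "lin_ext (\<O> V) id (sec N V) (\<lambda>(s, t). \<beta> V s t) x = \<zero>\<^bsub>sec N V\<^esub>"
    if V: "open V" "V \<subseteq> U"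
      and lt: "lin_target (\<O> V) (\<O> V) (sec N V) id (carrier (sec F V) \<times> carrier (sec G V)) (\<lambda>(s, t). \<beta> V s t)"
      and x: "x \<in> tensor_relators (\<O> V) (sec F V) (sec G V)" for V x
    by (rule tensor_resp[OF lt op_closed_sec[OF F V(1)] op_closed_sec[OF G V(1)] _ _ _ _ x])
      (simp_all add: add1 add2 smult1 smult2 V)
  have 3: "res N V W (case g of (s, t) \<Rightarrow> \<beta> V s t) =
      (case case g of (s, t) \<Rightarrow> (res F V W s, res G V W t) of (s, t) \<Rightarrow> \<beta> W s t)"
    if "open V" "open W" "W \<subseteq> V" "V \<subseteq> U" "g \<in> carrier (sec F V) \<times> carrier (sec G V)" for V W g
    using that nat by auto
  show "is_mor \<O> U (tensor_presheaf \<O> F G) N (\<lambda>V. quot_lift (\<O> V) id (sec N V) (\<lambda>(s, t). \<beta> V s t))"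
    by (rule L(1)) (assumption | rule 1 2 3)+
  show "quot_lift (\<O> V) id (sec N V) (\<lambda>(s, t). \<beta> V s t) (pten F G V s t) = \<beta> V s t"
    if V: "open V" "V \<subseteq> U" "s \<in> carrier (sec F V)" "t \<in> carrier (sec G V)" for V s t
  proof -
    have "quot_lift (\<O> V) id (sec N V) (\<lambda>(s, t). \<beta> V s t) (pten F G V s t) = (case (s, t) of (s, t) \<Rightarrow> \<beta> V s t)"
      unfolding pure_tensor_pres by (rule L(2)) (assumption | rule V 1 2 3 SigmaI)+
    then show ?thesis by simp
  qed
qed

lemma ext_presented:
  assumes F: "op_presheaf \<O> F"
  shows "presented_presheaf \<O> (ext_presheaf \<O> k F) (\<lambda>U. ext_gens k (sec F U))
    (\<lambda>U. ext_relators (\<O> U) k (sec F U)) (\<lambda>U V. map (res F U V))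
    (\<lambda>U V xs. pure_wedge (\<O> V) (sec F V) (map (res F U V) xs))"
proof (intro presented_presheaf.intro function_rings_axioms presented_presheaf_axioms.intro)
  fix U V x assume UV: "open U" "open V" "V \<subseteq> U"
    and lt: "lin_target (\<O> U) (\<O> V) (sec (ext_presheaf \<O> k F) V) (rst V) (ext_gens k (sec F U))
      (\<lambda>xs. pure_wedge (\<O> V) (sec F V) (map (res F U V) xs))"
    and x: "x \<in> ext_relators (\<O> U) k (sec F U)"
  note c = cring_O[OF UV(2)] op_closed_sec[OF F UV(2)]
  have m: "map (res F U V) xs \<in> ext_gens k (sec F V)" if "xs \<in> ext_gens k (sec F U)" for xs
    using that res_closed[OF F UV] by (auto simp: ext_gens_def)
  show "lin_ext (\<O> U) (rst V) (sec (ext_presheaf \<O> k F) V)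
      (\<lambda>xs. pure_wedge (\<O> V) (sec F V) (map (res F U V) xs)) x = \<zero>\<^bsub>sec (ext_presheaf \<O> k F) V\<^esub>"
  proof (rule ext_resp[OF lt op_closed_sec[OF F UV(1)] _ _ _ x])
    fix xs s ys assume s: "xs @ s # ys \<in> ext_gens k (sec F U)"
    note ms = m[OF s, simplified] and se = ext_gens_elem[OF s]
    fix t assume t: "t \<in> carrier (sec F U)"
    show "pure_wedge (\<O> V) (sec F V) (map (res F U V) (xs @ (s \<oplus>\<^bsub>sec F U\<^esub> t) # ys)) =
       pure_wedge (\<O> V) (sec F V) (map (res F U V) (xs @ s # ys)) \<oplus>\<^bsub>sec (ext_presheaf \<O> k F) V\<^esub>
       pure_wedge (\<O> V) (sec F V) (map (res F U V) (xs @ t # ys))"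
      using pure_wedge_add[OF c ms res_closed[OF F UV t]]
      by (simp add: res_add[OF F UV se t] ext_presheaf_def)
  next
    fix xs s ys r assume s: "xs @ s # ys \<in> ext_gens k (sec F U)" and r: "r \<in> carrier (\<O> U)"
    note ms = m[OF s, simplified] and se = ext_gens_elem[OF s]
    show "pure_wedge (\<O> V) (sec F V) (map (res F U V) (xs @ (r \<odot>\<^bsub>sec F U\<^esub> s) # ys)) =
       rst V r \<odot>\<^bsub>sec (ext_presheaf \<O> k F) V\<^esub> pure_wedge (\<O> V) (sec F V) (map (res F U V) (xs @ s # ys))"
      using pure_wedge_smult[OF c ms O_rst[OF UV r]]
      by (simp add: res_smult[OF F UV r se] ext_presheaf_def)
  next
    fix xs assume xs: "xs \<in> ext_gens k (sec F U)" "\<not> distinct xs"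
    then show "pure_wedge (\<O> V) (sec F V) (map (res F U V) xs) = \<zero>\<^bsub>sec (ext_presheaf \<O> k F) V\<^esub>"
      using pure_wedge_alt[OF c m[OF xs(1)]] by (simp add: ext_presheaf_def distinct_map)
  qed
next
  fix U V xs assume UV: "open U" "open V" "V \<subseteq> U" and xs: "xs \<in> ext_gens k (sec F U)"
  then show "map (res F U V) xs \<in> ext_gens k (sec F V)"
    using res_closed[OF F UV] by (auto simp: ext_gens_def)
  show "pure_wedge (\<O> V) (sec F V) (map (res F U V) xs) =
    pres_gen (\<O> V) (ext_gens k (sec F V)) (ext_relators (\<O> V) k (sec F V)) (map (res F U V) xs)"
    using xs by (simp add: pure_wedge_pres ext_gens_def)
next
  fix U xs assume "open U" "xs \<in> ext_gens k (sec F U)"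
  then show "map (res F U U) xs = xs" using res_id[OF F] by (auto simp: ext_gens_def intro: map_idI)
next
  fix U V W xs assume "open U" "open V" "open W" "W \<subseteq> V" "V \<subseteq> U" "xs \<in> ext_gens k (sec F U)"
  then show "map (res F V W) (map (res F U V) xs) = map (res F U W) xs"
    using res_comp[OF F] by (auto simp: ext_gens_def)
qed (auto simp: ext_presheaf_def ext_pow_pres ext_presentation cring_O op_closed_sec[OF F])

lemma sec_ext: "sec (ext_presheaf \<O> k F) U = ext_pow (\<O> U) k (sec F U)"
  by (simp add: ext_presheaf_def)

lemma ext_presheaf: "op_presheaf \<O> F \<Longrightarrow> is_presheaf \<O> (ext_presheaf \<O> k F)"
  using presented_presheaf.presheaf[OF ext_presented] .

lemma res_pure_wedge:
  assumes F: "op_presheaf \<O> F" and UV: "open U" "open V" "V \<subseteq> U" and xs: "xs \<in> ext_gens k (sec F U)"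
  shows "res (ext_presheaf \<O> k F) U V (pure_wedge (\<O> U) (sec F U) xs) =
    pure_wedge (\<O> V) (sec F V) (map (res F U V) xs)"
  using presented_presheaf.res_gen[OF ext_presented[OF F] UV xs] xs
  by (simp add: pure_wedge_pres ext_gens_def)

lemma ext_lift:
  assumes F: "op_presheaf \<O> F" and N: "is_presheaf \<O> N" and U: "open U"
    and clos: "\<And>V xs. open V \<Longrightarrow> V \<subseteq> U \<Longrightarrow> xs \<in> ext_gens k (sec F V) \<Longrightarrow> \<beta> V xs \<in> carrier (sec N V)"
    and add: "\<And>V xs s t ys. open V \<Longrightarrow> V \<subseteq> U \<Longrightarrow> xs @ s # ys \<in> ext_gens k (sec F V) \<Longrightarrow> t \<in> carrier (sec F V) \<Longrightarrow>
      \<beta> V (xs @ (s \<oplus>\<^bsub>sec F V\<^esub> t) # ys) = \<beta> V (xs @ s # ys) \<oplus>\<^bsub>sec N V\<^esub> \<beta> V (xs @ t # ys)"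
    and smult: "\<And>V xs r s ys. open V \<Longrightarrow> V \<subseteq> U \<Longrightarrow> xs @ s # ys \<in> ext_gens k (sec F V) \<Longrightarrow> r \<in> carrier (\<O> V) \<Longrightarrow>
      \<beta> V (xs @ (r \<odot>\<^bsub>sec F V\<^esub> s) # ys) = r \<odot>\<^bsub>sec N V\<^esub> \<beta> V (xs @ s # ys)"
    and alt: "\<And>V xs. open V \<Longrightarrow> V \<subseteq> U \<Longrightarrow> xs \<in> ext_gens k (sec F V) \<Longrightarrow> \<not> distinct xs \<Longrightarrow> \<beta> V xs = \<zero>\<^bsub>sec N V\<^esub>"
    and nat: "\<And>V W xs. open V \<Longrightarrow> open W \<Longrightarrow> W \<subseteq> V \<Longrightarrow> V \<subseteq> U \<Longrightarrow> xs \<in> ext_gens k (sec F V) \<Longrightarrow>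
      res N V W (\<beta> V xs) = \<beta> W (map (res F V W) xs)"
  shows "is_mor \<O> U (ext_presheaf \<O> k F) N (\<lambda>V. quot_lift (\<O> V) id (sec N V) (\<beta> V))"
    and "\<And>V xs. open V \<Longrightarrow> V \<subseteq> U \<Longrightarrow> xs \<in> ext_gens k (sec F V) \<Longrightarrow>
      quot_lift (\<O> V) id (sec N V) (\<beta> V) (pure_wedge (\<O> V) (sec F V) xs) = \<beta> V xs"
proof -
  note L = presented_presheaf.lift_mor[OF ext_presented[OF F, of k] N U, of \<beta>]
  have 2: "lin_ext (\<O> V) id (sec N V) (\<beta> V) x = \<zero>\<^bsub>sec N V\<^esub>"
    if V: "open V" "V \<subseteq> U"
      and lt: "lin_target (\<O> V) (\<O> V) (sec N V) id (ext_gens k (sec F V)) (\<beta> V)"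
      and x: "x \<in> ext_relators (\<O> V) k (sec F V)" for V x
    by (rule ext_resp[OF lt op_closed_sec[OF F V(1)] _ _ _ x])
      (simp_all add: add smult alt V)
  show "is_mor \<O> U (ext_presheaf \<O> k F) N (\<lambda>V. quot_lift (\<O> V) id (sec N V) (\<beta> V))"
    by (rule L(1)) (assumption | rule clos 2 nat)+
  show "quot_lift (\<O> V) id (sec N V) (\<beta> V) (pure_wedge (\<O> V) (sec F V) xs) = \<beta> V xs"
    if V: "open V" "V \<subseteq> U" "xs \<in> ext_gens k (sec F V)" for V xs
  proof -
    have "length xs = k" using V by (simp add: ext_gens_def)
    then have eq: "pure_wedge (\<O> V) (sec F V) xs =
        pres_gen (\<O> V) (ext_gens k (sec F V)) (ext_relators (\<O> V) k (sec F V)) xs"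
      by (simp add: pure_wedge_pres)
    show ?thesis unfolding eq by (rule L(2)) (assumption | rule V clos 2 nat)+
  qed
qed

end

section \<open>Germs\<close>

lemma germ_memI:
  "open V \<Longrightarrow> t \<in> carrier (sec P V) \<Longrightarrow> open W \<Longrightarrow> x \<in> W \<Longrightarrow> W \<subseteq> U \<inter> V \<Longrightarrow>
    res P U W s = res P V W t \<Longrightarrow> (V, t) \<in> germ P x U s"
  unfolding germ_def by auto

context
  fixes \<O> :: "('a::topological_space) ring_sheaf" and P :: "('a, 's) mod_presheaf"
  assumes P: "is_presheaf \<O> P"
begin

lemma germ_eqI:
  assumes U: "open U" "s \<in> carrier (sec P U)" and V: "open V" "t \<in> carrier (sec P V)"
    and W: "open W" "x \<in> W" "W \<subseteq> U \<inter> V" and eq: "res P U W s = res P V W t"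
  shows "germ P x U s = germ P x V t"
proof -
  note op = is_presheaf_op[OF P]
  have sub: "germ P x U s \<subseteq> germ P x V t"
    if U: "open U" "s \<in> carrier (sec P U)" and V: "open V" "t \<in> carrier (sec P V)"
      and W: "open W" "x \<in> W" "W \<subseteq> U \<inter> V" and eq: "res P U W s = res P V W t" for U s V t
  proof
    fix p assume p: "p \<in> germ P x U s"
    then obtain V' t' W' where p': "p = (V', t')" "open V'" "x \<in> V'" "t' \<in> carrier (sec P V')"
      and W': "open W'" "x \<in> W'" "W' \<subseteq> U \<inter> V'" "res P U W' s = res P V' W' t'"
      unfolding germ_def by auto
    have o: "open (W \<inter> W')" using W W' by auto
    have "res P V (W \<inter> W') t = res P W (W \<inter> W') (res P V W t)"
      using W V o by (simp add: res_comp[OF op])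
    also have "\<dots> = res P U (W \<inter> W') s" using W U o by (simp add: eq[symmetric] res_comp[OF op])
    also have "\<dots> = res P W' (W \<inter> W') (res P U W' s)"
      by (rule res_comp[OF op U(1) W'(1) o _ _ U(2), symmetric]) (use W' in auto)
    also have "\<dots> = res P V' (W \<inter> W') t'" using W' p' o by (simp add: res_comp[OF op])
    finally show "p \<in> germ P x V t"
      unfolding p'(1) by (intro germ_memI[OF p'(2,4) o]) (use W W' in auto)
  qed
  show ?thesis
    using sub[OF U V W eq] sub[OF V U W(1,2) _ eq[symmetric]] W(3) by blast
qed

lemma germ_self: "open U \<Longrightarrow> s \<in> carrier (sec P U) \<Longrightarrow> x \<in> U \<Longrightarrow> (U, s) \<in> germ P x U s"
  by (rule germ_memI[of _ _ _ U]) auto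

lemma germ_memD:
  assumes "(V, t) \<in> germ P x U s"
  obtains W where "open V" "x \<in> V" "t \<in> carrier (sec P V)" "open W" "x \<in> W" "W \<subseteq> U" "W \<subseteq> V"
    "res P U W s = res P V W t"
  using assms unfolding germ_def by auto

lemma germ_eqD:
  assumes "germ P x U s = germ P x V t" "open V" "t \<in> carrier (sec P V)" "x \<in> V"
  obtains W where "open W" "x \<in> W" "W \<subseteq> U" "W \<subseteq> V" "res P U W s = res P V W t"
  using germ_memD[of V t x U s] germ_self[OF assms(2-4)] assms(1) by metis

lemma germ_res: "open U \<Longrightarrow> s \<in> carrier (sec P U) \<Longrightarrow> open V \<Longrightarrow> V \<subseteq> U \<Longrightarrow> x \<in> V \<Longrightarrow>
    germ P x V (res P U V s) = germ P x U s"
  by (rule germ_eqI[of _ _ _ _ V])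
    (auto simp: res_closed[OF is_presheaf_op[OF P]] res_comp[OF is_presheaf_op[OF P]])

section \<open>Sections of the sheafification\<close>

lemma sh_carrier: "f \<in> carrier (sec (sheafify P) U) \<longleftrightarrow> f \<in> extensional U \<and>
    (\<forall>x\<in>U. \<exists>V t. open V \<and> x \<in> V \<and> V \<subseteq> U \<and> t \<in> carrier (sec P V) \<and> (\<forall>y\<in>V. f y = germ P y V t))"
  by (simp add: sheafify_def)

lemma sh_eqI: "f \<in> carrier (sec (sheafify P) U) \<Longrightarrow> g \<in> carrier (sec (sheafify P) U) \<Longrightarrow>
    (\<And>x. x \<in> U \<Longrightarrow> f x = g x) \<Longrightarrow> f = g"
  by (rule extensionalityI[where A = U]) (simp_all add: sh_carrier)

lemma sh_rep:
  assumes "f \<in> carrier (sec (sheafify P) U)" "x \<in> U"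
  obtains V t where "open V" "x \<in> V" "V \<subseteq> U" "t \<in> carrier (sec P V)" "\<And>y. y \<in> V \<Longrightarrow> f y = germ P y V t"
  using assms(1)[unfolded sh_carrier, THEN conjunct2, rule_format, OF assms(2)]
  by (elim exE conjE) (rule that, assumption+, drule bspec, assumption+)

lemma rep_shrink:
  assumes "open V" "t \<in> carrier (sec P V)" "\<And>y. y \<in> V \<Longrightarrow> f y = germ P y V t" "open W" "W \<subseteq> V"
  shows "res P V W t \<in> carrier (sec P W)" "\<And>y. y \<in> W \<Longrightarrow> f y = germ P y W (res P V W t)"
  using assms germ_res by (auto intro: res_closed[OF is_presheaf_op[OF P]] simp: subset_iff)

lemma sh_rep2:
  assumes "f \<in> carrier (sec (sheafify P) U)" "g \<in> carrier (sec (sheafify P) U)" "x \<in> U"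
  obtains V s t where "open V" "x \<in> V" "V \<subseteq> U" "s \<in> carrier (sec P V)" "\<And>y. y \<in> V \<Longrightarrow> f y = germ P y V s"
    "t \<in> carrier (sec P V)" "\<And>y. y \<in> V \<Longrightarrow> g y = germ P y V t"
proof -
  obtain V s where V: "open V" "x \<in> V" "V \<subseteq> U" "s \<in> carrier (sec P V)" "\<And>y. y \<in> V \<Longrightarrow> f y = germ P y V s"
    using sh_rep[OF assms(1,3)] by metis
  obtain W t where W: "open W" "x \<in> W" "W \<subseteq> U" "t \<in> carrier (sec P W)" "\<And>y. y \<in> W \<Longrightarrow> g y = germ P y W t"
    using sh_rep[OF assms(2,3)] by metis
  have o: "open (V \<inter> W)" using V W by auto
  show ?thesis
    by (rule that[of "V \<inter> W" "res P V (V \<inter> W) s" "res P W (V \<inter> W) t"])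
      (use V W o rep_shrink[OF V(1,4,5) o] rep_shrink[OF W(1,4,5) o] in auto)
qed

lemma sh_rep3:
  assumes "f \<in> carrier (sec (sheafify P) U)" "g \<in> carrier (sec (sheafify P) U)" "h \<in> carrier (sec (sheafify P) U)" "x \<in> U"
  obtains V s t r where "open V" "x \<in> V" "V \<subseteq> U" "s \<in> carrier (sec P V)" "\<And>y. y \<in> V \<Longrightarrow> f y = germ P y V s"
    "t \<in> carrier (sec P V)" "\<And>y. y \<in> V \<Longrightarrow> g y = germ P y V t"
    "r \<in> carrier (sec P V)" "\<And>y. y \<in> V \<Longrightarrow> h y = germ P y V r"
proof -
  obtain V s t where V: "open V" "x \<in> V" "V \<subseteq> U" "s \<in> carrier (sec P V)" "\<And>y. y \<in> V \<Longrightarrow> f y = germ P y V s"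
    "t \<in> carrier (sec P V)" "\<And>y. y \<in> V \<Longrightarrow> g y = germ P y V t"
    using sh_rep2[OF assms(1,2,4)] by metis
  obtain W r where W: "open W" "x \<in> W" "W \<subseteq> U" "r \<in> carrier (sec P W)" "\<And>y. y \<in> W \<Longrightarrow> h y = germ P y W r"
    using sh_rep[OF assms(3,4)] by metis
  have o: "open (V \<inter> W)" using V W by auto
  show ?thesis
    by (rule that[of "V \<inter> W" "res P V (V \<inter> W) s" "res P V (V \<inter> W) t" "res P W (V \<inter> W) r"])
      (use V W o rep_shrink[OF V(1,4,5) o] rep_shrink[OF V(1,6,7) o] rep_shrink[OF W(1,4,5) o] in auto)
qed

text \<open>The sum in the sheafification is a union over all representatives of the two germs.
  Every representative contributes the same germ, so the union may be read off from one pair of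
  representatives over a common open set; \<open>smult_at\<close> and \<open>sh_map_at\<close> rest
  on the same observation.\<close>

lemma add_at:
  assumes V: "open V" "x \<in> V" "s \<in> carrier (sec P V)" "t \<in> carrier (sec P V)"
    and f: "f x = germ P x V s" and g: "g x = germ P x V t" and x: "x \<in> U"
  shows "(f \<oplus>\<^bsub>sec (sheafify P) U\<^esub> g) x = germ P x V (s \<oplus>\<^bsub>sec P V\<^esub> t)"
proof -
  note op = is_presheaf_op[OF P]
  have *: "germ P x (V' \<inter> W') (res P V' (V' \<inter> W') s' \<oplus>\<^bsub>sec P (V' \<inter> W')\<^esub> res P W' (V' \<inter> W') t')
      = germ P x V (s \<oplus>\<^bsub>sec P V\<^esub> t)" if a: "(V', s') \<in> germ P x V s" "(W', t') \<in> germ P x V t" for V' s' W' t'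
  proof -
    obtain A where A: "open V'" "x \<in> V'" "s' \<in> carrier (sec P V')" "open A" "x \<in> A" "A \<subseteq> V" "A \<subseteq> V'"
      "res P V A s = res P V' A s'" using germ_memD[OF a(1)] by metis
    obtain B where B: "open W'" "x \<in> W'" "t' \<in> carrier (sec P W')" "open B" "x \<in> B" "B \<subseteq> V" "B \<subseteq> W'"
      "res P V B t = res P W' B t'" using germ_memD[OF a(2)] by metis
    let ?C = "A \<inter> B"
    have C: "open ?C" "?C \<subseteq> A" "?C \<subseteq> B" "?C \<subseteq> V" "?C \<subseteq> V'" "?C \<subseteq> W'" "?C \<subseteq> V' \<inter> W'" using A B by auto
    have VW: "open (V' \<inter> W')" using A B by auto
    have 1: "res P V ?C s = res P V' ?C s'"
      using A C V by (metis res_comp[OF op])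
    have 2: "res P V ?C t = res P W' ?C t'"
      using B C V by (metis res_comp[OF op])
    have "res P (V' \<inter> W') ?C (res P V' (V' \<inter> W') s' \<oplus>\<^bsub>sec P (V' \<inter> W')\<^esub> res P W' (V' \<inter> W') t') =
        res P V' ?C s' \<oplus>\<^bsub>sec P ?C\<^esub> res P W' ?C t'"
      using A B C VW by (simp add: res_add[OF op] res_closed[OF op] res_comp[OF op])
    also have "\<dots> = res P V ?C (s \<oplus>\<^bsub>sec P V\<^esub> t)"
      using V C by (simp add: res_add[OF op] 1 2)
    finally show ?thesis
      using A B C VW V by (intro germ_eqI[of _ _ _ _ ?C]) (auto intro!: op_add[OF op] res_closed[OF op])
  qed
  have "(f \<oplus>\<^bsub>sec (sheafify P) U\<^esub> g) x = (\<Union>(V', s')\<in>germ P x V s. \<Union>(W', t')\<in>germ P x V t.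
      germ P x (V' \<inter> W') (res P V' (V' \<inter> W') s' \<oplus>\<^bsub>sec P (V' \<inter> W')\<^esub> res P W' (V' \<inter> W') t'))"
    using x by (simp add: sheafify_def f g)
  also have "\<dots> = (\<Union>p\<in>germ P x V s. \<Union>q\<in>germ P x V t. germ P x V (s \<oplus>\<^bsub>sec P V\<^esub> t))"
    using * by (intro SUP_cong refl) (auto split: prod.split)
  also have "\<dots> = germ P x V (s \<oplus>\<^bsub>sec P V\<^esub> t)"
    using germ_self[OF V(1,3,2)] germ_self[OF V(1,4,2)] by blast
  finally show ?thesis .
qed

lemma zero_at:
  assumes "open U" "open V" "V \<subseteq> U" "x \<in> V"
  shows "\<zero>\<^bsub>sec (sheafify P) U\<^esub> x = germ P x V \<zero>\<^bsub>sec P V\<^esub>"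
proof -
  interpret U: Module.module "\<O> U" "sec P U" using presheaf_module[OF P assms(1)] .
  show ?thesis using germ_res[OF assms(1) U.M.zero_closed assms(2-4)] assms
    by (auto simp: sheafify_def res_zero[OF P])
qed

end

context function_rings
begin

context
  fixes P :: "('a, 's) mod_presheaf"
  assumes P: "is_presheaf \<O> P"
begin

lemma smult_at:
  assumes U: "open U" "r \<in> carrier (\<O> U)" and V: "open V" "x \<in> V" "V \<subseteq> U" "s \<in> carrier (sec P V)"
    and f: "f x = germ P x V s"
  shows "(r \<odot>\<^bsub>sec (sheafify P) U\<^esub> f) x = germ P x V (rst V r \<odot>\<^bsub>sec P V\<^esub> s)"
proof -
  note op = is_presheaf_op[OF P]
  have *: "germ P x (U \<inter> V') (rst (U \<inter> V') r \<odot>\<^bsub>sec P (U \<inter> V')\<^esub> res P V' (U \<inter> V') s')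
      = germ P x V (rst V r \<odot>\<^bsub>sec P V\<^esub> s)" if a: "(V', s') \<in> germ P x V s" for V' s'
  proof -
    obtain A where A: "open V'" "x \<in> V'" "s' \<in> carrier (sec P V')" "open A" "x \<in> A" "A \<subseteq> V" "A \<subseteq> V'"
      "res P V A s = res P V' A s'" using germ_memD[OF P a(1)] by metis
    have C: "A \<subseteq> U" "A \<subseteq> U \<inter> V'" "open (U \<inter> V')" "U \<inter> V' \<subseteq> U" using A V U by auto
    have "res P (U \<inter> V') A (rst (U \<inter> V') r \<odot>\<^bsub>sec P (U \<inter> V')\<^esub> res P V' (U \<inter> V') s') =
        rst A r \<odot>\<^bsub>sec P A\<^esub> res P V' A s'"
      using A C U by (simp add: res_smult[OF op] res_closed[OF op] res_comp[OF op] O_rst rst_rst[OF C(2)])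
    also have "\<dots> = res P V A (rst V r \<odot>\<^bsub>sec P V\<^esub> s)"
      using V A U by (simp add: res_smult[OF op] O_rst rst_rst)
    finally show ?thesis
      using A C V U by (intro germ_eqI[OF P, of _ _ _ _ A]) (auto intro!: op_smult[OF op] res_closed[OF op] O_rst[of U])
  qed
  have x: "x \<in> U" using V by auto
  have "(r \<odot>\<^bsub>sec (sheafify P) U\<^esub> f) x = (\<Union>(V', s')\<in>germ P x V s.
      germ P x (U \<inter> V') (rst (U \<inter> V') r \<odot>\<^bsub>sec P (U \<inter> V')\<^esub> res P V' (U \<inter> V') s'))"
    using x by (simp add: sheafify_def f)
  also have "\<dots> = (\<Union>p\<in>germ P x V s. germ P x V (rst V r \<odot>\<^bsub>sec P V\<^esub> s))"
    using * by (intro SUP_cong refl) (auto split: prod.split)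
  also have "\<dots> = germ P x V (rst V r \<odot>\<^bsub>sec P V\<^esub> s)"
    using germ_self[OF P V(1,4,2)] by blast
  finally show ?thesis .
qed

lemma sh_ext_add: "f \<oplus>\<^bsub>sec (sheafify P) U\<^esub> g \<in> extensional U"
  and sh_ext_smult: "r \<odot>\<^bsub>sec (sheafify P) U\<^esub> f \<in> extensional U"
  and sh_ext_zero: "\<zero>\<^bsub>sec (sheafify P) U\<^esub> \<in> extensional U"
  by (simp_all add: sheafify_def)

lemma sh_add_closed:
  assumes U: "open U" and f: "f \<in> carrier (sec (sheafify P) U)" and g: "g \<in> carrier (sec (sheafify P) U)"
  shows "f \<oplus>\<^bsub>sec (sheafify P) U\<^esub> g \<in> carrier (sec (sheafify P) U)"
  unfolding sh_carrier[OF P]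
proof (intro conjI ballI sh_ext_add)
  fix x assume "x \<in> U"
  from sh_rep2[OF P f g this] obtain V s t where V: "open V" "x \<in> V" "V \<subseteq> U" "s \<in> carrier (sec P V)" "\<And>y. y \<in> V \<Longrightarrow> f y = germ P y V s"
    "t \<in> carrier (sec P V)" "\<And>y. y \<in> V \<Longrightarrow> g y = germ P y V t" by metis
  have "\<forall>y\<in>V. (f \<oplus>\<^bsub>sec (sheafify P) U\<^esub> g) y = germ P y V (s \<oplus>\<^bsub>sec P V\<^esub> t)"
    using add_at[where f=f and g=g, OF P V(1) _ V(4,6) V(5) V(7)] V(3) by blast
  then show "\<exists>V t. open V \<and> x \<in> V \<and> V \<subseteq> U \<and> t \<in> carrier (sec P V) \<and>
      (\<forall>y\<in>V. (f \<oplus>\<^bsub>sec (sheafify P) U\<^esub> g) y = germ P y V t)"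
    using V op_add[OF is_presheaf_op[OF P] V(1,4,6)] by blast
qed

lemma sh_smult_closed:
  assumes U: "open U" and r: "r \<in> carrier (\<O> U)" and f: "f \<in> carrier (sec (sheafify P) U)"
  shows "r \<odot>\<^bsub>sec (sheafify P) U\<^esub> f \<in> carrier (sec (sheafify P) U)"
  unfolding sh_carrier[OF P]
proof (intro conjI ballI sh_ext_smult)
  fix x assume "x \<in> U"
  from sh_rep[OF P f this] obtain V s where V: "open V" "x \<in> V" "V \<subseteq> U" "s \<in> carrier (sec P V)" "\<And>y. y \<in> V \<Longrightarrow> f y = germ P y V s"
    by metis
  have "\<forall>y\<in>V. (r \<odot>\<^bsub>sec (sheafify P) U\<^esub> f) y = germ P y V (rst V r \<odot>\<^bsub>sec P V\<^esub> s)"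
    using smult_at[where f=f, OF U r V(1) _ V(3,4) V(5)] by blast
  then show "\<exists>V t. open V \<and> x \<in> V \<and> V \<subseteq> U \<and> t \<in> carrier (sec P V) \<and>
      (\<forall>y\<in>V. (r \<odot>\<^bsub>sec (sheafify P) U\<^esub> f) y = germ P y V t)"
    using V op_smult[OF is_presheaf_op[OF P] V(1) O_rst[OF U V(1,3) r] V(4)] by blast
qed

lemma sh_zero_closed:
  assumes U: "open U"
  shows "\<zero>\<^bsub>sec (sheafify P) U\<^esub> \<in> carrier (sec (sheafify P) U)"
proof -
  interpret U: Module.module "\<O> U" "sec P U" using presheaf_module[OF P U] .
  show ?thesis unfolding sh_carrier[OF P] using U zero_at[OF P U U] sh_ext_zero[of U]
    by (blast intro: U.M.zero_closed)
qed

text \<open>Each module axiom is checked pointwise, where by \<open>add_at\<close> and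
  \<open>smult_at\<close> it becomes the same axiom for sections of \<open>P\<close> on a small open
  set.\<close>

lemma sheafify_module:
  assumes U: "open U"
  shows "Module.module (\<O> U) (sec (sheafify P) U)"
proof (rule moduleI)
  note op = is_presheaf_op[OF P]
  have m: "Module.module (\<O> V) (sec P V)" if "open V" for V using presheaf_module[OF P that] .
  show "cring (\<O> U)" by (rule cring_O[OF U])
  show "abelian_group (sec (sheafify P) U)"
  proof (rule abelian_groupI)
    fix f g assume f: "f \<in> carrier (sec (sheafify P) U)" and g: "g \<in> carrier (sec (sheafify P) U)"
    show "f \<oplus>\<^bsub>sec (sheafify P) U\<^esub> g = g \<oplus>\<^bsub>sec (sheafify P) U\<^esub> f"
    proof (rule sh_eqI[OF P])
      fix x assume x: "x \<in> U"
      from sh_rep2[OF P f g x] obtain V s t where V: "open V" "x \<in> V" "V \<subseteq> U" "s \<in> carrier (sec P V)" "\<And>y. y \<in> V \<Longrightarrow> f y = germ P y V s"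
        "t \<in> carrier (sec P V)" "\<And>y. y \<in> V \<Longrightarrow> g y = germ P y V t" by metis
      interpret V: Module.module "\<O> V" "sec P V" using m V by blast
      show "(f \<oplus>\<^bsub>sec (sheafify P) U\<^esub> g) x = (g \<oplus>\<^bsub>sec (sheafify P) U\<^esub> f) x"
        by (simp only: add_at[where f=f and g=g, OF P V(1,2,4,6) V(5)[OF V(2)] V(7)[OF V(2)] x]
          add_at[where f=g and g=f, OF P V(1,2,6,4) V(7)[OF V(2)] V(5)[OF V(2)] x] V.M.a_comm[OF V(4,6)])
    qed (use f g in \<open>auto intro: sh_add_closed[OF U]\<close>)
    fix h assume h: "h \<in> carrier (sec (sheafify P) U)"
    show "f \<oplus>\<^bsub>sec (sheafify P) U\<^esub> g \<oplus>\<^bsub>sec (sheafify P) U\<^esub> h = f \<oplus>\<^bsub>sec (sheafify P) U\<^esub> (g \<oplus>\<^bsub>sec (sheafify P) U\<^esub> h)"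
    proof (rule sh_eqI[OF P])
      fix x assume x: "x \<in> U"
      from sh_rep3[OF P f g h x] obtain V s t r where V: "open V" "x \<in> V" "V \<subseteq> U" "s \<in> carrier (sec P V)" "\<And>y. y \<in> V \<Longrightarrow> f y = germ P y V s"
        "t \<in> carrier (sec P V)" "\<And>y. y \<in> V \<Longrightarrow> g y = germ P y V t"
        "r \<in> carrier (sec P V)" "\<And>y. y \<in> V \<Longrightarrow> h y = germ P y V r" by metis
      interpret V: Module.module "\<O> V" "sec P V" using m V by blast
      note e = V(5)[OF V(2)] V(7)[OF V(2)] V(9)[OF V(2)]
      note st = add_at[where f=f and g=g, OF P V(1,2,4,6) e(1,2) x] and tr = add_at[where f=g and g=h, OF P V(1,2,6,8) e(2,3) x]
      show "(f \<oplus>\<^bsub>sec (sheafify P) U\<^esub> g \<oplus>\<^bsub>sec (sheafify P) U\<^esub> h) x = (f \<oplus>\<^bsub>sec (sheafify P) U\<^esub> (g \<oplus>\<^bsub>sec (sheafify P) U\<^esub> h)) x"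
        by (simp only: add_at[where f="f \<oplus>\<^bsub>sec (sheafify P) U\<^esub> g" and g=h, OF P V(1,2) V.M.a_closed[OF V(4,6)] V(8) st e(3) x]
          add_at[where f=f and g="g \<oplus>\<^bsub>sec (sheafify P) U\<^esub> h", OF P V(1,2,4) V.M.a_closed[OF V(6,8)] e(1) tr x] V.M.a_assoc[OF V(4,6,8)])
    qed (use f g h in \<open>auto intro!: sh_add_closed[OF U]\<close>)
  next
    fix f assume f: "f \<in> carrier (sec (sheafify P) U)"
    show "\<zero>\<^bsub>sec (sheafify P) U\<^esub> \<oplus>\<^bsub>sec (sheafify P) U\<^esub> f = f"
    proof (rule sh_eqI[OF P])
      fix x assume x: "x \<in> U"
      from sh_rep[OF P f x] obtain V s where V: "open V" "x \<in> V" "V \<subseteq> U" "s \<in> carrier (sec P V)" "\<And>y. y \<in> V \<Longrightarrow> f y = germ P y V s" by metis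
      interpret V: Module.module "\<O> V" "sec P V" using m V by blast
      show "(\<zero>\<^bsub>sec (sheafify P) U\<^esub> \<oplus>\<^bsub>sec (sheafify P) U\<^esub> f) x = f x"
        using add_at[where f="\<zero>\<^bsub>sec (sheafify P) U\<^esub>" and g=f, OF P V(1,2) V.M.zero_closed V(4) zero_at[OF P U V(1,3,2)] V(5)[OF V(2)] x] V by simp
    qed (use f in \<open>auto intro!: sh_add_closed[OF U] sh_zero_closed[OF U]\<close>)
    let ?r = "\<lambda>x. if x \<in> U then - 1 else 0 :: complex"
    have r: "?r \<in> carrier (\<O> U)" by (rule O_const[OF U])
    have "?r \<odot>\<^bsub>sec (sheafify P) U\<^esub> f \<oplus>\<^bsub>sec (sheafify P) U\<^esub> f = \<zero>\<^bsub>sec (sheafify P) U\<^esub>"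
    proof (rule sh_eqI[OF P])
      fix x assume x: "x \<in> U"
      from sh_rep[OF P f x] obtain V s where V: "open V" "x \<in> V" "V \<subseteq> U" "s \<in> carrier (sec P V)" "\<And>y. y \<in> V \<Longrightarrow> f y = germ P y V s" by metis
      interpret V: Module.module "\<O> V" "sec P V" using m V by blast
      have rV: "rst V ?r \<in> carrier (\<O> V)" by (rule O_rst[OF U V(1,3) r])
      have "rst V ?r \<oplus>\<^bsub>\<O> V\<^esub> \<one>\<^bsub>\<O> V\<^esub> = \<zero>\<^bsub>\<O> V\<^esub>"
        using V(3) by (auto simp: O_add O_one O_zero rst_def fun_eq_iff)
      then have z: "rst V ?r \<odot>\<^bsub>sec P V\<^esub> s \<oplus>\<^bsub>sec P V\<^esub> s = \<zero>\<^bsub>sec P V\<^esub>"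
        using V.smult_l_distr[OF rV V.R.one_closed V(4)] V(4) by simp
      show "(?r \<odot>\<^bsub>sec (sheafify P) U\<^esub> f \<oplus>\<^bsub>sec (sheafify P) U\<^esub> f) x = \<zero>\<^bsub>sec (sheafify P) U\<^esub> x"
        by (simp only: add_at[where f="?r \<odot>\<^bsub>sec (sheafify P) U\<^esub> f" and g=f, OF P V(1,2) V.smult_closed[OF rV V(4)] V(4) smult_at[where f=f, OF U r V(1-4) V(5)[OF V(2)]] V(5)[OF V(2)] x]
          z zero_at[OF P U V(1,3,2)])
    qed (use f r in \<open>auto intro!: sh_add_closed[OF U] sh_smult_closed[OF U] sh_zero_closed[OF U]\<close>)
    then show "\<exists>y\<in>carrier (sec (sheafify P) U). y \<oplus>\<^bsub>sec (sheafify P) U\<^esub> f = \<zero>\<^bsub>sec (sheafify P) U\<^esub>"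
      using sh_smult_closed[OF U r f] by blast
  qed (auto intro: sh_add_closed[OF U] sh_zero_closed[OF U])
  fix a b f g assume a: "a \<in> carrier (\<O> U)" and b: "b \<in> carrier (\<O> U)"
    and f: "f \<in> carrier (sec (sheafify P) U)" and g: "g \<in> carrier (sec (sheafify P) U)"
  interpret OU: cring "\<O> U" by (rule cring_O[OF U])
  note cl = sh_add_closed[OF U] sh_smult_closed[OF U]
  show "(a \<oplus>\<^bsub>\<O> U\<^esub> b) \<odot>\<^bsub>sec (sheafify P) U\<^esub> f = a \<odot>\<^bsub>sec (sheafify P) U\<^esub> f \<oplus>\<^bsub>sec (sheafify P) U\<^esub> b \<odot>\<^bsub>sec (sheafify P) U\<^esub> f"
  proof (rule sh_eqI[OF P])
    fix x assume x: "x \<in> U"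
    from sh_rep[OF P f x] obtain V s where V: "open V" "x \<in> V" "V \<subseteq> U" "s \<in> carrier (sec P V)" "\<And>y. y \<in> V \<Longrightarrow> f y = germ P y V s" by metis
    interpret V: Module.module "\<O> V" "sec P V" using m V by blast
    note ra = O_rst[OF U V(1,3) a] and rb = O_rst[OF U V(1,3) b]
    note sm = smult_at[where f=f, OF U _ V(1-4) V(5)[OF V(2)]]
    have "rst V (a \<oplus>\<^bsub>\<O> U\<^esub> b) = rst V a \<oplus>\<^bsub>\<O> V\<^esub> rst V b" by (auto simp: O_add rst_def)
    then show "((a \<oplus>\<^bsub>\<O> U\<^esub> b) \<odot>\<^bsub>sec (sheafify P) U\<^esub> f) x = (a \<odot>\<^bsub>sec (sheafify P) U\<^esub> f \<oplus>\<^bsub>sec (sheafify P) U\<^esub> b \<odot>\<^bsub>sec (sheafify P) U\<^esub> f) x"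
      by (simp only: sm[OF OU.a_closed[OF a b]] V.smult_l_distr[OF ra rb V(4)]
        add_at[where f="a \<odot>\<^bsub>sec (sheafify P) U\<^esub> f" and g="b \<odot>\<^bsub>sec (sheafify P) U\<^esub> f", OF P V(1,2) V.smult_closed[OF ra V(4)] V.smult_closed[OF rb V(4)] sm[OF a] sm[OF b] x])
  qed (use a b f in \<open>auto intro!: cl OU.a_closed\<close>)
  show "a \<odot>\<^bsub>sec (sheafify P) U\<^esub> (f \<oplus>\<^bsub>sec (sheafify P) U\<^esub> g) = a \<odot>\<^bsub>sec (sheafify P) U\<^esub> f \<oplus>\<^bsub>sec (sheafify P) U\<^esub> a \<odot>\<^bsub>sec (sheafify P) U\<^esub> g"
  proof (rule sh_eqI[OF P])
    fix x assume x: "x \<in> U"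
    from sh_rep2[OF P f g x] obtain V s t where V: "open V" "x \<in> V" "V \<subseteq> U" "s \<in> carrier (sec P V)" "\<And>y. y \<in> V \<Longrightarrow> f y = germ P y V s"
        "t \<in> carrier (sec P V)" "\<And>y. y \<in> V \<Longrightarrow> g y = germ P y V t" by metis
    interpret V: Module.module "\<O> V" "sec P V" using m V by blast
    note ra = O_rst[OF U V(1,3) a]
    note e = V(5)[OF V(2)] V(7)[OF V(2)]
    show "(a \<odot>\<^bsub>sec (sheafify P) U\<^esub> (f \<oplus>\<^bsub>sec (sheafify P) U\<^esub> g)) x = (a \<odot>\<^bsub>sec (sheafify P) U\<^esub> f \<oplus>\<^bsub>sec (sheafify P) U\<^esub> a \<odot>\<^bsub>sec (sheafify P) U\<^esub> g) x"
      by (simp only: smult_at[where f="f \<oplus>\<^bsub>sec (sheafify P) U\<^esub> g", OF U a V(1-3) V.M.a_closed[OF V(4,6)] add_at[where f=f and g=g, OF P V(1,2,4,6) e x]]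
        V.smult_r_distr[OF ra V(4,6)] add_at[where f="a \<odot>\<^bsub>sec (sheafify P) U\<^esub> f" and g="a \<odot>\<^bsub>sec (sheafify P) U\<^esub> g",
          OF P V(1,2) V.smult_closed[OF ra V(4)] V.smult_closed[OF ra V(6)]
          smult_at[where f=f, OF U a V(1-4) e(1)] smult_at[where f=g, OF U a V(1-3,6) e(2)] x])
  qed (use a f g in \<open>auto intro!: cl\<close>)
  show "(a \<otimes>\<^bsub>\<O> U\<^esub> b) \<odot>\<^bsub>sec (sheafify P) U\<^esub> f = a \<odot>\<^bsub>sec (sheafify P) U\<^esub> (b \<odot>\<^bsub>sec (sheafify P) U\<^esub> f)"
  proof (rule sh_eqI[OF P])
    fix x assume x: "x \<in> U"
    from sh_rep[OF P f x] obtain V s where V: "open V" "x \<in> V" "V \<subseteq> U" "s \<in> carrier (sec P V)" "\<And>y. y \<in> V \<Longrightarrow> f y = germ P y V s" by metis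
    interpret V: Module.module "\<O> V" "sec P V" using m V by blast
    note ra = O_rst[OF U V(1,3) a] and rb = O_rst[OF U V(1,3) b]
    note sm = smult_at[where f=f, OF U _ V(1-4) V(5)[OF V(2)]]
    have "rst V (a \<otimes>\<^bsub>\<O> U\<^esub> b) = rst V a \<otimes>\<^bsub>\<O> V\<^esub> rst V b" by (auto simp: O_mult rst_def)
    then show "((a \<otimes>\<^bsub>\<O> U\<^esub> b) \<odot>\<^bsub>sec (sheafify P) U\<^esub> f) x = (a \<odot>\<^bsub>sec (sheafify P) U\<^esub> (b \<odot>\<^bsub>sec (sheafify P) U\<^esub> f)) x"
      by (simp only: sm[OF OU.m_closed[OF a b]] V.smult_assoc1[OF ra rb V(4)]
        smult_at[where f="b \<odot>\<^bsub>sec (sheafify P) U\<^esub> f", OF U a V(1-3) V.smult_closed[OF rb V(4)] sm[OF b]])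
  qed (use a b f in \<open>auto intro!: cl OU.m_closed\<close>)
next
  fix f assume f: "f \<in> carrier (sec (sheafify P) U)"
  interpret OU: cring "\<O> U" by (rule cring_O[OF U])
  note cl = sh_smult_closed[OF U] and m = presheaf_module[OF P]
  show "\<one>\<^bsub>\<O> U\<^esub> \<odot>\<^bsub>sec (sheafify P) U\<^esub> f = f"
  proof (rule sh_eqI[OF P])
    fix x assume x: "x \<in> U"
    from sh_rep[OF P f x] obtain V s where V: "open V" "x \<in> V" "V \<subseteq> U" "s \<in> carrier (sec P V)" "\<And>y. y \<in> V \<Longrightarrow> f y = germ P y V s" by metis
    interpret V: Module.module "\<O> V" "sec P V" using m V by blast
    have "rst V \<one>\<^bsub>\<O> U\<^esub> = \<one>\<^bsub>\<O> V\<^esub>" using V by (auto simp: O_one rst_def fun_eq_iff)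
    then show "(\<one>\<^bsub>\<O> U\<^esub> \<odot>\<^bsub>sec (sheafify P) U\<^esub> f) x = f x"
      by (simp only: smult_at[where f=f, OF U OU.one_closed V(1-4) V(5)[OF V(2)]] V.smult_one[OF V(4)] V(5)[OF V(2)])
  qed (use f in \<open>auto intro!: cl OU.one_closed\<close>)
qed (use sh_smult_closed[OF U] in auto)

lemma sh_res_closed:
  assumes "f \<in> carrier (sec (sheafify P) U)" "open V" "V \<subseteq> U"
  shows "restrict f V \<in> carrier (sec (sheafify P) V)"
  unfolding sh_carrier[OF P]
proof (intro conjI ballI)
  fix x assume x: "x \<in> V"
  then have "x \<in> U" using assms by auto
  then obtain A t where A: "open A" "x \<in> A" "A \<subseteq> U" "t \<in> carrier (sec P A)" "\<And>y. y \<in> A \<Longrightarrow> f y = germ P y A t"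
    using sh_rep[OF P assms(1)] by metis
  have o: "open (A \<inter> V)" using A assms by auto
  note r = rep_shrink[OF P A(1,4,5) o]
  show "\<exists>W t. open W \<and> x \<in> W \<and> W \<subseteq> V \<and> t \<in> carrier (sec P W) \<and> (\<forall>y\<in>W. restrict f V y = germ P y W t)"
    by (rule exI[of _ "A \<inter> V"], rule exI[of _ "res P A (A \<inter> V) t"]) (use r o x A in auto)
qed simp

lemma sheafify_presheaf: "is_presheaf \<O> (sheafify P)"
proof -
  have r: "res (sheafify P) U V f = restrict f V" for U V f by (simp add: sheafify_def)
  have add: "restrict (f \<oplus>\<^bsub>sec (sheafify P) U\<^esub> g) V = restrict f V \<oplus>\<^bsub>sec (sheafify P) V\<^esub> restrict g V"
    if "V \<subseteq> U" for U V f g using that by (auto simp: sheafify_def fun_eq_iff)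
  have smult: "restrict (a \<odot>\<^bsub>sec (sheafify P) U\<^esub> f) V = rst V a \<odot>\<^bsub>sec (sheafify P) V\<^esub> restrict f V"
    if UV: "open U" "open V" "V \<subseteq> U" and f: "f \<in> carrier (sec (sheafify P) U)" and a: "a \<in> carrier (\<O> U)" for U V f a
  proof (rule sh_eqI[OF P])
    fix x assume x: "x \<in> V"
    from sh_rep[OF P sh_res_closed[OF f UV(2,3)] x] obtain A s where
      A: "open A" "x \<in> A" "A \<subseteq> V" "s \<in> carrier (sec P A)" "\<And>y. y \<in> A \<Longrightarrow> restrict f V y = germ P y A s" by metis
    have AU: "A \<subseteq> U" using A UV by auto
    have fx: "f x = germ P x A s" using A(5)[OF A(2)] x by simp
    show "restrict (a \<odot>\<^bsub>sec (sheafify P) U\<^esub> f) V x = (rst V a \<odot>\<^bsub>sec (sheafify P) V\<^esub> restrict f V) x"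
      using smult_at[where f=f, OF UV(1) a A(1,2) AU A(4) fx] x
        smult_at[where f="restrict f V", OF UV(2) O_rst[OF UV a] A(1-4) A(5)[OF A(2)]] rst_rst[OF A(3)] by simp
  qed (use UV f a in \<open>auto intro!: sh_res_closed sh_smult_closed O_rst[OF UV]\<close>)
  show ?thesis unfolding is_presheaf_def r
    by (intro conjI allI impI ballI Pi_I)
      (auto simp: sheafify_module sh_res_closed add smult Int_absorb1, auto simp: sh_carrier[OF P] extensional_restrict)
qed

lemma res_sheafify: "res (sheafify P) U V f = restrict f V"
  by (simp add: sheafify_def)

lemma sheafify_sheaf: "is_sheaf \<O> (sheafify P)"
  unfolding is_sheaf_def res_sheafify
proof (intro conjI allI impI sheafify_presheaf)
  fix \<U> t
  assume a: "(\<forall>U\<in>\<U>. open U \<and> t U \<in> carrier (sec (sheafify P) U)) \<and>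
    (\<forall>U\<in>\<U>. \<forall>V\<in>\<U>. restrict (t U) (U \<inter> V) = restrict (t V) (U \<inter> V))"
  define s where "s = (\<lambda>x\<in>\<Union>\<U>. t (SOME U. U \<in> \<U> \<and> x \<in> U) x)"
  have sx: "s x = t U x" if U: "U \<in> \<U>" "x \<in> U" for U x
  proof -
    let ?V = "SOME U. U \<in> \<U> \<and> x \<in> U"
    have V: "?V \<in> \<U>" "x \<in> ?V" using someI[of "\<lambda>U. U \<in> \<U> \<and> x \<in> U" U] U by auto
    have "restrict (t U) (U \<inter> ?V) = restrict (t ?V) (U \<inter> ?V)" using a U(1) V(1) by blast
    then have "restrict (t U) (U \<inter> ?V) x = restrict (t ?V) (U \<inter> ?V) x" by (rule fun_cong)
    then have "t U x = t ?V x" using U V by simp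
    moreover have "s x = t ?V x" unfolding s_def by (rule restrict_apply') (use U in blast)
    ultimately show ?thesis by simp
  qed
  have ext: "s \<in> extensional (\<Union>\<U>)" by (simp add: s_def)
  have res: "restrict s U = t U" if "U \<in> \<U>" for U
    using a that sx by (intro extensionalityI[of _ U]) (auto simp: sh_carrier[OF P])
  have "s \<in> carrier (sec (sheafify P) (\<Union>\<U>))"
    unfolding sh_carrier[OF P]
  proof (intro conjI ballI ext)
    fix x assume "x \<in> \<Union>\<U>"
    then obtain U where U: "U \<in> \<U>" "x \<in> U" by blast
    then obtain A f where A: "open A" "x \<in> A" "A \<subseteq> U" "f \<in> carrier (sec P A)" "\<And>y. y \<in> A \<Longrightarrow> t U y = germ P y A f"
      using a sh_rep[OF P, of "t U" U x] by metis
    have "A \<subseteq> \<Union>\<U>" "\<forall>y\<in>A. s y = germ P y A f" using A U sx by auto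
    then show "\<exists>V t. open V \<and> x \<in> V \<and> V \<subseteq> \<Union>\<U> \<and> t \<in> carrier (sec P V) \<and> (\<forall>y\<in>V. s y = germ P y V t)"
      using A by blast
  qed
  moreover have "g = s" if "g \<in> carrier (sec (sheafify P) (\<Union>\<U>))" "\<forall>U\<in>\<U>. restrict g U = t U" for g
  proof (rule extensionalityI[of _ "\<Union>\<U>"])
    fix x assume "x \<in> \<Union>\<U>"
    then obtain U where U: "U \<in> \<U>" "x \<in> U" by blast
    then have "restrict g U x = t U x" using that by auto
    then show "g x = s x" using sx[OF U] U by simp
  qed (use that ext in \<open>auto simp: sh_carrier[OF P]\<close>)
  ultimately show "\<exists>!s. s \<in> carrier (sec (sheafify P) (\<Union>\<U>)) \<and> (\<forall>U\<in>\<U>. restrict s U = t U)"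
    using res by blast
qed

lemma sh_unit_closed: "open U \<Longrightarrow> s \<in> carrier (sec P U) \<Longrightarrow> sh_unit P U s \<in> carrier (sec (sheafify P) U)"
  unfolding sh_carrier[OF P] by (auto simp: sh_unit_def)

lemma sh_unit_mor: "is_mor \<O> UNIV P (sheafify P) (sh_unit P)"
proof -
  note op = is_presheaf_op[OF P]
  have add: "sh_unit P U (s \<oplus>\<^bsub>sec P U\<^esub> t) = sh_unit P U s \<oplus>\<^bsub>sec (sheafify P) U\<^esub> sh_unit P U t"
    if "open U" "s \<in> carrier (sec P U)" "t \<in> carrier (sec P U)" for U s t
  proof (rule sh_eqI[OF P, of _ U])
    fix x assume x: "x \<in> U"
    show "sh_unit P U (s \<oplus>\<^bsub>sec P U\<^esub> t) x = (sh_unit P U s \<oplus>\<^bsub>sec (sheafify P) U\<^esub> sh_unit P U t) x"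
      by (subst add_at[where f="sh_unit P U s" and g="sh_unit P U t", OF P that(1) x that(2,3) _ _ x])
        (simp_all add: sh_unit_def x)
  qed (use that in \<open>auto intro!: sh_unit_closed sh_add_closed op_add[OF op]\<close>)
  have smult: "sh_unit P U (r \<odot>\<^bsub>sec P U\<^esub> s) = r \<odot>\<^bsub>sec (sheafify P) U\<^esub> sh_unit P U s"
    if "open U" "s \<in> carrier (sec P U)" "r \<in> carrier (\<O> U)" for U s r
  proof (rule sh_eqI[OF P, of _ U])
    fix x assume x: "x \<in> U"
    show "sh_unit P U (r \<odot>\<^bsub>sec P U\<^esub> s) x = (r \<odot>\<^bsub>sec (sheafify P) U\<^esub> sh_unit P U s) x"
      by (subst smult_at[where f="sh_unit P U s", OF that(1,3,1) x subset_refl that(2)])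
        (simp_all add: sh_unit_def x rst_id that)
  qed (use that in \<open>auto intro!: sh_unit_closed sh_smult_closed op_smult[OF op]\<close>)
  have res: "sh_unit P V (res P U V s) = restrict (sh_unit P U s) V"
    if "open U" "open V" "V \<subseteq> U" "s \<in> carrier (sec P U)" for U V s
    using that by (auto simp: sh_unit_def germ_res[OF P] fun_eq_iff)
  show ?thesis unfolding is_mor_def mod_homs_def res_sheafify
    using add smult res sh_unit_closed by auto
qed

end

section \<open>Universal property of the sheafification\<close>

context
  fixes P :: "('a, 's) mod_presheaf" and G :: "('a, 't) mod_presheaf" and U \<psi>
  assumes P: "is_presheaf \<O> P" and G: "is_sheaf \<O> G" and U: "open U" and mor: "is_mor \<O> U P G \<psi>"
begin

text \<open>Sections of \<open>P\<close> with the same germs agree only after shrinking; their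
  images agree outright because the target is separated.\<close>

lemma sh_ext_agree:
  assumes V: "open V" "V \<subseteq> U" "s \<in> carrier (sec P V)" and W: "open W" "W \<subseteq> U" "t \<in> carrier (sec P W)"
    and eq: "\<And>y. y \<in> V \<inter> W \<Longrightarrow> germ P y V s = germ P y W t"
  shows "res G V (V \<inter> W) (\<psi> V s) = res G W (V \<inter> W) (\<psi> W t)"
proof -
  note opP = is_presheaf_op[OF P] and opG = is_presheaf_op[OF sheaf_presheaf[OF G]]
  have o: "open (V \<inter> W)" using V W by auto
  show ?thesis
  proof (rule sheaf_separated[OF G o])
    fix y assume y: "y \<in> V \<inter> W"
    then obtain A where A: "open A" "y \<in> A" "A \<subseteq> V" "A \<subseteq> W" "res P V A s = res P W A t"
      using germ_eqD[OF P eq[OF y] W(1,3)] by blast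
    have "res G (V \<inter> W) A (res G V (V \<inter> W) (\<psi> V s)) = res G V A (\<psi> V s)"
      using V A o mor_closed[OF mor V] by (simp add: res_comp[OF opG])
    also have "\<dots> = \<psi> A (res P V A s)" using mor_res[OF mor V(1) A(1,3) V(2,3)] by simp
    also have "\<dots> = res G W A (\<psi> W t)" using mor_res[OF mor W(1) A(1,4) W(2,3)] A(5) by simp
    also have "\<dots> = res G (V \<inter> W) A (res G W (V \<inter> W) (\<psi> W t))"
      using W A o mor_closed[OF mor W] by (simp add: res_comp[OF opG])
    finally show "\<exists>A. open A \<and> y \<in> A \<and> A \<subseteq> V \<inter> W \<and>
        res G (V \<inter> W) A (res G V (V \<inter> W) (\<psi> V s)) = res G (V \<inter> W) A (res G W (V \<inter> W) (\<psi> W t))"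
      using A by blast
  qed (use o V W mor_closed[OF mor] in \<open>auto intro!: res_closed[OF opG]\<close>)
qed

text \<open>A section \<open>f\<close> of the sheafification is locally the family of germs of a
  section \<open>t\<close> of \<open>P\<close>. The images \<open>\<psi> t\<close> glue to the
  section that \<open>sh_ext\<close> describes, and the second claim holds for every local
  representative, not only for those chosen in the gluing.\<close>

lemma sh_ext_local:
  assumes V: "open V" "V \<subseteq> U" and f: "f \<in> carrier (sec (sheafify P) V)"
  shows "sh_ext G \<psi> V f \<in> carrier (sec G V)"
    and "\<And>W t. open W \<Longrightarrow> W \<subseteq> V \<Longrightarrow> t \<in> carrier (sec P W) \<Longrightarrow> (\<And>y. y \<in> W \<Longrightarrow> f y = germ P y W t) \<Longrightarrow>
      res G V W (sh_ext G \<psi> V f) = \<psi> W t"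
proof -
  note opP = is_presheaf_op[OF P] and opG = is_presheaf_op[OF sheaf_presheaf[OF G]]
  let ?good = "\<lambda>x (W, t). open W \<and> x \<in> W \<and> W \<subseteq> V \<and> t \<in> carrier (sec P W) \<and> (\<forall>y\<in>W. f y = germ P y W t)"
  define c where "c x = (SOME p. ?good x p)" for x
  have c: "?good x (c x)" if "x \<in> V" for x
  proof -
    from sh_rep[OF P f that] obtain W t where
      W: "open W" "x \<in> W" "W \<subseteq> V" "t \<in> carrier (sec P W)" "\<And>y. y \<in> W \<Longrightarrow> f y = germ P y W t" by metis
    show ?thesis unfolding c_def by (rule someI[of "?good x" "(W, t)"]) (use W in simp)
  qed
  define A where "A x = fst (c x)" for x
  define u where "u x = snd (c x)" for x
  have Au: "open (A x)" "x \<in> A x" "A x \<subseteq> V" "u x \<in> carrier (sec P (A x))"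
    "\<And>y. y \<in> A x \<Longrightarrow> f y = germ P y (A x) (u x)" if "x \<in> V" for x
    using c[OF that] by (auto simp: A_def u_def split: prod.splits)
  have AU: "A x \<subseteq> U" if "x \<in> V" for x using Au[OF that] V by auto
  have cov: "(\<Union>x\<in>V. A x) = V" using Au by blast
  obtain g where g: "g \<in> carrier (sec G V)" "\<And>x. x \<in> V \<Longrightarrow> res G V (A x) g = \<psi> (A x) (u x)"
  proof (rule sheaf_glue[OF G, of V A "\<lambda>x. \<psi> (A x) (u x)"])
    fix x assume x: "x \<in> V"
    show "open (A x)" by (rule Au(1)[OF x])
    show "\<psi> (A x) (u x) \<in> carrier (sec G (A x))"
      by (rule mor_closed[OF mor Au(1)[OF x] AU[OF x] Au(4)[OF x]])
    fix y assume y: "y \<in> V"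
    show "res G (A x) (A x \<inter> A y) (\<psi> (A x) (u x)) = res G (A y) (A x \<inter> A y) (\<psi> (A y) (u y))"
      by (rule sh_ext_agree[OF Au(1)[OF x] AU[OF x] Au(4)[OF x] Au(1)[OF y] AU[OF y] Au(4)[OF y]])
        (use Au(5)[OF x] Au(5)[OF y] in auto)
  qed (use cov that in auto)
  have ginv: "\<forall>x\<in>V. \<exists>(W, s)\<in>f x. W \<subseteq> V \<and> res G V W g = \<psi> W s"
  proof
    fix x assume x: "x \<in> V"
    have "(A x, u x) \<in> f x" using Au(5)[OF x Au(2)[OF x]] germ_self[OF P Au(1)[OF x] Au(4)[OF x] Au(2)[OF x]] by simp
    then show "\<exists>(W, s)\<in>f x. W \<subseteq> V \<and> res G V W g = \<psi> W s" using Au[OF x] g(2)[OF x] by blast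
  qed
  have loc: "res G V W g' = \<psi> W t" if g': "g' \<in> carrier (sec G V)" "\<forall>x\<in>V. \<exists>(W, s)\<in>f x. W \<subseteq> V \<and> res G V W g' = \<psi> W s"
    and W: "open W" "W \<subseteq> V" "t \<in> carrier (sec P W)" "\<And>y. y \<in> W \<Longrightarrow> f y = germ P y W t" for g' W t
  proof (rule sheaf_separated[OF G W(1)])
    have WU: "W \<subseteq> U" using W V by auto
    show "\<psi> W t \<in> carrier (sec G W)" by (rule mor_closed[OF mor W(1) WU W(3)])
    show "res G V W g' \<in> carrier (sec G W)" by (rule res_closed[OF opG V(1) W(1,2) g'(1)])
    fix y assume y: "y \<in> W"
    then have yV: "y \<in> V" using W by auto
    obtain B s where B: "(B, s) \<in> f y" "B \<subseteq> V" "res G V B g' = \<psi> B s" using g'(2) yV by blast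
    have "(B, s) \<in> germ P y W t" using B(1) W(4)[OF y] by simp
    then obtain C where C: "open B" "y \<in> B" "s \<in> carrier (sec P B)" "open C" "y \<in> C" "C \<subseteq> W" "C \<subseteq> B"
      "res P W C t = res P B C s" by (rule germ_memD[OF P])
    have BU: "B \<subseteq> U" using B V by auto
    have "res G W C (res G V W g') = res G V C g'"
      by (rule res_comp[OF opG V(1) W(1) C(4,6) W(2) g'(1)])
    also have "\<dots> = res G B C (res G V B g')"
      by (rule res_comp[OF opG V(1) C(1,4,7) B(2) g'(1), symmetric])
    also have "\<dots> = \<psi> C (res P B C s)" using mor_res[OF mor C(1,4,7) BU C(3)] B(3) by simp
    also have "\<dots> = res G W C (\<psi> W t)" using mor_res[OF mor W(1) C(4,6) WU W(3)] C(8) by simp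
    finally show "\<exists>C. open C \<and> y \<in> C \<and> C \<subseteq> W \<and> res G W C (res G V W g') = res G W C (\<psi> W t)"
      using C by blast
  qed
  have uniq: "g' = g" if g': "g' \<in> carrier (sec G V)" "\<forall>x\<in>V. \<exists>(W, s)\<in>f x. W \<subseteq> V \<and> res G V W g' = \<psi> W s" for g'
  proof (rule sheaf_separated[OF G V(1) g'(1) g(1)])
    fix x assume x: "x \<in> V"
    have "res G V (A x) g' = res G V (A x) g"
      using loc[OF g' Au(1)[OF x] Au(3)[OF x] Au(4)[OF x] Au(5)[OF x]] g(2)[OF x] by simp
    then show "\<exists>W. open W \<and> x \<in> W \<and> W \<subseteq> V \<and> res G V W g' = res G V W g" using Au[OF x] by blast
  qed
  have eq: "sh_ext G \<psi> V f = g" unfolding sh_ext_def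
    by (rule the_equality, rule conjI[OF g(1) ginv], elim conjE, rule uniq)
  show "sh_ext G \<psi> V f \<in> carrier (sec G V)" using eq g by simp
  show "res G V W (sh_ext G \<psi> V f) = \<psi> W t"
    if "open W" "W \<subseteq> V" "t \<in> carrier (sec P W)" "\<And>y. y \<in> W \<Longrightarrow> f y = germ P y W t" for W t
    unfolding eq by (rule loc[OF g(1) ginv that])
qed

lemma sh_ext_mor: "is_mor \<O> U (sheafify P) G (sh_ext G \<psi>)"
proof -
  note opP = is_presheaf_op[OF P] and opG = is_presheaf_op[OF sheaf_presheaf[OF G]]
  have add: "sh_ext G \<psi> V (f \<oplus>\<^bsub>sec (sheafify P) V\<^esub> g) = sh_ext G \<psi> V f \<oplus>\<^bsub>sec G V\<^esub> sh_ext G \<psi> V g"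
    if V: "open V" "V \<subseteq> U" and f: "f \<in> carrier (sec (sheafify P) V)" and g: "g \<in> carrier (sec (sheafify P) V)" for V f g
  proof (rule sheaf_separated[OF G V(1)])
    note L = sh_ext_local[OF V]
    note fg = sh_add_closed[OF P V(1) f g]
    show "sh_ext G \<psi> V (f \<oplus>\<^bsub>sec (sheafify P) V\<^esub> g) \<in> carrier (sec G V)" by (rule L(1)[OF fg])
    show "sh_ext G \<psi> V f \<oplus>\<^bsub>sec G V\<^esub> sh_ext G \<psi> V g \<in> carrier (sec G V)"
      by (rule op_add[OF opG V(1) L(1)[OF f] L(1)[OF g]])
    fix x assume "x \<in> V"
    from sh_rep2[OF P f g this] obtain A s t where A: "open A" "x \<in> A" "A \<subseteq> V" "s \<in> carrier (sec P A)" "\<And>y. y \<in> A \<Longrightarrow> f y = germ P y A s"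
      "t \<in> carrier (sec P A)" "\<And>y. y \<in> A \<Longrightarrow> g y = germ P y A t" by metis
    have AU: "A \<subseteq> U" using A V by auto
    have sum: "\<And>y. y \<in> A \<Longrightarrow> (f \<oplus>\<^bsub>sec (sheafify P) V\<^esub> g) y = germ P y A (s \<oplus>\<^bsub>sec P A\<^esub> t)"
      using add_at[where f=f and g=g, OF P A(1) _ A(4,6) A(5) A(7)] A(3) by blast
    have "res G V A (sh_ext G \<psi> V (f \<oplus>\<^bsub>sec (sheafify P) V\<^esub> g)) = \<psi> A (s \<oplus>\<^bsub>sec P A\<^esub> t)"
      by (rule L(2)[OF fg A(1,3) op_add[OF opP A(1,4,6)] sum])
    also have "\<dots> = \<psi> A s \<oplus>\<^bsub>sec G A\<^esub> \<psi> A t" by (rule mor_add[OF mor A(1) AU A(4,6)])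
    also have "\<dots> = res G V A (sh_ext G \<psi> V f \<oplus>\<^bsub>sec G V\<^esub> sh_ext G \<psi> V g)"
      by (simp only: res_add[OF opG V(1) A(1,3) L(1)[OF f] L(1)[OF g]] L(2)[OF f A(1,3,4,5)] L(2)[OF g A(1,3,6,7)])
    finally show "\<exists>A. open A \<and> x \<in> A \<and> A \<subseteq> V \<and> res G V A (sh_ext G \<psi> V (f \<oplus>\<^bsub>sec (sheafify P) V\<^esub> g)) =
      res G V A (sh_ext G \<psi> V f \<oplus>\<^bsub>sec G V\<^esub> sh_ext G \<psi> V g)" using A by blast
  qed
  have smult: "sh_ext G \<psi> V (r \<odot>\<^bsub>sec (sheafify P) V\<^esub> f) = r \<odot>\<^bsub>sec G V\<^esub> sh_ext G \<psi> V f"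
    if V: "open V" "V \<subseteq> U" and r: "r \<in> carrier (\<O> V)" and f: "f \<in> carrier (sec (sheafify P) V)" for V r f
  proof (rule sheaf_separated[OF G V(1)])
    note L = sh_ext_local[OF V]
    note fg = sh_smult_closed[OF P V(1) r f]
    show "sh_ext G \<psi> V (r \<odot>\<^bsub>sec (sheafify P) V\<^esub> f) \<in> carrier (sec G V)" by (rule L(1)[OF fg])
    show "r \<odot>\<^bsub>sec G V\<^esub> sh_ext G \<psi> V f \<in> carrier (sec G V)"
      by (rule op_smult[OF opG V(1) r L(1)[OF f]])
    fix x assume "x \<in> V"
    from sh_rep[OF P f this] obtain A s where A: "open A" "x \<in> A" "A \<subseteq> V" "s \<in> carrier (sec P A)" "\<And>y. y \<in> A \<Longrightarrow> f y = germ P y A s"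
      by metis
    have AU: "A \<subseteq> U" using A V by auto
    note rA = O_rst[OF V(1) A(1,3) r]
    have sum: "\<And>y. y \<in> A \<Longrightarrow> (r \<odot>\<^bsub>sec (sheafify P) V\<^esub> f) y = germ P y A (rst A r \<odot>\<^bsub>sec P A\<^esub> s)"
      using smult_at[where f=f, OF P V(1) r A(1) _ A(3,4) A(5)] by blast
    have "res G V A (sh_ext G \<psi> V (r \<odot>\<^bsub>sec (sheafify P) V\<^esub> f)) = \<psi> A (rst A r \<odot>\<^bsub>sec P A\<^esub> s)"
      by (rule L(2)[OF fg A(1,3) op_smult[OF opP A(1) rA A(4)] sum])
    also have "\<dots> = rst A r \<odot>\<^bsub>sec G A\<^esub> \<psi> A s" by (rule mor_smult[OF mor A(1) AU rA A(4)])
    also have "\<dots> = res G V A (r \<odot>\<^bsub>sec G V\<^esub> sh_ext G \<psi> V f)"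
      by (simp only: res_smult[OF opG V(1) A(1,3) r L(1)[OF f]] L(2)[OF f A(1,3,4,5)])
    finally show "\<exists>A. open A \<and> x \<in> A \<and> A \<subseteq> V \<and> res G V A (sh_ext G \<psi> V (r \<odot>\<^bsub>sec (sheafify P) V\<^esub> f)) =
      res G V A (r \<odot>\<^bsub>sec G V\<^esub> sh_ext G \<psi> V f)" using A by blast
  qed
  have res: "sh_ext G \<psi> W (restrict f W) = res G V W (sh_ext G \<psi> V f)"
    if V: "open V" "open W" "W \<subseteq> V" "V \<subseteq> U" and f: "f \<in> carrier (sec (sheafify P) V)" for V W f
  proof (rule sheaf_separated[OF G V(2)])
    have WU: "W \<subseteq> U" using V by auto
    note LV = sh_ext_local[OF V(1,4)] and LW = sh_ext_local[OF V(2) WU]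
    note fW = sh_res_closed[OF P f V(2,3)]
    show "sh_ext G \<psi> W (restrict f W) \<in> carrier (sec G W)" by (rule LW(1)[OF fW])
    show "res G V W (sh_ext G \<psi> V f) \<in> carrier (sec G W)" by (rule res_closed[OF opG V(1-3) LV(1)[OF f]])
    fix x assume x: "x \<in> W"
    from sh_rep[OF P fW x] obtain A s where A: "open A" "x \<in> A" "A \<subseteq> W" "s \<in> carrier (sec P A)" "\<And>y. y \<in> A \<Longrightarrow> restrict f W y = germ P y A s"
      by metis
    have AV: "A \<subseteq> V" using A V by auto
    have fA: "\<And>y. y \<in> A \<Longrightarrow> f y = germ P y A s" using A(5,3) by (auto simp: subset_iff)
    have "res G W A (sh_ext G \<psi> W (restrict f W)) = \<psi> A s" by (rule LW(2)[OF fW A(1,3,4,5)])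
    also have "\<dots> = res G W A (res G V W (sh_ext G \<psi> V f))"
      by (simp only: res_comp[OF opG V(1,2) A(1,3) V(3) LV(1)[OF f]] LV(2)[OF f A(1) AV A(4) fA])
    finally show "\<exists>A. open A \<and> x \<in> A \<and> A \<subseteq> W \<and> res G W A (sh_ext G \<psi> W (restrict f W)) =
      res G W A (res G V W (sh_ext G \<psi> V f))" using A by blast
  qed
  show ?thesis unfolding is_mor_def mod_homs_def res_sheafify[OF P]
    using add smult res sh_ext_local(1) by auto
qed

lemma sh_ext_unit:
  assumes V: "open V" "V \<subseteq> U" and t: "t \<in> carrier (sec P V)"
  shows "sh_ext G \<psi> V (sh_unit P V t) = \<psi> V t"
proof -
  note opG = is_presheaf_op[OF sheaf_presheaf[OF G]]
  have "res G V V (sh_ext G \<psi> V (sh_unit P V t)) = \<psi> V t"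
    by (rule sh_ext_local(2)[OF V sh_unit_closed[OF P V(1) t] V(1) _ t]) (auto simp: sh_unit_def)
  then show ?thesis using res_id[OF opG V(1) sh_ext_local(1)[OF V sh_unit_closed[OF P V(1) t]]] by simp
qed

end

lemma sh_map_at:
  assumes P: "is_presheaf \<O> P" and Q: "is_presheaf \<O> Q" and mor: "is_mor \<O> UNIV P Q \<psi>"
    and V: "open V" "x \<in> V" "t \<in> carrier (sec P V)" and f: "f x = germ P x V t" and x: "x \<in> U"
  shows "sh_map Q \<psi> U f x = germ Q x V (\<psi> V t)"
proof -
  note m = mor_closed[OF mor]
  have *: "germ Q x W (\<psi> W s) = germ Q x V (\<psi> V t)" if "(W, s) \<in> germ P x V t" for W s
  proof -
    obtain C where C: "open W" "x \<in> W" "s \<in> carrier (sec P W)" "open C" "x \<in> C" "C \<subseteq> V" "C \<subseteq> W"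
      "res P V C t = res P W C s" using germ_memD[OF P \<open>(W, s) \<in> germ P x V t\<close>] by metis
    have "res Q W C (\<psi> W s) = res Q V C (\<psi> V t)"
      using mor_res[OF mor C(1,4,7) _ C(3)] mor_res[OF mor V(1) C(4,6) _ V(3)] C(8) by simp
    then show ?thesis
      using germ_eqI[OF Q C(1) m[OF C(1) subset_UNIV C(3)] V(1) m[OF V(1) subset_UNIV V(3)] C(4,5)] C(6,7) by simp
  qed
  have "sh_map Q \<psi> U f x = (\<Union>(W, s)\<in>germ P x V t. germ Q x W (\<psi> W s))"
    using x by (simp add: sh_map_def f)
  also have "\<dots> = (\<Union>p\<in>germ P x V t. germ Q x V (\<psi> V t))"
    using * by (intro SUP_cong refl) (auto split: prod.split)
  also have "\<dots> = germ Q x V (\<psi> V t)" using germ_self[OF P V(1,3,2)] by blast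
  finally show ?thesis .
qed

text \<open>The map is given by its effect on germs, so additivity, linearity and naturality are
  checked on local representatives.\<close>

lemma sh_map_mor:
  assumes P: "is_presheaf \<O> P" and Q: "is_presheaf \<O> Q" and mor: "is_mor \<O> UNIV P Q \<psi>"
  shows "is_mor \<O> UNIV (sheafify P) (sheafify Q) (sh_map Q \<psi>)"
proof -
  note m = mor_closed[OF mor] and at = sh_map_at[OF P Q mor]
  have clos: "sh_map Q \<psi> U f \<in> carrier (sec (sheafify Q) U)" if U: "open U" and f: "f \<in> carrier (sec (sheafify P) U)" for U f
    unfolding sh_carrier[OF Q]
  proof (intro conjI ballI)
    fix x assume "x \<in> U"
    from sh_rep[OF P f this] obtain A s where A: "open A" "x \<in> A" "A \<subseteq> U" "s \<in> carrier (sec P A)" "\<And>y. y \<in> A \<Longrightarrow> f y = germ P y A s"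
      by metis
    have "\<forall>y\<in>A. sh_map Q \<psi> U f y = germ Q y A (\<psi> A s)" using at[where f=f, OF A(1) _ A(4) A(5)] A(3) by blast
    then show "\<exists>V t. open V \<and> x \<in> V \<and> V \<subseteq> U \<and> t \<in> carrier (sec Q V) \<and> (\<forall>y\<in>V. sh_map Q \<psi> U f y = germ Q y V t)"
      using A m[OF A(1) subset_UNIV A(4)] by blast
  qed (simp add: sh_map_def)
  have add: "sh_map Q \<psi> U (f \<oplus>\<^bsub>sec (sheafify P) U\<^esub> g) = sh_map Q \<psi> U f \<oplus>\<^bsub>sec (sheafify Q) U\<^esub> sh_map Q \<psi> U g"
    if U: "open U" and f: "f \<in> carrier (sec (sheafify P) U)" and g: "g \<in> carrier (sec (sheafify P) U)" for U f g
  proof (rule sh_eqI[OF Q])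
    fix x assume x: "x \<in> U"
    from sh_rep2[OF P f g x] obtain A s t where A: "open A" "x \<in> A" "A \<subseteq> U" "s \<in> carrier (sec P A)" "\<And>y. y \<in> A \<Longrightarrow> f y = germ P y A s"
      "t \<in> carrier (sec P A)" "\<And>y. y \<in> A \<Longrightarrow> g y = germ P y A t" by metis
    note e = A(5)[OF A(2)] A(7)[OF A(2)]
    note cl = m[OF A(1) subset_UNIV]
    show "sh_map Q \<psi> U (f \<oplus>\<^bsub>sec (sheafify P) U\<^esub> g) x = (sh_map Q \<psi> U f \<oplus>\<^bsub>sec (sheafify Q) U\<^esub> sh_map Q \<psi> U g) x"
      by (simp only: at[where f="f \<oplus>\<^bsub>sec (sheafify P) U\<^esub> g", OF A(1,2) op_add[OF is_presheaf_op[OF P] A(1,4,6)] add_at[where f=f and g=g, OF P A(1,2,4,6) e x] x]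
        add_at[where f="sh_map Q \<psi> U f" and g="sh_map Q \<psi> U g", OF Q A(1,2) cl[OF A(4)] cl[OF A(6)]
          at[where f=f, OF A(1,2,4) e(1) x] at[where f=g, OF A(1,2,6) e(2) x] x]
        mor_add[OF mor A(1) subset_UNIV A(4,6)])
  qed (use U f g in \<open>auto intro!: clos sh_add_closed[OF P] sh_add_closed[OF Q]\<close>)
  have smult: "sh_map Q \<psi> U (r \<odot>\<^bsub>sec (sheafify P) U\<^esub> f) = r \<odot>\<^bsub>sec (sheafify Q) U\<^esub> sh_map Q \<psi> U f"
    if U: "open U" and r: "r \<in> carrier (\<O> U)" and f: "f \<in> carrier (sec (sheafify P) U)" for U r f
  proof (rule sh_eqI[OF Q])
    fix x assume x: "x \<in> U"
    from sh_rep[OF P f x] obtain A s where A: "open A" "x \<in> A" "A \<subseteq> U" "s \<in> carrier (sec P A)" "\<And>y. y \<in> A \<Longrightarrow> f y = germ P y A s"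
      by metis
    note e = A(5)[OF A(2)] and rA = O_rst[OF U A(1,3) r]
    note cl = m[OF A(1) subset_UNIV]
    show "sh_map Q \<psi> U (r \<odot>\<^bsub>sec (sheafify P) U\<^esub> f) x = (r \<odot>\<^bsub>sec (sheafify Q) U\<^esub> sh_map Q \<psi> U f) x"
      by (simp only: at[where f="r \<odot>\<^bsub>sec (sheafify P) U\<^esub> f", OF A(1,2) op_smult[OF is_presheaf_op[OF P] A(1) rA A(4)] smult_at[where f=f, OF P U r A(1-4) e] x]
        smult_at[where f="sh_map Q \<psi> U f", OF Q U r A(1-3) cl[OF A(4)] at[where f=f, OF A(1,2,4) e x]]
        mor_smult[OF mor A(1) subset_UNIV rA A(4)])
  qed (use U f r in \<open>auto intro!: clos sh_smult_closed[OF P] sh_smult_closed[OF Q]\<close>)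
  have res: "sh_map Q \<psi> W (restrict f W) = restrict (sh_map Q \<psi> V f) W" if "W \<subseteq> V" for V W f
    using that by (auto simp: sh_map_def fun_eq_iff)
  show ?thesis unfolding is_mor_def mod_homs_def res_sheafify[OF P] res_sheafify[OF Q]
    using add smult res clos by auto
qed

end

context function_rings
begin

section \<open>The structure sheaf and sheaves of homomorphisms\<close>

lemma str_simps:
  "carrier (sec (structure_sheaf \<O>) U) = carrier (\<O> U)"
  "\<zero>\<^bsub>sec (structure_sheaf \<O>) U\<^esub> = (\<lambda>_. 0)"
  "f \<oplus>\<^bsub>sec (structure_sheaf \<O>) U\<^esub> g = (\<lambda>x. f x + g x)"
  "f \<odot>\<^bsub>sec (structure_sheaf \<O>) U\<^esub> g = (\<lambda>x. f x * g x)"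
  "res (structure_sheaf \<O>) U V = rst V"
  by (simp_all add: structure_sheaf_def O_zero O_add O_mult)

lemma structure_presheaf: "is_presheaf \<O> (structure_sheaf \<O>)"
proof -
  have "Module.module (\<O> U) (sec (structure_sheaf \<O>) U)" if U: "open U" for U
  proof (rule moduleI)
    show "abelian_group (sec (structure_sheaf \<O>) U)"
    proof (rule abelian_groupI)
      fix f assume "f \<in> carrier (sec (structure_sheaf \<O>) U)"
      then show "\<exists>y\<in>carrier (sec (structure_sheaf \<O>) U). y \<oplus>\<^bsub>sec (structure_sheaf \<O>) U\<^esub> f = \<zero>\<^bsub>sec (structure_sheaf \<O>) U\<^esub>"
        by (intro bexI[of _ "\<lambda>x. - f x"]) (auto simp: str_simps O_uminus[OF U])
    qed (use O_const[OF U, of 0] in \<open>auto simp: str_simps O_add_closed[OF U] algebra_simps\<close>)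
  qed (auto simp: str_simps cring_O[OF U] O_mult_closed[OF U] O_add O_mult O_one O_restrict_one
      distrib_left distrib_right mult.assoc)
  then show ?thesis unfolding is_presheaf_def
    by (auto simp: str_simps O_rst rst_id rst_rst) (auto simp: rst_def)
qed

lemma cut_apply: "open V \<Longrightarrow> V \<subseteq> U \<Longrightarrow> s \<in> carrier (sec F V) \<Longrightarrow> cut F U \<phi> V s = \<phi> V s"
  by (simp add: cut_def)

lemma cut_cut: "V \<subseteq> U \<Longrightarrow> cut F V (cut F U \<phi>) = cut F V \<phi>"
  by (auto simp: cut_def fun_eq_iff)

lemma cut_cong: "(\<And>V s. open V \<Longrightarrow> V \<subseteq> U \<Longrightarrow> s \<in> carrier (sec F V) \<Longrightarrow> \<phi> V s = \<psi> V s) \<Longrightarrow>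
    cut F U \<phi> = cut F U \<psi>"
  by (auto simp: cut_def fun_eq_iff)

lemma is_mor_cut:
  assumes F: "op_presheaf \<O> F" and m: "is_mor \<O> U F G \<phi>"
  shows "is_mor \<O> U F G (cut F U \<phi>)"
  unfolding is_mor_def
proof (intro conjI allI impI ballI)
  fix V assume V: "open V \<and> V \<subseteq> U"
  then show "cut F U \<phi> V \<in> mod_homs (\<O> V) (sec F V) (sec G V)"
    by (auto simp: mod_homs_def cut_apply op_add[OF F] op_smult[OF F] mor_closed[OF m] mor_add[OF m] mor_smult[OF m])
next
  fix V W s assume V: "open V \<and> open W \<and> W \<subseteq> V \<and> V \<subseteq> U" and s: "s \<in> carrier (sec F V)"
  then have "W \<subseteq> U" "res F V W s \<in> carrier (sec F W)" by (auto intro: res_closed[OF F])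
  then show "cut F U \<phi> W (res F V W s) = res G V W (cut F U \<phi> V s)"
    using V s by (simp add: cut_apply mor_res[OF m])
qed

lemma hom_carrier: "\<phi> \<in> carrier (sec (hom_sheaf \<O> F G) U) \<longleftrightarrow> is_mor \<O> U F G \<phi> \<and> cut F U \<phi> = \<phi>"
  by (simp add: hom_sheaf_def)

lemma hom_simps:
  "\<phi> \<oplus>\<^bsub>sec (hom_sheaf \<O> F G) U\<^esub> \<psi> = cut F U (\<lambda>V s. \<phi> V s \<oplus>\<^bsub>sec G V\<^esub> \<psi> V s)"
  "r \<odot>\<^bsub>sec (hom_sheaf \<O> F G) U\<^esub> \<phi> = cut F U (\<lambda>V s. rst V r \<odot>\<^bsub>sec G V\<^esub> \<phi> V s)"
  "res (hom_sheaf \<O> F G) U V = cut F V"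
  by (simp_all add: hom_sheaf_def)

lemma mor_sum:
  assumes F: "op_presheaf \<O> F" and G: "is_presheaf \<O> G" and U: "open U"
    and m: "is_mor \<O> U F G \<phi>" "is_mor \<O> U F G \<psi>"
  shows "is_mor \<O> U F G (\<lambda>V s. \<phi> V s \<oplus>\<^bsub>sec G V\<^esub> \<psi> V s)"
  unfolding is_mor_def
proof (intro conjI allI impI ballI)
  note c = mor_closed[OF m(1)] mor_closed[OF m(2)] and opG = is_presheaf_op[OF G]
  fix V assume V: "open V \<and> V \<subseteq> U"
  interpret GV: Module.module "\<O> V" "sec G V" using presheaf_module[OF G] V by blast
  show "(\<lambda>s. \<phi> V s \<oplus>\<^bsub>sec G V\<^esub> \<psi> V s) \<in> mod_homs (\<O> V) (sec F V) (sec G V)"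
    using V by (auto simp: mod_homs_def c mor_add[OF m(1)] mor_add[OF m(2)] mor_smult[OF m(1)] mor_smult[OF m(2)]
        GV.smult_r_distr GV.M.a_ac)
next
  note c = mor_closed[OF m(1)] mor_closed[OF m(2)] and opG = is_presheaf_op[OF G]
  fix V W s assume V: "open V \<and> open W \<and> W \<subseteq> V \<and> V \<subseteq> U" and s: "s \<in> carrier (sec F V)"
  show "\<phi> W (res F V W s) \<oplus>\<^bsub>sec G W\<^esub> \<psi> W (res F V W s) = res G V W (\<phi> V s \<oplus>\<^bsub>sec G V\<^esub> \<psi> V s)"
    using V s by (simp add: c mor_res[OF m(1)] mor_res[OF m(2)] res_add[OF opG])
qed

lemma mor_scale:
  assumes F: "op_presheaf \<O> F" and G: "is_presheaf \<O> G" and U: "open U" and r: "r \<in> carrier (\<O> U)"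
    and m: "is_mor \<O> U F G \<phi>"
  shows "is_mor \<O> U F G (\<lambda>V s. rst V r \<odot>\<^bsub>sec G V\<^esub> \<phi> V s)"
  unfolding is_mor_def
proof (intro conjI allI impI ballI)
  note c = mor_closed[OF m]
  fix V assume V: "open V \<and> V \<subseteq> U"
  interpret GV: Module.module "\<O> V" "sec G V" using presheaf_module[OF G] V by blast
  have rV: "rst V r \<in> carrier (\<O> V)" using O_rst[OF U _ _ r] V by blast
  have "rst V r \<odot>\<^bsub>sec G V\<^esub> (a \<odot>\<^bsub>sec G V\<^esub> x) = a \<odot>\<^bsub>sec G V\<^esub> (rst V r \<odot>\<^bsub>sec G V\<^esub> x)"
    if "a \<in> carrier (\<O> V)" "x \<in> carrier (sec G V)" for a x
    using GV.smult_assoc1[OF rV that] GV.smult_assoc1[OF that(1) rV that(2)] GV.R.m_comm[OF rV that(1)] by simp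
  then show "(\<lambda>s. rst V r \<odot>\<^bsub>sec G V\<^esub> \<phi> V s) \<in> mod_homs (\<O> V) (sec F V) (sec G V)"
    using V rV by (auto simp: mod_homs_def c mor_add[OF m] mor_smult[OF m] GV.smult_r_distr)
next
  note c = mor_closed[OF m] and opG = is_presheaf_op[OF G]
  fix V W s assume V: "open V \<and> open W \<and> W \<subseteq> V \<and> V \<subseteq> U" and s: "s \<in> carrier (sec F V)"
  have rV: "rst V r \<in> carrier (\<O> V)" using O_rst[OF U _ _ r] V by blast
  show "rst W r \<odot>\<^bsub>sec G W\<^esub> \<phi> W (res F V W s) = res G V W (rst V r \<odot>\<^bsub>sec G V\<^esub> \<phi> V s)"
    using V s by (simp add: c mor_res[OF m] res_smult[OF opG _ _ _ rV] rst_rst)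
qed

text \<open>Homomorphisms are stored cut off to the sections over open subsets, so that equal
  morphisms are equal functions; every operation therefore has to be compared through
  \<open>cut\<close>.\<close>

lemma hom_op_presheaf:
  assumes F: "op_presheaf \<O> F" and G: "is_presheaf \<O> G"
  shows "op_presheaf \<O> (hom_sheaf \<O> F G)"
proof -
  have add: "\<phi> \<oplus>\<^bsub>sec (hom_sheaf \<O> F G) U\<^esub> \<psi> \<in> carrier (sec (hom_sheaf \<O> F G) U)"
    if "open U" "\<phi> \<in> carrier (sec (hom_sheaf \<O> F G) U)" "\<psi> \<in> carrier (sec (hom_sheaf \<O> F G) U)" for U \<phi> \<psi>
    using that by (auto simp: hom_carrier hom_simps cut_cut intro!: is_mor_cut[OF F] mor_sum[OF F G])
  have smult: "r \<odot>\<^bsub>sec (hom_sheaf \<O> F G) U\<^esub> \<phi> \<in> carrier (sec (hom_sheaf \<O> F G) U)"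
    if "open U" "\<phi> \<in> carrier (sec (hom_sheaf \<O> F G) U)" "r \<in> carrier (\<O> U)" for U \<phi> r
    using that by (auto simp: hom_carrier hom_simps cut_cut intro!: is_mor_cut[OF F] mor_scale[OF F G])
  have res: "cut F V \<phi> \<in> carrier (sec (hom_sheaf \<O> F G) V)"
    if "open U" "open V" "V \<subseteq> U" "\<phi> \<in> carrier (sec (hom_sheaf \<O> F G) U)" for U V \<phi>
    using that by (auto simp: hom_carrier cut_cut intro!: is_mor_cut[OF F] intro: is_mor_subset)
  have res_add: "cut F V (cut F U (\<lambda>W s. \<phi> W s \<oplus>\<^bsub>sec G W\<^esub> \<psi> W s)) =
      cut F V (\<lambda>W s. cut F V \<phi> W s \<oplus>\<^bsub>sec G W\<^esub> cut F V \<psi> W s)" if "V \<subseteq> U" for U V \<phi> \<psi>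
    unfolding cut_cut[OF that] by (rule cut_cong) (simp add: cut_apply)
  have res_smult: "cut F V (cut F U (\<lambda>W s. rst W r \<odot>\<^bsub>sec G W\<^esub> \<phi> W s)) =
      cut F V (\<lambda>W s. rst W (rst V r) \<odot>\<^bsub>sec G W\<^esub> cut F V \<phi> W s)" if "V \<subseteq> U" for U V \<phi> r
    unfolding cut_cut[OF that] by (rule cut_cong) (simp add: cut_apply rst_rst)
  show ?thesis unfolding op_presheaf_def op_closed_def
  proof (intro conjI allI impI ballI Pi_I)
    fix U \<phi> assume "open U" "\<phi> \<in> carrier (sec (hom_sheaf \<O> F G) U)"
    then show "res (hom_sheaf \<O> F G) U U \<phi> = \<phi>" by (simp add: hom_simps hom_carrier)
  next
    fix U V W :: "'a set" and \<phi> assume "open U \<and> open V \<and> open W \<and> W \<subseteq> V \<and> V \<subseteq> U"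
    then show "res (hom_sheaf \<O> F G) V W (res (hom_sheaf \<O> F G) U V \<phi>) = res (hom_sheaf \<O> F G) U W \<phi>"
      by (simp add: hom_simps cut_cut)
  next
    fix U V :: "'a set" and \<phi> \<psi> assume "open U \<and> open V \<and> V \<subseteq> U"
    then show "res (hom_sheaf \<O> F G) U V (\<phi> \<oplus>\<^bsub>sec (hom_sheaf \<O> F G) U\<^esub> \<psi>) =
        res (hom_sheaf \<O> F G) U V \<phi> \<oplus>\<^bsub>sec (hom_sheaf \<O> F G) V\<^esub> res (hom_sheaf \<O> F G) U V \<psi>"
      unfolding hom_simps by (intro res_add) simp
  next
    fix U V :: "'a set" and \<phi> r assume "open U \<and> open V \<and> V \<subseteq> U"
    then show "res (hom_sheaf \<O> F G) U V (r \<odot>\<^bsub>sec (hom_sheaf \<O> F G) U\<^esub> \<phi>) =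
        rst V r \<odot>\<^bsub>sec (hom_sheaf \<O> F G) V\<^esub> res (hom_sheaf \<O> F G) U V \<phi>"
      unfolding hom_simps by (intro res_smult) simp
  qed (use add smult res in \<open>auto simp: hom_simps(3)\<close>)
qed

lemma dual_op_presheaf: "op_presheaf \<O> F \<Longrightarrow> op_presheaf \<O> (dual_sheaf \<O> F)"
  unfolding dual_sheaf_def by (rule hom_op_presheaf[OF _ structure_presheaf])

lemma dual_mor: "\<alpha> \<in> carrier (sec (dual_sheaf \<O> F) U) \<Longrightarrow> is_mor \<O> U F (structure_sheaf \<O>) \<alpha>"
  by (simp add: dual_sheaf_def hom_carrier)

lemma dual_apply:
  assumes "\<alpha> \<in> carrier (sec (dual_sheaf \<O> F) U)" "open V" "V \<subseteq> U" "s \<in> carrier (sec F V)"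
  shows "\<alpha> V s \<in> carrier (\<O> V)"
    and "t \<in> carrier (sec F V) \<Longrightarrow> \<alpha> V (s \<oplus>\<^bsub>sec F V\<^esub> t) = \<alpha> V s \<oplus>\<^bsub>\<O> V\<^esub> \<alpha> V t"
    and "r \<in> carrier (\<O> V) \<Longrightarrow> \<alpha> V (r \<odot>\<^bsub>sec F V\<^esub> s) = r \<otimes>\<^bsub>\<O> V\<^esub> \<alpha> V s"
    and "open W \<Longrightarrow> W \<subseteq> V \<Longrightarrow> \<alpha> W (res F V W s) = rst W (\<alpha> V s)"
  using mor_closed[OF dual_mor[OF assms(1)] assms(2-4)] mor_add[OF dual_mor[OF assms(1)] assms(2-4)]
    mor_smult[OF dual_mor[OF assms(1)] assms(2,3) _ assms(4)]
    mor_res[OF dual_mor[OF assms(1)] assms(2) _ _ assms(3,4)]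
  by (simp_all add: str_simps O_add O_mult)

lemma dual_ops:
  assumes "open V" "V \<subseteq> U" "s \<in> carrier (sec F V)"
  shows "(\<alpha> \<oplus>\<^bsub>sec (dual_sheaf \<O> F) U\<^esub> \<beta>) V s = \<alpha> V s \<oplus>\<^bsub>\<O> V\<^esub> \<beta> V s"
    and "(r \<odot>\<^bsub>sec (dual_sheaf \<O> F) U\<^esub> \<alpha>) V s = rst V r \<otimes>\<^bsub>\<O> V\<^esub> \<alpha> V s"
    and "res (dual_sheaf \<O> F) W U \<alpha> V s = \<alpha> V s"
  using assms by (simp_all add: dual_sheaf_def hom_simps cut_apply str_simps O_add O_mult)

section \<open>Contraction\<close>

abbreviation "cpair F L U s \<equiv>
  (\<lambda>V. quot_lift (\<O> V) id (sec L V) (\<lambda>(\<alpha>, l). \<alpha> V (res F U V s) \<odot>\<^bsub>sec L V\<^esub> l))"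

text \<open>Pairing \<open>\<alpha> \<otimes> l\<close> with \<open>s\<close> gives
  \<open>\<alpha>(s) l\<close>, which is bilinear in \<open>(\<alpha>, l)\<close>: contraction
  before sheafification.\<close>

lemma cpair_mor:
  assumes F: "op_presheaf \<O> F" and L: "is_presheaf \<O> L" and U: "open U" and s: "s \<in> carrier (sec F U)"
  shows "is_mor \<O> U (tensor_presheaf \<O> (dual_sheaf \<O> F) L) L (cpair F L U s)"
    and "\<And>V \<alpha> l. open V \<Longrightarrow> V \<subseteq> U \<Longrightarrow> \<alpha> \<in> carrier (sec (dual_sheaf \<O> F) V) \<Longrightarrow> l \<in> carrier (sec L V) \<Longrightarrow>
      cpair F L U s V (pten (dual_sheaf \<O> F) L V \<alpha> l) = \<alpha> V (res F U V s) \<odot>\<^bsub>sec L V\<^esub> l"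
proof -
  note opL = is_presheaf_op[OF L] and dF = dual_op_presheaf[OF F]
  note rs = res_closed[OF F U _ _ s]
  let ?\<beta> = "\<lambda>V \<alpha> l. \<alpha> V (res F U V s) \<odot>\<^bsub>sec L V\<^esub> l"
  have 1: "?\<beta> V \<alpha> l \<in> carrier (sec L V)"
    if "open V" "V \<subseteq> U" "\<alpha> \<in> carrier (sec (dual_sheaf \<O> F) V)" "l \<in> carrier (sec L V)" for V \<alpha> l
    using that by (auto intro!: op_smult[OF opL] dual_apply(1) rs)
  have 2: "?\<beta> V (\<alpha> \<oplus>\<^bsub>sec (dual_sheaf \<O> F) V\<^esub> \<alpha>') l = ?\<beta> V \<alpha> l \<oplus>\<^bsub>sec L V\<^esub> ?\<beta> V \<alpha>' l"
    if "open V" "V \<subseteq> U" "\<alpha> \<in> carrier (sec (dual_sheaf \<O> F) V)" "\<alpha>' \<in> carrier (sec (dual_sheaf \<O> F) V)" "l \<in> carrier (sec L V)" for V \<alpha> \<alpha>' l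
  proof -
    interpret LV: Module.module "\<O> V" "sec L V" using presheaf_module[OF L] that by blast
    show ?thesis using that rs by (simp add: dual_ops LV.smult_l_distr dual_apply(1))
  qed
  have 3: "?\<beta> V \<alpha> (l \<oplus>\<^bsub>sec L V\<^esub> l') = ?\<beta> V \<alpha> l \<oplus>\<^bsub>sec L V\<^esub> ?\<beta> V \<alpha> l'"
    if "open V" "V \<subseteq> U" "\<alpha> \<in> carrier (sec (dual_sheaf \<O> F) V)" "l \<in> carrier (sec L V)" "l' \<in> carrier (sec L V)" for V \<alpha> l l'
  proof -
    interpret LV: Module.module "\<O> V" "sec L V" using presheaf_module[OF L] that by blast
    show ?thesis using that rs by (simp add: LV.smult_r_distr dual_apply(1))
  qed
  have 4: "?\<beta> V (r \<odot>\<^bsub>sec (dual_sheaf \<O> F) V\<^esub> \<alpha>) l = r \<odot>\<^bsub>sec L V\<^esub> ?\<beta> V \<alpha> l"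
    if "open V" "V \<subseteq> U" "r \<in> carrier (\<O> V)" "\<alpha> \<in> carrier (sec (dual_sheaf \<O> F) V)" "l \<in> carrier (sec L V)" for V r \<alpha> l
  proof -
    interpret LV: Module.module "\<O> V" "sec L V" using presheaf_module[OF L] that by blast
    show ?thesis using that rs by (simp add: dual_ops rst_id LV.smult_assoc1 dual_apply(1))
  qed
  have 5: "?\<beta> V \<alpha> (r \<odot>\<^bsub>sec L V\<^esub> l) = r \<odot>\<^bsub>sec L V\<^esub> ?\<beta> V \<alpha> l"
    if "open V" "V \<subseteq> U" "r \<in> carrier (\<O> V)" "\<alpha> \<in> carrier (sec (dual_sheaf \<O> F) V)" "l \<in> carrier (sec L V)" for V r \<alpha> l
  proof -
    interpret LV: Module.module "\<O> V" "sec L V" using presheaf_module[OF L] that by blast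
    have a: "\<alpha> V (res F U V s) \<in> carrier (\<O> V)" using that rs by (simp add: dual_apply(1))
    show ?thesis using LV.smult_assoc1[OF a that(3,5)] LV.smult_assoc1[OF that(3) a that(5)] LV.R.m_comm[OF a that(3)] by simp
  qed
  have 6: "res L V W (?\<beta> V \<alpha> l) = ?\<beta> W (res (dual_sheaf \<O> F) V W \<alpha>) (res L V W l)"
    if "open V" "open W" "W \<subseteq> V" "V \<subseteq> U" "\<alpha> \<in> carrier (sec (dual_sheaf \<O> F) V)" "l \<in> carrier (sec L V)" for V W \<alpha> l
  proof -
    have WU: "W \<subseteq> U" using that by blast
    have "\<alpha> W (res F U W s) = rst W (\<alpha> V (res F U V s))"
      using dual_apply(4)[OF that(5,1) subset_refl rs[OF that(1,4)] that(2,3)] that U s by (simp add: res_comp[OF F])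
    then show ?thesis using that rs WU
      by (simp add: res_smult[OF opL] dual_apply(1) dual_ops)
  qed
  note TL = tensor_lift[OF dF opL L U, of ?\<beta>]
  show "is_mor \<O> U (tensor_presheaf \<O> (dual_sheaf \<O> F) L) L (cpair F L U s)"
    by (rule TL(1)) (assumption | rule 1 2 3 4 5 6)+
  show "cpair F L U s V (pten (dual_sheaf \<O> F) L V \<alpha> l) = ?\<beta> V \<alpha> l"
    if V: "open V" "V \<subseteq> U" "\<alpha> \<in> carrier (sec (dual_sheaf \<O> F) V)" "l \<in> carrier (sec L V)" for V \<alpha> l
    by (rule TL(2)) (assumption | rule V 1 2 3 4 5 6)+
qed

lemma contract_alt: "contract \<O> F L U \<tau> s = sh_ext L (cpair F L U s) U \<tau>"
  by (simp add: contract_def)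

context
  fixes F :: "('a, 'f) mod_presheaf" and L :: "('a, 'l) mod_presheaf" and T
  assumes F: "op_presheaf \<O> F" and L: "is_sheaf \<O> L"
  defines "T \<equiv> tensor_presheaf \<O> (dual_sheaf \<O> F) L"
begin

lemma dual_tensor_presheaf: "is_presheaf \<O> T"
  unfolding T_def by (rule tensor_presheaf[OF dual_op_presheaf[OF F] is_presheaf_op[OF sheaf_presheaf[OF L]]])

lemma cpair_is_mor: "open U \<Longrightarrow> s \<in> carrier (sec F U) \<Longrightarrow> is_mor \<O> U T L (cpair F L U s)"
  unfolding T_def by (rule cpair_mor(1)[OF F sheaf_presheaf[OF L]])

lemma contract_mor: "open U \<Longrightarrow> s \<in> carrier (sec F U) \<Longrightarrow>
    is_mor \<O> U (sheafify T) L (sh_ext L (cpair F L U s))"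
  by (rule sh_ext_mor[OF dual_tensor_presheaf L _ cpair_is_mor])

lemma contract_closed:
  assumes "open U" "s \<in> carrier (sec F U)" "\<tau> \<in> carrier (sec (sheafify T) U)"
  shows "contract \<O> F L U \<tau> s \<in> carrier (sec L U)"
  unfolding contract_alt by (rule mor_closed[OF contract_mor[OF assms(1,2)] assms(1) _ assms(3)]) simp

lemma contract_minus:
  assumes "open U" "s \<in> carrier (sec F U)" "\<tau> \<in> carrier (sec (sheafify T) U)" "\<tau>' \<in> carrier (sec (sheafify T) U)"
  shows "contract \<O> F L U (\<tau> \<ominus>\<^bsub>sec (sheafify T) U\<^esub> \<tau>') s = contract \<O> F L U \<tau> s \<ominus>\<^bsub>sec L U\<^esub> contract \<O> F L U \<tau>' s"
  unfolding contract_alt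
  by (rule mor_minus[OF contract_mor[OF assms(1,2)] sheafify_presheaf[OF dual_tensor_presheaf] sheaf_presheaf[OF L] assms(1) _ assms(3,4)]) simp

lemma contract_local:
  assumes "open U" "s \<in> carrier (sec F U)" "\<tau> \<in> carrier (sec (sheafify T) U)"
    "open V" "V \<subseteq> U" "t \<in> carrier (sec T V)" "\<And>y. y \<in> V \<Longrightarrow> \<tau> y = germ T y V t"
  shows "res L U V (contract \<O> F L U \<tau> s) = cpair F L U s V t"
  unfolding contract_alt
  by (rule sh_ext_local(2)[OF dual_tensor_presheaf L assms(1) cpair_is_mor[OF assms(1,2)] assms(1) _ assms(3-7)]) simp

text \<open>The target is a sheaf, so a contraction is identified from its values on the presheaf
  tensors that represent \<open>\<tau>\<close> locally. Properties of the contraction thereby reduce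
  to pure tensors.\<close>

lemma contract_eqI:
  assumes U: "open U" and \<tau>: "\<tau> \<in> carrier (sec (sheafify T) U)" and a: "a \<in> carrier (sec L U)" and s: "s \<in> carrier (sec F U)"
    and loc: "\<And>V t. open V \<Longrightarrow> V \<subseteq> U \<Longrightarrow> t \<in> carrier (sec T V) \<Longrightarrow> (\<And>y. y \<in> V \<Longrightarrow> \<tau> y = germ T y V t) \<Longrightarrow>
      res L U V a = cpair F L U s V t"
  shows "contract \<O> F L U \<tau> s = a"
proof (rule sheaf_separated[OF L U contract_closed[OF U s \<tau>] a])
  fix x assume "x \<in> U"
  from sh_rep[OF dual_tensor_presheaf \<tau> this] obtain V t where V: "open V" "x \<in> V" "V \<subseteq> U" "t \<in> carrier (sec T V)" "\<And>y. y \<in> V \<Longrightarrow> \<tau> y = germ T y V t"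
    by metis
  show "\<exists>V. open V \<and> x \<in> V \<and> V \<subseteq> U \<and> res L U V (contract \<O> F L U \<tau> s) = res L U V a"
    using V contract_local[OF U s \<tau> V(1,3,4,5)] loc[OF V(1,3,4,5)] by auto
qed

lemma dual_tensor_induct [consumes 2, case_names zero pure add smult]:
  assumes "open U" "t \<in> carrier (sec T U)" "Pr \<zero>\<^bsub>sec T U\<^esub>"
    "\<And>s t. s \<in> carrier (sec (dual_sheaf \<O> F) U) \<Longrightarrow> t \<in> carrier (sec L U) \<Longrightarrow> Pr (pten (dual_sheaf \<O> F) L U s t)"
    "\<And>s t. s \<in> carrier (sec T U) \<Longrightarrow> t \<in> carrier (sec T U) \<Longrightarrow> Pr s \<Longrightarrow> Pr t \<Longrightarrow> Pr (s \<oplus>\<^bsub>sec T U\<^esub> t)"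
    "\<And>r s. r \<in> carrier (\<O> U) \<Longrightarrow> s \<in> carrier (sec T U) \<Longrightarrow> Pr s \<Longrightarrow> Pr (r \<odot>\<^bsub>sec T U\<^esub> s)"
  shows "Pr t"
  using tensor_induct[OF dual_op_presheaf[OF F] is_presheaf_op[OF sheaf_presheaf[OF L]] assms(1), of t Pr] assms(2-)
  unfolding T_def by blast

lemma cpair_add:
  assumes U: "open U" and V: "open V" "V \<subseteq> U" and s: "s \<in> carrier (sec F U)" "s' \<in> carrier (sec F U)"
    and t: "t \<in> carrier (sec T V)"
  shows "cpair F L U (s \<oplus>\<^bsub>sec F U\<^esub> s') V t = cpair F L U s V t \<oplus>\<^bsub>sec L V\<^esub> cpair F L U s' V t"
proof -
  note Lp = sheaf_presheaf[OF L]
  interpret LV: Module.module "\<O> V" "sec L V" by (rule presheaf_module[OF Lp V(1)])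
  note m = cpair_is_mor[OF U s(1)] cpair_is_mor[OF U s(2)] cpair_is_mor[OF U op_add[OF F U s]]
  note mc = mor_closed[OF m(1) V] mor_closed[OF m(2) V]
  note ma = mor_add[OF m(1) V] mor_add[OF m(2) V] mor_add[OF m(3) V]
  note ms = mor_smult[OF m(1) V] mor_smult[OF m(2) V] mor_smult[OF m(3) V]
  note mz = mor_zero[OF m(1) dual_tensor_presheaf Lp V] mor_zero[OF m(2) dual_tensor_presheaf Lp V] mor_zero[OF m(3) dual_tensor_presheaf Lp V]
  note mp = cpair_mor(2)[OF F Lp U s(1) V] cpair_mor(2)[OF F Lp U s(2) V] cpair_mor(2)[OF F Lp U op_add[OF F U s] V]
  show ?thesis using V(1) t
  proof (induction rule: dual_tensor_induct)
    case zero
    show ?case by (simp only: mz LV.M.l_zero LV.M.zero_closed)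
  next
    case (pure \<alpha> l)
    note rs = res_closed[OF F U V s(1)] res_closed[OF F U V s(2)]
    show ?case unfolding mp[OF pure]
      by (simp only: res_add[OF F U V s] dual_apply(2)[OF pure(1) V(1) subset_refl rs]
        LV.smult_l_distr[OF dual_apply(1)[OF pure(1) V(1) subset_refl rs(1)] dual_apply(1)[OF pure(1) V(1) subset_refl rs(2)] pure(2)])
  next
    case (add t t')
    show ?case
      by (simp only: ma[OF add(1,2)] add(3,4) LV.M.a_assoc LV.M.a_lcomm mc[OF add(1)] mc[OF add(2)] LV.M.a_closed)
  next
    case (smult r t)
    show ?case
      by (simp only: ms[OF smult(1,2)] smult(3) LV.smult_r_distr[OF smult(1) mc[OF smult(2)]])
  qed
qed

lemma cpair_smult:
  assumes U: "open U" and V: "open V" "V \<subseteq> U" and a: "a \<in> carrier (\<O> U)" and s: "s \<in> carrier (sec F U)"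
    and t: "t \<in> carrier (sec T V)"
  shows "cpair F L U (a \<odot>\<^bsub>sec F U\<^esub> s) V t = rst V a \<odot>\<^bsub>sec L V\<^esub> cpair F L U s V t"
proof -
  note Lp = sheaf_presheaf[OF L]
  interpret LV: Module.module "\<O> V" "sec L V" by (rule presheaf_module[OF Lp V(1)])
  note m = cpair_is_mor[OF U s] cpair_is_mor[OF U op_smult[OF F U a s]]
  note mc = mor_closed[OF m(1) V]
  note ma = mor_add[OF m(1) V] mor_add[OF m(2) V]
  note ms = mor_smult[OF m(1) V] mor_smult[OF m(2) V]
  note mz = mor_zero[OF m(1) dual_tensor_presheaf Lp V] mor_zero[OF m(2) dual_tensor_presheaf Lp V]
  note mp = cpair_mor(2)[OF F Lp U s V] cpair_mor(2)[OF F Lp U op_smult[OF F U a s] V]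
  note aV = O_rst[OF U V a]
  show ?thesis using V(1) t
  proof (induction rule: dual_tensor_induct)
    case zero
    show ?case by (simp only: mz LV.smult_r_null[OF aV])
  next
    case (pure \<alpha> l)
    note rs = res_closed[OF F U V s]
    show ?case unfolding mp[OF pure]
      by (simp only: res_smult[OF F U V a s] dual_apply(3)[OF pure(1) V(1) subset_refl rs aV]
        LV.smult_assoc1[OF aV dual_apply(1)[OF pure(1) V(1) subset_refl rs] pure(2)])
  next
    case (add t t')
    show ?case
      by (simp only: ma[OF add(1,2)] add(3,4) LV.smult_r_distr[OF aV mc[OF add(1)] mc[OF add(2)]])
  next
    case (smult r t)
    show ?case
      by (simp only: ms[OF smult(1,2)] smult(3) LV.smult_assoc1[OF aV smult(1) mc[OF smult(2)], symmetric]
        LV.smult_assoc1[OF smult(1) aV mc[OF smult(2)], symmetric] LV.R.m_comm[OF aV smult(1)])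
  qed
qed

lemma contract_add2:
  assumes U: "open U" and s: "s \<in> carrier (sec F U)" "s' \<in> carrier (sec F U)" and \<tau>: "\<tau> \<in> carrier (sec (sheafify T) U)"
  shows "contract \<O> F L U \<tau> (s \<oplus>\<^bsub>sec F U\<^esub> s') = contract \<O> F L U \<tau> s \<oplus>\<^bsub>sec L U\<^esub> contract \<O> F L U \<tau> s'"
proof (rule contract_eqI[OF U \<tau> _ op_add[OF F U s]])
  note opL = is_presheaf_op[OF sheaf_presheaf[OF L]]
  note c = contract_closed[OF U s(1) \<tau>] contract_closed[OF U s(2) \<tau>]
  show "contract \<O> F L U \<tau> s \<oplus>\<^bsub>sec L U\<^esub> contract \<O> F L U \<tau> s' \<in> carrier (sec L U)" by (rule op_add[OF opL U c])
  fix V t assume V: "open V" "V \<subseteq> U" "t \<in> carrier (sec T V)" "\<And>y. y \<in> V \<Longrightarrow> \<tau> y = germ T y V t"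
  show "res L U V (contract \<O> F L U \<tau> s \<oplus>\<^bsub>sec L U\<^esub> contract \<O> F L U \<tau> s') = cpair F L U (s \<oplus>\<^bsub>sec F U\<^esub> s') V t"
    by (simp only: res_add[OF opL U V(1,2) c] contract_local[OF U s(1) \<tau> V] contract_local[OF U s(2) \<tau> V]
      cpair_add[OF U V(1,2) s V(3)])
qed

lemma contract_smult2:
  assumes U: "open U" and a: "a \<in> carrier (\<O> U)" and s: "s \<in> carrier (sec F U)" and \<tau>: "\<tau> \<in> carrier (sec (sheafify T) U)"
  shows "contract \<O> F L U \<tau> (a \<odot>\<^bsub>sec F U\<^esub> s) = a \<odot>\<^bsub>sec L U\<^esub> contract \<O> F L U \<tau> s"
proof (rule contract_eqI[OF U \<tau> _ op_smult[OF F U a s]])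
  note opL = is_presheaf_op[OF sheaf_presheaf[OF L]]
  note c = contract_closed[OF U s \<tau>]
  show "a \<odot>\<^bsub>sec L U\<^esub> contract \<O> F L U \<tau> s \<in> carrier (sec L U)" by (rule op_smult[OF opL U a c])
  fix V t assume V: "open V" "V \<subseteq> U" "t \<in> carrier (sec T V)" "\<And>y. y \<in> V \<Longrightarrow> \<tau> y = germ T y V t"
  show "res L U V (a \<odot>\<^bsub>sec L U\<^esub> contract \<O> F L U \<tau> s) = cpair F L U (a \<odot>\<^bsub>sec F U\<^esub> s) V t"
    by (simp only: res_smult[OF opL U V(1,2) a c] contract_local[OF U s \<tau> V] cpair_smult[OF U V(1,2) a s V(3)])
qed

lemma contract_res:
  assumes U: "open U" "open U'" "U' \<subseteq> U" and s: "s \<in> carrier (sec F U)" and \<tau>: "\<tau> \<in> carrier (sec (sheafify T) U)"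
  shows "contract \<O> F L U' (restrict \<tau> U') (res F U U' s) = res L U U' (contract \<O> F L U \<tau> s)"
proof (rule contract_eqI[OF U(2) sh_res_closed[OF dual_tensor_presheaf \<tau> U(2,3)] _ res_closed[OF F U s]])
  note opL = is_presheaf_op[OF sheaf_presheaf[OF L]]
  note c = contract_closed[OF U(1) s \<tau>]
  show "res L U U' (contract \<O> F L U \<tau> s) \<in> carrier (sec L U')" by (rule res_closed[OF opL U c])
  fix V t assume V: "open V" "V \<subseteq> U'" "t \<in> carrier (sec T V)" "\<And>y. y \<in> V \<Longrightarrow> restrict \<tau> U' y = germ T y V t"
  have VU: "V \<subseteq> U" using V U by auto
  have \<tau>V: "\<And>y. y \<in> V \<Longrightarrow> \<tau> y = germ T y V t" using V(2,4) by (auto simp: subset_iff)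
  show "res L U' V (res L U U' (contract \<O> F L U \<tau> s)) = cpair F L U' (res F U U' s) V t"
    by (simp only: res_comp[OF opL U(1,2) V(1,2) U(3) c] contract_local[OF U(1) s \<tau> V(1) VU V(3) \<tau>V]
      res_comp[OF F U(1,2) V(1,2) U(3) s])
qed

end

lemma tensor_map_pre:
  assumes F: "op_presheaf \<O> F" and G: "op_presheaf \<O> G" and G': "op_presheaf \<O> G'" and \<phi>: "is_mor \<O> UNIV G G' \<phi>"
  shows "is_mor \<O> UNIV (tensor_presheaf \<O> F G) (tensor_presheaf \<O> F G')
      (\<lambda>V. quot_lift (\<O> V) id (tensor_mod (\<O> V) (sec F V) (sec G' V)) (\<lambda>(s, t). pten F G' V s (\<phi> V t)))"
    and "\<And>V s t. open V \<Longrightarrow> s \<in> carrier (sec F V) \<Longrightarrow> t \<in> carrier (sec G V) \<Longrightarrow>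
      quot_lift (\<O> V) id (tensor_mod (\<O> V) (sec F V) (sec G' V)) (\<lambda>(s, t). pten F G' V s (\<phi> V t)) (pten F G V s t) =
      pten F G' V s (\<phi> V t)"
proof -
  note c = pure_tensor_closed pure_tensor_add1 pure_tensor_add2 pure_tensor_smult1 pure_tensor_smult2
  note TL = tensor_lift[OF F G tensor_presheaf[OF F G'] open_UNIV, of "\<lambda>V s t. pten F G' V s (\<phi> V t)", unfolded sec_tensor]
  note m = mor_closed[OF \<phi> _ subset_UNIV] mor_add[OF \<phi> _ subset_UNIV] mor_smult[OF \<phi> _ subset_UNIV] mor_res[OF \<phi> _ _ _ subset_UNIV]
  show "is_mor \<O> UNIV (tensor_presheaf \<O> F G) (tensor_presheaf \<O> F G')
      (\<lambda>V. quot_lift (\<O> V) id (tensor_mod (\<O> V) (sec F V) (sec G' V)) (\<lambda>(s, t). pten F G' V s (\<phi> V t)))"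
    by (rule TL(1)) (simp_all add: c cring_O op_closed_sec[OF F] op_closed_sec[OF G'] m res_tensor[OF F G'])
  show "quot_lift (\<O> V) id (tensor_mod (\<O> V) (sec F V) (sec G' V)) (\<lambda>(s, t). pten F G' V s (\<phi> V t)) (pten F G V s t) =
      pten F G' V s (\<phi> V t)" if V: "open V" "s \<in> carrier (sec F V)" "t \<in> carrier (sec G V)" for V s t
    by (rule TL(2)) (simp_all add: V c cring_O op_closed_sec[OF F] op_closed_sec[OF G'] m res_tensor[OF F G'])
qed

lemma tensor_map_mor:
  assumes F: "op_presheaf \<O> F" and G: "op_presheaf \<O> G" and G': "op_presheaf \<O> G'" and \<phi>: "is_mor \<O> UNIV G G' \<phi>"
  shows "is_mor \<O> UNIV (tensor_sheaf \<O> F G) (tensor_sheaf \<O> F G') (tensor_map \<O> F G G' \<phi>)"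
  unfolding tensor_map_def tensor_sheaf_def
  by (rule sh_map_mor[OF tensor_presheaf[OF F G] tensor_presheaf[OF F G'] tensor_map_pre(1)[OF assms]])

text \<open>Contraction is natural in the second factor: on a pure tensor both sides are
  \<open>\<phi>(\<alpha>(s) l) = \<alpha>(s) \<phi>(l)\<close>.\<close>

lemma contract_map:
  assumes F: "op_presheaf \<O> F" and L: "is_sheaf \<O> L" and L': "is_sheaf \<O> L'" and \<phi>: "is_mor \<O> UNIV L L' \<phi>"
    and U: "open U" and s: "s \<in> carrier (sec F U)" and \<tau>: "\<tau> \<in> carrier (sec (tensor_sheaf \<O> (dual_sheaf \<O> F) L) U)"
  shows "contract \<O> F L' U (tensor_map \<O> (dual_sheaf \<O> F) L L' \<phi> U \<tau>) s = \<phi> U (contract \<O> F L U \<tau> s)"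
proof (rule sheaf_separated[OF L' U])
  note Lp = sheaf_presheaf[OF L] and Lp' = sheaf_presheaf[OF L']
  note opL = is_presheaf_op[OF Lp] and opL' = is_presheaf_op[OF Lp'] and dF = dual_op_presheaf[OF F]
  let ?T = "tensor_presheaf \<O> (dual_sheaf \<O> F) L" and ?T' = "tensor_presheaf \<O> (dual_sheaf \<O> F) L'"
  let ?m = "\<lambda>V. quot_lift (\<O> V) id (tensor_mod (\<O> V) (sec (dual_sheaf \<O> F) V) (sec L' V))
      (\<lambda>(s, t). pten (dual_sheaf \<O> F) L' V s (\<phi> V t))"
  note mm = tensor_map_pre[OF dF opL opL' \<phi>]
  have \<tau>': "\<tau> \<in> carrier (sec (sheafify ?T) U)" using \<tau> by (simp add: tensor_sheaf_def)
  note c = contract_closed[OF F L U s \<tau>']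
  have mt: "tensor_map \<O> (dual_sheaf \<O> F) L L' \<phi> U \<tau> \<in> carrier (sec (sheafify ?T') U)"
    using mor_closed[OF tensor_map_mor[OF dF opL opL' \<phi>] U subset_UNIV \<tau>] by (simp add: tensor_sheaf_def)
  show "contract \<O> F L' U (tensor_map \<O> (dual_sheaf \<O> F) L L' \<phi> U \<tau>) s \<in> carrier (sec L' U)"
    by (rule contract_closed[OF F L' U s mt])
  show "\<phi> U (contract \<O> F L U \<tau> s) \<in> carrier (sec L' U)" by (rule mor_closed[OF \<phi> U subset_UNIV c])
  fix x assume "x \<in> U"
  note TT = dual_tensor_presheaf[OF F L] and TT' = dual_tensor_presheaf[OF F L']
  from sh_rep[OF TT \<tau>' \<open>x \<in> U\<close>] obtain V t where
    V: "open V" "x \<in> V" "V \<subseteq> U" "t \<in> carrier (sec ?T V)" "\<And>y. y \<in> V \<Longrightarrow> \<tau> y = germ ?T y V t" by metis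
  have mV: "tensor_map \<O> (dual_sheaf \<O> F) L L' \<phi> U \<tau> y = germ ?T' y V (?m V t)" if "y \<in> V" for y
    unfolding tensor_map_def
    by (rule sh_map_at[where f=\<tau>, OF TT TT' mm(1) V(1) that V(4) V(5)[OF that]]) (use that V in auto)
  note cl = mor_closed[OF mm(1) V(1) subset_UNIV]
  have "cpair F L' U s V (?m V t) = \<phi> V (cpair F L U s V t)"
  proof -
    define \<mu> where "\<mu> = ?m"
    define q where "q = cpair F L U s"
    define q' where "q' = cpair F L' U s"
    note m' = mm(1)[folded \<mu>_def]
    note mq = cpair_is_mor[OF F L U s, folded q_def] and mq' = cpair_is_mor[OF F L' U s, folded q'_def]
    have qp: "q V (pten (dual_sheaf \<O> F) L V \<alpha> l) = \<alpha> V (res F U V s) \<odot>\<^bsub>sec L V\<^esub> l"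
      if "\<alpha> \<in> carrier (sec (dual_sheaf \<O> F) V)" "l \<in> carrier (sec L V)" for \<alpha> l
      using cpair_mor(2)[OF F Lp U s V(1,3) that] by (simp only: q_def)
    have qp': "q' V (pten (dual_sheaf \<O> F) L' V \<alpha> l) = \<alpha> V (res F U V s) \<odot>\<^bsub>sec L' V\<^esub> l"
      if "\<alpha> \<in> carrier (sec (dual_sheaf \<O> F) V)" "l \<in> carrier (sec L' V)" for \<alpha> l
      using cpair_mor(2)[OF F Lp' U s V(1,3) that] by (simp only: q'_def)
    have mp: "\<mu> V (pten (dual_sheaf \<O> F) L V \<alpha> l) = pten (dual_sheaf \<O> F) L' V \<alpha> (\<phi> V l)"
      if "\<alpha> \<in> carrier (sec (dual_sheaf \<O> F) V)" "l \<in> carrier (sec L V)" for \<alpha> l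
      using mm(2)[OF V(1) that] by (simp only: \<mu>_def)
    note \<mu>c = mor_closed[OF m' V(1) subset_UNIV] and qc = mor_closed[OF mq V(1,3)]
    have "q' V (\<mu> V t) = \<phi> V (q V t)"
    proof (rule dual_tensor_induct[OF F L V(1) V(4)], goal_cases zero pure add smult)
      case zero
      show ?case by (simp only: mor_zero[OF m' TT TT' V(1) subset_UNIV] mor_zero[OF mq' TT' Lp' V(1,3)]
        mor_zero[OF mq TT Lp V(1,3)] mor_zero[OF \<phi> Lp Lp' V(1) subset_UNIV])
    next
      case (pure \<alpha> l)
      have a: "\<alpha> V (res F U V s) \<in> carrier (\<O> V)"
        by (rule dual_apply(1)[OF pure(1) V(1) subset_refl res_closed[OF F U V(1,3) s]])
      show ?case by (simp only: mp[OF pure] qp[OF pure] qp'[OF pure(1) mor_closed[OF \<phi> V(1) subset_UNIV pure(2)]]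
        mor_smult[OF \<phi> V(1) subset_UNIV a pure(2)])
    next
      case (add t t')
      show ?case by (simp only: mor_add[OF m' V(1) subset_UNIV add(1,2)] mor_add[OF mq V(1,3) add(1,2)]
        mor_add[OF mq' V(1,3) \<mu>c[OF add(1)] \<mu>c[OF add(2)]]
        mor_add[OF \<phi> V(1) subset_UNIV qc[OF add(1)] qc[OF add(2)]] add(3,4))
    next
      case (smult r t)
      show ?case by (simp only: mor_smult[OF m' V(1) subset_UNIV smult(1,2)] mor_smult[OF mq V(1,3) smult(1,2)]
        mor_smult[OF mq' V(1,3) smult(1) \<mu>c[OF smult(2)]]
        mor_smult[OF \<phi> V(1) subset_UNIV smult(1) qc[OF smult(2)]] smult(3))
    qed
    then show ?thesis by (simp only: \<mu>_def q_def q'_def)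
  qed
  then have "res L' U V (contract \<O> F L' U (tensor_map \<O> (dual_sheaf \<O> F) L L' \<phi> U \<tau>) s) =
      res L' U V (\<phi> U (contract \<O> F L U \<tau> s))"
    by (simp only: contract_local[OF F L' U s mt V(1,3) cl[OF V(4)] mV] mor_res[OF \<phi> U V(1,3) subset_UNIV c, symmetric]
      contract_local[OF F L U s \<tau>' V(1,3,4,5)])
  then show "\<exists>V. open V \<and> x \<in> V \<and> V \<subseteq> U \<and> res L' U V (contract \<O> F L' U (tensor_map \<O> (dual_sheaf \<O> F) L L' \<phi> U \<tau>) s) =
      res L' U V (\<phi> U (contract \<O> F L U \<tau> s))" using V by blast
qed

section \<open>Twisting by an effective divisor\<close>

context
  fixes D :: "'a ideal_sheaf"
  assumes D: "effective_divisor \<O> D"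
begin

lemma D_ideal: "open U \<Longrightarrow> ideal (D U) (\<O> U)"
  using D unfolding effective_divisor_def by (elim conjE) simp

lemma D_sub: "open U \<Longrightarrow> f \<in> D U \<Longrightarrow> f \<in> carrier (\<O> U)"
  using ideal.Icarr[OF D_ideal] .

lemma D_rst: "open U \<Longrightarrow> open V \<Longrightarrow> V \<subseteq> U \<Longrightarrow> f \<in> D U \<Longrightarrow> rst V f \<in> D V"
  using D unfolding effective_divisor_def by (elim conjE) (simp add: image_subset_iff)

lemma ideal_module_simps:
  "carrier (sec (ideal_module \<O> D) U) = D U"
  "f \<oplus>\<^bsub>sec (ideal_module \<O> D) U\<^esub> g = (\<lambda>x. f x + g x)"
  "f \<odot>\<^bsub>sec (ideal_module \<O> D) U\<^esub> g = (\<lambda>x. f x * g x)"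
  "res (ideal_module \<O> D) U V = rst V"
  by (simp_all add: ideal_module_def structure_sheaf_def O_add O_mult)

lemma ideal_op_presheaf: "op_presheaf \<O> (ideal_module \<O> D)"
proof -
  have add: "(\<lambda>x. f x + g x) \<in> D U" if "open U" "f \<in> D U" "g \<in> D U" for U f g
  proof -
    show ?thesis using additive_subgroup.a_closed[OF ideal.axioms(1)[OF D_ideal[OF that(1)]] that(2,3)] by (simp add: O_add)
  qed
  have smult: "(\<lambda>x. r x * f x) \<in> D U" if "open U" "r \<in> carrier (\<O> U)" "f \<in> D U" for U r f
    using ideal.I_l_closed[OF D_ideal[OF that(1)] that(3,2)] by (simp add: O_mult)
  show ?thesis unfolding op_presheaf_def op_closed_def ideal_module_simps
    by (auto simp: add smult D_rst rst_rst rst_id[OF D_sub]) (auto simp: rst_def)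
qed

lemma divisor_op_presheaf: "op_presheaf \<O> (divisor_sheaf \<O> D)"
  unfolding divisor_sheaf_def by (rule dual_op_presheaf[OF ideal_op_presheaf])

lemma canonical_closed: "open U \<Longrightarrow> canonical_section \<O> D U \<in> carrier (sec (divisor_sheaf \<O> D) U)"
proof -
  assume U: "open U"
  have "is_mor \<O> U (ideal_module \<O> D) (structure_sheaf \<O>) (\<lambda>V f. f)"
    unfolding is_mor_def mod_homs_def by (auto simp: ideal_module_simps str_simps D_sub)
  then show ?thesis unfolding divisor_sheaf_def dual_sheaf_def hom_carrier canonical_section_def
    by (auto simp: cut_cut intro: is_mor_cut[OF ideal_op_presheaf])
qed

lemma canonical_res: "V \<subseteq> U \<Longrightarrow> res (divisor_sheaf \<O> D) U V (canonical_section \<O> D U) = canonical_section \<O> D V"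
  by (simp add: divisor_sheaf_def dual_sheaf_def hom_simps canonical_section_def cut_cut)

lemma canonical_apply: "open V \<Longrightarrow> f \<in> D V \<Longrightarrow> canonical_section \<O> D V V f = f"
  by (simp add: canonical_section_def cut_apply ideal_module_simps)

context
  fixes L :: "('a, 'l) mod_presheaf"
  assumes L: "is_sheaf \<O> L"
begin

lemma twist_pre: "is_presheaf \<O> (tensor_presheaf \<O> L (divisor_sheaf \<O> D))"
  by (rule tensor_presheaf[OF is_presheaf_op[OF sheaf_presheaf[OF L]] divisor_op_presheaf])

lemma twist_sheaf: "is_sheaf \<O> (twist \<O> L D)"
  unfolding twist_def tensor_sheaf_def by (rule sheafify_sheaf[OF twist_pre])

lemma twist_incl_mor: "is_mor \<O> UNIV L (twist \<O> L D) (twist_incl \<O> L D)"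
proof -
  note opL = is_presheaf_op[OF sheaf_presheaf[OF L]] and dD = divisor_op_presheaf
  let ?P = "tensor_presheaf \<O> L (divisor_sheaf \<O> D)"
  have "is_mor \<O> UNIV L ?P (\<lambda>U l. pten L (divisor_sheaf \<O> D) U l (canonical_section \<O> D U))"
    unfolding is_mor_def mod_homs_def
    by (auto simp: pten_closed[OF opL dD] canonical_closed res_tensor[OF opL dD] canonical_res sec_tensor
        pure_tensor_add1[OF cring_O op_closed_sec[OF opL] op_closed_sec[OF dD]]
        pure_tensor_smult1[OF cring_O op_closed_sec[OF opL] op_closed_sec[OF dD]]
        pure_tensor_closed[OF cring_O op_closed_sec[OF opL] op_closed_sec[OF dD]])
  note m = this and u = sh_unit_mor[OF twist_pre]
  show ?thesis unfolding is_mor_def mod_homs_def twist_def tensor_sheaf_def twist_incl_def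
  proof (intro conjI allI impI CollectI ballI funcsetI)
    fix V :: "'a set" assume V: "open V \<and> V \<subseteq> UNIV"
    then have o: "open V" by simp
    note mc = mor_closed[OF m o subset_UNIV]
    {
      fix l assume l: "l \<in> carrier (sec L V)"
      show "sh_unit ?P V (pten L (divisor_sheaf \<O> D) V l (canonical_section \<O> D V)) \<in> carrier (sec (sheafify ?P) V)"
        by (rule sh_unit_closed[OF twist_pre o mc[OF l]])
      fix l' assume l': "l' \<in> carrier (sec L V)"
      show "sh_unit ?P V (pten L (divisor_sheaf \<O> D) V (l \<oplus>\<^bsub>sec L V\<^esub> l') (canonical_section \<O> D V)) =
        sh_unit ?P V (pten L (divisor_sheaf \<O> D) V l (canonical_section \<O> D V)) \<oplus>\<^bsub>sec (sheafify ?P) V\<^esub>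
        sh_unit ?P V (pten L (divisor_sheaf \<O> D) V l' (canonical_section \<O> D V))"
        by (simp only: mor_add[OF m o subset_UNIV l l'] mor_add[OF u o subset_UNIV mc[OF l] mc[OF l']])
    next
      fix r l assume r: "r \<in> carrier (\<O> V)" and l: "l \<in> carrier (sec L V)"
      show "sh_unit ?P V (pten L (divisor_sheaf \<O> D) V (r \<odot>\<^bsub>sec L V\<^esub> l) (canonical_section \<O> D V)) =
        r \<odot>\<^bsub>sec (sheafify ?P) V\<^esub> sh_unit ?P V (pten L (divisor_sheaf \<O> D) V l (canonical_section \<O> D V))"
        by (simp only: mor_smult[OF m o subset_UNIV r l] mor_smult[OF u o subset_UNIV r mc[OF l]])
    }
  next
    fix V W :: "'a set" and l assume V: "open V \<and> open W \<and> W \<subseteq> V \<and> V \<subseteq> UNIV" and l: "l \<in> carrier (sec L V)"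
    then have o: "open V" "open W" "W \<subseteq> V" by simp_all
    show "sh_unit ?P W (pten L (divisor_sheaf \<O> D) W (res L V W l) (canonical_section \<O> D W)) =
      res (sheafify ?P) V W (sh_unit ?P V (pten L (divisor_sheaf \<O> D) V l (canonical_section \<O> D V)))"
      by (simp only: mor_res[OF m o subset_UNIV l] mor_res[OF u o subset_UNIV mor_closed[OF m o(1) subset_UNIV l]])
  qed
qed

text \<open>A section of \<open>\<O>(D)\<close> is a homomorphism from the ideal of
  \<open>D\<close>, so it can be evaluated at an element \<open>f\<close> of the ideal; this gives a
  map \<open>L(D) \<rightarrow> L\<close>. The canonical section is the inclusion of the ideal,
  whose value at \<open>f\<close> is \<open>f\<close>. For a local equation \<open>f\<close> this
  serves to clear denominators.\<close>

lemma twist_eval: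
  assumes V: "open V" and f: "f \<in> D V"
  obtains \<epsilon> where "is_mor \<O> V (twist \<O> L D) L \<epsilon>"
    "\<And>l. l \<in> carrier (sec L V) \<Longrightarrow> \<epsilon> V (twist_incl \<O> L D V l) = f \<odot>\<^bsub>sec L V\<^esub> l"
proof -
  note Lp = sheaf_presheaf[OF L] note opL = is_presheaf_op[OF Lp] and dD = divisor_op_presheaf
  note rf = D_rst[OF V _ _ f]
  let ?I = "ideal_module \<O> D"
  let ?\<beta> = "\<lambda>W l \<alpha>. \<alpha> W (rst W f) \<odot>\<^bsub>sec L W\<^esub> l"
  have ap: "\<alpha> W (rst W f) \<in> carrier (\<O> W)"
    if "open W" "W \<subseteq> V" "\<alpha> \<in> carrier (sec (divisor_sheaf \<O> D) W)" for W \<alpha>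
    using that rf unfolding divisor_sheaf_def by (auto intro: dual_apply(1)[of \<alpha> ?I W W] simp: ideal_module_simps)
  have ops: "(\<alpha> \<oplus>\<^bsub>sec (divisor_sheaf \<O> D) W\<^esub> \<alpha>') W (rst W f) = \<alpha> W (rst W f) \<oplus>\<^bsub>\<O> W\<^esub> \<alpha>' W (rst W f)"
    "r \<in> carrier (\<O> W) \<Longrightarrow> (r \<odot>\<^bsub>sec (divisor_sheaf \<O> D) W\<^esub> \<alpha>) W (rst W f) = r \<otimes>\<^bsub>\<O> W\<^esub> \<alpha> W (rst W f)"
    if "open W" "W \<subseteq> V" for W \<alpha> \<alpha>' r
    using that rf unfolding divisor_sheaf_def by (simp_all add: dual_ops[of W W _ ?I] ideal_module_simps rst_id)
  have nat: "(res (divisor_sheaf \<O> D) W W' \<alpha>) W' (rst W' f) = rst W' (\<alpha> W (rst W f))"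
    if "open W" "open W'" "W' \<subseteq> W" "W \<subseteq> V" "\<alpha> \<in> carrier (sec (divisor_sheaf \<O> D) W)" for W W' \<alpha>
    using that rf dual_apply(4)[of \<alpha> ?I W W "rst W f" W'] unfolding divisor_sheaf_def
    by (simp add: dual_ops[of W' W' _ ?I] ideal_module_simps rst_rst)
  have 1: "?\<beta> W l \<alpha> \<in> carrier (sec L W)"
    if "open W" "W \<subseteq> V" "l \<in> carrier (sec L W)" "\<alpha> \<in> carrier (sec (divisor_sheaf \<O> D) W)" for W \<alpha> l
    using that by (auto intro!: op_smult[OF opL] ap)
  have 2: "?\<beta> W (l \<oplus>\<^bsub>sec L W\<^esub> l') \<alpha> = ?\<beta> W l \<alpha> \<oplus>\<^bsub>sec L W\<^esub> ?\<beta> W l' \<alpha>"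
    if "open W" "W \<subseteq> V" "l \<in> carrier (sec L W)" "l' \<in> carrier (sec L W)" "\<alpha> \<in> carrier (sec (divisor_sheaf \<O> D) W)" for W \<alpha> l l'
    using Module.module.smult_r_distr[OF presheaf_module[OF Lp that(1)] ap[OF that(1,2,5)] that(3,4)] .
  have 3: "?\<beta> W l (\<alpha> \<oplus>\<^bsub>sec (divisor_sheaf \<O> D) W\<^esub> \<alpha>') = ?\<beta> W l \<alpha> \<oplus>\<^bsub>sec L W\<^esub> ?\<beta> W l \<alpha>'"
    if "open W" "W \<subseteq> V" "l \<in> carrier (sec L W)" "\<alpha> \<in> carrier (sec (divisor_sheaf \<O> D) W)"
      "\<alpha>' \<in> carrier (sec (divisor_sheaf \<O> D) W)" for W \<alpha> \<alpha>' l
    using Module.module.smult_l_distr[OF presheaf_module[OF Lp that(1)] ap[OF that(1,2,4)] ap[OF that(1,2,5)] that(3)]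
    by (simp add: ops[OF that(1,2)])
  have 4: "?\<beta> W (r \<odot>\<^bsub>sec L W\<^esub> l) \<alpha> = r \<odot>\<^bsub>sec L W\<^esub> ?\<beta> W l \<alpha>"
    if "open W" "W \<subseteq> V" "r \<in> carrier (\<O> W)" "l \<in> carrier (sec L W)" "\<alpha> \<in> carrier (sec (divisor_sheaf \<O> D) W)" for W r \<alpha> l
  proof -
    interpret LW: Module.module "\<O> W" "sec L W" by (rule presheaf_module[OF Lp that(1)])
    note a = ap[OF that(1,2,5)]
    show ?thesis using LW.smult_assoc1[OF a that(3,4)] LW.smult_assoc1[OF that(3) a that(4)] LW.R.m_comm[OF a that(3)] by simp
  qed
  have 5: "?\<beta> W l (r \<odot>\<^bsub>sec (divisor_sheaf \<O> D) W\<^esub> \<alpha>) = r \<odot>\<^bsub>sec L W\<^esub> ?\<beta> W l \<alpha>"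
    if "open W" "W \<subseteq> V" "r \<in> carrier (\<O> W)" "l \<in> carrier (sec L W)" "\<alpha> \<in> carrier (sec (divisor_sheaf \<O> D) W)" for W r \<alpha> l
    using Module.module.smult_assoc1[OF presheaf_module[OF Lp that(1)] that(3) ap[OF that(1,2,5)] that(4)]
    by (simp add: ops[OF that(1,2)] that(3))
  have 6: "res L W W' (?\<beta> W l \<alpha>) = ?\<beta> W' (res L W W' l) (res (divisor_sheaf \<O> D) W W' \<alpha>)"
    if "open W" "open W'" "W' \<subseteq> W" "W \<subseteq> V" "l \<in> carrier (sec L W)" "\<alpha> \<in> carrier (sec (divisor_sheaf \<O> D) W)" for W W' \<alpha> l
    using that by (simp add: res_smult[OF opL _ _ _ ap] nat)
  note TL = tensor_lift[OF opL dD Lp V, of ?\<beta>]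
  define \<psi> where "\<psi> = (\<lambda>W. quot_lift (\<O> W) id (sec L W) (\<lambda>(l, \<alpha>). ?\<beta> W l \<alpha>))"
  have m: "is_mor \<O> V (tensor_presheaf \<O> L (divisor_sheaf \<O> D)) L \<psi>"
    unfolding \<psi>_def by (rule TL(1)) (assumption | rule 1 2 3 4 5 6)+
  have val: "\<psi> V (pten L (divisor_sheaf \<O> D) V l \<alpha>) = ?\<beta> V l \<alpha>"
    if "l \<in> carrier (sec L V)" "\<alpha> \<in> carrier (sec (divisor_sheaf \<O> D) V)" for l \<alpha>
    unfolding \<psi>_def by (rule TL(2)) (assumption | rule V subset_refl that 1 2 3 4 5 6)+
  show ?thesis
  proof (rule that[of "sh_ext L \<psi>"])
    show "is_mor \<O> V (twist \<O> L D) L (sh_ext L \<psi>)"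
      unfolding twist_def tensor_sheaf_def by (rule sh_ext_mor[OF twist_pre L V m])
    fix l assume l: "l \<in> carrier (sec L V)"
    have "sh_ext L \<psi> V (twist_incl \<O> L D V l) = \<psi> V (pten L (divisor_sheaf \<O> D) V l (canonical_section \<O> D V))"
      unfolding twist_incl_def
      by (rule sh_ext_unit[OF twist_pre L V m V subset_refl pten_closed[OF opL dD V l canonical_closed[OF V]]])
    also have "\<dots> = f \<odot>\<^bsub>sec L V\<^esub> l"
      using val[OF l canonical_closed[OF V]] canonical_apply[OF V f] D_sub[OF V f] by (simp add: rst_id)
    finally show "sh_ext L \<psi> V (twist_incl \<O> L D V l) = f \<odot>\<^bsub>sec L V\<^esub> l" .
  qed
qed

end

end

end

section \<open>Alternating multilinear maps\<close>

locale alternating = M: Module.module R M + T: Module.module R T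
  for R :: "('r, 'x) ring_scheme" and M :: "('r, 's) module" and T :: "('r, 't) module" +
  fixes k :: nat and m :: "'s list \<Rightarrow> 't"
  assumes m_closed: "xs \<in> ext_gens k M \<Longrightarrow> m xs \<in> carrier T"
    and m_add: "xs @ s # ys \<in> ext_gens k M \<Longrightarrow> t \<in> carrier M \<Longrightarrow>
      m (xs @ (s \<oplus>\<^bsub>M\<^esub> t) # ys) = m (xs @ s # ys) \<oplus>\<^bsub>T\<^esub> m (xs @ t # ys)"
    and m_smult: "xs @ s # ys \<in> ext_gens k M \<Longrightarrow> r \<in> carrier R \<Longrightarrow>
      m (xs @ (r \<odot>\<^bsub>M\<^esub> s) # ys) = r \<odot>\<^bsub>T\<^esub> m (xs @ s # ys)"
    and m_alt: "xs \<in> ext_gens k M \<Longrightarrow> \<not> distinct xs \<Longrightarrow> m xs = \<zero>\<^bsub>T\<^esub>"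
begin

definition sg :: "nat \<Rightarrow> 'r" where
  "sg n = (if even n then \<one>\<^bsub>R\<^esub> else \<ominus>\<^bsub>R\<^esub> \<one>\<^bsub>R\<^esub>)"

lemma sg_closed: "sg n \<in> carrier R"
  by (simp add: sg_def)

lemma sg_Suc: "x \<in> carrier T \<Longrightarrow> sg (Suc n) \<odot>\<^bsub>T\<^esub> x = \<ominus>\<^bsub>T\<^esub> (sg n \<odot>\<^bsub>T\<^esub> x)"
  by (simp add: sg_def T.smult_l_minus)

lemma ext_gens_iff: "xs @ s # ys \<in> ext_gens k M \<longleftrightarrow>
    Suc (length xs + length ys) = k \<and> set xs \<subseteq> carrier M \<and> s \<in> carrier M \<and> set ys \<subseteq> carrier M"
  by (auto simp: ext_gens_def)

lemma m_swap:
  assumes "xs @ s # t # ys \<in> ext_gens k M"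
  shows "m (xs @ s # t # ys) = \<ominus>\<^bsub>T\<^esub> m (xs @ t # s # ys)"
proof -
  have g: "xs @ a # b # ys \<in> ext_gens k M" if "a \<in> carrier M" "b \<in> carrier M" for a b
    using assms that by (auto simp: ext_gens_def)
  have st: "s \<in> carrier M" "t \<in> carrier M" using assms by (auto simp: ext_gens_def)
  let ?q = "s \<oplus>\<^bsub>M\<^esub> t"
  have q: "?q \<in> carrier M" using st by simp
  have g': "(xs @ [a]) @ b # ys \<in> ext_gens k M" if "a \<in> carrier M" "b \<in> carrier M" for a b
    using g[OF that] by simp
  have z: "m (xs @ a # a # ys) = \<zero>\<^bsub>T\<^esub>" if "a \<in> carrier M" for a
    using m_alt[OF g[OF that that]] by simp
  have "\<zero>\<^bsub>T\<^esub> = m (xs @ ?q # ?q # ys)" using z[OF q] by simp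
  also have "\<dots> = m (xs @ s # ?q # ys) \<oplus>\<^bsub>T\<^esub> m (xs @ t # ?q # ys)"
    by (rule m_add[OF g[OF st(1) q] st(2)])
  also have "\<dots> = (m (xs @ s # s # ys) \<oplus>\<^bsub>T\<^esub> m (xs @ s # t # ys)) \<oplus>\<^bsub>T\<^esub> (m (xs @ t # s # ys) \<oplus>\<^bsub>T\<^esub> m (xs @ t # t # ys))"
    using m_add[OF g'[OF st(1,1)] st(2)] m_add[OF g'[OF st(2,1)] st(2)] by simp
  also have "\<dots> = m (xs @ s # t # ys) \<oplus>\<^bsub>T\<^esub> m (xs @ t # s # ys)"
    using z[OF st(1)] z[OF st(2)] m_closed[OF g[OF st]] m_closed[OF g[OF st(2,1)]] by simp
  finally show ?thesis
    using T.M.minus_equality[of "m (xs @ s # t # ys)" "m (xs @ t # s # ys)"] m_closed[OF g[OF st]] m_closed[OF g[OF st(2,1)]] by simp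
qed

text \<open>Moving an entry across \<open>ys\<close> is a product of adjacent
  transpositions.\<close>

lemma m_move:
  assumes "pre @ x # ys @ zs \<in> ext_gens k M"
  shows "m (pre @ x # ys @ zs) = sg (length ys) \<odot>\<^bsub>T\<^esub> m (pre @ ys @ x # zs)"
  using assms
proof (induction ys arbitrary: pre)
  case Nil
  then show ?case using m_closed[OF Nil] by (simp add: sg_def)
next
  case (Cons y ys)
  have g: "(pre @ [y]) @ x # ys @ zs \<in> ext_gens k M" "pre @ (y # ys) @ x # zs \<in> ext_gens k M"
    using Cons.prems by (auto simp: ext_gens_def)
  have "m (pre @ x # (y # ys) @ zs) = \<ominus>\<^bsub>T\<^esub> m ((pre @ [y]) @ x # ys @ zs)"
    using m_swap[of pre x y "ys @ zs"] Cons.prems by simp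
  also have "\<dots> = \<ominus>\<^bsub>T\<^esub> (sg (length ys) \<odot>\<^bsub>T\<^esub> m (pre @ (y # ys) @ x # zs))"
    using Cons.IH[OF g(1)] by simp
  finally show ?case using sg_Suc[OF m_closed[OF g(2)]] by simp
qed

text \<open>Row operation: multiples of an entry already present may be subtracted from all the
  others.\<close>

lemma m_drop:
  assumes "x \<in> set pre" "set pre \<subseteq> carrier M" "length pre + length js = k"
    and "\<And>j. j \<in> set js \<Longrightarrow> v j \<in> carrier M" "\<And>j. j \<in> set js \<Longrightarrow> c j \<in> carrier R"
  shows "m (pre @ map (\<lambda>j. v j \<oplus>\<^bsub>M\<^esub> c j \<odot>\<^bsub>M\<^esub> x) js) = m (pre @ map v js)"
  using assms
proof (induction js arbitrary: pre)
  case (Cons j js)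
  let ?w = "\<lambda>j. v j \<oplus>\<^bsub>M\<^esub> c j \<odot>\<^bsub>M\<^esub> x"
  have x: "x \<in> carrier M" using Cons.prems by auto
  have g: "pre @ a # map ?w js \<in> ext_gens k M" if "a \<in> carrier M" for a
    using Cons.prems that x by (auto simp: ext_gens_def)
  have vj: "v j \<in> carrier M" "c j \<in> carrier R" using Cons.prems by auto
  have "m (pre @ map ?w (j # js)) = m (pre @ v j # map ?w js) \<oplus>\<^bsub>T\<^esub> m (pre @ (c j \<odot>\<^bsub>M\<^esub> x) # map ?w js)"
    using m_add[OF g[OF vj(1)], of "c j \<odot>\<^bsub>M\<^esub> x"] vj x by simp
  also have "m (pre @ (c j \<odot>\<^bsub>M\<^esub> x) # map ?w js) = c j \<odot>\<^bsub>T\<^esub> m (pre @ x # map ?w js)"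
    by (rule m_smult[OF g[OF x] vj(2)])
  also have "m (pre @ x # map ?w js) = \<zero>\<^bsub>T\<^esub>"
    using m_alt[OF g[OF x]] Cons.prems(1) by auto
  also have "m (pre @ v j # map ?w js) \<oplus>\<^bsub>T\<^esub> c j \<odot>\<^bsub>T\<^esub> \<zero>\<^bsub>T\<^esub> = m ((pre @ [v j]) @ map ?w js)"
    using m_closed[OF g[OF vj(1)]] vj by simp
  also have "\<dots> = m ((pre @ [v j]) @ map v js)"
    by (rule Cons.IH) (use Cons.prems in auto)
  finally show ?case by simp
qed simp

lemma m_zero:
  assumes "Suc (length xs + length ys) = k" "set xs \<subseteq> carrier M" "set ys \<subseteq> carrier M"
  shows "m (xs @ \<zero>\<^bsub>M\<^esub> # ys) = \<zero>\<^bsub>T\<^esub>"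
proof -
  have g: "xs @ \<zero>\<^bsub>M\<^esub> # ys \<in> ext_gens k M" using assms by (simp add: ext_gens_iff)
  show ?thesis using m_smult[OF g M.R.zero_closed] m_closed[OF g] by simp
qed

lemma m_finsum:
  assumes "Suc (length xs + length ys) = k" "set xs \<subseteq> carrier M" "set ys \<subseteq> carrier M"
    and "finite B" "\<And>l. l \<in> B \<Longrightarrow> a l \<in> carrier R" "\<And>l. l \<in> B \<Longrightarrow> e l \<in> carrier M"
  shows "m (xs @ (\<Oplus>\<^bsub>M\<^esub>l\<in>B. a l \<odot>\<^bsub>M\<^esub> e l) # ys) = (\<Oplus>\<^bsub>T\<^esub>l\<in>B. a l \<odot>\<^bsub>T\<^esub> m (xs @ e l # ys))"
  using assms(4-)
proof (induction B rule: finite_induct)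
  case empty
  then show ?case using m_zero[OF assms(1-3)] by simp
next
  case (insert b B)
  have g: "xs @ s # ys \<in> ext_gens k M" if "s \<in> carrier M" for s
    using assms(1-3) that by (simp add: ext_gens_iff)
  have c: "(\<Oplus>\<^bsub>M\<^esub>l\<in>B. a l \<odot>\<^bsub>M\<^esub> e l) \<in> carrier M" using insert by (auto intro!: M.M.finsum_closed)
  have "m (xs @ (\<Oplus>\<^bsub>M\<^esub>l\<in>insert b B. a l \<odot>\<^bsub>M\<^esub> e l) # ys) =
      m (xs @ (a b \<odot>\<^bsub>M\<^esub> e b \<oplus>\<^bsub>M\<^esub> (\<Oplus>\<^bsub>M\<^esub>l\<in>B. a l \<odot>\<^bsub>M\<^esub> e l)) # ys)"
    using insert by (subst M.M.finsum_insert) (auto simp: Pi_iff)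
  also have "\<dots> = m (xs @ (a b \<odot>\<^bsub>M\<^esub> e b) # ys) \<oplus>\<^bsub>T\<^esub> m (xs @ (\<Oplus>\<^bsub>M\<^esub>l\<in>B. a l \<odot>\<^bsub>M\<^esub> e l) # ys)"
    by (rule m_add[OF g c]) (use insert in auto)
  also have "m (xs @ (a b \<odot>\<^bsub>M\<^esub> e b) # ys) = a b \<odot>\<^bsub>T\<^esub> m (xs @ e b # ys)"
    by (rule m_smult[OF g]) (use insert in auto)
  also have "m (xs @ (\<Oplus>\<^bsub>M\<^esub>l\<in>B. a l \<odot>\<^bsub>M\<^esub> e l) # ys) = (\<Oplus>\<^bsub>T\<^esub>l\<in>B. a l \<odot>\<^bsub>T\<^esub> m (xs @ e l # ys))"
    using insert by simp
  also have "a b \<odot>\<^bsub>T\<^esub> m (xs @ e b # ys) \<oplus>\<^bsub>T\<^esub> (\<Oplus>\<^bsub>T\<^esub>l\<in>B. a l \<odot>\<^bsub>T\<^esub> m (xs @ e l # ys)) =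
      (\<Oplus>\<^bsub>T\<^esub>l\<in>insert b B. a l \<odot>\<^bsub>T\<^esub> m (xs @ e l # ys))"
    using insert g m_closed by (subst T.M.finsum_insert) (auto simp: Pi_iff)
  finally show ?case .
qed

lemma m_replace:
  assumes "a \<in> set pre" "set pre \<subseteq> carrier M" "set post \<subseteq> carrier M"
    and "length pre + length js + length post = k"
    and "\<And>j. j \<in> set js \<Longrightarrow> v j \<in> carrier M" "\<And>j. j \<in> set js \<Longrightarrow> u j \<in> carrier M"
    and "\<And>xs j ys. j \<in> set js \<Longrightarrow> a \<in> set xs \<Longrightarrow> xs @ u j # ys \<in> ext_gens k M \<Longrightarrow> m (xs @ u j # ys) = \<zero>\<^bsub>T\<^esub>"
  shows "m (pre @ map (\<lambda>j. v j \<oplus>\<^bsub>M\<^esub> u j) js @ post) = m (pre @ map v js @ post)"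
  using assms
proof (induction js arbitrary: pre)
  case (Cons j js)
  let ?w = "\<lambda>j. v j \<oplus>\<^bsub>M\<^esub> u j"
  have g: "pre @ b # (map ?w js @ post) \<in> ext_gens k M" if "b \<in> carrier M" for b
    using Cons.prems that by (auto simp: ext_gens_def)
  have vj: "v j \<in> carrier M" "u j \<in> carrier M" using Cons.prems by auto
  have "m (pre @ map ?w (j # js) @ post) = m (pre @ v j # (map ?w js @ post)) \<oplus>\<^bsub>T\<^esub> m (pre @ u j # (map ?w js @ post))"
    using m_add[OF g[OF vj(1)] vj(2)] by simp
  also have "m (pre @ u j # (map ?w js @ post)) = \<zero>\<^bsub>T\<^esub>"
    using Cons.prems(7)[of j pre] g[OF vj(2)] Cons.prems(1) by simp
  also have "m (pre @ v j # (map ?w js @ post)) \<oplus>\<^bsub>T\<^esub> \<zero>\<^bsub>T\<^esub> = m ((pre @ [v j]) @ map ?w js @ post)"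
    using m_closed[OF g[OF vj(1)]] by simp
  also have "\<dots> = m ((pre @ [v j]) @ map v js @ post)"
    by (rule Cons.IH) (use Cons.prems in auto)
  finally show ?case by simp
qed simp

text \<open>If any two of the \<open>u j\<close> annihilate each other, only the terms linear in \<open>u\<close> survive when
  \<open>v + u\<close> is expanded.\<close>

lemma m_expand:
  assumes v: "\<And>j. j < k \<Longrightarrow> v j \<in> carrier M" and u: "\<And>j. j < k \<Longrightarrow> u j \<in> carrier M"
    and zero: "\<And>xs i j ys. i < k \<Longrightarrow> j < k \<Longrightarrow> u i \<in> set xs \<Longrightarrow> xs @ u j # ys \<in> ext_gens k M \<Longrightarrow>
      m (xs @ u j # ys) = \<zero>\<^bsub>T\<^esub>"
  defines "s \<equiv> \<lambda>j. v j \<oplus>\<^bsub>M\<^esub> u j"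
  shows "m (map s [0..<k]) = m (map v [0..<k]) \<oplus>\<^bsub>T\<^esub>
    (\<Oplus>\<^bsub>T\<^esub>j\<in>{..<k}. sg j \<odot>\<^bsub>T\<^esub> m (u j # map s ([0..<j] @ [Suc j..<k])))"
proof -
  let ?t = "\<lambda>j. sg j \<odot>\<^bsub>T\<^esub> m (u j # map s ([0..<j] @ [Suc j..<k]))"
  have s: "s j \<in> carrier M" if "j < k" for j using u v that by (simp add: s_def)
  have tc: "?t j \<in> carrier T" if "j < k" for j
    using that u s by (auto intro!: T.smult_closed sg_closed m_closed simp: ext_gens_def)
  \<comment> \<open>The entries \<open>s j\<close> are replaced by \<open>v j\<close> from the left; replacing the \<open>i\<close>th one produces the \<open>i\<close>th summand.\<close>
  have "i \<le> k \<Longrightarrow> m (map s [0..<k]) = m (map v [0..<i] @ map s [i..<k]) \<oplus>\<^bsub>T\<^esub> (\<Oplus>\<^bsub>T\<^esub>j\<in>{..<i}. ?t j)" for i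
  proof (induction i)
    case 0
    have "m (map s [0..<k]) \<in> carrier T" using s by (intro m_closed) (auto simp: ext_gens_def)
    then show ?case by simp
  next
    case (Suc i)
    then have i: "i < k" by simp
    let ?A = "map v [0..<i]" and ?B = "map s [Suc i..<k]"
    have g: "?A @ a # ?B \<in> ext_gens k M" if "a \<in> carrier M" for a
      using that i s v by (auto simp: ext_gens_def)
    have g': "u i # ?A @ ?B \<in> ext_gens k M"
      using i s v u by (auto simp: ext_gens_def)
    have split: "[i..<k] = i # [Suc i..<k]" using i by (simp add: upt_conv_Cons)
    have "m (?A @ map s [i..<k]) = m (?A @ v i # ?B) \<oplus>\<^bsub>T\<^esub> m (?A @ u i # ?B)"
      unfolding split using m_add[OF g[OF v[OF i]] u[OF i]] by (simp add: s_def)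
    also have "m (?A @ u i # ?B) = sg i \<odot>\<^bsub>T\<^esub> m (u i # ?A @ ?B)"
    proof -
      have "sg i \<odot>\<^bsub>T\<^esub> m (u i # ?A @ ?B) = sg i \<odot>\<^bsub>T\<^esub> (sg i \<odot>\<^bsub>T\<^esub> m (?A @ u i # ?B))"
        using m_move[of "[]" "u i" ?A ?B] g' by simp
      also have "\<dots> = m (?A @ u i # ?B)"
        using m_closed[OF g[OF u[OF i]]] by (simp add: sg_def T.smult_l_minus T.smult_r_minus)
      finally show ?thesis by simp
    qed
    also have "m (u i # ?A @ ?B) = m (u i # map s [0..<i] @ ?B)"
    proof -
      have "set ?B \<subseteq> carrier M" using s by auto
      then have "m ([u i] @ map (\<lambda>j. v j \<oplus>\<^bsub>M\<^esub> u j) [0..<i] @ ?B) = m ([u i] @ map v [0..<i] @ ?B)"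
        using i u v zero[OF i] by (intro m_replace[of "u i"]) auto
      then show ?thesis by (simp add: s_def)
    qed
    also have "sg i \<odot>\<^bsub>T\<^esub> m (u i # map s [0..<i] @ ?B) = ?t i" by simp
    finally have step: "m (?A @ map s [i..<k]) = m (map v [0..<Suc i] @ ?B) \<oplus>\<^bsub>T\<^esub> ?t i"
      using i by simp
    have fc: "(\<Oplus>\<^bsub>T\<^esub>j\<in>{..<i}. ?t j) \<in> carrier T" using tc i by (intro T.M.finsum_closed) auto
    have "(\<Oplus>\<^bsub>T\<^esub>j\<in>{..<Suc i}. ?t j) = ?t i \<oplus>\<^bsub>T\<^esub> (\<Oplus>\<^bsub>T\<^esub>j\<in>{..<i}. ?t j)"
      unfolding lessThan_Suc by (rule T.M.finsum_insert) (use tc i in auto)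
    moreover have "m (map v [0..<Suc i] @ ?B) \<in> carrier T" using m_closed[OF g[OF v[OF i]]] by simp
    ultimately show ?case using Suc.IH i step tc[OF i] fc T.M.a_assoc by simp
  qed
  from this[of k] show ?thesis by simp
qed

end

text \<open>Two entries on a common line \<open>R g\<close> are, after pulling out scalars, two
  equal entries.\<close>

lemma (in alternating) m_line_zero:
  assumes g: "xs @ c' \<odot>\<^bsub>M\<^esub> g # ys \<in> ext_gens k M" and a: "c \<odot>\<^bsub>M\<^esub> g \<in> set xs"
    and c: "c \<in> carrier R" "c' \<in> carrier R" and gM: "g \<in> carrier M"
  shows "m (xs @ c' \<odot>\<^bsub>M\<^esub> g # ys) = \<zero>\<^bsub>T\<^esub>"
proof -
  obtain xs1 xs2 where xs: "xs = xs1 @ (c \<odot>\<^bsub>M\<^esub> g) # xs2" using split_list[OF a] by blast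
  have 0: "xs1 @ g # xs2 @ g # ys \<in> ext_gens k M" and 1: "xs1 @ g # xs2 @ (c' \<odot>\<^bsub>M\<^esub> g) # ys \<in> ext_gens k M"
    and 2: "(xs1 @ g # xs2) @ g # ys \<in> ext_gens k M"
    using g gM unfolding xs by (auto simp: ext_gens_def)
  have "m (xs @ c' \<odot>\<^bsub>M\<^esub> g # ys) = c \<odot>\<^bsub>T\<^esub> m ((xs1 @ g # xs2) @ (c' \<odot>\<^bsub>M\<^esub> g) # ys)"
    using m_smult[OF 1 c(1)] by (simp add: xs)
  also have "m ((xs1 @ g # xs2) @ (c' \<odot>\<^bsub>M\<^esub> g) # ys) = c' \<odot>\<^bsub>T\<^esub> m ((xs1 @ g # xs2) @ g # ys)"
    by (rule m_smult[OF 2 c(2)])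
  also have "m ((xs1 @ g # xs2) @ g # ys) = \<zero>\<^bsub>T\<^esub>" by (rule m_alt[OF 2]) simp
  finally show ?thesis using c by simp
qed

lemma (in Module.module) finsum_smult_rdistr:
  assumes "finite A" "\<And>i. i \<in> A \<Longrightarrow> f i \<in> carrier R" "x \<in> carrier M"
  shows "(\<Oplus>\<^bsub>M\<^esub>i\<in>A. f i \<odot>\<^bsub>M\<^esub> x) = (\<Oplus>\<^bsub>R\<^esub>i\<in>A. f i) \<odot>\<^bsub>M\<^esub> x"
  using assms
proof (induction A rule: finite_induct)
  case (insert a A)
  then show ?case by (simp add: Pi_iff smult_l_distr)
qed simp

section \<open>Determinants\<close>

context function_rings
begin

lemma O_finsum:
  assumes U: "open U" and "finite A" "\<And>i. i \<in> A \<Longrightarrow> f i \<in> carrier (\<O> U)"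
  shows "(\<Oplus>\<^bsub>\<O> U\<^esub>i\<in>A. f i) x = (\<Sum>i\<in>A. f i x)"
  using assms(2-)
proof (induction A rule: finite_induct)
  case empty
  interpret cring "\<O> U" by (rule cring_O[OF U])
  show ?case by (simp add: O_zero)
next
  case (insert a A)
  interpret cring "\<O> U" by (rule cring_O[OF U])
  show ?case using insert by (subst finsum_insert) (auto simp: O_add)
qed

text \<open>Functions form a ring with zero divisors, and the determinant is taken pointwise, where
  the theory of matrices over a field applies. Outside \<open>V\<close> the value is zero, as for
  every function on \<open>V\<close>.\<close>

definition detf :: "'a set \<Rightarrow> nat \<Rightarrow> (nat \<Rightarrow> nat \<Rightarrow> 'a \<Rightarrow> complex) \<Rightarrow> 'a \<Rightarrow> complex" where
  "detf V N A = (\<lambda>x. if x \<in> V then Determinant.det (Matrix.mat N N (\<lambda>(j, l). A j l x)) else 0)"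

abbreviation skip :: "nat \<Rightarrow> nat \<Rightarrow> nat" where
  "skip l j \<equiv> (if j < l then j else Suc j)"

lemma skip_image: "l < Suc n \<Longrightarrow> {..<Suc n} = insert l (skip l ` {..<n})"
proof -
  assume l: "l < Suc n"
  have "j \<in> insert l (skip l ` {..<n})" if j: "j < Suc n" for j
  proof (cases "j \<le> l")
    case True
    then show ?thesis using l by (cases "j = l") (auto intro!: image_eqI[of _ _ j])
  next
    case False
    then show ?thesis using j by (auto intro!: image_eqI[of _ _ "j - 1"])
  qed
  then have "{..<Suc n} \<subseteq> insert l (skip l ` {..<n})" by blast
  moreover have "insert l (skip l ` {..<n}) \<subseteq> {..<Suc n}"
  proof
    fix j assume "j \<in> insert l (skip l ` {..<n})"
    then consider "j = l" | i where "i < n" "j = skip l i" by blast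
    then show "j \<in> {..<Suc n}" using l by cases (simp_all split: if_splits)
  qed
  ultimately show ?thesis by (rule equalityI)
qed

lemma map_skip: "l \<le> n \<Longrightarrow> map (\<lambda>j. e (skip l j)) [0..<n] = map e [0..<l] @ map e [Suc l..<Suc n]"
proof -
  assume l: "l \<le> n"
  then have "[0..<n] = [0..<l] @ [l..<n]" using upt_add_eq_append[of 0 l "n - l"] by simp
  moreover have "map (\<lambda>j. e (skip l j)) [l..<n] = map e [Suc l..<Suc n]"
    by (simp add: map_Suc_upt[symmetric] del: upt_Suc)
  ultimately show ?thesis by simp
qed

lemma detf_laplace:
  "detf V (Suc n) A x = (\<Sum>l<Suc n. A 0 l x * (detf V n (\<lambda>j i. A (Suc j) (skip l i)) x * (if x \<in> V then (-1)^l else 0)))"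
proof (cases "x \<in> V")
  case True
  let ?B = "Matrix.mat (Suc n) (Suc n) (\<lambda>(j, l). A j l x)"
  have "Determinant.det ?B = (\<Sum>l<Suc n. ?B $$ (0, l) * cofactor ?B 0 l)"
    by (rule laplace_expansion_row[of _ "Suc n"]) auto
  also have "\<dots> = (\<Sum>l<Suc n. A 0 l x * (detf V n (\<lambda>j i. A (Suc j) (skip l i)) x * (-1)^l))"
  proof (intro sum.cong refl)
    fix l assume l: "l \<in> {..<Suc n}"
    have "mat_delete ?B 0 l = Matrix.mat n n (\<lambda>(j, i). A (Suc j) (skip l i) x)"
      using l by (intro eq_matI) (auto simp: mat_delete_def)
    then show "?B $$ (0, l) * cofactor ?B 0 l = A 0 l x * (detf V n (\<lambda>j i. A (Suc j) (skip l i)) x * (-1)^l)"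
      using l True by (simp add: cofactor_def detf_def)
  qed
  finally show ?thesis using True by (simp add: detf_def)
qed (simp add: detf_def)

lemma alternating_sg:
  assumes "alternating (\<O> V) M T k m" "open V"
  shows "alternating.sg (\<O> V) l = (\<lambda>x. if x \<in> V then (-1)^l else 0)"
proof -
  interpret alternating "\<O> V" M T k m by fact
  have "\<ominus>\<^bsub>\<O> V\<^esub> \<one>\<^bsub>\<O> V\<^esub> = (\<lambda>x. if x \<in> V then -1 else 0)"
    by (rule M.R.minus_equality) (auto simp: O_add O_one O_zero O_const[OF assms(2)] fun_eq_iff)
  then show ?thesis by (auto simp: sg_def O_one fun_eq_iff)
qed

text \<open>Expand the first entry as \<open>\<Sum> A 0 l e l\<close>. Once \<open>e l\<close> is
  among the entries, its multiples can be dropped from the others, which then form a matrix of size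
  one less; moving \<open>e l\<close> into its place produces the sign of the Laplace expansion
  along the first row. The prefix \<open>pre\<close> collects the entries already expanded in the
  induction.\<close>

lemma alternating_det:
  assumes alt: "alternating (\<O> V) M T k m" and V: "open V"
    and pre: "length pre + N = k" "set pre \<subseteq> carrier M"
    and e: "\<And>l. l < N \<Longrightarrow> e l \<in> carrier M"
    and A: "\<And>j l. j < N \<Longrightarrow> l < N \<Longrightarrow> A j l \<in> carrier (\<O> V)"
  shows "detf V N A \<in> carrier (\<O> V) \<and>
    m (pre @ map (\<lambda>j. \<Oplus>\<^bsub>M\<^esub>l\<in>{..<N}. A j l \<odot>\<^bsub>M\<^esub> e l) [0..<N]) = detf V N A \<odot>\<^bsub>T\<^esub> m (pre @ map e [0..<N])"
  using pre e A
proof (induction N arbitrary: pre e A)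
  case 0
  interpret alternating "\<O> V" M T k m by (rule alt)
  have "detf V 0 A = \<one>\<^bsub>\<O> V\<^esub>" by (auto simp: detf_def O_one)
  moreover have "m pre \<in> carrier T" using 0 by (intro m_closed) (simp add: ext_gens_def)
  ultimately show ?case by simp
next
  case (Suc n)
  interpret alternating "\<O> V" M T k m by (rule alt)
  let ?row = "\<lambda>j. \<Oplus>\<^bsub>M\<^esub>l\<in>{..<Suc n}. A j l \<odot>\<^bsub>M\<^esub> e l"
  let ?rest = "map (\<lambda>j. ?row (Suc j)) [0..<n]"
  let ?E = "m (pre @ map e [0..<Suc n])"
  let ?D = "\<lambda>l. detf V n (\<lambda>j i. A (Suc j) (skip l i))"
  have row: "?row j \<in> carrier M" if "j < Suc n" for j
    using that Suc.prems(3,4) by (intro M.M.finsum_closed) auto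
  have up: "[0..<Suc n] = 0 # map Suc [0..<n]" by (simp add: upt_conv_Cons map_Suc_upt del: upt_Suc)
  have E: "?E \<in> carrier T" using Suc.prems by (intro m_closed) (auto simp: ext_gens_def)
  have main: "?D l \<in> carrier (\<O> V) \<and> m (pre @ e l # ?rest) = ?D l \<odot>\<^bsub>T\<^esub> (sg l \<odot>\<^bsub>T\<^esub> ?E)" if l: "l < Suc n" for l
  proof -
    let ?e = "\<lambda>i. e (skip l i)" and ?A = "\<lambda>j i. A (Suc j) (skip l i)"
    have decomp: "?row (Suc j) = (\<Oplus>\<^bsub>M\<^esub>i\<in>{..<n}. ?A j i \<odot>\<^bsub>M\<^esub> ?e i) \<oplus>\<^bsub>M\<^esub> A (Suc j) l \<odot>\<^bsub>M\<^esub> e l"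
      if j: "j < n" for j
    proof -
      have inj: "inj_on (skip l) {..<n}" by (auto simp: inj_on_def split: if_splits)
      have c: "(\<lambda>l. A (Suc j) l \<odot>\<^bsub>M\<^esub> e l) \<in> skip l ` {..<n} \<rightarrow> carrier M"
        using j Suc.prems(3,4) by (auto split: if_splits)
      have c': "A (Suc j) l \<odot>\<^bsub>M\<^esub> e l \<in> carrier M" using j l Suc.prems(3,4) by auto
      have "?row (Suc j) = A (Suc j) l \<odot>\<^bsub>M\<^esub> e l \<oplus>\<^bsub>M\<^esub> (\<Oplus>\<^bsub>M\<^esub>l\<in>skip l ` {..<n}. A (Suc j) l \<odot>\<^bsub>M\<^esub> e l)"
        unfolding skip_image[OF l] by (rule M.M.finsum_insert) (use c c' in auto)
      also have "(\<Oplus>\<^bsub>M\<^esub>l\<in>skip l ` {..<n}. A (Suc j) l \<odot>\<^bsub>M\<^esub> e l) = (\<Oplus>\<^bsub>M\<^esub>i\<in>{..<n}. ?A j i \<odot>\<^bsub>M\<^esub> ?e i)"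
        by (rule M.M.finsum_reindex[OF c inj])
      finally have 1: "?row (Suc j) = A (Suc j) l \<odot>\<^bsub>M\<^esub> e l \<oplus>\<^bsub>M\<^esub> (\<Oplus>\<^bsub>M\<^esub>i\<in>{..<n}. ?A j i \<odot>\<^bsub>M\<^esub> ?e i)" .
      have "(\<Oplus>\<^bsub>M\<^esub>i\<in>{..<n}. ?A j i \<odot>\<^bsub>M\<^esub> ?e i) \<in> carrier M"
        by (rule M.M.finsum_closed, rule funcsetI, rule M.smult_closed)
          (use j Suc.prems(3,4) in \<open>simp_all\<close>)
      from M.M.a_comm[OF c' this] show ?thesis unfolding 1 .
    qed
    have pe: "length (pre @ [e l]) + n = k" "set (pre @ [e l]) \<subseteq> carrier M" using Suc.prems(1,2,3) l by auto
    have e': "?e i \<in> carrier M" if "i < n" for i using that Suc.prems(3) by auto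
    have A': "?A j i \<in> carrier (\<O> V)" if "j < n" "i < n" for j i using that Suc.prems(4) by auto
    note IH = Suc.IH[of "pre @ [e l]" ?e ?A, OF pe e' A']
    have "?rest = map (\<lambda>j. (\<Oplus>\<^bsub>M\<^esub>i\<in>{..<n}. ?A j i \<odot>\<^bsub>M\<^esub> ?e i) \<oplus>\<^bsub>M\<^esub> A (Suc j) l \<odot>\<^bsub>M\<^esub> e l) [0..<n]"
      by (rule map_cong) (use decomp in auto)
    then have "m (pre @ e l # ?rest) =
        m ((pre @ [e l]) @ map (\<lambda>j. (\<Oplus>\<^bsub>M\<^esub>i\<in>{..<n}. ?A j i \<odot>\<^bsub>M\<^esub> ?e i) \<oplus>\<^bsub>M\<^esub> A (Suc j) l \<odot>\<^bsub>M\<^esub> e l) [0..<n])"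
      by (simp only: append.simps append_assoc)
    also have "\<dots> = m ((pre @ [e l]) @ map (\<lambda>j. \<Oplus>\<^bsub>M\<^esub>i\<in>{..<n}. ?A j i \<odot>\<^bsub>M\<^esub> ?e i) [0..<n])"
    proof (rule m_drop[OF _ pe(2)])
      show "length (pre @ [e l]) + length [0..<n] = k" using pe by simp
      fix j assume "j \<in> set [0..<n]"
      then have j: "j < n" by simp
      show "(\<Oplus>\<^bsub>M\<^esub>i\<in>{..<n}. ?A j i \<odot>\<^bsub>M\<^esub> ?e i) \<in> carrier M"
        by (rule M.M.finsum_closed, rule funcsetI, rule M.smult_closed, rule A'[OF j], simp, rule e', simp)
      show "A (Suc j) l \<in> carrier (\<O> V)" using Suc.prems(4)[of "Suc j" l] j l by simp
    qed simp
    also have "\<dots> = ?D l \<odot>\<^bsub>T\<^esub> m ((pre @ [e l]) @ map ?e [0..<n])" by (rule IH[THEN conjunct2])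
    also have "m ((pre @ [e l]) @ map ?e [0..<n]) = m (pre @ e l # map e [0..<l] @ map e [Suc l..<Suc n])"
      using l by (subst map_skip) (simp_all del: upt_Suc)
    also have "\<dots> = sg (length (map e [0..<l])) \<odot>\<^bsub>T\<^esub> m (pre @ map e [0..<l] @ e l # map e [Suc l..<Suc n])"
      by (rule m_move) (use l Suc.prems in \<open>auto simp: ext_gens_def\<close>)
    also have "map e [0..<l] @ e l # map e [Suc l..<Suc n] = map e [0..<Suc n]"
    proof -
      have "[0..<Suc n] = [0..<l] @ [l..<Suc n]" using upt_add_eq_append[of 0 l "Suc n - l"] l by (simp del: upt_Suc)
      also have "[l..<Suc n] = l # [Suc l..<Suc n]" using l by (simp add: upt_conv_Cons del: upt_Suc)
      finally show ?thesis by (simp del: upt_Suc)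
    qed
    finally show ?thesis using IH by simp
  qed
  have m1: "m (pre @ map ?row [0..<Suc n]) = (\<Oplus>\<^bsub>T\<^esub>l\<in>{..<Suc n}. A 0 l \<odot>\<^bsub>T\<^esub> m (pre @ e l # ?rest))"
  proof -
    have "map ?row [0..<Suc n] = ?row 0 # ?rest" unfolding up by (simp add: comp_def)
    moreover have "m (pre @ ?row 0 # ?rest) = (\<Oplus>\<^bsub>T\<^esub>l\<in>{..<Suc n}. A 0 l \<odot>\<^bsub>T\<^esub> m (pre @ e l # ?rest))"
      by (rule m_finsum) (use Suc.prems row in auto)
    ultimately show ?thesis by simp
  qed
  let ?g = "\<lambda>l. A 0 l \<otimes>\<^bsub>\<O> V\<^esub> (?D l \<otimes>\<^bsub>\<O> V\<^esub> sg l)"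
  have gc: "?g l \<in> carrier (\<O> V)" if "l < Suc n" for l
    using that main Suc.prems(4) sg_closed by auto
  have "(\<Oplus>\<^bsub>T\<^esub>l\<in>{..<Suc n}. A 0 l \<odot>\<^bsub>T\<^esub> m (pre @ e l # ?rest)) = (\<Oplus>\<^bsub>T\<^esub>l\<in>{..<Suc n}. ?g l \<odot>\<^bsub>T\<^esub> ?E)"
    by (rule T.M.finsum_cong') (use main Suc.prems(4) sg_closed E in \<open>auto simp: T.smult_assoc1\<close>)
  also have "\<dots> = (\<Oplus>\<^bsub>\<O> V\<^esub>l\<in>{..<Suc n}. ?g l) \<odot>\<^bsub>T\<^esub> ?E"
    by (rule T.finsum_smult_rdistr) (use gc E in auto)
  also have "(\<Oplus>\<^bsub>\<O> V\<^esub>l\<in>{..<Suc n}. ?g l) = detf V (Suc n) A"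
  proof
    fix x
    show "(\<Oplus>\<^bsub>\<O> V\<^esub>l\<in>{..<Suc n}. ?g l) x = detf V (Suc n) A x"
      unfolding detf_laplace using gc
      by (subst O_finsum[OF V]) (auto simp: O_mult alternating_sg[OF alt V])
  qed
  finally have eq: "m (pre @ map ?row [0..<Suc n]) = detf V (Suc n) A \<odot>\<^bsub>T\<^esub> ?E" using m1 by simp
  have "(\<Oplus>\<^bsub>\<O> V\<^esub>l\<in>{..<Suc n}. ?g l) \<in> carrier (\<O> V)" using gc by (intro M.R.finsum_closed) auto
  then show ?case using eq \<open>(\<Oplus>\<^bsub>\<O> V\<^esub>l\<in>{..<Suc n}. ?g l) = detf V (Suc n) A\<close> by simp
qed

text \<open>Where \<open>r 0\<close> does not vanish the matrix has a nonzero kernel vector, so its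
  determinant is zero there; elsewhere the factor \<open>r 0\<close> is zero.\<close>

lemma det_kernel:
  assumes V: "open V" and A: "\<And>j l. j < N \<Longrightarrow> l < N \<Longrightarrow> A j l \<in> carrier (\<O> V)"
    and r: "\<And>l. l < N \<Longrightarrow> r l \<in> carrier (\<O> V)" and N: "0 < N"
    and ker: "\<And>j. j < N \<Longrightarrow> (\<Oplus>\<^bsub>\<O> V\<^esub>l\<in>{..<N}. A j l \<otimes>\<^bsub>\<O> V\<^esub> r l) = \<zero>\<^bsub>\<O> V\<^esub>"
  shows "detf V N A \<otimes>\<^bsub>\<O> V\<^esub> r 0 = \<zero>\<^bsub>\<O> V\<^esub>"
proof
  fix x
  show "(detf V N A \<otimes>\<^bsub>\<O> V\<^esub> r 0) x = \<zero>\<^bsub>\<O> V\<^esub> x"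
  proof (cases "x \<in> V \<and> r 0 x \<noteq> 0")
    case False
    then show ?thesis by (auto simp: O_mult O_zero detf_def)
  next
    case True
    interpret cring "\<O> V" by (rule cring_O[OF V])
    let ?B = "Matrix.mat N N (\<lambda>(j, l). A j l x)" and ?v = "Matrix.vec N (\<lambda>l. r l x)"
    have "?B *\<^sub>v ?v = 0\<^sub>v N"
    proof (rule eq_vecI)
      fix j assume "j < dim_vec (0\<^sub>v N :: complex Matrix.vec)"
      then have j: "j < N" by simp
      have "(\<Oplus>\<^bsub>\<O> V\<^esub>l\<in>{..<N}. A j l \<otimes>\<^bsub>\<O> V\<^esub> r l) x = (\<Sum>l<N. (A j l \<otimes>\<^bsub>\<O> V\<^esub> r l) x)"
        by (rule O_finsum[OF V]) (use A[OF j] r in auto)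
      then have "(\<Sum>l<N. A j l x * r l x) = 0" using ker[OF j] by (simp add: O_mult O_zero)
      then show "vec_index (?B *\<^sub>v ?v) j = vec_index (0\<^sub>v N :: complex Matrix.vec) j"
        using j by (simp add: scalar_prod_def lessThan_atLeast0)
    qed simp
    moreover have "?v \<noteq> 0\<^sub>v N"
    proof
      assume "?v = 0\<^sub>v N"
      then have "vec_index ?v 0 = vec_index (0\<^sub>v N) 0" by simp
      then show False using True N by simp
    qed
    ultimately have "Determinant.det ?B = 0"
      by (subst det_0_iff_vec_prod_zero[of _ N]) (auto intro!: exI[of _ ?v])
    then show ?thesis using True by (simp add: O_mult O_zero detf_def)
  qed
qed

text \<open>By \<open>det_kernel\<close> the determinant of the coordinates is annihilated by the
  nonzerodivisor \<open>r 0\<close>, and the value of \<open>m\<close> is this determinant times its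
  value on \<open>e\<close>.\<close>

lemma alternating_kernel_zero:
  assumes alt: "alternating (\<O> V) M T N m" and V: "open V" and N: "0 < N"
    and e: "\<And>l. l < N \<Longrightarrow> e l \<in> carrier M"
    and A: "\<And>j l. j < N \<Longrightarrow> l < N \<Longrightarrow> A j l \<in> carrier (\<O> V)"
    and r: "\<And>l. l < N \<Longrightarrow> r l \<in> carrier (\<O> V)"
    and ker: "\<And>j. j < N \<Longrightarrow> (\<Oplus>\<^bsub>\<O> V\<^esub>l\<in>{..<N}. A j l \<otimes>\<^bsub>\<O> V\<^esub> r l) = \<zero>\<^bsub>\<O> V\<^esub>"
    and nzd: "\<And>g. g \<in> carrier (\<O> V) \<Longrightarrow> g \<otimes>\<^bsub>\<O> V\<^esub> r 0 = \<zero>\<^bsub>\<O> V\<^esub> \<Longrightarrow> g = \<zero>\<^bsub>\<O> V\<^esub>"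
  shows "m (map (\<lambda>j. \<Oplus>\<^bsub>M\<^esub>l\<in>{..<N}. A j l \<odot>\<^bsub>M\<^esub> e l) [0..<N]) = \<zero>\<^bsub>T\<^esub>"
proof -
  interpret alternating "\<O> V" M T N m by (rule alt)
  note D = alternating_det[OF alt V, of "[]" N e A]
  have D': "detf V N A \<in> carrier (\<O> V)"
    "m (map (\<lambda>j. \<Oplus>\<^bsub>M\<^esub>l\<in>{..<N}. A j l \<odot>\<^bsub>M\<^esub> e l) [0..<N]) = detf V N A \<odot>\<^bsub>T\<^esub> m (map e [0..<N])"
    using D e A by auto
  have "detf V N A = \<zero>\<^bsub>\<O> V\<^esub>"
    by (rule nzd[OF D'(1) det_kernel[OF V A r N ker]])
  moreover have "m (map e [0..<N]) \<in> carrier T" using e by (intro m_closed) (auto simp: ext_gens_def)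
  ultimately show ?thesis using D'(2) by simp
qed

section \<open>Wedge products as alternating maps\<close>

lemma pure_wedge_alternating:
  assumes E: "is_presheaf \<O> E" and V: "open V"
  shows "alternating (\<O> V) (sec E V) (ext_pow (\<O> V) k (sec E V)) k (pure_wedge (\<O> V) (sec E V))"
proof -
  note c = cring_O[OF V] op_closed_sec[OF is_presheaf_op[OF E] V]
  show ?thesis
    by (intro alternating.intro alternating_axioms.intro presheaf_module[OF E V] ext_module[OF c])
      (auto simp: pure_wedge_closed[OF c] pure_wedge_add[OF c] pure_wedge_smult[OF c] pure_wedge_alt[OF c])
qed

lemma wedge_alternating:
  assumes E: "is_presheaf \<O> E" and V: "open V"
  shows "alternating (\<O> V) (sec E V) (sec (ext_sheaf \<O> k E) V) k (wedge \<O> E V)"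
proof -
  note P = ext_presheaf[OF is_presheaf_op[OF E], of k] and u = sh_unit_mor[OF ext_presheaf[OF is_presheaf_op[OF E], of k]]
  interpret pw: alternating "\<O> V" "sec E V" "ext_pow (\<O> V) k (sec E V)" k "pure_wedge (\<O> V) (sec E V)"
    by (rule pure_wedge_alternating[OF E V])
  have w: "wedge \<O> E V xs = sh_unit (ext_presheaf \<O> k E) V (pure_wedge (\<O> V) (sec E V) xs)"
    if "xs \<in> ext_gens k (sec E V)" for xs using that by (simp add: wedge_def ext_gens_def)
  have c: "pure_wedge (\<O> V) (sec E V) xs \<in> carrier (sec (ext_presheaf \<O> k E) V)"
    if "xs \<in> ext_gens k (sec E V)" for xs using pw.m_closed[OF that] by (simp add: sec_ext)
  note cl = ext_gens_closed[OF op_closed_sec[OF is_presheaf_op[OF E] V]]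
  show ?thesis
  proof (intro alternating.intro alternating_axioms.intro presheaf_module[OF E V])
    show "Module.module (\<O> V) (sec (ext_sheaf \<O> k E) V)" unfolding ext_sheaf_def by (rule sheafify_module[OF P V])
  next
    fix xs assume xs: "xs \<in> ext_gens k (sec E V)"
    show "wedge \<O> E V xs \<in> carrier (sec (ext_sheaf \<O> k E) V)"
      unfolding w[OF xs] ext_sheaf_def by (rule sh_unit_closed[OF P V c[OF xs]])
    assume d: "\<not> distinct xs"
    show "wedge \<O> E V xs = \<zero>\<^bsub>sec (ext_sheaf \<O> k E) V\<^esub>"
      unfolding w[OF xs] ext_sheaf_def pw.m_alt[OF xs d]
      using mor_zero[OF u P sheafify_presheaf[OF P] V] by (simp add: sec_ext)
  next
    fix xs s ys t assume s: "xs @ s # ys \<in> ext_gens k (sec E V)" and t: "t \<in> carrier (sec E V)"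
    note t' = ext_gens_replace[OF s t]
    show "wedge \<O> E V (xs @ (s \<oplus>\<^bsub>sec E V\<^esub> t) # ys) =
      wedge \<O> E V (xs @ s # ys) \<oplus>\<^bsub>sec (ext_sheaf \<O> k E) V\<^esub> wedge \<O> E V (xs @ t # ys)"
      unfolding w[OF s] w[OF t'] w[OF cl(1)[OF s t]] pw.m_add[OF s t] ext_sheaf_def
      using mor_add[OF u V subset_UNIV c[OF s] c[OF t']] by (simp add: sec_ext)
  next
    fix xs s ys r assume s: "xs @ s # ys \<in> ext_gens k (sec E V)" and r: "r \<in> carrier (\<O> V)"
    show "wedge \<O> E V (xs @ (r \<odot>\<^bsub>sec E V\<^esub> s) # ys) =
      r \<odot>\<^bsub>sec (ext_sheaf \<O> k E) V\<^esub> wedge \<O> E V (xs @ s # ys)"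
      unfolding w[OF s] w[OF cl(2)[OF s r]] pw.m_smult[OF s r] ext_sheaf_def
      using mor_smult[OF u V subset_UNIV r c[OF s]] by (simp add: sec_ext)
  qed
qed

lemma wedge_res:
  assumes E: "is_presheaf \<O> E" and UV: "open U" "open V" "V \<subseteq> U" and xs: "set xs \<subseteq> carrier (sec E U)"
  shows "restrict (wedge \<O> E U xs) V = wedge \<O> E V (map (res E U V) xs)"
proof -
  note op = is_presheaf_op[OF E] and P = ext_presheaf[OF is_presheaf_op[OF E], of "length xs"]
  have g: "xs \<in> ext_gens (length xs) (sec E U)" using xs by (simp add: ext_gens_def)
  have c: "pure_wedge (\<O> U) (sec E U) xs \<in> carrier (sec (ext_presheaf \<O> (length xs) E) U)"
    using pure_wedge_closed[OF cring_O[OF UV(1)] op_closed_sec[OF op UV(1)] g] by (simp add: sec_ext)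
  show ?thesis
    using mor_res[OF sh_unit_mor[OF P] UV subset_UNIV c]
    by (simp add: wedge_def res_sheafify[OF P] res_pure_wedge[OF op UV g])
qed

end

section \<open>Differences and finite sums\<close>

lemma (in abelian_group) minus_telescope:
  assumes "a \<in> carrier G" "b \<in> carrier G" "c \<in> carrier G"
  shows "(a \<ominus> b) \<oplus> (b \<ominus> c) = a \<ominus> c"
proof -
  have "(a \<oplus> \<ominus> b) \<oplus> (b \<oplus> \<ominus> c) = a \<oplus> (\<ominus> b \<oplus> (b \<oplus> \<ominus> c))"
    by (rule a_assoc) (use assms in simp_all)
  also have "\<ominus> b \<oplus> (b \<oplus> \<ominus> c) = \<ominus> c"
    by (rule r_neg1) (use assms in simp_all)
  finally show ?thesis by (simp only: a_minus_def)
qed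

lemma (in abelian_group) minus_diff:
  assumes "a \<in> carrier G" "b \<in> carrier G"
  shows "\<ominus> (a \<ominus> b) = b \<ominus> a"
proof -
  have "\<ominus> (a \<oplus> \<ominus> b) = \<ominus> a \<oplus> b" using assms by (simp add: minus_add)
  also have "\<dots> = b \<oplus> \<ominus> a" by (rule a_comm) (use assms in simp_all)
  finally show ?thesis by (simp only: a_minus_def)
qed

lemma (in abelian_group) minus_minus_cancel:
  assumes "s \<in> carrier G" "a \<in> carrier G" "b \<in> carrier G"
  shows "(s \<ominus> a) \<ominus> (s \<ominus> b) = b \<ominus> a"
proof -
  have "(s \<ominus> a) \<ominus> (s \<ominus> b) = (s \<ominus> a) \<oplus> (b \<ominus> s)"
    using minus_diff[OF assms(1,3)] by (simp only: a_minus_def[of G "s \<ominus> a"])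
  also have "\<dots> = (b \<ominus> s) \<oplus> (s \<ominus> a)" by (rule a_comm) (use assms in simp_all)
  also have "\<dots> = b \<ominus> a" by (rule minus_telescope[OF assms(3,1,2)])
  finally show ?thesis .
qed

lemma (in abelian_group) minus_swap:
  assumes "x \<in> carrier G" "x' \<in> carrier G" "y \<in> carrier G" "y' \<in> carrier G" "x \<ominus> x' = y \<ominus> y'"
  shows "x \<ominus> y = x' \<ominus> y'"
proof -
  have "x \<ominus> y = (x \<ominus> x') \<oplus> (x' \<ominus> y)" by (rule minus_telescope[OF assms(1-3), symmetric])
  also have "\<dots> = (y \<ominus> y') \<oplus> (x' \<ominus> y)" by (simp only: assms(5))
  also have "\<dots> = (x' \<ominus> y) \<oplus> (y \<ominus> y')" by (rule a_comm) (use assms(1-4) in simp_all)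
  also have "\<dots> = x' \<ominus> y'" by (rule minus_telescope[OF assms(2-4)])
  finally show ?thesis .
qed

lemma (in abelian_group) zero_minus_eq:
  assumes "x \<in> carrier G" "y \<in> carrier G" "z \<in> carrier G" "\<zero> \<ominus> x = y \<ominus> z"
  shows "x = z \<ominus> y"
proof -
  have "x = \<ominus> (\<zero> \<ominus> x)" using assms(1) by (simp add: a_minus_def)
  also have "\<dots> = z \<ominus> y" unfolding assms(4) by (rule minus_diff[OF assms(2,3)])
  finally show ?thesis .
qed

lemma (in abelian_monoid) finsum_lessThan_Suc_shift:
  assumes "\<And>l. l < Suc n \<Longrightarrow> h l \<in> carrier G"
  shows "(\<Oplus>l\<in>{..<Suc n}. h l) = h 0 \<oplus> (\<Oplus>k\<in>{..<n}. h (Suc k))"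
proof -
  have "(\<Oplus>l\<in>{..<Suc n}. h l) = h 0 \<oplus> (\<Oplus>l\<in>Suc ` {..<n}. h l)"
    unfolding lessThan_Suc_eq_insert_0 by (rule finsum_insert) (use assms in auto)
  also have "(\<Oplus>l\<in>Suc ` {..<n}. h l) = (\<Oplus>k\<in>{..<n}. h (Suc k))"
    by (rule finsum_reindex) (use assms in auto)
  finally show ?thesis .
qed

lemma linear_finsum:
  assumes M: "Module.module R M" and N: "Module.module R N"
    and h: "\<And>s. s \<in> carrier M \<Longrightarrow> h s \<in> carrier N"
      "\<And>s t. s \<in> carrier M \<Longrightarrow> t \<in> carrier M \<Longrightarrow> h (s \<oplus>\<^bsub>M\<^esub> t) = h s \<oplus>\<^bsub>N\<^esub> h t"
      "\<And>r s. r \<in> carrier R \<Longrightarrow> s \<in> carrier M \<Longrightarrow> h (r \<odot>\<^bsub>M\<^esub> s) = r \<odot>\<^bsub>N\<^esub> h s"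
    and "finite A" "\<And>k. k \<in> A \<Longrightarrow> c k \<in> carrier R" "\<And>k. k \<in> A \<Longrightarrow> f k \<in> carrier M"
  shows "h (\<Oplus>\<^bsub>M\<^esub>k\<in>A. c k \<odot>\<^bsub>M\<^esub> f k) = (\<Oplus>\<^bsub>N\<^esub>k\<in>A. c k \<odot>\<^bsub>N\<^esub> h (f k))"
proof -
  interpret M: Module.module R M by (rule M)
  interpret N: Module.module R N by (rule N)
  show ?thesis using assms(6-)
  proof (induction A rule: finite_induct)
    case empty
    have "h \<zero>\<^bsub>M\<^esub> = h (\<zero>\<^bsub>R\<^esub> \<odot>\<^bsub>M\<^esub> \<zero>\<^bsub>M\<^esub>)" by simp
    also have "\<dots> = \<zero>\<^bsub>N\<^esub>" using h(1) by (subst h(3)) auto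
    finally show ?case by simp
  next
    case (insert a A)
    have 1: "(\<Oplus>\<^bsub>M\<^esub>k\<in>insert a A. c k \<odot>\<^bsub>M\<^esub> f k) = c a \<odot>\<^bsub>M\<^esub> f a \<oplus>\<^bsub>M\<^esub> (\<Oplus>\<^bsub>M\<^esub>k\<in>A. c k \<odot>\<^bsub>M\<^esub> f k)"
      by (rule M.M.finsum_insert) (use insert in auto)
    have 2: "(\<Oplus>\<^bsub>N\<^esub>k\<in>insert a A. c k \<odot>\<^bsub>N\<^esub> h (f k)) = c a \<odot>\<^bsub>N\<^esub> h (f a) \<oplus>\<^bsub>N\<^esub> (\<Oplus>\<^bsub>N\<^esub>k\<in>A. c k \<odot>\<^bsub>N\<^esub> h (f k))"
      by (rule N.M.finsum_insert) (use insert h in auto)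
    have 3: "(\<Oplus>\<^bsub>M\<^esub>k\<in>A. c k \<odot>\<^bsub>M\<^esub> f k) \<in> carrier M" using insert by (intro M.M.finsum_closed) auto
    show ?case unfolding 1 2 using insert 3 by (simp add: h)
  qed
qed

section \<open>Cech cocycles\<close>

text \<open>Cohomology classes are sets of cocycles; reflexivity shows that a class contains the
  cocycles that define it.\<close>

lemma cech_refl:
  assumes P: "is_presheaf \<O> P" and z: "z \<in> cech_Z1 P"
  shows "(z, z) \<in> cech_rel P"
proof -
  note op = is_presheaf_op[OF P]
  obtain \<U> c where z': "z = (\<U>, c)" "open_cover \<U>" and c: "\<And>U V. U \<in> \<U> \<Longrightarrow> V \<in> \<U> \<Longrightarrow> c U V \<in> carrier (sec P (U \<inter> V))"
    using z unfolding cech_Z1_def by auto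
  have o: "open U" if "U \<in> \<U>" for U using z'(2) that by (simp add: open_cover_def)
  have eq: "x \<ominus>\<^bsub>sec P U\<^esub> x = y \<ominus>\<^bsub>sec P U\<^esub> y" if "open U" "x \<in> carrier (sec P U)" "y \<in> carrier (sec P U)" for U x y
  proof -
    interpret Module.module "\<O> U" "sec P U" by (rule presheaf_module[OF P that(1)])
    show ?thesis using that by (simp add: a_minus_def M.r_neg)
  qed
  have zc: "\<zero>\<^bsub>sec P U\<^esub> \<in> carrier (sec P U)" if "open U" for U
  proof -
    interpret Module.module "\<O> U" "sec P U" by (rule presheaf_module[OF P that])
    show ?thesis by simp
  qed
  have "\<exists>\<W> u v b. open_cover \<W> \<and>
        (\<forall>W\<in>\<W>. u W \<in> \<U> \<and> W \<subseteq> u W \<and> v W \<in> \<U> \<and> W \<subseteq> v W \<and> b W \<in> carrier (sec P W)) \<and>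
        (\<forall>W\<in>\<W>. \<forall>W'\<in>\<W>.
           res P (u W \<inter> u W') (W \<inter> W') (c (u W) (u W'))
             \<ominus>\<^bsub>sec P (W \<inter> W')\<^esub> res P (v W \<inter> v W') (W \<inter> W') (c (v W) (v W'))
           = res P W' (W \<inter> W') (b W') \<ominus>\<^bsub>sec P (W \<inter> W')\<^esub> res P W (W \<inter> W') (b W))"
  proof (rule exI[of _ \<U>], rule exI[of _ "\<lambda>W. W"], rule exI[of _ "\<lambda>W. W"], rule exI[of _ "\<lambda>W. \<zero>\<^bsub>sec P W\<^esub>"], intro conjI ballI z'(2))
    fix W W' assume W: "W \<in> \<U>" "W' \<in> \<U>"
    have oW: "open (W \<inter> W')" using o W by auto
    have r: "res P W' (W \<inter> W') \<zero>\<^bsub>sec P W'\<^esub> = \<zero>\<^bsub>sec P (W \<inter> W')\<^esub>" "res P W (W \<inter> W') \<zero>\<^bsub>sec P W\<^esub> = \<zero>\<^bsub>sec P (W \<inter> W')\<^esub>"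
      using o W by (auto intro: res_zero[OF P])
    have c': "res P (W \<inter> W') (W \<inter> W') (c W W') \<in> carrier (sec P (W \<inter> W'))"
      by (rule res_closed[OF op oW oW subset_refl c[OF W]])
    show "res P (W \<inter> W') (W \<inter> W') (c W W') \<ominus>\<^bsub>sec P (W \<inter> W')\<^esub> res P (W \<inter> W') (W \<inter> W') (c W W')
           = res P W' (W \<inter> W') \<zero>\<^bsub>sec P W'\<^esub> \<ominus>\<^bsub>sec P (W \<inter> W')\<^esub> res P W (W \<inter> W') \<zero>\<^bsub>sec P W\<^esub>"
      unfolding r by (rule eq[OF oW c' zc[OF oW]])
  qed (use o zc in auto)
  then show ?thesis using z z' unfolding cech_rel_def by simp
qed

lemma cech_Z1_map:
  assumes P: "is_presheaf \<O> P" and m: "is_mor \<O> UNIV P Q \<phi>" and z: "(\<U>, c) \<in> cech_Z1 P"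
  shows "(\<U>, \<lambda>U V. \<phi> (U \<inter> V) (c U V)) \<in> cech_Z1 Q"
proof -
  note op = is_presheaf_op[OF P]
  have oc: "open_cover \<U>" and c: "\<And>U V. U \<in> \<U> \<Longrightarrow> V \<in> \<U> \<Longrightarrow> c U V \<in> carrier (sec P (U \<inter> V))"
    and co: "\<And>U V W. U \<in> \<U> \<Longrightarrow> V \<in> \<U> \<Longrightarrow> W \<in> \<U> \<Longrightarrow>
        res P (U \<inter> V) (U \<inter> V \<inter> W) (c U V) \<oplus>\<^bsub>sec P (U \<inter> V \<inter> W)\<^esub> res P (V \<inter> W) (U \<inter> V \<inter> W) (c V W)
          = res P (U \<inter> W) (U \<inter> V \<inter> W) (c U W)"
    using z unfolding cech_Z1_def by auto
  have o: "open U" if "U \<in> \<U>" for U using oc that by (simp add: open_cover_def)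
  have "res Q (U \<inter> V) (U \<inter> V \<inter> W) (\<phi> (U \<inter> V) (c U V)) \<oplus>\<^bsub>sec Q (U \<inter> V \<inter> W)\<^esub> res Q (V \<inter> W) (U \<inter> V \<inter> W) (\<phi> (V \<inter> W) (c V W))
          = res Q (U \<inter> W) (U \<inter> V \<inter> W) (\<phi> (U \<inter> W) (c U W))" if U: "U \<in> \<U>" "V \<in> \<U>" "W \<in> \<U>" for U V W
  proof -
    let ?X = "U \<inter> V \<inter> W"
    have X: "open ?X" "?X \<subseteq> U \<inter> V" "?X \<subseteq> V \<inter> W" "?X \<subseteq> U \<inter> W" "open (U \<inter> V)" "open (V \<inter> W)" "open (U \<inter> W)"
      using o U by auto
    note cc = c[OF U(1,2)] c[OF U(2,3)] c[OF U(1,3)]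
    note r = mor_res[OF m X(5,1,2) subset_UNIV cc(1)] mor_res[OF m X(6,1,3) subset_UNIV cc(2)] mor_res[OF m X(7,1,4) subset_UNIV cc(3)]
    show ?thesis unfolding r[symmetric]
      by (simp only: mor_add[OF m X(1) subset_UNIV res_closed[OF op X(5,1,2) cc(1)] res_closed[OF op X(6,1,3) cc(2)], symmetric] co[OF U])
  qed
  moreover have "\<phi> (U \<inter> V) (c U V) \<in> carrier (sec Q (U \<inter> V))" if "U \<in> \<U>" "V \<in> \<U>" for U V
    using mor_closed[OF m _ subset_UNIV c[OF that]] o that by auto
  ultimately show ?thesis using oc unfolding cech_Z1_def by simp
qed

context function_rings
begin

section \<open>Local frames\<close>

lemma free_expand:
  assumes F: "is_presheaf \<O> F" and U: "open U" and \<phi>: "is_mor \<O> U (free_sheaf \<O> n) F \<phi>"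
    and V: "open V" "V \<subseteq> U" and c: "c \<in> {..<n} \<rightarrow>\<^sub>E carrier (\<O> V)"
  defines "d W k \<equiv> (\<lambda>j\<in>{..<n}. if j = k then \<one>\<^bsub>\<O> W\<^esub> else \<zero>\<^bsub>\<O> W\<^esub>)"
  shows "\<And>k. k < n \<Longrightarrow> \<phi> U (d U k) \<in> carrier (sec F U)"
    and "\<phi> V c = (\<Oplus>\<^bsub>sec F V\<^esub>k\<in>{..<n}. c k \<odot>\<^bsub>sec F V\<^esub> res F U V (\<phi> U (d U k)))"
    and "\<phi> V (\<lambda>j\<in>{..<n}. \<zero>\<^bsub>\<O> V\<^esub>) = \<zero>\<^bsub>sec F V\<^esub>"
proof -
  interpret FV: Module.module "\<O> V" "sec F V" by (rule presheaf_module[OF F V(1)])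
  have car: "carrier (sec (free_sheaf \<O> n) W) = ({..<n} \<rightarrow>\<^sub>E carrier (\<O> W))" for W by (simp add: free_sheaf_def)
  have plus: "s \<oplus>\<^bsub>sec (free_sheaf \<O> n) W\<^esub> t = (\<lambda>j\<in>{..<n}. s j \<oplus>\<^bsub>\<O> W\<^esub> t j)" for s t W by (simp add: free_sheaf_def)
  have scal: "r \<odot>\<^bsub>sec (free_sheaf \<O> n) W\<^esub> t = (\<lambda>j\<in>{..<n}. r \<otimes>\<^bsub>\<O> W\<^esub> t j)" for r t W by (simp add: free_sheaf_def)
  have dc: "d W k \<in> carrier (sec (free_sheaf \<O> n) W)" if "open W" for W k
  proof -
    interpret W: cring "\<O> W" by (rule cring_O[OF that])
    show ?thesis by (auto simp: car d_def)
  qed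
  show 1: "\<phi> U (d U k) \<in> carrier (sec F U)" for k
    by (rule mor_closed[OF \<phi> U subset_refl dc[OF U]])
  have dV: "res F U V (\<phi> U (d U k)) = \<phi> V (d V k)" for k
  proof -
    have "res (free_sheaf \<O> n) U V (d U k) = d V k"
      using V(2) by (auto simp: free_sheaf_def d_def O_one O_zero rst_def fun_eq_iff)
    then show ?thesis using mor_res[OF \<phi> U V(1,2) subset_refl dc[OF U]] by metis
  qed
  have z0: "(\<lambda>j\<in>{..<n}. \<zero>\<^bsub>\<O> V\<^esub>) \<in> carrier (sec (free_sheaf \<O> n) V)" by (auto simp: car)
  have "(\<lambda>j\<in>{..<n}. \<zero>\<^bsub>\<O> V\<^esub>) \<oplus>\<^bsub>sec (free_sheaf \<O> n) V\<^esub> (\<lambda>j\<in>{..<n}. \<zero>\<^bsub>\<O> V\<^esub>) = (\<lambda>j\<in>{..<n}. \<zero>\<^bsub>\<O> V\<^esub>)"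
    by (auto simp: plus fun_eq_iff)
  then have "\<phi> V (\<lambda>j\<in>{..<n}. \<zero>\<^bsub>\<O> V\<^esub>) \<oplus>\<^bsub>sec F V\<^esub> \<phi> V (\<lambda>j\<in>{..<n}. \<zero>\<^bsub>\<O> V\<^esub>) = \<phi> V (\<lambda>j\<in>{..<n}. \<zero>\<^bsub>\<O> V\<^esub>)"
    using mor_add[OF \<phi> V z0 z0] by simp
  then show zero: "\<phi> V (\<lambda>j\<in>{..<n}. \<zero>\<^bsub>\<O> V\<^esub>) = \<zero>\<^bsub>sec F V\<^esub>"
    using mor_closed[OF \<phi> V z0] FV.M.add.r_cancel_one by simp
  have cj: "c j \<in> carrier (\<O> V)" if "j < n" for j using c that by auto
  have "m \<le> n \<Longrightarrow> \<phi> V (\<lambda>j\<in>{..<n}. if j < m then c j else \<zero>\<^bsub>\<O> V\<^esub>) =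
      (\<Oplus>\<^bsub>sec F V\<^esub>k\<in>{..<m}. c k \<odot>\<^bsub>sec F V\<^esub> \<phi> V (d V k))" for m
  proof (induction m)
    case 0
    show ?case by (simp only: not_less_zero if_False lessThan_0 FV.M.finsum_empty zero)
  next
    case (Suc m)
    let ?c = "\<lambda>m. (\<lambda>j\<in>{..<n}. if j < m then c j else \<zero>\<^bsub>\<O> V\<^esub>)"
    have cm: "?c m \<in> carrier (sec (free_sheaf \<O> n) V)" using cj by (auto simp: car)
    have m: "c m \<in> carrier (\<O> V)" using cj Suc by simp
    have sc: "c m \<odot>\<^bsub>sec (free_sheaf \<O> n) V\<^esub> d V m \<in> carrier (sec (free_sheaf \<O> n) V)"
    proof -
      interpret cring "\<O> V" by (rule cring_O[OF V(1)])
      show ?thesis using m by (auto simp: car scal d_def)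
    qed
    have \<phi>d: "\<phi> V (d V k) \<in> carrier (sec F V)" for k by (rule mor_closed[OF \<phi> V dc[OF V(1)]])
    interpret V: cring "\<O> V" by (rule cring_O[OF V(1)])
    have eq: "?c (Suc m) = ?c m \<oplus>\<^bsub>sec (free_sheaf \<O> n) V\<^esub> (c m \<odot>\<^bsub>sec (free_sheaf \<O> n) V\<^esub> d V m)"
      unfolding plus scal d_def
    proof (rule restrict_ext)
      fix j assume "j \<in> {..<n}"
      then have "c j \<in> carrier (\<O> V)" using cj by simp
      then show "(if j < Suc m then c j else \<zero>\<^bsub>\<O> V\<^esub>) = ?c m j \<oplus>\<^bsub>\<O> V\<^esub>
          (\<lambda>j\<in>{..<n}. c m \<otimes>\<^bsub>\<O> V\<^esub> (\<lambda>j\<in>{..<n}. if j = m then \<one>\<^bsub>\<O> V\<^esub> else \<zero>\<^bsub>\<O> V\<^esub>) j) j"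
        using \<open>j \<in> {..<n}\<close> m by (cases "j < m"; cases "j = m") simp_all
    qed
    have "\<phi> V (?c (Suc m)) = \<phi> V (?c m) \<oplus>\<^bsub>sec F V\<^esub> c m \<odot>\<^bsub>sec F V\<^esub> \<phi> V (d V m)"
      by (simp only: eq mor_add[OF \<phi> V cm sc] mor_smult[OF \<phi> V m dc[OF V(1)]])
    also have "\<phi> V (?c m) = (\<Oplus>\<^bsub>sec F V\<^esub>k\<in>{..<m}. c k \<odot>\<^bsub>sec F V\<^esub> \<phi> V (d V k))" by (rule Suc.IH) (use Suc.prems in simp)
    also have "\<dots> \<oplus>\<^bsub>sec F V\<^esub> c m \<odot>\<^bsub>sec F V\<^esub> \<phi> V (d V m) = (\<Oplus>\<^bsub>sec F V\<^esub>k\<in>{..<Suc m}. c k \<odot>\<^bsub>sec F V\<^esub> \<phi> V (d V k))"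
    proof -
      have 2: "(\<Oplus>\<^bsub>sec F V\<^esub>k\<in>{..<Suc m}. c k \<odot>\<^bsub>sec F V\<^esub> \<phi> V (d V k)) =
          c m \<odot>\<^bsub>sec F V\<^esub> \<phi> V (d V m) \<oplus>\<^bsub>sec F V\<^esub> (\<Oplus>\<^bsub>sec F V\<^esub>k\<in>{..<m}. c k \<odot>\<^bsub>sec F V\<^esub> \<phi> V (d V k))"
        unfolding lessThan_Suc by (rule FV.M.finsum_insert) (use Suc cj \<phi>d m in auto)
      have 3: "(\<Oplus>\<^bsub>sec F V\<^esub>k\<in>{..<m}. c k \<odot>\<^bsub>sec F V\<^esub> \<phi> V (d V k)) \<in> carrier (sec F V)"
        using Suc cj \<phi>d by (intro FV.M.finsum_closed) auto
      show ?thesis unfolding 2 by (rule FV.M.a_comm[OF 3 FV.smult_closed[OF m \<phi>d]])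
    qed
    finally show ?case .
  qed
  from this[OF order_refl] have 2: "\<phi> V (\<lambda>j\<in>{..<n}. if j < n then c j else \<zero>\<^bsub>\<O> V\<^esub>) =
      (\<Oplus>\<^bsub>sec F V\<^esub>k\<in>{..<n}. c k \<odot>\<^bsub>sec F V\<^esub> \<phi> V (d V k))" .
  have "(\<lambda>j\<in>{..<n}. if j < n then c j else \<zero>\<^bsub>\<O> V\<^esub>) = (\<lambda>j\<in>{..<n}. c j)"
    by (rule restrict_ext) simp
  also have "\<dots> = c" by (rule PiE_restrict[OF c])
  finally have 3: "(\<lambda>j\<in>{..<n}. if j < n then c j else \<zero>\<^bsub>\<O> V\<^esub>) = c" .
  from 2[unfolded 3] show "\<phi> V c = (\<Oplus>\<^bsub>sec F V\<^esub>k\<in>{..<n}. c k \<odot>\<^bsub>sec F V\<^esub> res F U V (\<phi> U (d U k)))"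
    by (simp only: dV)
qed

text \<open>A local isomorphism with \<open>\<O>\<^sup>n\<close> carries the standard basis to
  sections that span and are independent over every smaller open set.\<close>

lemma local_frame:
  assumes F: "locally_free \<O> n F"
  obtains U f where "open U" "x \<in> U" "\<forall>k<n. f k \<in> carrier (sec F U)"
    "\<forall>V s. open V \<and> V \<subseteq> U \<and> s \<in> carrier (sec F V) \<longrightarrow>
      (\<exists>c. (\<forall>k<n. c k \<in> carrier (\<O> V)) \<and> s = (\<Oplus>\<^bsub>sec F V\<^esub>k\<in>{..<n}. c k \<odot>\<^bsub>sec F V\<^esub> res F U V (f k)))"
    "\<forall>V c. open V \<and> V \<subseteq> U \<and> (\<forall>k<n. c k \<in> carrier (\<O> V)) \<and>
      (\<Oplus>\<^bsub>sec F V\<^esub>k\<in>{..<n}. c k \<odot>\<^bsub>sec F V\<^esub> res F U V (f k)) = \<zero>\<^bsub>sec F V\<^esub> \<longrightarrow> (\<forall>k<n. c k = \<zero>\<^bsub>\<O> V\<^esub>)"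
proof -
  have Fp: "is_presheaf \<O> F" using F by (simp add: locally_free_def sheaf_presheaf)
  obtain U \<phi> where U: "open U" "x \<in> U" and iso: "is_iso \<O> U (free_sheaf \<O> n) F \<phi>"
    using F[unfolded locally_free_def, THEN conjunct2, THEN spec[of _ x]] by (elim exE conjE)
  have m: "is_mor \<O> U (free_sheaf \<O> n) F \<phi>"
    and bij: "\<And>V. open V \<Longrightarrow> V \<subseteq> U \<Longrightarrow> bij_betw (\<phi> V) (carrier (sec (free_sheaf \<O> n) V)) (carrier (sec F V))"
    using iso unfolding is_iso_def by auto
  have car: "carrier (sec (free_sheaf \<O> n) W) = ({..<n} \<rightarrow>\<^sub>E carrier (\<O> W))" for W by (simp add: free_sheaf_def)
  define f where "f k = \<phi> U (\<lambda>j\<in>{..<n}. if j = k then \<one>\<^bsub>\<O> U\<^esub> else \<zero>\<^bsub>\<O> U\<^esub>)" for k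
  have zU: "(\<lambda>j\<in>{..<n}. \<zero>\<^bsub>\<O> U\<^esub>) \<in> {..<n} \<rightarrow>\<^sub>E carrier (\<O> U)"
  proof -
    interpret cring "\<O> U" by (rule cring_O[OF U(1)])
    show ?thesis by auto
  qed
  note FE = free_expand[OF Fp U(1) m, folded f_def]
  have ex: "\<phi> V c = (\<Oplus>\<^bsub>sec F V\<^esub>k\<in>{..<n}. c k \<odot>\<^bsub>sec F V\<^esub> res F U V (f k))"
    if "open V" "V \<subseteq> U" "c \<in> {..<n} \<rightarrow>\<^sub>E carrier (\<O> V)" for V c
    using FE(2)[OF that] .
  show ?thesis
  proof (rule that[of U f], goal_cases)
    case 1 show ?case by (rule U)
  next
    case 2 show ?case by (rule U)
  next
    case 3 show ?case using FE(1)[OF U(1) subset_refl zU] by blast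
  next
    case 4
    have "\<exists>c. (\<forall>k<n. c k \<in> carrier (\<O> V)) \<and> s = (\<Oplus>\<^bsub>sec F V\<^esub>k\<in>{..<n}. c k \<odot>\<^bsub>sec F V\<^esub> res F U V (f k))"
      if V: "open V" "V \<subseteq> U" "s \<in> carrier (sec F V)" for V s
    proof -
      obtain c where c: "c \<in> {..<n} \<rightarrow>\<^sub>E carrier (\<O> V)" "s = \<phi> V c"
        using bij[OF V(1,2)] V(3) unfolding bij_betw_def car by blast
      then show ?thesis using ex[OF V(1,2) c(1)] by auto
    qed
    then show ?case by simp
  next
    case 5
    have "\<forall>k<n. c k = \<zero>\<^bsub>\<O> V\<^esub>" if V: "open V" "V \<subseteq> U" and c: "\<And>k. k < n \<Longrightarrow> c k \<in> carrier (\<O> V)"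
      and eq: "(\<Oplus>\<^bsub>sec F V\<^esub>k\<in>{..<n}. c k \<odot>\<^bsub>sec F V\<^esub> res F U V (f k)) = \<zero>\<^bsub>sec F V\<^esub>" for V c
    proof -
    interpret V: cring "\<O> V" by (rule cring_O[OF V(1)])
    interpret FV: Module.module "\<O> V" "sec F V" by (rule presheaf_module[OF Fp V(1)])
    define c' where "c' = (\<lambda>j\<in>{..<n}. c j)"
    have c': "c' \<in> {..<n} \<rightarrow>\<^sub>E carrier (\<O> V)" using c by (auto simp: c'_def)
    have rf: "res F U V (f k) \<in> carrier (sec F V)" if "k < n" for k
      by (rule res_closed[OF is_presheaf_op[OF Fp] U(1) V FE(1)[OF U(1) subset_refl zU that]])
    have "(\<Oplus>\<^bsub>sec F V\<^esub>k\<in>{..<n}. c' k \<odot>\<^bsub>sec F V\<^esub> res F U V (f k)) = (\<Oplus>\<^bsub>sec F V\<^esub>k\<in>{..<n}. c k \<odot>\<^bsub>sec F V\<^esub> res F U V (f k))"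
      by (rule FV.M.finsum_cong') (use c rf in \<open>auto simp: c'_def\<close>)
    then have "\<phi> V c' = \<phi> V (\<lambda>j\<in>{..<n}. \<zero>\<^bsub>\<O> V\<^esub>)" using ex[OF V c'] eq FE(3)[OF V c'] by simp
    moreover have "(\<lambda>j\<in>{..<n}. \<zero>\<^bsub>\<O> V\<^esub>) \<in> {..<n} \<rightarrow>\<^sub>E carrier (\<O> V)" by auto
    ultimately have "c' = (\<lambda>j\<in>{..<n}. \<zero>\<^bsub>\<O> V\<^esub>)"
      using bij[OF V] c' unfolding bij_betw_def car inj_on_def by blast
    then have "c' k = (\<lambda>j\<in>{..<n}. \<zero>\<^bsub>\<O> V\<^esub>) k" for k by (rule fun_cong)
    from this[unfolded c'_def] have "c k = \<zero>\<^bsub>\<O> V\<^esub>" if "k < n" for k using that by (metis lessThan_iff restrict_apply')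
    then show ?thesis by blast
    qed
    then show ?case by simp
  qed
qed

lemma line_frame:
  assumes L: "invertible_sheaf \<O> L"
  obtains U e where "open U" "x \<in> U" "e \<in> carrier (sec L U)"
    "\<forall>V s. open V \<and> V \<subseteq> U \<and> s \<in> carrier (sec L V) \<longrightarrow> (\<exists>c\<in>carrier (\<O> V). s = c \<odot>\<^bsub>sec L V\<^esub> res L U V e)"
    "\<forall>V c. open V \<and> V \<subseteq> U \<and> c \<in> carrier (\<O> V) \<and> c \<odot>\<^bsub>sec L V\<^esub> res L U V e = \<zero>\<^bsub>sec L V\<^esub> \<longrightarrow> c = \<zero>\<^bsub>\<O> V\<^esub>"
proof -
  have Lp: "is_presheaf \<O> L" using L by (simp add: locally_free_def sheaf_presheaf)
  obtain U f where U: "open U" "x \<in> U" "\<forall>k<1. f k \<in> carrier (sec L U)"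
    and span: "\<forall>V s. open V \<and> V \<subseteq> U \<and> s \<in> carrier (sec L V) \<longrightarrow>
      (\<exists>c. (\<forall>k<1. c k \<in> carrier (\<O> V)) \<and> s = (\<Oplus>\<^bsub>sec L V\<^esub>k\<in>{..<1::nat}. c k \<odot>\<^bsub>sec L V\<^esub> res L U V (f k)))"
    and indep: "\<forall>V c. open V \<and> V \<subseteq> U \<and> (\<forall>k<1. c k \<in> carrier (\<O> V)) \<and>
      (\<Oplus>\<^bsub>sec L V\<^esub>k\<in>{..<1::nat}. c k \<odot>\<^bsub>sec L V\<^esub> res L U V (f k)) = \<zero>\<^bsub>sec L V\<^esub> \<longrightarrow> (\<forall>k<1. c k = \<zero>\<^bsub>\<O> V\<^esub>)"
    by (rule local_frame[OF L, of x])
  have sum: "(\<Oplus>\<^bsub>sec L V\<^esub>k\<in>{..<1::nat}. c k \<odot>\<^bsub>sec L V\<^esub> res L U V (f k)) = c 0 \<odot>\<^bsub>sec L V\<^esub> res L U V (f 0)"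
    if V: "open V" "V \<subseteq> U" "c 0 \<in> carrier (\<O> V)" for V c
  proof -
    interpret LV: Module.module "\<O> V" "sec L V" by (rule presheaf_module[OF Lp V(1)])
    have "res L U V (f 0) \<in> carrier (sec L V)" using res_closed[OF is_presheaf_op[OF Lp] U(1) V(1,2)] U(3) by simp
    moreover have "{..<1::nat} = {0}" by auto
    ultimately show ?thesis using V by simp
  qed
  show ?thesis
  proof (rule that[of U "f 0"])
    have "\<exists>c\<in>carrier (\<O> V). s = c \<odot>\<^bsub>sec L V\<^esub> res L U V (f 0)"
      if V: "open V" "V \<subseteq> U" "s \<in> carrier (sec L V)" for V s
    proof -
      obtain c where c: "\<forall>k<1. c k \<in> carrier (\<O> V)" "s = (\<Oplus>\<^bsub>sec L V\<^esub>k\<in>{..<1::nat}. c k \<odot>\<^bsub>sec L V\<^esub> res L U V (f k))"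
        using span V by blast
      then have "c 0 \<in> carrier (\<O> V)" by simp
      then show ?thesis using c sum[OF V(1,2), of c] by blast
    qed
    then show "\<forall>V s. open V \<and> V \<subseteq> U \<and> s \<in> carrier (sec L V) \<longrightarrow> (\<exists>c\<in>carrier (\<O> V). s = c \<odot>\<^bsub>sec L V\<^esub> res L U V (f 0))"
      by blast
    have "c = \<zero>\<^bsub>\<O> V\<^esub>" if V: "open V" "V \<subseteq> U" "c \<in> carrier (\<O> V)" "c \<odot>\<^bsub>sec L V\<^esub> res L U V (f 0) = \<zero>\<^bsub>sec L V\<^esub>" for V c
      using indep[THEN spec[of _ V], THEN spec[of _ "\<lambda>_. c"]] sum[OF V(1,2), of "\<lambda>_. c"] V by simp
    then show "\<forall>V c. open V \<and> V \<subseteq> U \<and> c \<in> carrier (\<O> V) \<and> c \<odot>\<^bsub>sec L V\<^esub> res L U V (f 0) = \<zero>\<^bsub>sec L V\<^esub> \<longrightarrow> c = \<zero>\<^bsub>\<O> V\<^esub>"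
      by blast
  qed (use U in auto)
qed

end

section \<open>Extensions by a line bundle\<close>

context function_rings
begin

lemma ext_is_sheaf: "is_presheaf \<O> E \<Longrightarrow> is_sheaf \<O> (ext_sheaf \<O> k E)"
  unfolding ext_sheaf_def by (rule sheafify_sheaf[OF ext_presheaf[OF is_presheaf_op]])

lemma res_ext: "is_presheaf \<O> E \<Longrightarrow> res (ext_sheaf \<O> k E) U V \<omega> = restrict \<omega> V"
  unfolding ext_sheaf_def by (rule res_sheafify[OF ext_presheaf[OF is_presheaf_op]])

end

locale line_extension = function_rings \<O>
  for \<O> :: "('a::topological_space) ring_sheaf" +
  fixes L :: "('a, 'l) mod_presheaf" and E :: "('a, 'e) mod_presheaf" and F :: "('a, 'f) mod_presheaf"
    and i :: "'a set \<Rightarrow> 'l \<Rightarrow> 'e" and p :: "'a set \<Rightarrow> 'e \<Rightarrow> 'f"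
  assumes L: "invertible_sheaf \<O> L" and E: "is_sheaf \<O> E" and F: "is_sheaf \<O> F"
    and exact: "short_exact \<O> L E F i p"
begin

lemma Ls: "is_sheaf \<O> L" using L by (simp add: locally_free_def)
lemma Lp: "is_presheaf \<O> L" by (rule sheaf_presheaf[OF Ls])
lemma Ep: "is_presheaf \<O> E" by (rule sheaf_presheaf[OF E])
lemma Fp: "is_presheaf \<O> F" by (rule sheaf_presheaf[OF F])
lemmas opL = is_presheaf_op[OF Lp] and opE = is_presheaf_op[OF Ep] and opF = is_presheaf_op[OF Fp]

lemma imor: "is_mor \<O> UNIV L E i" and pmor: "is_mor \<O> UNIV E F p"
  using exact by (simp_all add: short_exact_def)

lemma i_inj: "open U \<Longrightarrow> l \<in> carrier (sec L U) \<Longrightarrow> l' \<in> carrier (sec L U) \<Longrightarrow> i U l = i U l' \<Longrightarrow> l = l'"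
  using exact by (auto simp: short_exact_def dest: inj_onD)

lemma ker_local: "open U \<Longrightarrow> e \<in> carrier (sec E U) \<Longrightarrow> p U e = \<zero>\<^bsub>sec F U\<^esub> \<Longrightarrow> x \<in> U \<Longrightarrow>
    \<exists>V. open V \<and> x \<in> V \<and> V \<subseteq> U \<and> res E U V e \<in> i V ` carrier (sec L V)"
  using exact by (simp add: short_exact_def)

lemmas i_closed = mor_closed[OF imor _ subset_UNIV] and p_closed = mor_closed[OF pmor _ subset_UNIV]

text \<open>Sheaf exactness only gives preimages locally; as \<open>i\<close> is injective they glue.\<close>

lemma exact_kernel:
  assumes U: "open U" and e: "e \<in> carrier (sec E U)" and pe: "p U e = \<zero>\<^bsub>sec F U\<^esub>"
  obtains l where "l \<in> carrier (sec L U)" "i U l = e"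
proof -
  define A where "A x = (SOME V. open V \<and> x \<in> V \<and> V \<subseteq> U \<and> res E U V e \<in> i V ` carrier (sec L V))" for x
  have A: "open (A x)" "x \<in> A x" "A x \<subseteq> U" "res E U (A x) e \<in> i (A x) ` carrier (sec L (A x))" if "x \<in> U" for x
    using someI_ex[OF ker_local[OF U e pe that]] by (auto simp: A_def)
  define l where "l x = (SOME l. l \<in> carrier (sec L (A x)) \<and> i (A x) l = res E U (A x) e)" for x
  have l: "l x \<in> carrier (sec L (A x))" "i (A x) (l x) = res E U (A x) e" if x: "x \<in> U" for x
  proof -
    have "\<exists>l. l \<in> carrier (sec L (A x)) \<and> i (A x) l = res E U (A x) e" using A(4)[OF x] by (auto simp: image_iff)
    from someI_ex[OF this] show "l x \<in> carrier (sec L (A x))" "i (A x) (l x) = res E U (A x) e" by (auto simp: l_def)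
  qed
  have cov: "(\<Union>x\<in>U. A x) = U" using A by blast
  obtain g where g: "g \<in> carrier (sec L U)" "\<And>x. x \<in> U \<Longrightarrow> res L U (A x) g = l x"
  proof (rule sheaf_glue[OF Ls, of U A l])
    fix x y assume x: "x \<in> U" and y: "y \<in> U"
    have o: "open (A x \<inter> A y)" using A x y by auto
    note c = res_closed[OF opL A(1)[OF x] o _ l(1)[OF x]] res_closed[OF opL A(1)[OF y] o _ l(1)[OF y]]
    have "i (A x \<inter> A y) (res L (A x) (A x \<inter> A y) (l x)) = res E U (A x \<inter> A y) e"
      using A[OF x] l[OF x] o U e by (simp add: mor_res[OF imor A(1)[OF x] o _ subset_UNIV l(1)[OF x]] res_comp[OF opE])
    moreover have "i (A x \<inter> A y) (res L (A y) (A x \<inter> A y) (l y)) = res E U (A x \<inter> A y) e"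
      using A[OF y] l[OF y] o U e by (simp add: mor_res[OF imor A(1)[OF y] o _ subset_UNIV l(1)[OF y]] res_comp[OF opE])
    ultimately show "res L (A x) (A x \<inter> A y) (l x) = res L (A y) (A x \<inter> A y) (l y)"
      by (intro i_inj[OF o] c) auto
  qed (use A(1) l(1) cov that in auto)
  have "i U g = e"
  proof (rule sheaf_separated[OF E U i_closed[OF U g(1)] e])
    fix x assume x: "x \<in> U"
    have "res E U (A x) (i U g) = res E U (A x) e"
      using mor_res[OF imor U A(1)[OF x] A(3)[OF x] subset_UNIV g(1)] g(2)[OF x] l(2)[OF x] by simp
    then show "\<exists>V. open V \<and> x \<in> V \<and> V \<subseteq> U \<and> res E U V (i U g) = res E U V e" using A[OF x] by blast
  qed
  then show ?thesis using that g(1) by blast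
qed

text \<open>\<open>L\<close> has rank one, so locally \<open>i l\<close> and \<open>i l'\<close> are
  multiples of the image of one generator.\<close>

lemma wedge_line_zero:
  assumes U: "open U" and l: "l \<in> carrier (sec L U)" "l' \<in> carrier (sec L U)"
    and xs: "xs @ i U l' # ys \<in> ext_gens k (sec E U)" and mem: "i U l \<in> set xs"
  shows "wedge \<O> E U (xs @ i U l' # ys) = \<zero>\<^bsub>sec (ext_sheaf \<O> k E) U\<^esub>"
proof (rule sheaf_separated[OF ext_is_sheaf[OF Ep] U])
  interpret W: alternating "\<O> U" "sec E U" "sec (ext_sheaf \<O> k E) U" k "wedge \<O> E U" by (rule wedge_alternating[OF Ep U])
  show "wedge \<O> E U (xs @ i U l' # ys) \<in> carrier (sec (ext_sheaf \<O> k E) U)" by (rule W.m_closed[OF xs])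
  show "\<zero>\<^bsub>sec (ext_sheaf \<O> k E) U\<^esub> \<in> carrier (sec (ext_sheaf \<O> k E) U)" by (rule W.T.M.zero_closed)
  fix x assume x: "x \<in> U"
  obtain A e where A: "open A" "x \<in> A" "e \<in> carrier (sec L A)"
    and sp: "\<forall>V s. open V \<and> V \<subseteq> A \<and> s \<in> carrier (sec L V) \<longrightarrow> (\<exists>c\<in>carrier (\<O> V). s = c \<odot>\<^bsub>sec L V\<^esub> res L A V e)"
    by (rule line_frame[OF L, of x])
  let ?V = "U \<inter> A"
  have V: "open ?V" "?V \<subseteq> U" "?V \<subseteq> A" using U A by auto
  note eV = res_closed[OF opL A(1) V(1,3) A(3)]
  let ?g = "i ?V (res L A ?V e)"
  have gc: "?g \<in> carrier (sec E ?V)" by (rule i_closed[OF V(1) eV])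
  have gen: "\<exists>c\<in>carrier (\<O> ?V). res E U ?V (i U l) = c \<odot>\<^bsub>sec E ?V\<^esub> ?g" if l: "l \<in> carrier (sec L U)" for l
  proof -
    obtain c where c: "c \<in> carrier (\<O> ?V)" "res L U ?V l = c \<odot>\<^bsub>sec L ?V\<^esub> res L A ?V e"
      using sp res_closed[OF opL U V(1,2) l] V by blast
    have "res E U ?V (i U l) = i ?V (res L U ?V l)" by (rule mor_res[OF imor U V(1,2) subset_UNIV l, symmetric])
    then show ?thesis using c mor_smult[OF imor V(1) subset_UNIV c(1) eV] by auto
  qed
  obtain c where c: "c \<in> carrier (\<O> ?V)" "res E U ?V (i U l) = c \<odot>\<^bsub>sec E ?V\<^esub> ?g" using gen[OF l(1)] by blast
  obtain c' where c': "c' \<in> carrier (\<O> ?V)" "res E U ?V (i U l') = c' \<odot>\<^bsub>sec E ?V\<^esub> ?g" using gen[OF l(2)] by blast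
  interpret V: alternating "\<O> ?V" "sec E ?V" "sec (ext_sheaf \<O> k E) ?V" k "wedge \<O> E ?V"
    by (rule wedge_alternating[OF Ep V(1)])
  let ?r = "res E U ?V"
  have sub: "set (xs @ i U l' # ys) \<subseteq> carrier (sec E U)" and len: "length (xs @ i U l' # ys) = k"
    using xs by (auto simp: ext_gens_def)
  have "map ?r xs @ (c' \<odot>\<^bsub>sec E ?V\<^esub> ?g) # map ?r ys \<in> ext_gens k (sec E ?V)"
    using sub len res_closed[OF opE U V(1,2)] c' gc by (auto simp: ext_gens_def)
  moreover have "c \<odot>\<^bsub>sec E ?V\<^esub> ?g \<in> set (map ?r xs)" using mem c(2)[symmetric] by auto
  ultimately have "wedge \<O> E ?V (map ?r xs @ (c' \<odot>\<^bsub>sec E ?V\<^esub> ?g) # map ?r ys) = \<zero>\<^bsub>sec (ext_sheaf \<O> k E) ?V\<^esub>"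
    by (rule V.m_line_zero[OF _ _ c(1) c'(1) gc])
  then have "restrict (wedge \<O> E U (xs @ i U l' # ys)) ?V = \<zero>\<^bsub>sec (ext_sheaf \<O> k E) ?V\<^esub>"
    using wedge_res[OF Ep U V(1,2) sub] c'(2) by simp
  then have "res (ext_sheaf \<O> k E) U ?V (wedge \<O> E U (xs @ i U l' # ys)) =
      res (ext_sheaf \<O> k E) U ?V \<zero>\<^bsub>sec (ext_sheaf \<O> k E) U\<^esub>"
    using res_zero[OF sheaf_presheaf[OF ext_is_sheaf[OF Ep]] U V(1,2), of k] by (simp add: res_ext[OF Ep])
  then show "\<exists>V. open V \<and> x \<in> V \<and> V \<subseteq> U \<and> res (ext_sheaf \<O> k E) U V (wedge \<O> E U (xs @ i U l' # ys)) =
      res (ext_sheaf \<O> k E) U V \<zero>\<^bsub>sec (ext_sheaf \<O> k E) U\<^esub>" using V A x by blast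
qed

section \<open>The product of a section of the line bundle with a wedge product\<close>

text \<open>Each \<open>y - \<sigma> (p y)\<close> comes from \<open>L\<close>, and such entries
  disappear behind \<open>i l\<close>. Hence a product \<open>i l \<and> y\<^sub>1 \<and> \<dots>
  \<and> y\<^sub>n\<close> depends only on the images \<open>p y\<^sub>j\<close>.\<close>

lemma wedge_splitting:
  assumes U: "open U" and \<sigma>: "is_mor \<O> U F E \<sigma>" "\<And>V s. open V \<Longrightarrow> V \<subseteq> U \<Longrightarrow> s \<in> carrier (sec F V) \<Longrightarrow> p V (\<sigma> V s) = s"
    and l: "l \<in> carrier (sec L U)" and ys: "ys \<in> ext_gens n (sec E U)"
  shows "wedge \<O> E U (i U l # map (\<lambda>y. \<sigma> U (p U y)) ys) = wedge \<O> E U (i U l # ys)"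
proof -
  interpret W: alternating "\<O> U" "sec E U" "sec (ext_sheaf \<O> (Suc n) E) U" "Suc n" "wedge \<O> E U" by (rule wedge_alternating[OF Ep U])
  have yc: "y \<in> carrier (sec E U)" if "y \<in> set ys" for y using ys that by (auto simp: ext_gens_def)
  let ?v = "\<lambda>y. \<sigma> U (p U y)" and ?u = "\<lambda>y. y \<ominus>\<^bsub>sec E U\<^esub> \<sigma> U (p U y)"
  have v: "?v y \<in> carrier (sec E U)" if "y \<in> set ys" for y
    by (rule mor_closed[OF \<sigma>(1) U subset_refl p_closed[OF U yc[OF that]]])
  have u: "\<exists>l'\<in>carrier (sec L U). ?u y = i U l'" if y: "y \<in> set ys" for y
  proof -
    interpret FU: Module.module "\<O> U" "sec F U" by (rule presheaf_module[OF Fp U])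
    have "p U (?u y) = \<zero>\<^bsub>sec F U\<^esub>"
      using mor_minus[OF pmor Ep Fp U subset_UNIV yc[OF y] v[OF y]] \<sigma>(2)[OF U subset_refl p_closed[OF U yc[OF y]]]
        p_closed[OF U yc[OF y]] by (simp add: a_minus_def FU.M.r_neg)
    then obtain l' where "l' \<in> carrier (sec L U)" "i U l' = ?u y"
      using exact_kernel[OF U, of "?u y"] yc[OF y] v[OF y] by (metis W.M.M.minus_closed)
    then show ?thesis by metis
  qed
  have uc: "?u y \<in> carrier (sec E U)" if "y \<in> set ys" for y using yc[OF that] v[OF that] by simp
  have "wedge \<O> E U ([i U l] @ map (\<lambda>y. ?v y \<oplus>\<^bsub>sec E U\<^esub> ?u y) ys @ []) = wedge \<O> E U ([i U l] @ map ?v ys @ [])"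
  proof (rule W.m_replace[of "i U l"])
    show "set [i U l] \<subseteq> carrier (sec E U)" using i_closed[OF U l] by simp
    show "length [i U l] + length ys + length [] = Suc n" using ys by (simp add: ext_gens_def)
    fix xs y zs assume y: "y \<in> set ys" and a: "i U l \<in> set xs" and g: "xs @ ?u y # zs \<in> ext_gens (Suc n) (sec E U)"
    obtain l' where l': "l' \<in> carrier (sec L U)" "?u y = i U l'" using u[OF y] by blast
    show "wedge \<O> E U (xs @ ?u y # zs) = \<zero>\<^bsub>sec (ext_sheaf \<O> (Suc n) E) U\<^esub>"
      unfolding l'(2) by (rule wedge_line_zero[OF U l l'(1) g[unfolded l'(2)] a])
  qed (use v uc in auto)
  moreover have "map (\<lambda>y. ?v y \<oplus>\<^bsub>sec E U\<^esub> ?u y) ys = ys"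
  proof (rule map_idI)
    fix y assume y: "y \<in> set ys"
    show "?v y \<oplus>\<^bsub>sec E U\<^esub> ?u y = y" using yc[OF y] v[OF y]
      by (simp add: a_minus_def W.M.M.a_lcomm W.M.M.r_neg)
  qed
  ultimately show ?thesis by simp
qed

text \<open>Over an open set with a splitting \<open>\<sigma>\<close>, multiplication by
  \<open>l\<close> is a morphism of exterior powers, \<open>x\<^sub>1 \<and> \<dots> \<and>
  x\<^sub>n \<mapsto> i l \<and> \<sigma> x\<^sub>1 \<and> \<dots> \<and> \<sigma>
  x\<^sub>n\<close>. Its existence makes products independent of how an element of
  \<open>\<And>\<^sup>n F\<close> is written.\<close>

lemma wedge_lift:
  assumes U: "open U" and \<sigma>: "is_mor \<O> U F E \<sigma>" and l: "l \<in> carrier (sec L U)"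
  obtains \<Psi> where "is_mor \<O> U (ext_sheaf \<O> n F) (ext_sheaf \<O> (Suc n) E) \<Psi>"
    "\<And>xs. xs \<in> ext_gens n (sec F U) \<Longrightarrow> \<Psi> U (wedge \<O> F U xs) = wedge \<O> E U (i U l # map (\<sigma> U) xs)"
proof -
  let ?N = "ext_sheaf \<O> (Suc n) E"
  note Ns = ext_is_sheaf[OF Ep, of "Suc n"] note Np = sheaf_presheaf[OF Ns]
  let ?\<beta> = "\<lambda>V xs. wedge \<O> E V (i V (res L U V l) # map (\<sigma> V) xs)"
  have g: "i V (res L U V l) # map (\<sigma> V) xs \<in> ext_gens (Suc n) (sec E V)"
    if "open V" "V \<subseteq> U" "xs \<in> ext_gens n (sec F V)" for V xs
    using that i_closed[OF that(1) res_closed[OF opL U that(1,2) l]] mor_closed[OF \<sigma> that(1,2)] by (auto simp: ext_gens_def)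
  have 1: "?\<beta> V xs \<in> carrier (sec ?N V)" if V: "open V" "V \<subseteq> U" "xs \<in> ext_gens n (sec F V)" for V xs
    by (rule alternating.m_closed[OF wedge_alternating[OF Ep V(1)] g[OF V]])
  have 2: "?\<beta> V (xs @ (s \<oplus>\<^bsub>sec F V\<^esub> t) # ys) = ?\<beta> V (xs @ s # ys) \<oplus>\<^bsub>sec ?N V\<^esub> ?\<beta> V (xs @ t # ys)"
    if V: "open V" "V \<subseteq> U" and s: "xs @ s # ys \<in> ext_gens n (sec F V)" and t: "t \<in> carrier (sec F V)" for V xs s t ys
    using alternating.m_add[OF wedge_alternating[OF Ep V(1)], of "i V (res L U V l) # map (\<sigma> V) xs" "\<sigma> V s" "map (\<sigma> V) ys" "Suc n" "\<sigma> V t"]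
      g[OF V s] mor_closed[OF \<sigma> V t] mor_add[OF \<sigma> V ext_gens_elem[OF s] t] by simp
  have 3: "?\<beta> V (xs @ (r \<odot>\<^bsub>sec F V\<^esub> s) # ys) = r \<odot>\<^bsub>sec ?N V\<^esub> ?\<beta> V (xs @ s # ys)"
    if V: "open V" "V \<subseteq> U" and s: "xs @ s # ys \<in> ext_gens n (sec F V)" and r: "r \<in> carrier (\<O> V)" for V xs s r ys
    using alternating.m_smult[OF wedge_alternating[OF Ep V(1)], of "i V (res L U V l) # map (\<sigma> V) xs" "\<sigma> V s" "map (\<sigma> V) ys" "Suc n" r]
      g[OF V s] r mor_smult[OF \<sigma> V r ext_gens_elem[OF s]] by simp
  have 4: "?\<beta> V xs = \<zero>\<^bsub>sec ?N V\<^esub>" if V: "open V" "V \<subseteq> U" "xs \<in> ext_gens n (sec F V)" and d: "\<not> distinct xs" for V xs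
    by (rule alternating.m_alt[OF wedge_alternating[OF Ep V(1)] g[OF V]]) (use d in \<open>auto simp: distinct_map\<close>)
  have 5: "res ?N V W (?\<beta> V xs) = ?\<beta> W (map (res F V W) xs)"
    if V: "open V" "open W" "W \<subseteq> V" "V \<subseteq> U" and xs: "xs \<in> ext_gens n (sec F V)" for V W xs
  proof -
    have sub: "set (i V (res L U V l) # map (\<sigma> V) xs) \<subseteq> carrier (sec E V)" using g[OF V(1,4) xs] by (simp add: ext_gens_def)
    have "res E V W (i V (res L U V l)) = i W (res L U W l)"
      using mor_res[OF imor V(1-3) subset_UNIV res_closed[OF opL U V(1,4) l]] res_comp[OF opL U V(1-4) l] by simp
    moreover have "map (res E V W) (map (\<sigma> V) xs) = map (\<sigma> W) (map (res F V W) xs)"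
      using xs mor_res[OF \<sigma> V] by (auto simp: ext_gens_def)
    ultimately show ?thesis using wedge_res[OF Ep V(1-3) sub] by (simp only: res_ext[OF Ep] list.map)
  qed
  define \<psi> where "\<psi> = (\<lambda>V. quot_lift (\<O> V) id (sec ?N V) (?\<beta> V))"
  note EL = ext_lift[OF opF Np U, of n ?\<beta>]
  have m: "is_mor \<O> U (ext_presheaf \<O> n F) ?N \<psi>"
    unfolding \<psi>_def by (rule EL(1)) (assumption | rule 1 2 3 4 5)+
  have val: "\<psi> U (pure_wedge (\<O> U) (sec F U) xs) = ?\<beta> U xs" if xs: "xs \<in> ext_gens n (sec F U)" for xs
    unfolding \<psi>_def by (rule EL(2)) (assumption | rule U subset_refl xs 1 2 3 4 5)+
  note P = ext_presheaf[OF opF, of n]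
  show ?thesis
  proof (rule that[of "sh_ext ?N \<psi>"])
    show "is_mor \<O> U (ext_sheaf \<O> n F) ?N (sh_ext ?N \<psi>)"
      unfolding ext_sheaf_def[of \<O> n F] by (rule sh_ext_mor[OF P Ns U m])
    fix xs assume xs: "xs \<in> ext_gens n (sec F U)"
    have c: "pure_wedge (\<O> U) (sec F U) xs \<in> carrier (sec (ext_presheaf \<O> n F) U)"
      using pure_wedge_closed[OF cring_O[OF U] op_closed_sec[OF opF U] xs] by (simp add: sec_ext)
    have "wedge \<O> F U xs = sh_unit (ext_presheaf \<O> n F) U (pure_wedge (\<O> U) (sec F U) xs)"
      using xs by (simp add: wedge_def ext_gens_def)
    then show "sh_ext ?N \<psi> U (wedge \<O> F U xs) = wedge \<O> E U (i U l # map (\<sigma> U) xs)"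
      using sh_ext_unit[OF P Ns U m U subset_refl c] val[OF xs] res_id[OF opL U l] by simp
  qed
qed

text \<open>The product \<open>det_mult\<close> is described by a condition on all presentations
  \<open>a (p e\<^sub>1 \<and> \<dots> \<and> p e\<^sub>n)\<close> of restrictions of the second
  factor. For \<open>p s\<^sub>1 \<and> \<dots> \<and> p s\<^sub>n\<close> the section \<open>i l
  \<and> s\<^sub>1 \<and> \<dots> \<and> s\<^sub>n\<close> meets the condition: apply locally the
  map of \<open>wedge_lift\<close> and remove the splitting with
  \<open>wedge_splitting\<close>.\<close>

lemma det_mult_wedge:
  assumes split: "\<And>x. \<exists>U \<sigma>. open U \<and> x \<in> U \<and> is_mor \<O> U F E \<sigma> \<and>
      (\<forall>V. open V \<and> V \<subseteq> U \<longrightarrow> (\<forall>s\<in>carrier (sec F V). p V (\<sigma> V s) = s))"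
    and l: "l \<in> carrier (H0 L)" and ss: "ss \<in> ext_gens n (H0 E)"
  shows "det_mult \<O> n L E F i p UNIV l (wedge \<O> F UNIV (map (p UNIV) ss)) = wedge \<O> E UNIV (i UNIV l # ss)"
  unfolding det_mult_def Let_def
proof (rule the_equality)
  let ?dF = "ext_sheaf \<O> n F" and ?dE = "ext_sheaf \<O> (n + 1) E"
  let ?\<omega> = "wedge \<O> F UNIV (map (p UNIV) ss)" and ?\<theta> = "wedge \<O> E UNIV (i UNIV l # ss)"
  note dEs = ext_is_sheaf[OF Ep, of "n + 1"] note dEp = sheaf_presheaf[OF dEs] note opdE = is_presheaf_op[OF dEp]
  note dFs = ext_is_sheaf[OF Fp, of n] note dFp = sheaf_presheaf[OF dFs] note opdF = is_presheaf_op[OF dFp]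
  have ssc: "set ss \<subseteq> carrier (H0 E)" and len: "length ss = n" using ss by (auto simp: ext_gens_def)
  have pss: "map (p UNIV) ss \<in> ext_gens n (H0 F)" using ss p_closed[OF open_UNIV] by (auto simp: ext_gens_def)
  have iss: "set (i UNIV l # ss) \<subseteq> carrier (H0 E)" using ssc i_closed[OF open_UNIV l] by auto
  have \<theta>c: "?\<theta> \<in> carrier (H0 ?dE)"
    by (rule alternating.m_closed[OF wedge_alternating[OF Ep open_UNIV]]) (use iss len in \<open>simp add: ext_gens_def\<close>)
  have \<omega>c: "?\<omega> \<in> carrier (H0 ?dF)"
    by (rule alternating.m_closed[OF wedge_alternating[OF Fp open_UNIV] pss])
  have main: "res ?dE UNIV V ?\<theta> = a \<odot>\<^bsub>sec ?dE V\<^esub> wedge \<O> E V (i V (res L UNIV V l) # es)"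
    if V: "open V" and a: "a \<in> carrier (\<O> V)" and es: "length es = n" "set es \<subseteq> carrier (sec E V)"
      and eq: "res ?dF UNIV V ?\<omega> = a \<odot>\<^bsub>sec ?dF V\<^esub> wedge \<O> F V (map (p V) es)" for V a es
  proof (rule sheaf_separated[OF dEs V])
    note lV = res_closed[OF opL open_UNIV V subset_UNIV l]
    have ies: "set (i V (res L UNIV V l) # es) \<subseteq> carrier (sec E V)" using es i_closed[OF V lV] by auto
    have wE: "wedge \<O> E V (i V (res L UNIV V l) # es) \<in> carrier (sec ?dE V)"
      by (rule alternating.m_closed[OF wedge_alternating[OF Ep V]]) (use ies es in \<open>simp add: ext_gens_def\<close>)
    have pes: "map (p V) es \<in> ext_gens n (sec F V)" using es p_closed[OF V] by (auto simp: ext_gens_def)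
    have wF: "wedge \<O> F V (map (p V) es) \<in> carrier (sec ?dF V)"
      by (rule alternating.m_closed[OF wedge_alternating[OF Fp V] pes])
    show "res ?dE UNIV V ?\<theta> \<in> carrier (sec ?dE V)" by (rule res_closed[OF opdE open_UNIV V subset_UNIV \<theta>c])
    show "a \<odot>\<^bsub>sec ?dE V\<^esub> wedge \<O> E V (i V (res L UNIV V l) # es) \<in> carrier (sec ?dE V)"
      by (rule op_smult[OF opdE V a wE])
    fix x assume x: "x \<in> V"
    obtain U \<sigma> where U: "open U" "x \<in> U" and \<sigma>U: "is_mor \<O> U F E \<sigma>"
      and \<sigma>p: "\<forall>V. open V \<and> V \<subseteq> U \<longrightarrow> (\<forall>s\<in>carrier (sec F V). p V (\<sigma> V s) = s)"
      using split[of x] by (elim exE conjE)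
    let ?W = "V \<inter> U"
    have W: "open ?W" "?W \<subseteq> V" "?W \<subseteq> U" using V U by auto
    have \<sigma>: "is_mor \<O> ?W F E \<sigma>" by (rule is_mor_subset[OF \<sigma>U W(3)])
    have \<sigma>p': "p A (\<sigma> A s) = s" if "open A" "A \<subseteq> ?W" "s \<in> carrier (sec F A)" for A s
      using \<sigma>p that W(3) by blast
    let ?lW = "res L UNIV ?W l"
    note lW = res_closed[OF opL open_UNIV W(1) subset_UNIV l]
    obtain \<Psi> where \<Psi>: "is_mor \<O> ?W ?dF (ext_sheaf \<O> (Suc n) E) \<Psi>"
      "\<And>xs. xs \<in> ext_gens n (sec F ?W) \<Longrightarrow> \<Psi> ?W (wedge \<O> F ?W xs) = wedge \<O> E ?W (i ?W ?lW # map (\<sigma> ?W) xs)"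
      using wedge_lift[OF W(1) \<sigma> lW] by metis
    let ?ss = "map (res E UNIV ?W) ss" and ?es = "map (res E V ?W) es"
    have ssW: "?ss \<in> ext_gens n (sec E ?W)" using ss res_closed[OF opE open_UNIV W(1) subset_UNIV] by (auto simp: ext_gens_def)
    have esW: "?es \<in> ext_gens n (sec E ?W)" using es res_closed[OF opE V W(1,2)] by (auto simp: ext_gens_def)
    have val: "\<Psi> ?W (wedge \<O> F ?W (map (p ?W) ys)) = wedge \<O> E ?W (i ?W ?lW # ys)" if ys: "ys \<in> ext_gens n (sec E ?W)" for ys
    proof -
      have "map (p ?W) ys \<in> ext_gens n (sec F ?W)" using ys p_closed[OF W(1)] by (auto simp: ext_gens_def)
      then have "\<Psi> ?W (wedge \<O> F ?W (map (p ?W) ys)) = wedge \<O> E ?W (i ?W ?lW # map (\<lambda>y. \<sigma> ?W (p ?W y)) ys)"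
        using \<Psi>(2) by (simp add: comp_def)
      also have "\<dots> = wedge \<O> E ?W (i ?W ?lW # ys)" by (rule wedge_splitting[OF W(1) \<sigma> \<sigma>p' lW ys])
      finally show ?thesis .
    qed
    have pr1: "map (res F UNIV ?W) (map (p UNIV) ss) = map (p ?W) ?ss"
      using ssc mor_res[OF pmor open_UNIV W(1) subset_UNIV subset_UNIV] by auto
    have pr2: "map (res F V ?W) (map (p V) es) = map (p ?W) ?es"
      using es mor_res[OF pmor V W(1,2) subset_UNIV] by auto
    have w1: "res ?dF UNIV ?W ?\<omega> = wedge \<O> F ?W (map (p ?W) ?ss)"
      unfolding pr1[symmetric] res_ext[OF Fp]
      by (rule wedge_res[OF Fp open_UNIV W(1) subset_UNIV]) (use pss in \<open>simp add: ext_gens_def\<close>)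
    have w2: "res ?dF V ?W (wedge \<O> F V (map (p V) es)) = wedge \<O> F ?W (map (p ?W) ?es)"
      unfolding pr2[symmetric] res_ext[OF Fp]
      by (rule wedge_res[OF Fp V W(1,2)]) (use pes in \<open>simp add: ext_gens_def\<close>)
    have esF: "map (p ?W) ?es \<in> ext_gens n (sec F ?W)" using esW p_closed[OF W(1)] by (auto simp: ext_gens_def)
    note aW = O_rst[OF V W(1,2) a]
    have "wedge \<O> F ?W (map (p ?W) ?ss) = res ?dF V ?W (res ?dF UNIV V ?\<omega>)"
      unfolding w1[symmetric] by (rule res_comp[OF opdF open_UNIV V W(1,2) subset_UNIV \<omega>c, symmetric])
    also have "\<dots> = rst ?W a \<odot>\<^bsub>sec ?dF ?W\<^esub> wedge \<O> F ?W (map (p ?W) ?es)"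
      unfolding eq res_smult[OF opdF V W(1,2) a wF] w2 ..
    finally have "wedge \<O> E ?W (i ?W ?lW # ?ss) = \<Psi> ?W (rst ?W a \<odot>\<^bsub>sec ?dF ?W\<^esub> wedge \<O> F ?W (map (p ?W) ?es))"
      using val[OF ssW] by simp
    also have "\<dots> = rst ?W a \<odot>\<^bsub>sec (ext_sheaf \<O> (Suc n) E) ?W\<^esub> wedge \<O> E ?W (i ?W ?lW # ?es)"
      using mor_smult[OF \<Psi>(1) W(1) subset_refl aW alternating.m_closed[OF wedge_alternating[OF Fp W(1)] esF]] val[OF esW] by simp
    finally have key: "wedge \<O> E ?W (i ?W ?lW # ?ss) = rst ?W a \<odot>\<^bsub>sec ?dE ?W\<^esub> wedge \<O> E ?W (i ?W ?lW # ?es)" by simp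
    have i1: "res E UNIV ?W (i UNIV l) = i ?W ?lW" by (rule mor_res[OF imor open_UNIV W(1) subset_UNIV subset_UNIV l, symmetric])
    have i2: "res E V ?W (i V (res L UNIV V l)) = i ?W ?lW"
      using mor_res[OF imor V W(1,2) subset_UNIV lV] res_comp[OF opL open_UNIV V W(1,2) subset_UNIV l] by simp
    have "res ?dE V ?W (res ?dE UNIV V ?\<theta>) = res ?dE UNIV ?W ?\<theta>"
      by (rule res_comp[OF opdE open_UNIV V W(1,2) subset_UNIV \<theta>c])
    also have "\<dots> = wedge \<O> E ?W (i ?W ?lW # ?ss)"
      unfolding res_ext[OF Ep] using wedge_res[OF Ep open_UNIV W(1) subset_UNIV iss] i1 by simp
    also have "\<dots> = res ?dE V ?W (a \<odot>\<^bsub>sec ?dE V\<^esub> wedge \<O> E V (i V (res L UNIV V l) # es))"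
      unfolding key res_smult[OF opdE V W(1,2) a wE] using wedge_res[OF Ep V W(1,2) ies] i2 by (simp add: res_ext[OF Ep])
    finally show "\<exists>W. open W \<and> x \<in> W \<and> W \<subseteq> V \<and> res ?dE V W (res ?dE UNIV V ?\<theta>) =
        res ?dE V W (a \<odot>\<^bsub>sec ?dE V\<^esub> wedge \<O> E V (i V (res L UNIV V l) # es))" using W U x by blast
  qed
  show "?\<theta> \<in> carrier (H0 ?dE) \<and> (\<forall>V a es. open V \<and> V \<subseteq> UNIV \<and> a \<in> carrier (\<O> V) \<and> length es = n \<and>
           set es \<subseteq> carrier (sec E V) \<and> res ?dF UNIV V ?\<omega> = a \<odot>\<^bsub>sec ?dF V\<^esub> wedge \<O> F V (map (p V) es) \<longrightarrow>
           res ?dE UNIV V ?\<theta> = a \<odot>\<^bsub>sec ?dE V\<^esub> wedge \<O> E V (i V (res L UNIV V l) # es))"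
    using \<theta>c main by blast
  \<comment> \<open>Uniqueness: \<open>ss\<close> itself is an admissible family, with \<open>V\<close> the whole space and factor \<open>1\<close>.\<close>
  fix \<theta> assume \<theta>: "\<theta> \<in> carrier (H0 ?dE) \<and> (\<forall>V a es. open V \<and> V \<subseteq> UNIV \<and> a \<in> carrier (\<O> V) \<and> length es = n \<and>
           set es \<subseteq> carrier (sec E V) \<and> res ?dF UNIV V ?\<omega> = a \<odot>\<^bsub>sec ?dF V\<^esub> wedge \<O> F V (map (p V) es) \<longrightarrow>
           res ?dE UNIV V \<theta> = a \<odot>\<^bsub>sec ?dE V\<^esub> wedge \<O> E V (i V (res L UNIV V l) # es))"
  interpret dE: Module.module "\<O> UNIV" "H0 ?dE" by (rule presheaf_module[OF dEp open_UNIV])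
  interpret dF: Module.module "\<O> UNIV" "H0 ?dF" by (rule presheaf_module[OF dFp open_UNIV])
  have "res ?dF UNIV UNIV ?\<omega> = \<one>\<^bsub>\<O> UNIV\<^esub> \<odot>\<^bsub>H0 ?dF\<^esub> wedge \<O> F UNIV (map (p UNIV) ss)"
    using \<omega>c res_id[OF opdF open_UNIV \<omega>c] by simp
  then have "res ?dE UNIV UNIV \<theta> = \<one>\<^bsub>\<O> UNIV\<^esub> \<odot>\<^bsub>H0 ?dE\<^esub> wedge \<O> E UNIV (i UNIV (res L UNIV UNIV l) # ss)"
    using \<theta>[THEN conjunct2, THEN spec[of _ UNIV], THEN spec[of _ "\<one>\<^bsub>\<O> UNIV\<^esub>"], THEN spec[of _ ss]] len ssc by simp
  moreover have "res ?dE UNIV UNIV \<theta> = \<theta>" by (rule res_id[OF opdE open_UNIV conjunct1[OF \<theta>]])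
  ultimately show "\<theta> = ?\<theta>" unfolding res_id[OF opL open_UNIV l] dE.smult_one[OF \<theta>c] by simp
qed

end

section \<open>Retraction onto the twisted line bundle\<close>

text \<open>The data hidden in the hypothesis on the extension class. Over a cover
  \<open>\<U>\<close> there are splittings \<open>\<sigma>\<close> of \<open>E \<rightarrow>
  F\<close>, whose differences are the cocycle \<open>c\<close> in \<open>F\<^sup>\<or> \<otimes>
  L\<close>. The image of \<open>c\<close> in \<open>F\<^sup>\<or> \<otimes> L(D)\<close> is the
  coboundary of sections \<open>b\<close> on a refinement \<open>\<W>\<close>; the map
  \<open>v\<close> sends a member of \<open>\<W>\<close> to a member of \<open>\<U>\<close>
  containing it.\<close>

locale split_twist = line_extension \<O> L E F i p
  for \<O> :: "('a::topological_space) ring_sheaf" and L :: "('a, 'l) mod_presheaf"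
    and E :: "('a, 'e) mod_presheaf" and F :: "('a, 'f) mod_presheaf" and i p +
  fixes n :: nat and D :: "'a ideal_sheaf"
    and c :: "'a set \<Rightarrow> 'a set \<Rightarrow> 'a \<Rightarrow> ('a, (('a set \<Rightarrow> 'f \<Rightarrow> 'a \<Rightarrow> complex) \<times> 'l \<Rightarrow> 'a \<Rightarrow> complex) set) germ"
    and \<U> \<sigma> \<W> v b
  assumes Fl: "locally_free \<O> n F" and D: "effective_divisor \<O> D"
    and U_open: "\<And>U. U \<in> \<U> \<Longrightarrow> open U"
    and c: "\<And>U U'. U \<in> \<U> \<Longrightarrow> U' \<in> \<U> \<Longrightarrow> c U U' \<in> carrier (sec (tensor_sheaf \<O> (dual_sheaf \<O> F) L) (U \<inter> U'))"
    and sig: "\<And>U. U \<in> \<U> \<Longrightarrow> is_mor \<O> U F E (\<sigma> U)"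
    and sig_split: "\<And>U V s. U \<in> \<U> \<Longrightarrow> open V \<Longrightarrow> V \<subseteq> U \<Longrightarrow> s \<in> carrier (sec F V) \<Longrightarrow> p V (\<sigma> U V s) = s"
    and sig_diff: "\<And>U U' V s. U \<in> \<U> \<Longrightarrow> U' \<in> \<U> \<Longrightarrow> open V \<Longrightarrow> V \<subseteq> U \<inter> U' \<Longrightarrow> s \<in> carrier (sec F V) \<Longrightarrow>
      i V (contract \<O> F L V (res (tensor_sheaf \<O> (dual_sheaf \<O> F) L) (U \<inter> U') V (c U U')) s) =
        \<sigma> U' V s \<ominus>\<^bsub>sec E V\<^esub> \<sigma> U V s"
    and W_open: "\<And>W. W \<in> \<W> \<Longrightarrow> open W" and W_cover: "\<Union>\<W> = UNIV"
    and v: "\<And>W. W \<in> \<W> \<Longrightarrow> v W \<in> \<U>" "\<And>W. W \<in> \<W> \<Longrightarrow> W \<subseteq> v W"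
    and b: "\<And>W. W \<in> \<W> \<Longrightarrow> b W \<in> carrier (sec (tensor_sheaf \<O> (dual_sheaf \<O> F) (twist \<O> L D)) W)"
    and b_diff: "\<And>W W'. W \<in> \<W> \<Longrightarrow> W' \<in> \<W> \<Longrightarrow>
      res (tensor_sheaf \<O> (dual_sheaf \<O> F) (twist \<O> L D)) (v W \<inter> v W') (W \<inter> W')
        (tensor_map \<O> (dual_sheaf \<O> F) L (twist \<O> L D) (twist_incl \<O> L D) (v W \<inter> v W') (c (v W) (v W'))) =
      res (tensor_sheaf \<O> (dual_sheaf \<O> F) (twist \<O> L D)) W (W \<inter> W') (b W)
        \<ominus>\<^bsub>sec (tensor_sheaf \<O> (dual_sheaf \<O> F) (twist \<O> L D)) (W \<inter> W')\<^esub>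
      res (tensor_sheaf \<O> (dual_sheaf \<O> F) (twist \<O> L D)) W' (W \<inter> W') (b W')"
begin

lemma in_cover:
  obtains W where "W \<in> \<W>" "x \<in> W"
proof -
  have "x \<in> \<Union>\<W>" unfolding W_cover by simp
  then show ?thesis by (rule UnionE) (rule that)
qed

abbreviation "Tw \<equiv> twist \<O> L D"
abbreviation "inc \<equiv> twist_incl \<O> L D"
abbreviation "con \<equiv> contract \<O> F Tw"
abbreviation "TL \<equiv> tensor_sheaf \<O> (dual_sheaf \<O> F) L"
abbreviation "TG \<equiv> tensor_sheaf \<O> (dual_sheaf \<O> F) Tw"

lemma TwS: "is_sheaf \<O> Tw" by (rule twist_sheaf[OF D Ls])
lemma TwP: "is_presheaf \<O> Tw" by (rule sheaf_presheaf[OF TwS])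
lemmas opTw = is_presheaf_op[OF TwP]
lemma incm: "is_mor \<O> UNIV L Tw inc" by (rule twist_incl_mor[OF D Ls])
lemma preL: "is_presheaf \<O> (tensor_presheaf \<O> (dual_sheaf \<O> F) L)"
  by (rule tensor_presheaf[OF dual_op_presheaf[OF opF] opL])
lemma preG: "is_presheaf \<O> (tensor_presheaf \<O> (dual_sheaf \<O> F) Tw)"
  by (rule tensor_presheaf[OF dual_op_presheaf[OF opF] opTw])
lemma TLp: "is_presheaf \<O> TL" unfolding tensor_sheaf_def by (rule sheafify_presheaf[OF preL])
lemma TGp: "is_presheaf \<O> TG" unfolding tensor_sheaf_def by (rule sheafify_presheaf[OF preG])
lemma tmor: "is_mor \<O> UNIV TL TG (tensor_map \<O> (dual_sheaf \<O> F) L Tw inc)"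
  by (rule tensor_map_mor[OF dual_op_presheaf[OF opF] opL opTw incm])

lemma con_closed: "open U \<Longrightarrow> s \<in> carrier (sec F U) \<Longrightarrow> \<tau> \<in> carrier (sec TG U) \<Longrightarrow> con U \<tau> s \<in> carrier (sec Tw U)"
  using contract_closed[OF opF TwS] unfolding tensor_sheaf_def .
lemma con_minus: "open U \<Longrightarrow> s \<in> carrier (sec F U) \<Longrightarrow> \<tau> \<in> carrier (sec TG U) \<Longrightarrow> \<tau>' \<in> carrier (sec TG U) \<Longrightarrow>
    con U (\<tau> \<ominus>\<^bsub>sec TG U\<^esub> \<tau>') s = con U \<tau> s \<ominus>\<^bsub>sec Tw U\<^esub> con U \<tau>' s"
  using contract_minus[OF opF TwS] unfolding tensor_sheaf_def .
lemma con_add: "open U \<Longrightarrow> s \<in> carrier (sec F U) \<Longrightarrow> s' \<in> carrier (sec F U) \<Longrightarrow> \<tau> \<in> carrier (sec TG U) \<Longrightarrow>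
    con U \<tau> (s \<oplus>\<^bsub>sec F U\<^esub> s') = con U \<tau> s \<oplus>\<^bsub>sec Tw U\<^esub> con U \<tau> s'"
  using contract_add2[OF opF TwS] unfolding tensor_sheaf_def .
lemma con_smult: "open U \<Longrightarrow> a \<in> carrier (\<O> U) \<Longrightarrow> s \<in> carrier (sec F U) \<Longrightarrow> \<tau> \<in> carrier (sec TG U) \<Longrightarrow>
    con U \<tau> (a \<odot>\<^bsub>sec F U\<^esub> s) = a \<odot>\<^bsub>sec Tw U\<^esub> con U \<tau> s"
  using contract_smult2[OF opF TwS] unfolding tensor_sheaf_def .
lemma con_res: "open U \<Longrightarrow> open V \<Longrightarrow> V \<subseteq> U \<Longrightarrow> s \<in> carrier (sec F U) \<Longrightarrow> \<tau> \<in> carrier (sec TG U) \<Longrightarrow>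
    con V (res TG U V \<tau>) (res F U V s) = res Tw U V (con U \<tau> s)"
  using contract_res[OF opF TwS] unfolding tensor_sheaf_def res_sheafify[OF preG] .

text \<open>The local decomposition \<open>E \<cong> L \<oplus> F\<close> given by
  \<open>\<sigma>\<close>; this is the component in \<open>L\<close>.\<close>

definition line_part :: "'a set \<Rightarrow> 'e \<Rightarrow> 'l" where
  "line_part W s = (SOME l. l \<in> carrier (sec L W) \<and> i W l = res E UNIV W s \<ominus>\<^bsub>sec E W\<^esub> \<sigma> (v W) W (p W (res E UNIV W s)))"

lemma line_part:
  assumes W: "W \<in> \<W>" and s: "s \<in> carrier (H0 E)"
  shows "line_part W s \<in> carrier (sec L W)"
    "i W (line_part W s) = res E UNIV W s \<ominus>\<^bsub>sec E W\<^esub> \<sigma> (v W) W (p W (res E UNIV W s))"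
proof -
  note o = W_open[OF W]
  interpret EW: Module.module "\<O> W" "sec E W" by (rule presheaf_module[OF Ep o])
  interpret FW: Module.module "\<O> W" "sec F W" by (rule presheaf_module[OF Fp o])
  let ?s = "res E UNIV W s"
  have sc: "?s \<in> carrier (sec E W)" by (rule res_closed[OF opE open_UNIV o subset_UNIV s])
  note ps = p_closed[OF o sc]
  have sg: "\<sigma> (v W) W (p W ?s) \<in> carrier (sec E W)" by (rule mor_closed[OF sig[OF v(1)[OF W]] o v(2)[OF W] ps])
  have "p W (?s \<ominus>\<^bsub>sec E W\<^esub> \<sigma> (v W) W (p W ?s)) = \<zero>\<^bsub>sec F W\<^esub>"
    using mor_minus[OF pmor Ep Fp o subset_UNIV sc sg] sig_split[OF v(1)[OF W] o v(2)[OF W] ps] ps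
    by (simp add: a_minus_def FW.M.r_neg)
  then obtain l where "l \<in> carrier (sec L W)" "i W l = ?s \<ominus>\<^bsub>sec E W\<^esub> \<sigma> (v W) W (p W ?s)"
    by (rule exact_kernel[OF o EW.M.minus_closed[OF sc sg]])
  then have "\<exists>l. l \<in> carrier (sec L W) \<and> i W l = ?s \<ominus>\<^bsub>sec E W\<^esub> \<sigma> (v W) W (p W ?s)" by blast
  from someI_ex[OF this] show "line_part W s \<in> carrier (sec L W)" "i W (line_part W s) = ?s \<ominus>\<^bsub>sec E W\<^esub> \<sigma> (v W) W (p W ?s)"
    by (auto simp: line_part_def)
qed

text \<open>The local component in \<open>L\<close>, corrected by \<open>b\<close>. On the image of
  \<open>L\<close> it is the inclusion \<open>L \<rightarrow> L(D)\<close>, and the correction makes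
  it independent of \<open>W\<close>: together these maps are a retraction \<open>E \<rightarrow>
  L(D)\<close>.\<close>

definition retract :: "'a set \<Rightarrow> 'e \<Rightarrow> _" where
  "retract W s = inc W (line_part W s) \<ominus>\<^bsub>sec Tw W\<^esub> con W (b W) (p W (res E UNIV W s))"

lemma p_res: "open W \<Longrightarrow> s \<in> carrier (H0 E) \<Longrightarrow> p W (res E UNIV W s) \<in> carrier (sec F W)"
  by (rule p_closed[OF _ res_closed[OF opE open_UNIV _ subset_UNIV]])

lemma p_res_res:
  assumes "open W" "open V" "V \<subseteq> W" "s \<in> carrier (H0 E)"
  shows "res F W V (p W (res E UNIV W s)) = p V (res E UNIV V s)"
  using mor_res[OF pmor assms(1-3) subset_UNIV res_closed[OF opE open_UNIV assms(1) subset_UNIV assms(4)]]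
    res_comp[OF opE open_UNIV assms(1-3) subset_UNIV assms(4)] by simp

lemma retract_closed:
  assumes W: "W \<in> \<W>" and s: "s \<in> carrier (H0 E)"
  shows "retract W s \<in> carrier (sec Tw W)"
proof -
  note o = W_open[OF W]
  interpret TW: Module.module "\<O> W" "sec Tw W" by (rule presheaf_module[OF TwP o])
  show ?thesis unfolding retract_def
    by (rule TW.M.minus_closed[OF mor_closed[OF incm o subset_UNIV line_part(1)[OF W s]] con_closed[OF o p_res[OF o s] b[OF W]]])
qed

lemma i_line_part_res:
  assumes W: "W \<in> \<W>" and s: "s \<in> carrier (H0 E)" and V: "open V" "V \<subseteq> W"
  shows "i V (res L W V (line_part W s)) = res E UNIV V s \<ominus>\<^bsub>sec E V\<^esub> \<sigma> (v W) V (p V (res E UNIV V s))"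
proof -
  note o = W_open[OF W]
  note sW = res_closed[OF opE open_UNIV o subset_UNIV s] and pW = p_res[OF o s]
  note sg = mor_closed[OF sig[OF v(1)[OF W]] o v(2)[OF W] pW]
  have "i V (res L W V (line_part W s)) = res E W V (i W (line_part W s))"
    by (rule mor_res[OF imor o V subset_UNIV line_part(1)[OF W s]])
  also have "\<dots> = res E W V (res E UNIV W s) \<ominus>\<^bsub>sec E V\<^esub> res E W V (\<sigma> (v W) W (p W (res E UNIV W s)))"
    unfolding line_part(2)[OF W s] by (rule res_minus[OF Ep o V sW sg])
  also have "res E W V (res E UNIV W s) = res E UNIV V s" by (rule res_comp[OF opE open_UNIV o V subset_UNIV s])
  also have "res E W V (\<sigma> (v W) W (p W (res E UNIV W s))) = \<sigma> (v W) V (p V (res E UNIV V s))"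
    unfolding mor_res[OF sig[OF v(1)[OF W]] o V v(2)[OF W] pW, symmetric] p_res_res[OF o V s] ..
  finally show ?thesis .
qed

lemma retract_res:
  assumes W: "W \<in> \<W>" and s: "s \<in> carrier (H0 E)" and V: "open V" "V \<subseteq> W"
  shows "res Tw W V (retract W s) = inc V (res L W V (line_part W s)) \<ominus>\<^bsub>sec Tw V\<^esub> con V (res TG W V (b W)) (p V (res E UNIV V s))"
proof -
  note o = W_open[OF W]
  show ?thesis unfolding retract_def
    res_minus[OF TwP o V mor_closed[OF incm o subset_UNIV line_part(1)[OF W s]] con_closed[OF o p_res[OF o s] b[OF W]]]
    mor_res[OF incm o V subset_UNIV line_part(1)[OF W s], symmetric]
    con_res[OF o V p_res[OF o s] b[OF W], symmetric] p_res_res[OF o V s] ..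
qed

text \<open>Changing the splitting changes the component in \<open>L\<close> by the contraction of
  \<open>c\<close> with \<open>p s\<close>. In \<open>L(D)\<close> this is the contraction of
  \<open>b W - b W'\<close>, which the correction terms cancel.\<close>

lemma retract_agree:
  assumes W: "W \<in> \<W>" "W' \<in> \<W>" and s: "s \<in> carrier (H0 E)"
  shows "res Tw W (W \<inter> W') (retract W s) = res Tw W' (W \<inter> W') (retract W' s)"
proof -
  let ?X = "W \<inter> W'"
  note o = W_open[OF W(1)] W_open[OF W(2)]
  have X: "open ?X" "?X \<subseteq> W" "?X \<subseteq> W'" "?X \<subseteq> v W \<inter> v W'" "open (v W \<inter> v W')"
    using o v[OF W(1)] v[OF W(2)] U_open by auto
  interpret EX: Module.module "\<O> ?X" "sec E ?X" by (rule presheaf_module[OF Ep X(1)])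
  interpret LX: Module.module "\<O> ?X" "sec L ?X" by (rule presheaf_module[OF Lp X(1)])
  interpret TX: Module.module "\<O> ?X" "sec Tw ?X" by (rule presheaf_module[OF TwP X(1)])
  let ?\<eta> = "p ?X (res E UNIV ?X s)" and ?l = "res L W ?X (line_part W s)" and ?l' = "res L W' ?X (line_part W' s)"
  have \<eta>: "?\<eta> \<in> carrier (sec F ?X)" by (rule p_res[OF X(1) s])
  have sX: "res E UNIV ?X s \<in> carrier (sec E ?X)" by (rule res_closed[OF opE open_UNIV X(1) subset_UNIV s])
  have l: "?l \<in> carrier (sec L ?X)" "?l' \<in> carrier (sec L ?X)"
    using res_closed[OF opL o(1) X(1,2) line_part(1)[OF W(1) s]] res_closed[OF opL o(2) X(1,3) line_part(1)[OF W(2) s]] by auto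
  have sub: "?X \<subseteq> v W" "?X \<subseteq> v W'" using X by auto
  note sg = mor_closed[OF sig[OF v(1)[OF W(1)]] X(1) sub(1) \<eta>] mor_closed[OF sig[OF v(1)[OF W(2)]] X(1) sub(2) \<eta>]
  let ?c = "res TL (v W \<inter> v W') ?X (c (v W) (v W'))"
  note cc = c[OF v(1)[OF W(1)] v(1)[OF W(2)]]
  have cX: "?c \<in> carrier (sec TL ?X)" by (rule res_closed[OF is_presheaf_op[OF TLp] X(5,1,4) cc])
  have \<kappa>: "contract \<O> F L ?X ?c ?\<eta> \<in> carrier (sec L ?X)"
    using contract_closed[OF opF Ls X(1) \<eta>] cX unfolding tensor_sheaf_def by blast
  have "i ?X (?l \<ominus>\<^bsub>sec L ?X\<^esub> ?l') = i ?X ?l \<ominus>\<^bsub>sec E ?X\<^esub> i ?X ?l'"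
    by (rule mor_minus[OF imor Lp Ep X(1) subset_UNIV l])
  also have "\<dots> = \<sigma> (v W') ?X ?\<eta> \<ominus>\<^bsub>sec E ?X\<^esub> \<sigma> (v W) ?X ?\<eta>"
    unfolding i_line_part_res[OF W(1) s X(1,2)] i_line_part_res[OF W(2) s X(1,3)]
    by (rule EX.M.minus_minus_cancel[OF sX sg])
  also have "\<dots> = i ?X (contract \<O> F L ?X ?c ?\<eta>)"
    by (rule sig_diff[OF v(1)[OF W(1)] v(1)[OF W(2)] X(1,4) \<eta>, symmetric])
  finally have ll: "?l \<ominus>\<^bsub>sec L ?X\<^esub> ?l' = contract \<O> F L ?X ?c ?\<eta>"
    by (rule i_inj[OF X(1) LX.M.minus_closed[OF l] \<kappa>])
  let ?b = "res TG W ?X (b W)" and ?b' = "res TG W' ?X (b W')"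
  have bX: "?b \<in> carrier (sec TG ?X)" "?b' \<in> carrier (sec TG ?X)"
    using res_closed[OF is_presheaf_op[OF TGp] o(1) X(1,2) b[OF W(1)]]
      res_closed[OF is_presheaf_op[OF TGp] o(2) X(1,3) b[OF W(2)]] by auto
  have "tensor_map \<O> (dual_sheaf \<O> F) L Tw inc ?X ?c = ?b \<ominus>\<^bsub>sec TG ?X\<^esub> ?b'"
    unfolding mor_res[OF tmor X(5,1,4) subset_UNIV cc] by (rule b_diff[OF W])
  then have "inc ?X (contract \<O> F L ?X ?c ?\<eta>) = con ?X (?b \<ominus>\<^bsub>sec TG ?X\<^esub> ?b') ?\<eta>"
    using contract_map[OF opF Ls TwS incm X(1) \<eta> cX] by simp
  also have "\<dots> = con ?X ?b ?\<eta> \<ominus>\<^bsub>sec Tw ?X\<^esub> con ?X ?b' ?\<eta>" by (rule con_minus[OF X(1) \<eta> bX])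
  finally have "inc ?X ?l \<ominus>\<^bsub>sec Tw ?X\<^esub> inc ?X ?l' = con ?X ?b ?\<eta> \<ominus>\<^bsub>sec Tw ?X\<^esub> con ?X ?b' ?\<eta>"
    unfolding ll[symmetric] mor_minus[OF incm Lp TwP X(1) subset_UNIV l] .
  then have "inc ?X ?l \<ominus>\<^bsub>sec Tw ?X\<^esub> con ?X ?b ?\<eta> = inc ?X ?l' \<ominus>\<^bsub>sec Tw ?X\<^esub> con ?X ?b' ?\<eta>"
    by (rule TX.M.minus_swap[OF mor_closed[OF incm X(1) subset_UNIV l(1)] mor_closed[OF incm X(1) subset_UNIV l(2)]
      con_closed[OF X(1) \<eta> bX(1)] con_closed[OF X(1) \<eta> bX(2)]])
  then show ?thesis unfolding retract_res[OF W(1) s X(1,2)] retract_res[OF W(2) s X(1,3)] .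
qed

lemma retract_glue:
  assumes s: "s \<in> carrier (H0 E)"
  obtains t where "t \<in> carrier (H0 Tw)" "\<And>W. W \<in> \<W> \<Longrightarrow> res Tw UNIV W t = retract W s"
proof -
  have cov: "(\<Union>W\<in>\<W>. W) = UNIV" using W_cover by simp
  show ?thesis
  proof (rule sheaf_glue[OF TwS, of \<W> "\<lambda>W. W" "\<lambda>W. retract W s"])
    fix t assume t: "t \<in> carrier (sec Tw (\<Union>W\<in>\<W>. W))" "\<And>W. W \<in> \<W> \<Longrightarrow> res Tw (\<Union>W\<in>\<W>. W) W t = retract W s"
    show thesis by (rule that[of t]) (use t in \<open>simp_all only: cov\<close>)
  next
    fix W W' assume "W \<in> \<W>" "W' \<in> \<W>"
    then show "res Tw W (W \<inter> W') (retract W s) = res Tw W' (W \<inter> W') (retract W' s)" by (rule retract_agree[OF _ _ s])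
  qed (simp_all add: W_open retract_closed[OF _ s])
qed

lemma exists_split: "\<exists>U \<sigma>. open U \<and> x \<in> U \<and> is_mor \<O> U F E \<sigma> \<and>
    (\<forall>V. open V \<and> V \<subseteq> U \<longrightarrow> (\<forall>s\<in>carrier (sec F V). p V (\<sigma> V s) = s))"
proof -
  obtain W where W: "W \<in> \<W>" "x \<in> W" by (rule in_cover)
  have vW: "v W \<in> \<U>" "x \<in> v W" using v[OF W(1)] W(2) by auto
  show ?thesis
  proof (intro exI conjI allI impI ballI)
    show "open (v W)" by (rule U_open[OF vW(1)])
    show "x \<in> v W" by (rule vW(2))
    show "is_mor \<O> (v W) F E (\<sigma> (v W))" by (rule sig[OF vW(1)])
    fix V s assume "open V \<and> V \<subseteq> v W" "s \<in> carrier (sec F V)"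
    then show "p V (\<sigma> (v W) V s) = s" by (elim conjE) (rule sig_split[OF vW(1)])
  qed
qed

text \<open>The sections \<open>s j - i (l j)\<close> lie in the kernel of the retraction \<open>E
  \<rightarrow> L(D)\<close>, whose generic rank is \<open>n\<close>. So their coordinates in a
  local frame of \<open>E\<close> satisfy a linear relation, and \<open>n + 1\<close> of them have
  zero wedge product. The relation is over \<open>\<O>\<close> once \<open>L(D)\<close> is mapped to
  \<open>L\<close> by evaluation at a local equation \<open>g\<close> of \<open>D\<close>; its first
  coefficient is then \<open>g\<close>, a nonzerodivisor.\<close>

lemma kernel_wedge_zero:
  assumes s: "\<And>j. j < n + 1 \<Longrightarrow> s j \<in> carrier (H0 E)" and l: "\<And>j. j < n + 1 \<Longrightarrow> l j \<in> carrier (H0 L)"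
    and rl: "\<And>j W. j < n + 1 \<Longrightarrow> W \<in> \<W> \<Longrightarrow> retract W (s j) = res Tw UNIV W (inc UNIV (l j))"
  shows "wedge \<O> E UNIV (map (\<lambda>j. s j \<ominus>\<^bsub>H0 E\<^esub> i UNIV (l j)) [0..<n + 1]) = \<zero>\<^bsub>H0 (ext_sheaf \<O> (n + 1) E)\<^esub>"
proof (rule sheaf_separated[OF ext_is_sheaf[OF Ep] open_UNIV])
  interpret H: alternating "\<O> UNIV" "H0 E" "H0 (ext_sheaf \<O> (n + 1) E)" "n + 1" "wedge \<O> E UNIV"
    by (rule wedge_alternating[OF Ep open_UNIV])
  let ?t = "\<lambda>j. s j \<ominus>\<^bsub>H0 E\<^esub> i UNIV (l j)"
  have il: "i UNIV (l j) \<in> carrier (H0 E)" if "j < n + 1" for j by (rule i_closed[OF open_UNIV l[OF that]])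
  have t: "?t j \<in> carrier (H0 E)" if "j < n + 1" for j using s[OF that] il[OF that] by simp
  have tg: "map ?t [0..<n + 1] \<in> ext_gens (n + 1) (H0 E)" using t by (auto simp: ext_gens_def simp del: upt_Suc)
  show "wedge \<O> E UNIV (map ?t [0..<n + 1]) \<in> carrier (H0 (ext_sheaf \<O> (n + 1) E))" by (rule H.m_closed[OF tg])
  show "\<zero>\<^bsub>H0 (ext_sheaf \<O> (n + 1) E)\<^esub> \<in> carrier (H0 (ext_sheaf \<O> (n + 1) E))" by (rule H.T.M.zero_closed)
  fix x :: 'a
  obtain W where W: "W \<in> \<W>" "x \<in> W" by (rule in_cover)
  obtain A f where A: "open A" "x \<in> A" "\<forall>k<n. f k \<in> carrier (sec F A)"
    and fspan: "\<forall>V s. open V \<and> V \<subseteq> A \<and> s \<in> carrier (sec F V) \<longrightarrow>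
      (\<exists>c. (\<forall>k<n. c k \<in> carrier (\<O> V)) \<and> s = (\<Oplus>\<^bsub>sec F V\<^esub>k\<in>{..<n}. c k \<odot>\<^bsub>sec F V\<^esub> res F A V (f k)))"
    by (rule local_frame[OF Fl, of x])
  obtain B e where B: "open B" "x \<in> B" "e \<in> carrier (sec L B)"
    and espan: "\<forall>V s. open V \<and> V \<subseteq> B \<and> s \<in> carrier (sec L V) \<longrightarrow> (\<exists>c\<in>carrier (\<O> V). s = c \<odot>\<^bsub>sec L V\<^esub> res L B V e)"
    and efree: "\<forall>V c. open V \<and> V \<subseteq> B \<and> c \<in> carrier (\<O> V) \<and> c \<odot>\<^bsub>sec L V\<^esub> res L B V e = \<zero>\<^bsub>sec L V\<^esub> \<longrightarrow> c = \<zero>\<^bsub>\<O> V\<^esub>"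
    by (rule line_frame[OF L, of x])
  obtain C g where C: "open C" "x \<in> C" "g \<in> carrier (\<O> C)"
    and gD: "\<forall>V. open V \<and> V \<subseteq> C \<longrightarrow>
           (\<forall>h\<in>carrier (\<O> V). h \<otimes>\<^bsub>\<O> V\<^esub> rst V g = \<zero>\<^bsub>\<O> V\<^esub> \<longrightarrow> h = \<zero>\<^bsub>\<O> V\<^esub>) \<and>
           D V = (\<lambda>h. h \<otimes>\<^bsub>\<O> V\<^esub> rst V g) ` carrier (\<O> V)"
    using D[unfolded effective_divisor_def, THEN conjunct2, THEN conjunct2, THEN conjunct2, THEN spec[of _ x]]
    by (elim exE conjE)
  let ?V = "W \<inter> A \<inter> B \<inter> C"
  have oV: "open ?V" and VW: "?V \<subseteq> W" and VA: "?V \<subseteq> A" and VB: "?V \<subseteq> B" and VC: "?V \<subseteq> C" and xV: "x \<in> ?V"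
    using W_open[OF W(1)] A B C W by auto
  note oW = W_open[OF W(1)]
  interpret V: cring "\<O> ?V" by (rule cring_O[OF oV])
  interpret EV: Module.module "\<O> ?V" "sec E ?V" by (rule presheaf_module[OF Ep oV])
  interpret FV: Module.module "\<O> ?V" "sec F ?V" by (rule presheaf_module[OF Fp oV])
  interpret LV: Module.module "\<O> ?V" "sec L ?V" by (rule presheaf_module[OF Lp oV])
  interpret TV: Module.module "\<O> ?V" "sec Tw ?V" by (rule presheaf_module[OF TwP oV])
  let ?g = "rst ?V g" and ?e = "res L B ?V e" and ?f = "\<lambda>k. res F A ?V (f k)" and ?b = "res TG W ?V (b W)"
  have gc: "?g \<in> carrier (\<O> ?V)" by (rule O_rst[OF C(1) oV VC C(3)])
  have nzd: "h = \<zero>\<^bsub>\<O> ?V\<^esub>" if "h \<in> carrier (\<O> ?V)" "h \<otimes>\<^bsub>\<O> ?V\<^esub> ?g = \<zero>\<^bsub>\<O> ?V\<^esub>" for h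
    using gD[THEN spec[of _ ?V]] oV VC that by blast
  have "\<one>\<^bsub>\<O> ?V\<^esub> \<otimes>\<^bsub>\<O> ?V\<^esub> ?g \<in> D ?V" using gD[THEN spec[of _ ?V]] oV VC V.one_closed by blast
  then have gDV: "?g \<in> D ?V" using gc by simp
  obtain \<epsilon> where \<epsilon>: "is_mor \<O> ?V Tw L \<epsilon>" "\<And>l. l \<in> carrier (sec L ?V) \<Longrightarrow> \<epsilon> ?V (inc ?V l) = ?g \<odot>\<^bsub>sec L ?V\<^esub> l"
  proof (rule twist_eval[OF D Ls oV gDV], goal_cases)
    case (1 \<epsilon>)
    show ?case by (rule 1(1)[OF 1(2)]) (rule 1(3))
  qed
  have ec: "?e \<in> carrier (sec L ?V)" by (rule res_closed[OF opL B(1) oV VB B(3)])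
  have fc: "?f k \<in> carrier (sec F ?V)" if "k < n" for k using res_closed[OF opF A(1) oV VA] A(3) that by blast
  have bV: "?b \<in> carrier (sec TG ?V)" by (rule res_closed[OF is_presheaf_op[OF TGp] oW oV VW b[OF W(1)]])
  have \<epsilon>c: "\<epsilon> ?V (con ?V ?b (?f k)) \<in> carrier (sec L ?V)" if "k < n" for k
    by (rule mor_closed[OF \<epsilon>(1) oV subset_refl con_closed[OF oV fc[OF that] bV]])
  have "\<exists>r. \<forall>k<n. r k \<in> carrier (\<O> ?V) \<and> \<epsilon> ?V (con ?V ?b (?f k)) = r k \<odot>\<^bsub>sec L ?V\<^esub> ?e"
  proof -
    have "\<exists>r\<in>carrier (\<O> ?V). \<epsilon> ?V (con ?V ?b (?f k)) = r \<odot>\<^bsub>sec L ?V\<^esub> ?e" if "k < n" for k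
      using espan[THEN spec[of _ ?V], THEN spec[of _ "\<epsilon> ?V (con ?V ?b (?f k))"]] oV VB \<epsilon>c[OF that] by blast
    then have "\<forall>k. \<exists>r. k < n \<longrightarrow> r \<in> carrier (\<O> ?V) \<and> \<epsilon> ?V (con ?V ?b (?f k)) = r \<odot>\<^bsub>sec L ?V\<^esub> ?e" by blast
    from choice[OF this] show ?thesis by blast
  qed
  then obtain r where r: "\<And>k. k < n \<Longrightarrow> r k \<in> carrier (\<O> ?V)"
    "\<And>k. k < n \<Longrightarrow> \<epsilon> ?V (con ?V ?b (?f k)) = r k \<odot>\<^bsub>sec L ?V\<^esub> ?e" by blast
  let ?eta = "\<lambda>j. p ?V (res E UNIV ?V (s j))"
  let ?a = "\<lambda>j. res L W ?V (line_part W (s j)) \<ominus>\<^bsub>sec L ?V\<^esub> res L UNIV ?V (l j)"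
  have lamV: "res L W ?V (line_part W (s j)) \<in> carrier (sec L ?V)" and lV: "res L UNIV ?V (l j) \<in> carrier (sec L ?V)"
    if "j < n + 1" for j
    using res_closed[OF opL oW oV VW line_part(1)[OF W(1) s[OF that]]] res_closed[OF opL open_UNIV oV subset_UNIV l[OF that]] by auto
  have ac: "?a j \<in> carrier (sec L ?V)" if "j < n + 1" for j using lamV[OF that] lV[OF that] by simp
  have eta: "?eta j \<in> carrier (sec F ?V)" if "j < n + 1" for j by (rule p_res[OF oV s[OF that]])
  have "\<forall>j. \<exists>a. j < n + 1 \<longrightarrow> a \<in> carrier (\<O> ?V) \<and> ?a j = a \<odot>\<^bsub>sec L ?V\<^esub> ?e"
  proof
    fix j
    show "\<exists>a. j < n + 1 \<longrightarrow> a \<in> carrier (\<O> ?V) \<and> ?a j = a \<odot>\<^bsub>sec L ?V\<^esub> ?e"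
      using espan[THEN spec[of _ ?V], THEN spec[of _ "?a j"]] oV VB ac[of j] by blast
  qed
  from choice[OF this] obtain a where a: "\<And>j. j < n + 1 \<Longrightarrow> a j \<in> carrier (\<O> ?V)"
    "\<And>j. j < n + 1 \<Longrightarrow> ?a j = a j \<odot>\<^bsub>sec L ?V\<^esub> ?e" by blast
  have "\<forall>j. \<exists>c. j < n + 1 \<longrightarrow> (\<forall>k<n. c k \<in> carrier (\<O> ?V)) \<and> ?eta j = (\<Oplus>\<^bsub>sec F ?V\<^esub>k\<in>{..<n}. c k \<odot>\<^bsub>sec F ?V\<^esub> ?f k)"
  proof
    fix j
    show "\<exists>c. j < n + 1 \<longrightarrow> (\<forall>k<n. c k \<in> carrier (\<O> ?V)) \<and> ?eta j = (\<Oplus>\<^bsub>sec F ?V\<^esub>k\<in>{..<n}. c k \<odot>\<^bsub>sec F ?V\<^esub> ?f k)"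
      using fspan[THEN spec[of _ ?V], THEN spec[of _ "?eta j"]] oV VA eta[of j] by blast
  qed
  from choice[OF this] obtain q where q: "\<And>j k. j < n + 1 \<Longrightarrow> k < n \<Longrightarrow> q j k \<in> carrier (\<O> ?V)"
    "\<And>j. j < n + 1 \<Longrightarrow> ?eta j = (\<Oplus>\<^bsub>sec F ?V\<^esub>k\<in>{..<n}. q j k \<odot>\<^bsub>sec F ?V\<^esub> ?f k)" by blast
  \<comment> \<open>Vanishing of the retraction at \<open>s j - i (l j)\<close>, evaluated at \<open>g\<close>, in coordinates.\<close>
  have rel: "?g \<otimes>\<^bsub>\<O> ?V\<^esub> a j = (\<Oplus>\<^bsub>\<O> ?V\<^esub>k\<in>{..<n}. q j k \<otimes>\<^bsub>\<O> ?V\<^esub> r k)" if j: "j < n + 1" for j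
  proof -
    have "inc ?V (res L W ?V (line_part W (s j))) \<ominus>\<^bsub>sec Tw ?V\<^esub> con ?V ?b (?eta j) = inc ?V (res L UNIV ?V (l j))"
    proof -
      have "res Tw W ?V (retract W (s j)) = res Tw UNIV ?V (inc UNIV (l j))"
        unfolding rl[OF j W(1)] by (rule res_comp[OF opTw open_UNIV oW oV VW subset_UNIV mor_closed[OF incm open_UNIV subset_UNIV l[OF j]]])
      then show ?thesis unfolding retract_res[OF W(1) s[OF j] oV VW] mor_res[OF incm open_UNIV oV subset_UNIV subset_UNIV l[OF j]] .
    qed
    then have "inc ?V (res L W ?V (line_part W (s j))) \<ominus>\<^bsub>sec Tw ?V\<^esub> con ?V ?b (?eta j) = inc ?V (res L UNIV ?V (l j)) \<ominus>\<^bsub>sec Tw ?V\<^esub> \<zero>\<^bsub>sec Tw ?V\<^esub>"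
      using mor_closed[OF incm oV subset_UNIV lV[OF j]] by (simp add: a_minus_def)
    then have "inc ?V (res L W ?V (line_part W (s j))) \<ominus>\<^bsub>sec Tw ?V\<^esub> inc ?V (res L UNIV ?V (l j)) = con ?V ?b (?eta j) \<ominus>\<^bsub>sec Tw ?V\<^esub> \<zero>\<^bsub>sec Tw ?V\<^esub>"
      by (rule TV.M.minus_swap[OF mor_closed[OF incm oV subset_UNIV lamV[OF j]] con_closed[OF oV eta[OF j] bV]
        mor_closed[OF incm oV subset_UNIV lV[OF j]] TV.M.zero_closed])
    also have "\<dots> = con ?V ?b (?eta j)" using con_closed[OF oV eta[OF j] bV] by (simp add: a_minus_def)
    finally have "inc ?V (?a j) = con ?V ?b (?eta j)"
      unfolding mor_minus[OF incm Lp TwP oV subset_UNIV lamV[OF j] lV[OF j]] .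
    also have "\<dots> = (\<Oplus>\<^bsub>sec Tw ?V\<^esub>k\<in>{..<n}. q j k \<odot>\<^bsub>sec Tw ?V\<^esub> con ?V ?b (?f k))"
      unfolding q(2)[OF j]
      by (rule linear_finsum[OF FV.module_axioms TV.module_axioms])
        (use con_closed[OF oV _ bV] con_add[OF oV _ _ bV] con_smult[OF oV _ _ bV] q(1)[OF j] fc in auto)
    finally have 1: "\<epsilon> ?V (inc ?V (?a j)) = \<epsilon> ?V (\<Oplus>\<^bsub>sec Tw ?V\<^esub>k\<in>{..<n}. q j k \<odot>\<^bsub>sec Tw ?V\<^esub> con ?V ?b (?f k))" by simp
    also have "\<dots> = (\<Oplus>\<^bsub>sec L ?V\<^esub>k\<in>{..<n}. q j k \<odot>\<^bsub>sec L ?V\<^esub> \<epsilon> ?V (con ?V ?b (?f k)))"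
      by (rule linear_finsum[OF TV.module_axioms LV.module_axioms])
        (use mor_closed[OF \<epsilon>(1) oV subset_refl] mor_add[OF \<epsilon>(1) oV subset_refl] mor_smult[OF \<epsilon>(1) oV subset_refl]
          q(1)[OF j] con_closed[OF oV fc bV] in auto)
    also have "\<dots> = (\<Oplus>\<^bsub>sec L ?V\<^esub>k\<in>{..<n}. (q j k \<otimes>\<^bsub>\<O> ?V\<^esub> r k) \<odot>\<^bsub>sec L ?V\<^esub> ?e)"
      by (rule LV.M.finsum_cong') (use q(1)[OF j] r ec in \<open>auto simp: LV.smult_assoc1\<close>)
    also have "\<dots> = (\<Oplus>\<^bsub>\<O> ?V\<^esub>k\<in>{..<n}. q j k \<otimes>\<^bsub>\<O> ?V\<^esub> r k) \<odot>\<^bsub>sec L ?V\<^esub> ?e"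
      by (rule LV.finsum_smult_rdistr) (use q(1)[OF j] r ec in auto)
    finally have 2: "\<epsilon> ?V (inc ?V (?a j)) = (\<Oplus>\<^bsub>\<O> ?V\<^esub>k\<in>{..<n}. q j k \<otimes>\<^bsub>\<O> ?V\<^esub> r k) \<odot>\<^bsub>sec L ?V\<^esub> ?e" .
    have 3: "\<epsilon> ?V (inc ?V (?a j)) = (?g \<otimes>\<^bsub>\<O> ?V\<^esub> a j) \<odot>\<^bsub>sec L ?V\<^esub> ?e"
      unfolding \<epsilon>(2)[OF ac[OF j]] unfolding a(2)[OF j] by (rule LV.smult_assoc1[OF gc a(1)[OF j] ec, symmetric])
    let ?y = "\<Oplus>\<^bsub>\<O> ?V\<^esub>k\<in>{..<n}. q j k \<otimes>\<^bsub>\<O> ?V\<^esub> r k"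
    have yc: "?y \<in> carrier (\<O> ?V)" using q(1)[OF j] r(1) by (intro V.finsum_closed) auto
    have xc: "?g \<otimes>\<^bsub>\<O> ?V\<^esub> a j \<in> carrier (\<O> ?V)" using gc a(1)[OF j] by simp
    have "(?g \<otimes>\<^bsub>\<O> ?V\<^esub> a j \<ominus>\<^bsub>\<O> ?V\<^esub> ?y) \<odot>\<^bsub>sec L ?V\<^esub> ?e = (?g \<otimes>\<^bsub>\<O> ?V\<^esub> a j) \<odot>\<^bsub>sec L ?V\<^esub> ?e \<ominus>\<^bsub>sec L ?V\<^esub> ?y \<odot>\<^bsub>sec L ?V\<^esub> ?e"
      unfolding a_minus_def[of "\<O> ?V"] a_minus_def[of "sec L ?V"]
      by (simp only: LV.smult_l_distr[OF xc V.a_inv_closed[OF yc] ec] LV.smult_l_minus[OF yc ec])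
    also have "\<dots> = \<zero>\<^bsub>sec L ?V\<^esub>" unfolding 2[symmetric] 3[symmetric]
      using ac[OF j] gc by (simp add: \<epsilon>(2) LV.M.minus_eq_zero_iff)
    finally have "?g \<otimes>\<^bsub>\<O> ?V\<^esub> a j \<ominus>\<^bsub>\<O> ?V\<^esub> ?y = \<zero>\<^bsub>\<O> ?V\<^esub>"
      using efree[THEN spec[of _ ?V], THEN spec[of _ "?g \<otimes>\<^bsub>\<O> ?V\<^esub> a j \<ominus>\<^bsub>\<O> ?V\<^esub> ?y"]] oV VB xc yc by blast
    then show ?thesis using V.minus_eq_zero_iff[OF xc yc] by simp
  qed
  \<comment> \<open>The frame of \<open>E\<close> is \<open>i e, \<sigma> f\<^sub>0, \<sigma> f\<^sub>1, \<dots>\<close>; the column \<open>(g, - r 0, - r 1, \<dots>)\<close> is killed by all coordinate rows.\<close>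
  let ?A = "\<lambda>j m. case m of 0 \<Rightarrow> a j | Suc k \<Rightarrow> q j k"
  let ?r = "\<lambda>m. case m of 0 \<Rightarrow> ?g | Suc k \<Rightarrow> (\<lambda>x. - r k x)"
  let ?E = "\<lambda>m. case m of 0 \<Rightarrow> i ?V ?e | Suc k \<Rightarrow> \<sigma> (v W) ?V (?f k)"
  have AC: "?A j m \<in> carrier (\<O> ?V)" if "j < n + 1" "m < n + 1" for j m using that a(1) q(1) by (cases m) auto
  have RC: "?r m \<in> carrier (\<O> ?V)" if "m < n + 1" for m using that gc O_uminus[OF oV r(1)] by (cases m) auto
  have Vv: "?V \<subseteq> v W" using VW v(2)[OF W(1)] by blast
  note sgm = sig[OF v(1)[OF W(1)]]
  have EC: "?E m \<in> carrier (sec E ?V)" if "m < n + 1" for m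
    using that i_closed[OF oV ec] mor_closed[OF sgm oV Vv fc] by (cases m) auto
  have ker: "(\<Oplus>\<^bsub>\<O> ?V\<^esub>m\<in>{..<n + 1}. ?A j m \<otimes>\<^bsub>\<O> ?V\<^esub> ?r m) = \<zero>\<^bsub>\<O> ?V\<^esub>" if j: "j < n + 1" for j
  proof
    fix y
    have "(\<Oplus>\<^bsub>\<O> ?V\<^esub>k\<in>{..<n}. q j k \<otimes>\<^bsub>\<O> ?V\<^esub> r k) y = (\<Sum>k<n. (q j k \<otimes>\<^bsub>\<O> ?V\<^esub> r k) y)"
      by (rule O_finsum[OF oV]) (use q(1)[OF j] r(1) in auto)
    then have "?g y * a j y = (\<Sum>k<n. q j k y * r k y)"
      unfolding rel[OF j, symmetric] by (simp add: O_mult)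
    moreover have "(\<Oplus>\<^bsub>\<O> ?V\<^esub>m\<in>{..<n + 1}. ?A j m \<otimes>\<^bsub>\<O> ?V\<^esub> ?r m) y = (\<Sum>m<n + 1. (?A j m \<otimes>\<^bsub>\<O> ?V\<^esub> ?r m) y)"
      by (rule O_finsum[OF oV]) (use AC[OF j] RC in auto)
    ultimately show "(\<Oplus>\<^bsub>\<O> ?V\<^esub>m\<in>{..<n + 1}. ?A j m \<otimes>\<^bsub>\<O> ?V\<^esub> ?r m) y = \<zero>\<^bsub>\<O> ?V\<^esub> y"
      by (simp add: O_mult O_zero sum.lessThan_Suc_shift sum_negf mult.commute del: sum.lessThan_Suc)
  qed
  have row: "res E UNIV ?V (?t j) = (\<Oplus>\<^bsub>sec E ?V\<^esub>m\<in>{..<n + 1}. ?A j m \<odot>\<^bsub>sec E ?V\<^esub> ?E m)" if j: "j < n + 1" for j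
  proof -
    have sV: "res E UNIV ?V (s j) \<in> carrier (sec E ?V)" by (rule res_closed[OF opE open_UNIV oV subset_UNIV s[OF j]])
    note sge = mor_closed[OF sgm oV Vv eta[OF j]]
    note il' = i_closed[OF oV lV[OF j]] and ila = i_closed[OF oV lamV[OF j]]
    have "res E UNIV ?V (?t j) = res E UNIV ?V (s j) \<ominus>\<^bsub>sec E ?V\<^esub> i ?V (res L UNIV ?V (l j))"
      unfolding mor_res[OF imor open_UNIV oV subset_UNIV subset_UNIV l[OF j]]
      by (rule res_minus[OF Ep open_UNIV oV subset_UNIV s[OF j] il[OF j]])
    also have "\<dots> = i ?V (?a j) \<oplus>\<^bsub>sec E ?V\<^esub> \<sigma> (v W) ?V (?eta j)"
    proof -
      have "i ?V (?a j) = (res E UNIV ?V (s j) \<ominus>\<^bsub>sec E ?V\<^esub> \<sigma> (v W) ?V (?eta j)) \<ominus>\<^bsub>sec E ?V\<^esub> i ?V (res L UNIV ?V (l j))"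
        unfolding mor_minus[OF imor Lp Ep oV subset_UNIV lamV[OF j] lV[OF j]] i_line_part_res[OF W(1) s[OF j] oV VW] ..
      also have "\<dots> = (res E UNIV ?V (s j) \<ominus>\<^bsub>sec E ?V\<^esub> i ?V (res L UNIV ?V (l j))) \<ominus>\<^bsub>sec E ?V\<^esub> \<sigma> (v W) ?V (?eta j)"
        using sV sge il' by (simp add: a_minus_def EV.M.a_ac)
      finally have 1: "i ?V (?a j) = (res E UNIV ?V (s j) \<ominus>\<^bsub>sec E ?V\<^esub> i ?V (res L UNIV ?V (l j))) \<ominus>\<^bsub>sec E ?V\<^esub> \<sigma> (v W) ?V (?eta j)" .
      have dc: "res E UNIV ?V (s j) \<ominus>\<^bsub>sec E ?V\<^esub> i ?V (res L UNIV ?V (l j)) \<in> carrier (sec E ?V)" using sV il' by simp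
      show ?thesis unfolding 1 a_minus_def[of "sec E ?V" _ "\<sigma> (v W) ?V (?eta j)"]
        using EV.M.a_assoc[OF dc EV.M.a_inv_closed[OF sge] sge] dc sge by (simp add: EV.M.l_neg)
    qed
    also have "i ?V (?a j) = a j \<odot>\<^bsub>sec E ?V\<^esub> i ?V ?e"
      unfolding a(2)[OF j] by (rule mor_smult[OF imor oV subset_UNIV a(1)[OF j] ec])
    also have "\<sigma> (v W) ?V (?eta j) = (\<Oplus>\<^bsub>sec E ?V\<^esub>k\<in>{..<n}. q j k \<odot>\<^bsub>sec E ?V\<^esub> \<sigma> (v W) ?V (?f k))"
      unfolding q(2)[OF j]
      by (rule linear_finsum[OF FV.module_axioms EV.module_axioms])
        (use mor_closed[OF sgm oV Vv] mor_add[OF sgm oV Vv] mor_smult[OF sgm oV Vv] q(1)[OF j] fc in auto)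
    also have "a j \<odot>\<^bsub>sec E ?V\<^esub> i ?V ?e \<oplus>\<^bsub>sec E ?V\<^esub> (\<Oplus>\<^bsub>sec E ?V\<^esub>k\<in>{..<n}. q j k \<odot>\<^bsub>sec E ?V\<^esub> \<sigma> (v W) ?V (?f k)) =
        (\<Oplus>\<^bsub>sec E ?V\<^esub>m\<in>{..<Suc n}. ?A j m \<odot>\<^bsub>sec E ?V\<^esub> ?E m)"
    proof -
      have "?A j m \<odot>\<^bsub>sec E ?V\<^esub> ?E m \<in> carrier (sec E ?V)" if "m < Suc n" for m
        using AC[OF j, of m] EC[of m] that by simp
      from EV.M.finsum_lessThan_Suc_shift[of n "\<lambda>m. ?A j m \<odot>\<^bsub>sec E ?V\<^esub> ?E m", OF this] show ?thesis by simp
    qed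
    finally show ?thesis by simp
  qed
  have sub: "set (map ?t [0..<n + 1]) \<subseteq> carrier (H0 E)" using tg by (simp only: ext_gens_def mem_Collect_eq)
  have "restrict (wedge \<O> E UNIV (map ?t [0..<n + 1])) ?V = wedge \<O> E ?V (map (res E UNIV ?V) (map ?t [0..<n + 1]))"
    by (rule wedge_res[OF Ep open_UNIV oV subset_UNIV sub])
  also have "map (res E UNIV ?V) (map ?t [0..<n + 1]) = map (\<lambda>j. \<Oplus>\<^bsub>sec E ?V\<^esub>m\<in>{..<n + 1}. ?A j m \<odot>\<^bsub>sec E ?V\<^esub> ?E m) [0..<n + 1]"
    unfolding map_map by (rule map_cong[OF refl]) (use row in \<open>simp del: upt_Suc\<close>)
  also have "wedge \<O> E ?V \<dots> = \<zero>\<^bsub>sec (ext_sheaf \<O> (n + 1) E) ?V\<^esub>"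
  proof (rule alternating_kernel_zero[OF wedge_alternating[OF Ep oV] oV])
    show "\<And>m. m < n + 1 \<Longrightarrow> ?r m \<in> carrier (\<O> ?V)" by (rule RC)
    show "\<And>j. j < n + 1 \<Longrightarrow> (\<Oplus>\<^bsub>\<O> ?V\<^esub>m\<in>{..<n + 1}. ?A j m \<otimes>\<^bsub>\<O> ?V\<^esub> ?r m) = \<zero>\<^bsub>\<O> ?V\<^esub>" by (rule ker)
    show "\<And>h. h \<in> carrier (\<O> ?V) \<Longrightarrow> h \<otimes>\<^bsub>\<O> ?V\<^esub> (case 0 of 0 \<Rightarrow> ?g | Suc k \<Rightarrow> (\<lambda>x. - r k x)) = \<zero>\<^bsub>\<O> ?V\<^esub> \<Longrightarrow> h = \<zero>\<^bsub>\<O> ?V\<^esub>"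
      unfolding nat.case(1) by (rule nzd)
  qed (use AC EC in auto)
  finally have wz: "restrict (wedge \<O> E UNIV (map ?t [0..<n + 1])) ?V = \<zero>\<^bsub>sec (ext_sheaf \<O> (n + 1) E) ?V\<^esub>" .
  have "res (ext_sheaf \<O> (n + 1) E) UNIV ?V (wedge \<O> E UNIV (map ?t [0..<n + 1])) =
      res (ext_sheaf \<O> (n + 1) E) UNIV ?V \<zero>\<^bsub>H0 (ext_sheaf \<O> (n + 1) E)\<^esub>"
    unfolding res_zero[OF sheaf_presheaf[OF ext_is_sheaf[OF Ep]] open_UNIV oV subset_UNIV]
    by (simp only: res_ext[OF Ep] wz)
  then show "\<exists>V. open V \<and> x \<in> V \<and> V \<subseteq> UNIV \<and> res (ext_sheaf \<O> (n + 1) E) UNIV V (wedge \<O> E UNIV (map ?t [0..<n + 1])) =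
      res (ext_sheaf \<O> (n + 1) E) UNIV V \<zero>\<^bsub>H0 (ext_sheaf \<O> (n + 1) E)\<^esub>"
    using oV xV by blast
qed

end

section \<open>Adjoint forms\<close>

lemma (in abelian_monoid) finsum_delta:
  assumes "finite A" "i \<in> A" "f i \<in> carrier G" "\<And>j. j \<in> A \<Longrightarrow> j \<noteq> i \<Longrightarrow> f j = \<zero>"
  shows "(\<Oplus>j\<in>A. f j) = f i"
proof -
  have A: "A = insert i (A - {i})" using assms(2) by blast
  have "(\<Oplus>j\<in>insert i (A - {i}). f j) = f i \<oplus> (\<Oplus>j\<in>A - {i}. f j)"
    by (rule finsum_insert) (use assms in auto)
  also have "(\<Oplus>j\<in>A - {i}. f j) = (\<Oplus>j\<in>A - {i}. \<zero>)"
    by (rule finsum_cong') (use assms in auto)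
  finally show ?thesis using A assms(3) by simp
qed

lemma cspan_base:
  assumes "Module.module R M" "\<one>\<^bsub>R\<^esub> = (\<lambda>_. 1)" "x \<in> S" "x \<in> carrier M"
  shows "x \<in> cspan M S"
proof -
  interpret Module.module R M by fact
  have "lin_comb M 1 (\<lambda>_. 1) (\<lambda>_. x) = x"
    using assms(2,4) smult_one[of x] by (simp add: lin_comb_def lessThan_Suc)
  then show ?thesis unfolding cspan_def using assms(3)
    by (intro CollectI exI[of _ 1] exI[of _ "\<lambda>_. 1"] exI[of _ "\<lambda>_. x"]) simp
qed

lemma (in function_rings) cbasis_mem:
  assumes M: "Module.module (\<O> UNIV) M" and b: "is_cbasis M W k \<eta>" and j: "j < k"
  shows "\<eta> j \<in> W"
proof -
  interpret Module.module "\<O> UNIV" M by fact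
  have \<eta>: "\<eta> i \<in> carrier M" if "i < k" for i using b that by (simp add: is_cbasis_def)
  have one: "(\<lambda>_. 1) = \<one>\<^bsub>\<O> UNIV\<^esub>" and zero: "(\<lambda>_. 0) = \<zero>\<^bsub>\<O> UNIV\<^esub>" by (simp_all add: O_one O_zero)
  have "lin_comb M k (\<lambda>i. if i = j then 1 else 0) \<eta> = (\<lambda>_. if j = j then 1 else 0) \<odot>\<^bsub>M\<^esub> \<eta> j"
    unfolding lin_comb_def
    by (rule M.finsum_delta) (use j \<eta> one zero in auto)
  then have "\<eta> j = lin_comb M k (\<lambda>i. if i = j then 1 else 0) \<eta>" using one \<eta>[OF j] by simp
  then have "\<eta> j \<in> {lin_comb M k c \<eta> | c. True}" by (intro CollectI exI conjI TrueI)
  also have "{lin_comb M k c \<eta> | c. True} = W" using b by (simp add: is_cbasis_def)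
  finally show ?thesis .
qed

text \<open>The retraction takes the lift \<open>s j\<close> to a global section of
  \<open>L(D)\<close>, hence to the image of some \<open>l j\<close> in \<open>H\<^sup>0(L)\<close>.
  Expand \<open>\<Omega> = \<And> ((s j - i (l j)) + i (l j))\<close>: the product of the first
  parts is zero by \<open>kernel_wedge_zero\<close>, terms with two factors from \<open>L\<close>
  are zero, and what is left are the products \<open>i (l j) \<and> \<And>\<^bsub>k \<noteq>
  j\<^esub> s k\<close>, up to sign.\<close>

lemma (in split_twist) adjoint_form_in_image:
  assumes adj: "is_adjoint_form \<O> n E F p X \<Omega>"
    and bij: "bij_betw (twist_incl \<O> L D UNIV) (carrier (H0 L)) (carrier (H0 (twist \<O> L D)))"
  shows "\<Omega> \<in> mult_image \<O> n L E F i p (lambda_image \<O> n F X)"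
proof -
  obtain \<eta> s where \<eta>: "is_cbasis (H0 F) X (n + 1) \<eta>" and s: "\<And>j. j < n + 1 \<Longrightarrow> s j \<in> carrier (H0 E)"
    and ps: "\<And>j. j < n + 1 \<Longrightarrow> p UNIV (s j) = \<eta> j" and \<Omega>: "\<Omega> = wedge \<O> E UNIV (map s [0..<n + 1])"
    using adj unfolding is_adjoint_form_def by blast
  have "\<forall>j. \<exists>l. j < n + 1 \<longrightarrow> l \<in> carrier (H0 L) \<and> (\<forall>W\<in>\<W>. retract W (s j) = res Tw UNIV W (inc UNIV l))"
  proof
    fix j
    show "\<exists>l. j < n + 1 \<longrightarrow> l \<in> carrier (H0 L) \<and> (\<forall>W\<in>\<W>. retract W (s j) = res Tw UNIV W (inc UNIV l))"
    proof (cases "j < n + 1")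
      case True
      obtain t where t: "t \<in> carrier (H0 Tw)" "\<And>W. W \<in> \<W> \<Longrightarrow> res Tw UNIV W t = retract W (s j)"
        using retract_glue[OF s[OF True]] by metis
      obtain l where "l \<in> carrier (H0 L)" "t = inc UNIV l"
        using bij t(1) unfolding bij_betw_def by blast
      then show ?thesis using t(2) by auto
    qed simp
  qed
  from choice[OF this] obtain l where l: "\<And>j. j < n + 1 \<Longrightarrow> l j \<in> carrier (H0 L)"
    and rl: "\<And>j W. j < n + 1 \<Longrightarrow> W \<in> \<W> \<Longrightarrow> retract W (s j) = res Tw UNIV W (inc UNIV (l j))" by blast
  let ?dE = "ext_sheaf \<O> (n + 1) E"
  interpret H: alternating "\<O> UNIV" "H0 E" "H0 ?dE" "n + 1" "wedge \<O> E UNIV"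
    by (rule wedge_alternating[OF Ep open_UNIV])
  let ?u = "\<lambda>j. i UNIV (l j)" and ?v = "\<lambda>j. s j \<ominus>\<^bsub>H0 E\<^esub> i UNIV (l j)"
  have u: "?u j \<in> carrier (H0 E)" if "j < n + 1" for j by (rule i_closed[OF open_UNIV l[OF that]])
  have v: "?v j \<in> carrier (H0 E)" if "j < n + 1" for j using s[OF that] u[OF that] by simp
  have vu: "?v j \<oplus>\<^bsub>H0 E\<^esub> ?u j = s j" if "j < n + 1" for j
    using s[OF that] u[OF that] by (simp add: a_minus_def H.M.M.a_assoc H.M.M.l_neg)
  let ?ss = "\<lambda>j. map s ([0..<j] @ [Suc j..<n + 1])"
  have ssE: "map (\<lambda>j. ?v j \<oplus>\<^bsub>H0 E\<^esub> ?u j) ([0..<j] @ [Suc j..<n + 1]) = ?ss j" if "j < n + 1" for j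
    by (rule map_cong[OF refl], rule vu) (use that in auto)
  have ss: "?ss j \<in> ext_gens n (H0 E)" if "j < n + 1" for j
    using s that by (auto simp: ext_gens_def simp del: upt_Suc)
  have "map (\<lambda>j. ?v j \<oplus>\<^bsub>H0 E\<^esub> ?u j) [0..<n + 1] = map s [0..<n + 1]"
    by (rule map_cong[OF refl], rule vu) auto
  then have "\<Omega> = wedge \<O> E UNIV (map (\<lambda>j. ?v j \<oplus>\<^bsub>H0 E\<^esub> ?u j) [0..<n + 1])" unfolding \<Omega> by (simp only:)
  also have "\<dots> = wedge \<O> E UNIV (map ?v [0..<n + 1]) \<oplus>\<^bsub>H0 ?dE\<^esub>
      (\<Oplus>\<^bsub>H0 ?dE\<^esub>j\<in>{..<n + 1}. H.sg j \<odot>\<^bsub>H0 ?dE\<^esub>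
        wedge \<O> E UNIV (?u j # map (\<lambda>j. ?v j \<oplus>\<^bsub>H0 E\<^esub> ?u j) ([0..<j] @ [Suc j..<n + 1])))"
  proof (rule H.m_expand[OF v u])
    fix xs j j' ys assume j: "j < n + 1" "j' < n + 1" "?u j \<in> set xs" "xs @ ?u j' # ys \<in> ext_gens (n + 1) (H0 E)"
    show "wedge \<O> E UNIV (xs @ ?u j' # ys) = \<zero>\<^bsub>H0 ?dE\<^esub>"
      by (rule wedge_line_zero[OF open_UNIV l[OF j(1)] l[OF j(2)] j(4,3)])
  qed
  also have "wedge \<O> E UNIV (map ?v [0..<n + 1]) = \<zero>\<^bsub>H0 ?dE\<^esub>"
    by (rule kernel_wedge_zero[OF s l rl])
  finally have \<Omega>1: "\<Omega> = \<zero>\<^bsub>H0 ?dE\<^esub> \<oplus>\<^bsub>H0 ?dE\<^esub> (\<Oplus>\<^bsub>H0 ?dE\<^esub>j\<in>{..<n + 1}. H.sg j \<odot>\<^bsub>H0 ?dE\<^esub>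
        wedge \<O> E UNIV (?u j # map (\<lambda>j. ?v j \<oplus>\<^bsub>H0 E\<^esub> ?u j) ([0..<j] @ [Suc j..<n + 1])))" .
  let ?w = "\<lambda>j. wedge \<O> F UNIV (map (p UNIV) (?ss j))"
  have wc: "wedge \<O> E UNIV (?u j # ?ss j) \<in> carrier (H0 ?dE)" if "j < n + 1" for j
    using u[OF that] ss[OF that] by (intro H.m_closed) (auto simp: ext_gens_def simp del: upt_Suc)
  have dm: "det_mult \<O> n L E F i p UNIV (l j) (?w j) = wedge \<O> E UNIV (?u j # ?ss j)" if "j < n + 1" for j
    by (rule det_mult_wedge[OF exists_split l[OF that] ss[OF that]])
  have sg: "H.sg j = (\<lambda>_. (-1) ^ j)" for j
    using alternating_sg[OF wedge_alternating[OF Ep open_UNIV] open_UNIV] by simp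
  have eq3: "(\<Oplus>\<^bsub>H0 ?dE\<^esub>j\<in>{..<n + 1}. H.sg j \<odot>\<^bsub>H0 ?dE\<^esub>
        wedge \<O> E UNIV (?u j # map (\<lambda>j. ?v j \<oplus>\<^bsub>H0 E\<^esub> ?u j) ([0..<j] @ [Suc j..<n + 1]))) =
      lin_comb (H0 ?dE) (n + 1) (\<lambda>j. (-1) ^ j) (\<lambda>j. det_mult \<O> n L E F i p UNIV (l j) (?w j))"
    unfolding lin_comb_def
  proof (rule H.T.M.finsum_cong'[OF refl])
    show "(\<lambda>j. (\<lambda>_. (- 1) ^ j) \<odot>\<^bsub>H0 ?dE\<^esub> det_mult \<O> n L E F i p UNIV (l j) (?w j)) \<in> {..<n + 1} \<rightarrow> carrier (H0 ?dE)"
    proof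
      fix j assume "j \<in> {..<n + 1}"
      then have j: "j < n + 1" by simp
      show "(\<lambda>_. (- 1) ^ j) \<odot>\<^bsub>H0 ?dE\<^esub> det_mult \<O> n L E F i p UNIV (l j) (?w j) \<in> carrier (H0 ?dE)"
        unfolding dm[OF j] sg[symmetric] by (rule H.T.smult_closed[OF H.sg_closed wc[OF j]])
    qed
    fix j assume "j \<in> {..<n + 1}"
    then have j: "j < n + 1" by simp
    show "H.sg j \<odot>\<^bsub>H0 ?dE\<^esub> wedge \<O> E UNIV (?u j # map (\<lambda>j. ?v j \<oplus>\<^bsub>H0 E\<^esub> ?u j) ([0..<j] @ [Suc j..<n + 1])) =
      (\<lambda>_. (- 1) ^ j) \<odot>\<^bsub>H0 ?dE\<^esub> det_mult \<O> n L E F i p UNIV (l j) (?w j)"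
      unfolding dm[OF j] sg ssE[OF j] ..
  qed
  have closed: "lin_comb (H0 ?dE) (n + 1) (\<lambda>j. (-1) ^ j) (\<lambda>j. det_mult \<O> n L E F i p UNIV (l j) (?w j)) \<in> carrier (H0 ?dE)"
    unfolding lin_comb_def
  proof (rule H.T.M.finsum_closed, rule funcsetI)
    fix j assume "j \<in> {..<n + 1}"
    then have j: "j < n + 1" by simp
    show "(\<lambda>_. (- 1) ^ j) \<odot>\<^bsub>H0 ?dE\<^esub> det_mult \<O> n L E F i p UNIV (l j) (?w j) \<in> carrier (H0 ?dE)"
      unfolding dm[OF j] sg[symmetric] by (rule H.T.smult_closed[OF H.sg_closed wc[OF j]])
  qed
  have \<Omega>2: "\<Omega> = lin_comb (H0 ?dE) (n + 1) (\<lambda>j. (-1) ^ j) (\<lambda>j. det_mult \<O> n L E F i p UNIV (l j) (?w j))"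
    unfolding \<Omega>1 eq3 by (rule H.T.M.l_zero[OF closed])
  have wl: "?w j \<in> lambda_image \<O> n F X" if j: "j < n + 1" for j
    unfolding lambda_image_def
  proof (rule cspan_base)
    show "Module.module (\<O> UNIV) (H0 (ext_sheaf \<O> n F))"
      by (rule presheaf_module[OF sheaf_presheaf[OF ext_is_sheaf[OF Fp]] open_UNIV])
    show "\<one>\<^bsub>\<O> UNIV\<^esub> = (\<lambda>_. 1)" by (simp add: O_one)
    have pg: "map (p UNIV) (?ss j) \<in> ext_gens n (H0 F)"
      using ss[OF j] p_closed[OF open_UNIV] by (auto simp: ext_gens_def simp del: upt_Suc)
    show "?w j \<in> carrier (H0 (ext_sheaf \<O> n F))"
      by (rule alternating.m_closed[OF wedge_alternating[OF Fp open_UNIV] pg])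
    have "p UNIV (s k) \<in> X" if "k < n + 1" for k
      unfolding ps[OF that] by (rule cbasis_mem[OF presheaf_module[OF Fp open_UNIV] \<eta> that])
    then have "set (map (p UNIV) (?ss j)) \<subseteq> X" using j by (auto simp del: upt_Suc)
    moreover have "length (map (p UNIV) (?ss j)) = n" using pg by (simp only: ext_gens_def mem_Collect_eq)
    ultimately show "?w j \<in> {wedge \<O> F UNIV ws | ws. length ws = n \<and> set ws \<subseteq> X}" by blast
  qed
  show ?thesis unfolding mult_image_def cspan_def
    using \<Omega>2 l wl by blast
qed

text \<open>Unfolding the hypotheses on \<open>\<xi>\<close> yields the data of
  \<open>split_twist\<close>: a nonempty class supplies a cocycle of differences of splittings, and
  since it maps into the zero class, its image is cohomologous to the zero cocycle of the trivial
  cover.\<close>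

lemma (in function_rings) adjoint_theorem:
  fixes L :: "('a, 'l) mod_presheaf" and E :: "('a, 'e) mod_presheaf" and F :: "('a, 'f) mod_presheaf"
  assumes Fl: "locally_free \<O> n F" and L: "invertible_sheaf \<O> L" and E: "is_sheaf \<O> E"
    and ex: "short_exact \<O> L E F i p"
    and \<xi>1: "\<xi> \<in> H1 (tensor_sheaf \<O> (dual_sheaf \<O> F) L)"
    and \<xi>2: "\<xi> = extension_class \<O> L E F i p"
    and D: "effective_divisor \<O> D"
    and adj: "is_adjoint_form \<O> n E F p X \<Omega>"
    and bij: "bij_betw (twist_incl \<O> L D UNIV) (carrier (H0 L)) (carrier (H0 (twist \<O> L D)))"
    and ker: "H1_map (tensor_sheaf \<O> (dual_sheaf \<O> F) (twist \<O> L D))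
           (tensor_map \<O> (dual_sheaf \<O> F) L (twist \<O> L D) (twist_incl \<O> L D)) \<xi>
         = H1_zero (tensor_sheaf \<O> (dual_sheaf \<O> F) (twist \<O> L D))"
  shows "\<Omega> \<in> mult_image \<O> n L E F i p (lambda_image \<O> n F X)"
proof -
  have Fs: "is_sheaf \<O> F" using Fl by (simp add: locally_free_def)
  interpret line_extension \<O> L E F i p
    by (intro line_extension.intro function_rings_axioms line_extension_axioms.intro L E Fs ex)
  let ?T = "tensor_sheaf \<O> (dual_sheaf \<O> F) L" and ?G = "tensor_sheaf \<O> (dual_sheaf \<O> F) (twist \<O> L D)"
  let ?\<Phi> = "tensor_map \<O> (dual_sheaf \<O> F) L (twist \<O> L D) (twist_incl \<O> L D)"
  note opTw = is_presheaf_op[OF sheaf_presheaf[OF twist_sheaf[OF D Ls]]]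
  have Tp: "is_presheaf \<O> ?T" unfolding tensor_sheaf_def
    by (rule sheafify_presheaf[OF tensor_presheaf[OF dual_op_presheaf[OF opF] opL]])
  have Gp: "is_presheaf \<O> ?G" unfolding tensor_sheaf_def
    by (rule sheafify_presheaf[OF tensor_presheaf[OF dual_op_presheaf[OF opF] opTw]])
  have tm: "is_mor \<O> UNIV ?T ?G ?\<Phi>"
    by (rule tensor_map_mor[OF dual_op_presheaf[OF opF] opL opTw twist_incl_mor[OF D Ls]])
  obtain z where z: "z \<in> cech_Z1 ?T" "\<xi> = cech_rel ?T `` {z}" using \<xi>1 unfolding H1_def by (rule quotientE)
  have "z \<in> \<xi>" using z cech_refl[OF Tp] by auto
  define Sp where "Sp \<U> c \<sigma> \<longleftrightarrow> (\<forall>U\<in>\<U>. is_mor \<O> U F E (\<sigma> U) \<and>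
                (\<forall>V. open V \<and> V \<subseteq> U \<longrightarrow> (\<forall>s\<in>carrier (sec F V). p V (\<sigma> U V s) = s))) \<and>
      (\<forall>U\<in>\<U>. \<forall>U'\<in>\<U>. \<forall>V. open V \<and> V \<subseteq> U \<inter> U' \<longrightarrow> (\<forall>s\<in>carrier (sec F V).
                i V (contract \<O> F L V (res ?T (U \<inter> U') V (c U U')) s)
                  = \<sigma> U' V s \<ominus>\<^bsub>sec E V\<^esub> \<sigma> U V s))" for \<U> c and \<sigma> :: "'a set \<Rightarrow> 'a set \<Rightarrow> 'f \<Rightarrow> 'e"
  have \<xi>: "\<xi> = \<Union>{H1_class ?T (\<U>, c) | \<U> c. (\<U>, c) \<in> cech_Z1 ?T \<and> (\<exists>\<sigma>. Sp \<U> c \<sigma>)}"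
    unfolding \<xi>2 extension_class_def Let_def Sp_def ..
  obtain \<U> c \<sigma> where Z: "(\<U>, c) \<in> cech_Z1 ?T" and Sp: "Sp \<U> c \<sigma>"
    using \<open>z \<in> \<xi>\<close> unfolding \<xi> by blast
  have sub: "H1_class ?T (\<U>, c) \<subseteq> \<xi>" unfolding \<xi> using Z Sp by blast
  note \<sigma> = Sp[unfolded Sp_def, THEN conjunct1] Sp[unfolded Sp_def, THEN conjunct2]
  have "(\<U>, c) \<in> \<xi>" using sub cech_refl[OF Tp Z] by (auto simp: H1_class_def)
  then have "H1_class ?G (\<U>, \<lambda>U V. ?\<Phi> (U \<inter> V) (c U V)) \<subseteq> H1_zero ?G"
    unfolding ker[symmetric] H1_map_def by auto
  moreover have "(\<U>, \<lambda>U V. ?\<Phi> (U \<inter> V) (c U V)) \<in> H1_class ?G (\<U>, \<lambda>U V. ?\<Phi> (U \<inter> V) (c U V))"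
    unfolding H1_class_def using cech_refl[OF Gp cech_Z1_map[OF Tp tm Z]] by auto
  ultimately have "(({UNIV}, \<lambda>_ _. \<zero>\<^bsub>H0 ?G\<^esub>), (\<U>, \<lambda>U V. ?\<Phi> (U \<inter> V) (c U V))) \<in> cech_rel ?G"
    unfolding H1_zero_def H1_class_def by auto
  then obtain \<W> u v b where W: "open_cover \<W>"
    and uv: "\<forall>W\<in>\<W>. u W \<in> {UNIV} \<and> W \<subseteq> u W \<and> v W \<in> \<U> \<and> W \<subseteq> v W \<and> b W \<in> carrier (sec ?G W)"
    and diff: "\<forall>W\<in>\<W>. \<forall>W'\<in>\<W>.
           res ?G (u W \<inter> u W') (W \<inter> W') \<zero>\<^bsub>H0 ?G\<^esub>
             \<ominus>\<^bsub>sec ?G (W \<inter> W')\<^esub> res ?G (v W \<inter> v W') (W \<inter> W') (?\<Phi> (v W \<inter> v W') (c (v W) (v W')))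
           = res ?G W' (W \<inter> W') (b W') \<ominus>\<^bsub>sec ?G (W \<inter> W')\<^esub> res ?G W (W \<inter> W') (b W)"
    unfolding cech_rel_def by auto
  have oU: "open_cover \<U>" and cU: "\<And>U V. U \<in> \<U> \<Longrightarrow> V \<in> \<U> \<Longrightarrow> c U V \<in> carrier (sec ?T (U \<inter> V))"
    using Z unfolding cech_Z1_def by auto
  \<comment> \<open>On the trivial cover every \<open>u W\<close> is the whole space, so its term in the coboundary equation is zero.\<close>
  have b_diff: "res ?G (v W \<inter> v W') (W \<inter> W') (?\<Phi> (v W \<inter> v W') (c (v W) (v W'))) =
      res ?G W (W \<inter> W') (b W) \<ominus>\<^bsub>sec ?G (W \<inter> W')\<^esub> res ?G W' (W \<inter> W') (b W')"
    if WW: "W1 \<in> \<W>" "W \<in> \<W>" "W' \<in> \<W>" for W1 W W'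
  proof -
    have o: "open W" "open W'" "open (W \<inter> W')" using W WW by (auto simp: open_cover_def)
    have vo: "open (v W \<inter> v W')" "W \<inter> W' \<subseteq> v W \<inter> v W'" using uv WW oU by (auto simp: open_cover_def)
    have vU: "v W \<in> \<U>" "v W' \<in> \<U>" using uv WW by auto
    interpret GX: Module.module "\<O> (W \<inter> W')" "sec ?G (W \<inter> W')" by (rule presheaf_module[OF Gp o(3)])
    have uu: "u W \<inter> u W' = UNIV" using uv WW by auto
    have x: "res ?G (v W \<inter> v W') (W \<inter> W') (?\<Phi> (v W \<inter> v W') (c (v W) (v W'))) \<in> carrier (sec ?G (W \<inter> W'))"
      by (rule res_closed[OF is_presheaf_op[OF Gp] vo(1) o(3) vo(2) mor_closed[OF tm vo(1) subset_UNIV cU[OF vU]]])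
    have y: "res ?G W' (W \<inter> W') (b W') \<in> carrier (sec ?G (W \<inter> W'))" "res ?G W (W \<inter> W') (b W) \<in> carrier (sec ?G (W \<inter> W'))"
      using uv WW o by (auto intro!: res_closed[OF is_presheaf_op[OF Gp]])
    have d: "res ?G UNIV (W \<inter> W') \<zero>\<^bsub>H0 ?G\<^esub>
             \<ominus>\<^bsub>sec ?G (W \<inter> W')\<^esub> res ?G (v W \<inter> v W') (W \<inter> W') (?\<Phi> (v W \<inter> v W') (c (v W) (v W')))
           = res ?G W' (W \<inter> W') (b W') \<ominus>\<^bsub>sec ?G (W \<inter> W')\<^esub> res ?G W (W \<inter> W') (b W)"
      using diff[rule_format, OF WW(2,3)] unfolding uu .
    show ?thesis
      by (rule GX.M.zero_minus_eq[OF x y d[unfolded res_zero[OF Gp open_UNIV o(3) subset_UNIV]]])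
  qed
  interpret split_twist \<O> L E F i p n D c \<U> \<sigma> \<W> v b
  proof (intro split_twist.intro line_extension_axioms split_twist_axioms.intro Fl D, goal_cases)
    case 1 then show ?case using oU by (simp add: open_cover_def)
  next
    case 2 then show ?case by (rule cU)
  next
    case 3 then show ?case using \<sigma>(1) by blast
  next
    case 4 then show ?case using \<sigma>(1) by blast
  next
    case (5 U U' V s)
    then show ?case by (intro \<sigma>(2)[THEN bspec, THEN bspec, THEN spec, THEN mp, THEN bspec] conjI)
  next
    case 6 then show ?case using W by (simp add: open_cover_def)
  next
    case 7 then show ?case using W by (simp add: open_cover_def)
  next
    case 8 then show ?case using uv by blast
  next
    case 9 then show ?case using uv by blast
  next
    case 10 then show ?case using uv by blast
  next
    case (11 W W') then show ?case by (intro b_diff[OF 11(1)])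
  qed
  show ?thesis by (rule adjoint_form_in_image[OF adj bij])
qed

section \<open>Rings of holomorphic functions\<close>

text \<open>Complex differentiability at a point depends only on values near it.\<close>

lemma mh_cong_open:
  assumes "open S" "\<And>z. z \<in> S \<Longrightarrow> f z = g z" "multi_holomorphic_on f S"
  shows "multi_holomorphic_on g S"
  unfolding multi_holomorphic_on_def
proof
  fix z assume z: "z \<in> S"
  then obtain f' where f': "(f has_derivative f') (at z)" "\<forall>c v. f' (c *s v) = c * f' v"
    using assms(3) unfolding multi_holomorphic_on_def by blast
  have "(g has_derivative f') (at z)"
    by (rule has_derivative_transform_within_open[OF f'(1) assms(1) z assms(2)])
  then show "\<exists>f'. (g has_derivative f') (at z) \<and> (\<forall>c v. f' (c *s v) = c * f' v)" using f'(2) by blast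
qed

lemma mh_subset: "multi_holomorphic_on f S \<Longrightarrow> T \<subseteq> S \<Longrightarrow> multi_holomorphic_on f T"
  unfolding multi_holomorphic_on_def by blast

lemma mh_const: "multi_holomorphic_on (\<lambda>_. c) S"
  unfolding multi_holomorphic_on_def
proof
  fix z
  show "\<exists>f'. ((\<lambda>_. c) has_derivative f') (at z) \<and> (\<forall>c v. f' (c *s v) = c * f' v)"
    by (rule exI[of _ "\<lambda>_. 0"]) (simp add: has_derivative_const)
qed

lemma mh_add:
  assumes "multi_holomorphic_on f S" "multi_holomorphic_on g S"
  shows "multi_holomorphic_on (\<lambda>z. f z + g z) S"
  unfolding multi_holomorphic_on_def
proof
  fix z assume "z \<in> S"
  then obtain f' g' where "(f has_derivative f') (at z)" "\<forall>c v. f' (c *s v) = c * f' v"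
    "(g has_derivative g') (at z)" "\<forall>c v. g' (c *s v) = c * g' v"
    using assms unfolding multi_holomorphic_on_def by blast
  then show "\<exists>h'. ((\<lambda>z. f z + g z) has_derivative h') (at z) \<and> (\<forall>c v. h' (c *s v) = c * h' v)"
    by (intro exI[of _ "\<lambda>v. f' v + g' v"]) (auto intro: has_derivative_add simp: distrib_left)
qed

lemma mh_mult:
  assumes "multi_holomorphic_on f S" "multi_holomorphic_on g S"
  shows "multi_holomorphic_on (\<lambda>z. f z * g z) S"
  unfolding multi_holomorphic_on_def
proof
  fix z assume "z \<in> S"
  then obtain f' g' where "(f has_derivative f') (at z)" "\<forall>c v. f' (c *s v) = c * f' v"
    "(g has_derivative g') (at z)" "\<forall>c v. g' (c *s v) = c * g' v"
    using assms unfolding multi_holomorphic_on_def by blast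
  then show "\<exists>h'. ((\<lambda>z. f z * g z) has_derivative h') (at z) \<and> (\<forall>c v. h' (c *s v) = c * h' v)"
    by (intro exI[of _ "\<lambda>v. f z * g' v + f' v * g z"]) (auto intro: has_derivative_mult simp: algebra_simps)
qed

text \<open>The domain \<open>x ` (U \<inter> V)\<close> of a function in a chart is open, so
  changing a function outside it, as extension by zero does, leaves it holomorphic.\<close>

lemma hol_function_rings:
  assumes A: "complex_atlas A"
  shows "function_rings (hol A)"
proof -
  have chart: "open V" "open (x ` V)" "homeomorphism V (x ` V) x (inv_into V x)" if "(V, x) \<in> A" for V x
    using A that unfolding complex_atlas_def by auto
  have op: "open (x ` (U \<inter> V))" if "(V, x) \<in> A" "open U" for U V x
  proof -
    note c = chart[OF that(1)]
    have "openin (top_of_set V) (U \<inter> V)" using that(2) c(1) by (auto simp: openin_open_eq)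
    then have "openin (top_of_set (x ` V)) (x ` (U \<inter> V))" by (rule homeomorphism_imp_open_map[OF c(3)])
    then show ?thesis using c(2) by (simp add: openin_open_eq)
  qed
  have inv: "inv_into V x z \<in> U \<inter> V" if "(V, x) \<in> A" "z \<in> x ` (U \<inter> V)" for U V x z
    using that(2) homeomorphism_apply1[OF chart(3)[OF that(1)]] by auto
  have mem: "f \<in> carrier (hol A U) \<longleftrightarrow> (\<forall>y. y \<notin> U \<longrightarrow> f y = 0) \<and>
      (\<forall>(V, x)\<in>A. multi_holomorphic_on (f \<circ> inv_into V x) (x ` (U \<inter> V)))" for f U
    by (simp add: hol_def)
  show ?thesis
  proof
    fix U c assume U: "open (U :: 'a set)"
    have "multi_holomorphic_on ((\<lambda>y. if y \<in> U then c else 0) \<circ> inv_into V x) (x ` (U \<inter> V))" if "(V, x) \<in> A" for V x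
      by (rule mh_cong_open[OF op[OF that U] _ mh_const[of c]]) (use inv[OF that] in auto)
    then show "(\<lambda>y. if y \<in> U then c else 0) \<in> carrier (hol A U)" unfolding mem by auto
  next
    fix U f g assume "f \<in> carrier (hol A U)" "g \<in> carrier (hol A U)"
    then show "(\<lambda>y. f y + g y) \<in> carrier (hol A U)" unfolding mem comp_def by (auto intro!: mh_add)
  next
    fix U f g assume "f \<in> carrier (hol A U)" "g \<in> carrier (hol A U)"
    then show "(\<lambda>y. f y * g y) \<in> carrier (hol A U)" unfolding mem comp_def by (auto intro!: mh_mult)
  next
    fix U V f assume U: "open (U :: 'a set)" "open V" "V \<subseteq> U" and f: "f \<in> carrier (hol A U)"
    have "multi_holomorphic_on (rst V f \<circ> inv_into B x) (x ` (V \<inter> B))" if "(B, x) \<in> A" for B x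
    proof (rule mh_cong_open[OF op[OF that U(2)]])
      have "multi_holomorphic_on (f \<circ> inv_into B x) (x ` (U \<inter> B))" using f that unfolding mem by auto
      then show "multi_holomorphic_on (f \<circ> inv_into B x) (x ` (V \<inter> B))" by (rule mh_subset) (use U(3) in auto)
      show "(f \<circ> inv_into B x) z = (rst V f \<circ> inv_into B x) z" if z: "z \<in> x ` (V \<inter> B)" for z
        using inv[OF \<open>(B, x) \<in> A\<close> z] by (simp add: rst_def)
    qed
    then show "rst V f \<in> carrier (hol A V)" unfolding mem by (auto simp: rst_def)
  qed (auto simp: hol_def)
qed

theorem mainTheorem2:
  fixes A :: "('a::t2_space set \<times> ('a \<Rightarrow> complex^'m)) set"
    and n :: nat
    and F :: "('a, 'f) mod_presheaf"
    and L :: "('a, 'l) mod_presheaf"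
    and E :: "('a, 'e) mod_presheaf"
    and i :: "'a set \<Rightarrow> 'l \<Rightarrow> 'e"
    and p :: "'a set \<Rightarrow> 'e \<Rightarrow> 'f"
    and W :: "'f set"
    and D :: "'a ideal_sheaf"
    and \<xi> and \<Omega>
  assumes "compact_complex_manifold A"
    and "locally_free (hol A) n F"
    and "invertible_sheaf (hol A) L"
    and "is_sheaf (hol A) E"
    and "short_exact (hol A) L E F i p"
    and "\<xi> \<in> H1 (tensor_sheaf (hol A) (dual_sheaf (hol A) F) L)"
    and "\<xi> = extension_class (hol A) L E F i p"
    and "\<exists>\<eta>. is_cbasis (H0 F) W (n + 1) \<eta>"
    and "W \<subseteq> {\<eta> \<in> carrier (H0 F). connecting L E F i p \<eta> = H1_zero L}"
    and "lambda_image (hol A) n F W \<noteq> {\<zero>\<^bsub>H0 (ext_sheaf (hol A) n F)\<^esub>}"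
    and "is_fixed_divisor (hol A) (ext_sheaf (hol A) n F) (lambda_image (hol A) n F W) D"
    and "is_adjoint_form (hol A) n E F p W \<Omega>"
    and "bij_betw (twist_incl (hol A) L D UNIV) (carrier (H0 L)) (carrier (H0 (twist (hol A) L D)))"
    and "H1_map (tensor_sheaf (hol A) (dual_sheaf (hol A) F) (twist (hol A) L D))
           (tensor_map (hol A) (dual_sheaf (hol A) F) L (twist (hol A) L D) (twist_incl (hol A) L D))
           \<xi>
         = H1_zero (tensor_sheaf (hol A) (dual_sheaf (hol A) F) (twist (hol A) L D))"
  shows "\<Omega> \<in> mult_image (hol A) n L E F i p (lambda_image (hol A) n F W)"
proof -
  interpret function_rings "hol A"
    by (rule hol_function_rings) (use assms(1) in \<open>simp add: compact_complex_manifold_def\<close>)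
  have "effective_divisor (hol A) D" using assms(11) by (simp add: is_fixed_divisor_def Let_def)
  then show ?thesis by (rule adjoint_theorem[OF assms(2-7) _ assms(12-14)])
qed

end
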